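(* Let $n\ge 1$, let $G$ be a finitely generated group with property ${\rm F}\mathcal{B}_{\widetilde{A}_n}$, let $K$ be a field of positive characteristic, and let $\rho:G\rightarrow \mathrm{GL}_{n+1}(K)$ be a linear representation (a group homomorphism). Then $\rho(G)$ is finite.
   Context: The Coxeter group $W$ of type $\widetilde{A}_n$ ($n\ge 1$) is the infinite dihedral group with its two standard generating involutions if $n=1$; for $n\ge 2$ it has generators $s_0,\dots,s_n$ (indices mod $n+1$) with relations $s_i^2=1$, $(s_is_{i+1})^3=1$, and $(s_is_j)^2=1$ for $j\ne i,i\pm1$. Its Coxeter complex is the simplicial complex whose simplices are the cosets $wW_J$ ($w\in W$, $J\subsetneq I=\{s_0,\dots,s_n\}$, $W_J=\langle J\rangle$), ordered by reverse inclusion. A building of type $\widetilde{A}_n$ is a simplicial complex that is a union of subcomplexes (apartments), each isomorphic to this Coxeter complex, such that any two simplices lie in a common apartment, and for any two apartments containing simplices $A$ and $B$ there is an isomorphism between the apartments fixing $A$ and $B$ pointwise. Buildings are not assumed thick (the Coxeter complex itself is a building). Such a building has a type function (vertex coloring) with values in a set of $n+1$ types, such that the vertices of every maximal simplex (chamber) have pairwise distinct types and realize all types. A simplicial action is type preserving (color-preserving) if every group element preserves the type of every vertex. A group $G$ has property ${\rm F}\mathcal{B}_{\widetilde{A}_n}$ if every simplicial type preserving action of $G$ on any building of type $\widetilde{A}_n$ has a fixed point (in the geometric realisation). *)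

theory Defs
  imports
    Complex_Main
    "HOL-Algebra.Group_Action"
    "HOL-Algebra.Generated_Groups"
    "Jordan_Normal_Form.Matrix"
begin

section \<open>The Coxeter complex of type $\widetilde{A}_n$\<close>

text \<open>
  The Coxeter group is given by its presentation: words over the alphabet \<open>{0..n}\<close> modulo the
  congruence generated by the relators. Formal inverse letters are not needed because every
  generator is an involution. For \<open>n = 1\<close> there are only the relators \<open>s\<^sub>i\<^sup>2\<close>, which gives the
  infinite dihedral group.
\<close>

definition adjacent :: "nat \<Rightarrow> nat \<Rightarrow> nat \<Rightarrow> bool" where
  "adjacent n i j \<longleftrightarrow> j = (i + 1) mod (n + 1) \<or> i = (j + 1) mod (n + 1)"

definition relators :: "nat \<Rightarrow> nat list set" where
  "relators n =
     {[i, i] | i. i \<le> n} \<union>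
     (if n \<ge> 2 then
        {[i, j, i, j, i, j] | i j. i \<le> n \<and> j = (i + 1) mod (n + 1)} \<union>
        {[i, j, i, j] | i j. i \<le> n \<and> j \<le> n \<and> j \<noteq> i \<and> \<not> adjacent n i j}
      else {})"

inductive word_equiv :: "nat \<Rightarrow> nat list \<Rightarrow> nat list \<Rightarrow> bool" for n where
  word_equiv_refl: "u \<in> lists {0..n} \<Longrightarrow> word_equiv n u u"
| word_equiv_sym: "word_equiv n u v \<Longrightarrow> word_equiv n v u"
| word_equiv_trans: "word_equiv n u v \<Longrightarrow> word_equiv n v w \<Longrightarrow> word_equiv n u w"
| word_equiv_relator:
    "u \<in> lists {0..n} \<Longrightarrow> v \<in> lists {0..n} \<Longrightarrow> r \<in> relators n \<Longrightarrow> word_equiv n (u @ r @ v) (u @ v)"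

definition word_class :: "nat \<Rightarrow> nat list \<Rightarrow> nat list set" where
  "word_class n u = {v. word_equiv n u v}"

definition coxeter_group :: "nat \<Rightarrow> nat list set monoid" where
  "coxeter_group n =
     \<lparr>carrier = word_class n ` lists {0..n},
      Group.monoid.mult = (\<lambda>a b. \<Union>u\<in>a. \<Union>v\<in>b. word_class n (u @ v)),
      one = word_class n []\<rparr>"

definition coxeter_gens :: "nat \<Rightarrow> nat list set set" where
  "coxeter_gens n = (\<lambda>i. word_class n [i]) ` {0..n}"

text \<open>The simplices \<open>wW\<^sub>J\<close> with \<open>J\<close> a proper subset of the generators; the face relation
  is reverse inclusion, so the empty simplex (\<open>J = I\<close>) is left out.\<close>

definition coxeter_complex :: "nat \<Rightarrow> nat list set set set" where
  "coxeter_complex n =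
     {w <#\<^bsub>coxeter_group n\<^esub> generate (coxeter_group n) J | w J.
        w \<in> carrier (coxeter_group n) \<and> J \<subset> coxeter_gens n}"

lemma word_equiv_lists:
  assumes "word_equiv n u v"
  shows "u \<in> lists {0..n} \<and> v \<in> lists {0..n}"
  using assms
proof (induction rule: word_equiv.induct)
  case (word_equiv_relator u v r)
  have "(i + 1) mod (n + 1) \<le> n" for i
    using mod_less_divisor[of "n + 1" "i + 1"] by linarith
  then have "r \<in> lists {0..n}"
    using word_equiv_relator(3) by (auto simp: relators_def simp del: One_nat_def add_Suc_right split: if_splits)
  with word_equiv_relator show ?case by auto
qed auto

lemma word_equiv_append_left:
  assumes "word_equiv n u v" "w \<in> lists {0..n}"
  shows "word_equiv n (w @ u) (w @ v)"
  using assms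
proof (induction rule: word_equiv.induct)
  case (word_equiv_refl u)
  then show ?case by (intro word_equiv.word_equiv_refl) auto
next
  case (word_equiv_sym u v)
  then show ?case by (meson word_equiv.word_equiv_sym)
next
  case (word_equiv_trans u v x)
  then show ?case by (meson word_equiv.word_equiv_trans)
next
  case (word_equiv_relator u v r)
  then show ?case using word_equiv.word_equiv_relator[of "w @ u" n v r] by auto
qed

lemma word_equiv_append_right:
  assumes "word_equiv n u v" "w \<in> lists {0..n}"
  shows "word_equiv n (u @ w) (v @ w)"
  using assms
proof (induction rule: word_equiv.induct)
  case (word_equiv_refl u)
  then show ?case by (intro word_equiv.word_equiv_refl) auto
next
  case (word_equiv_sym u v)
  then show ?case by (meson word_equiv.word_equiv_sym)
next
  case (word_equiv_trans u v x)
  then show ?case by (meson word_equiv.word_equiv_trans)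
next
  case (word_equiv_relator u v r)
  then show ?case using word_equiv.word_equiv_relator[of u n "v @ w" r] by auto
qed

lemma word_class_eq_iff:
  assumes "u \<in> lists {0..n}" "v \<in> lists {0..n}"
  shows "word_class n u = word_class n v \<longleftrightarrow> word_equiv n u v"
proof
  assume "word_class n u = word_class n v"
  moreover have "v \<in> word_class n v"
    using assms by (simp add: word_class_def word_equiv_refl)
  ultimately have "v \<in> word_class n u" by simp
  then show "word_equiv n u v" by (simp add: word_class_def)
next
  assume "word_equiv n u v"
  then have "word_equiv n u x \<longleftrightarrow> word_equiv n v x" for x
    by (meson word_equiv_sym word_equiv_trans)
  then show "word_class n u = word_class n v" by (simp add: word_class_def)
qed

lemma coxeter_group_mult:
  assumes "u \<in> lists {0..n}" "v \<in> lists {0..n}"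
  shows "word_class n u \<otimes>\<^bsub>coxeter_group n\<^esub> word_class n v = word_class n (u @ v)"
proof -
  have *: "word_class n (u' @ v') = word_class n (u @ v)"
    if "word_equiv n u u'" "word_equiv n v v'" for u' v'
  proof -
    have u': "u' \<in> lists {0..n}" "v' \<in> lists {0..n}"
      using that word_equiv_lists by metis+
    have "word_equiv n (u @ v) (u' @ v)"
      using that assms by (intro word_equiv_append_right)
    moreover have "word_equiv n (u' @ v) (u' @ v')"
      using that u' by (intro word_equiv_append_left)
    ultimately have "word_equiv n (u @ v) (u' @ v')" by (rule word_equiv_trans)
    moreover have "u @ v \<in> lists {0..n}" "u' @ v' \<in> lists {0..n}" using assms u' by auto
    ultimately show ?thesis using word_class_eq_iff by metis
  qed
  have uv: "u \<in> word_class n u" "v \<in> word_class n v"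
    using assms by (auto simp: word_class_def intro: word_equiv_refl)
  have "word_class n u \<otimes>\<^bsub>coxeter_group n\<^esub> word_class n v =
      (\<Union>u'\<in>word_class n u. \<Union>v'\<in>word_class n v. word_class n (u' @ v'))"
    by (simp add: coxeter_group_def)
  also have "\<dots> = (\<Union>u'\<in>word_class n u. \<Union>v'\<in>word_class n v. word_class n (u @ v))"
    using * by (intro SUP_cong refl) (simp add: word_class_def)
  also have "\<dots> = word_class n (u @ v)" using uv by blast
  finally show ?thesis .
qed

lemma word_equiv_rev:
  assumes "u \<in> lists {0..n}"
  shows "word_equiv n (rev u @ u) []"
  using assms
proof (induction u)
  case Nil
  then show ?case by (simp add: word_equiv_refl)
next
  case (Cons i u)
  then have u: "u \<in> lists {0..n}" "rev u \<in> lists {0..n}" "i \<le> n" by auto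
  have "word_equiv n (rev u @ [i, i] @ u) (rev u @ u)"
    using u by (intro word_equiv_relator) (auto simp: relators_def)
  then have "word_equiv n (rev u @ [i, i] @ u) []"
    using Cons.IH by (rule word_equiv_trans)
  then show ?case by simp
qed

lemma group_coxeter_group: "group (coxeter_group n)"
proof (rule groupI)
  fix x y z assume xyz: "x \<in> carrier (coxeter_group n)" "y \<in> carrier (coxeter_group n)" "z \<in> carrier (coxeter_group n)"
  show "x \<otimes>\<^bsub>coxeter_group n\<^esub> y \<otimes>\<^bsub>coxeter_group n\<^esub> z = x \<otimes>\<^bsub>coxeter_group n\<^esub> (y \<otimes>\<^bsub>coxeter_group n\<^esub> z)"
  proof -
    obtain u v w where "x = word_class n u" "y = word_class n v" "z = word_class n w"
      "u \<in> lists {0..n}" "v \<in> lists {0..n}" "w \<in> lists {0..n}"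
      using xyz by (auto simp: coxeter_group_def)
    moreover from this have "u @ v \<in> lists {0..n}" "v @ w \<in> lists {0..n}" by auto
    ultimately show ?thesis by (simp only: coxeter_group_mult append_assoc)
  qed
next
  fix x y assume "x \<in> carrier (coxeter_group n)" "y \<in> carrier (coxeter_group n)"
  then obtain u v where "x = word_class n u" "y = word_class n v" "u \<in> lists {0..n}" "v \<in> lists {0..n}"
    by (auto simp: coxeter_group_def)
  moreover from this have "u @ v \<in> lists {0..n}" by auto
  ultimately show "x \<otimes>\<^bsub>coxeter_group n\<^esub> y \<in> carrier (coxeter_group n)"
    by (simp only: coxeter_group_mult) (simp add: coxeter_group_def)
next
  show "\<one>\<^bsub>coxeter_group n\<^esub> \<in> carrier (coxeter_group n)" by (auto simp: coxeter_group_def)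
next
  fix x assume "x \<in> carrier (coxeter_group n)"
  then obtain u where u: "x = word_class n u" "u \<in> lists {0..n}" by (auto simp: coxeter_group_def)
  have one: "\<one>\<^bsub>coxeter_group n\<^esub> = word_class n []" by (simp add: coxeter_group_def)
  show "\<one>\<^bsub>coxeter_group n\<^esub> \<otimes>\<^bsub>coxeter_group n\<^esub> x = x"
    using u coxeter_group_mult[of "[]" n u] by (simp add: one)
  have ru: "rev u \<in> lists {0..n}" using u by auto
  have "word_class n (rev u @ u) = word_class n []"
    using u ru word_equiv_rev[of u n] word_class_eq_iff[of "rev u @ u" n "[]"] by simp
  then have "word_class n (rev u) \<otimes>\<^bsub>coxeter_group n\<^esub> x = \<one>\<^bsub>coxeter_group n\<^esub>"
    using u ru coxeter_group_mult[of "rev u" n u] by (simp add: one)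
  moreover have "word_class n (rev u) \<in> carrier (coxeter_group n)"
    using ru by (simp add: coxeter_group_def)
  ultimately show "\<exists>y\<in>carrier (coxeter_group n). y \<otimes>\<^bsub>coxeter_group n\<^esub> x = \<one>\<^bsub>coxeter_group n\<^esub>"
    by blast
qed

section \<open>Simplicial complexes and buildings\<close>

text \<open>Simplices are nonempty finite sets of vertices; the vertex set of \<open>\<Delta>\<close> is \<open>\<Union>\<Delta>\<close>.\<close>

definition simplicial_cplx :: "'v set set \<Rightarrow> bool" where
  "simplicial_cplx \<Delta> \<longleftrightarrow>
     (\<forall>A\<in>\<Delta>. finite A \<and> A \<noteq> {}) \<and> (\<forall>A\<in>\<Delta>. \<forall>B. B \<subseteq> A \<and> B \<noteq> {} \<longrightarrow> B \<in> \<Delta>)"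

definition subcplx :: "'v set set \<Rightarrow> 'v set set \<Rightarrow> bool" where
  "subcplx \<Sigma> \<Delta> \<longleftrightarrow> simplicial_cplx \<Sigma> \<and> \<Sigma> \<subseteq> \<Delta>"

definition simplicial_iso :: "'v set set \<Rightarrow> 'w set set \<Rightarrow> ('v \<Rightarrow> 'w) \<Rightarrow> bool" where
  "simplicial_iso \<Sigma> \<Sigma>' f \<longleftrightarrow> bij_betw f (\<Union>\<Sigma>) (\<Union>\<Sigma>') \<and> (\<lambda>A. f ` A) ` \<Sigma> = \<Sigma>'"

text \<open>Isomorphism with the Coxeter complex, as an isomorphism of face posets.\<close>

definition iso_coxeter_complex :: "nat \<Rightarrow> 'v set set \<Rightarrow> bool" where
  "iso_coxeter_complex n \<Sigma> \<longleftrightarrow>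
     (\<exists>f. bij_betw f \<Sigma> (coxeter_complex n) \<and> (\<forall>A\<in>\<Sigma>. \<forall>B\<in>\<Sigma>. A \<subseteq> B \<longleftrightarrow> f B \<subseteq> f A))"

text \<open>Nonemptiness is part of the definition: it is automatic when the empty set
  counts as a simplex, which it does not here.\<close>

definition building :: "nat \<Rightarrow> 'v set set \<Rightarrow> bool" where
  "building n \<Delta> \<longleftrightarrow>
     simplicial_cplx \<Delta> \<and> \<Delta> \<noteq> {} \<and>
     (\<exists>\<A>. \<Delta> = \<Union>\<A> \<and>
        (\<forall>\<Sigma>\<in>\<A>. subcplx \<Sigma> \<Delta> \<and> iso_coxeter_complex n \<Sigma>) \<and>
        (\<forall>A\<in>\<Delta>. \<forall>B\<in>\<Delta>. \<exists>\<Sigma>\<in>\<A>. A \<in> \<Sigma> \<and> B \<in> \<Sigma>) \<and>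
        (\<forall>\<Sigma>\<in>\<A>. \<forall>\<Sigma>'\<in>\<A>. \<forall>A\<in>\<Sigma> \<inter> \<Sigma>'. \<forall>B\<in>\<Sigma> \<inter> \<Sigma>'.
           \<exists>f. simplicial_iso \<Sigma> \<Sigma>' f \<and> (\<forall>v\<in>A \<union> B. f v = v)))"

definition chamber :: "'v set set \<Rightarrow> 'v set \<Rightarrow> bool" where
  "chamber \<Delta> C \<longleftrightarrow> C \<in> \<Delta> \<and> (\<forall>D\<in>\<Delta>. C \<subseteq> D \<longrightarrow> D = C)"

definition type_function :: "nat \<Rightarrow> 'v set set \<Rightarrow> ('v \<Rightarrow> nat) \<Rightarrow> bool" where
  "type_function n \<Delta> \<tau> \<longleftrightarrow> (\<forall>C. chamber \<Delta> C \<longrightarrow> bij_betw \<tau> C {0..n})"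

section \<open>Actions and the fixed point property\<close>

definition simplicial_action ::
    "('g, 'm) monoid_scheme \<Rightarrow> 'v set set \<Rightarrow> ('g \<Rightarrow> 'v \<Rightarrow> 'v) \<Rightarrow> bool" where
  "simplicial_action G \<Delta> \<phi> \<longleftrightarrow>
     group_action G (\<Union>\<Delta>) \<phi> \<and> (\<forall>g\<in>carrier G. \<forall>A\<in>\<Delta>. \<phi> g ` A \<in> \<Delta>)"

definition type_preserving ::
    "('g, 'm) monoid_scheme \<Rightarrow> 'v set set \<Rightarrow> ('v \<Rightarrow> nat) \<Rightarrow> ('g \<Rightarrow> 'v \<Rightarrow> 'v) \<Rightarrow> bool" where
  "type_preserving G \<Delta> \<tau> \<phi> \<longleftrightarrow> (\<forall>g\<in>carrier G. \<forall>v\<in>\<Union>\<Delta>. \<tau> (\<phi> g v) = \<tau> v)"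

text \<open>Points of the geometric realisation are given by barycentric coordinates.\<close>

definition realisation :: "'v set set \<Rightarrow> ('v \<Rightarrow> real) set" where
  "realisation \<Delta> =
     {b. (\<forall>v. 0 \<le> b v) \<and> {v. b v \<noteq> 0} \<in> \<Delta> \<and> (\<Sum>v\<in>{v. b v \<noteq> 0}. b v) = 1}"

definition realisation_act ::
    "('g, 'm) monoid_scheme \<Rightarrow> 'v set set \<Rightarrow> ('g \<Rightarrow> 'v \<Rightarrow> 'v) \<Rightarrow> 'g \<Rightarrow> ('v \<Rightarrow> real) \<Rightarrow> ('v \<Rightarrow> real)" where
  "realisation_act G \<Delta> \<phi> g b = (\<lambda>v. if v \<in> \<Union>\<Delta> then b (\<phi> (inv\<^bsub>G\<^esub> g) v) else 0)"

definition has_fixed_point ::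
    "('g, 'm) monoid_scheme \<Rightarrow> 'v set set \<Rightarrow> ('g \<Rightarrow> 'v \<Rightarrow> 'v) \<Rightarrow> bool" where
  "has_fixed_point G \<Delta> \<phi> \<longleftrightarrow>
     (\<exists>b\<in>realisation \<Delta>. \<forall>g\<in>carrier G. realisation_act G \<Delta> \<phi> g b = b)"

text \<open>
  A definition cannot quantify over types, so the type \<open>'v\<close> of potential vertices is a parameter;
  the property speaks about all buildings whose vertices lie in \<open>'v\<close>. For a countable (in
  particular a finitely generated) group all infinite \<open>'v\<close> give the same property: each orbit of
  simplices lies in a countable invariant subbuilding, obtained by repeatedly adjoining
  apartments through pairs of simplices and their translates, and a fixed point of the
  subbuilding is a fixed point of the building. If \<open>'v\<close> were finite, there would be no buildings of
  this type at all and the property would hold vacuously.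
\<close>

definition property_FB :: "'v itself \<Rightarrow> nat \<Rightarrow> ('g, 'm) monoid_scheme \<Rightarrow> bool" where
  "property_FB _ n G \<longleftrightarrow>
     (\<forall>(\<Delta> :: 'v set set) \<tau> \<phi>.
        building n \<Delta> \<and> type_function n \<Delta> \<tau> \<and>
        simplicial_action G \<Delta> \<phi> \<and> type_preserving G \<Delta> \<tau> \<phi> \<longrightarrow>
        has_fixed_point G \<Delta> \<phi>)"

section \<open>Groups\<close>

definition finitely_generated :: "('g, 'm) monoid_scheme \<Rightarrow> bool" where
  "finitely_generated G \<longleftrightarrow> (\<exists>S. finite S \<and> S \<subseteq> carrier G \<and> generate G S = carrier G)"

definition general_linear :: "'k::field itself \<Rightarrow> nat \<Rightarrow> 'k mat monoid" where
  "general_linear ty m = units_of (ring_mat ty m ())"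

end

theory Submission
  imports Defs "Jordan_Normal_Form.Char_Poly" "Jordan_Normal_Form.Column_Operations"
    "HOL-Library.Countable_Set" "HOL-Computational_Algebra.Primes" "HOL-Algebra.Algebraic_Closure_Type"
begin

no_notation fps_nth (infixl \<open>$\<close> 75)
no_notation fls_nth (infixl \<open>$$\<close> 75)
no_notation Polynomials.var (\<open>X\<index>\<close>)
hide_const (open) Polynomials.degree Polynomials.lead_coeff up_ring.coeff up_ring.monom module.smult Divisibility.prime Divisibility.irreducible

text \<open>
  By Burnside and Schur it suffices that the characteristic polynomials of all \<open>\<rho> g\<close> have
  coefficients algebraic over the prime field. If such a coefficient \<open>x\<close> were transcendental, some
  countable subfield containing \<open>x\<close> and the entries of \<open>\<rho>\<close> on a finite generating set would carry a
  discrete valuation with a pole at \<open>x\<close>. Then \<open>G\<close> acts on the building of lattice classes. The valuation of the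
  determinant vanishes, since otherwise \<open>G\<close> would map onto the integers and could act by hyperbolic
  translations without a fixed point. Hence the action preserves types, a fixed point
  gives an invariant lattice, and all characteristic polynomials are integral at the valuation, so
  \<open>x\<close> has no pole.
\<close>

text \<open>The vertices of a building must live in the type \<open>'v\<close>, known only to be
  infinite. This forces countable subfields: the lattice classes are then countable and can be
  copied into \<open>'v\<close>. Such a field is not complete, so the building axioms rest on an
  argument valid over every discretely valued field: two periodic lattice chains are compared level
  by level, and their relative position is a permutation of the integers. The same permutations
  model the Coxeter group, so apartments, monomial matrices and cosets share one language, and the
  isomorphism with the Coxeter complex comes down to the word problem. All frames have determinant
  of value 0, which makes the index of a vertex modulo \<open>N\<close> a type. Positive
  characteristic enters the finiteness argument twice: finitely many elements algebraic over the
  prime field lie in a finite field, and finitely many matrices generate a finite additive group.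
  Characteristic polynomials suffice because the trace form of an irreducible matrix algebra over an
  algebraically closed field is nondegenerate, so that words are determined by traces.\<close>

locale affine_type =
  fixes n :: nat
  assumes n_pos: "n \<ge> 1"
begin

definition N :: int where "N = int n + 1"

lemma N_gt_1: "N > 1" and N_pos [simp]: "N > 0"
  using n_pos by (auto simp: N_def)

text \<open>
  The Coxeter group is realised by permutations of the integers that commute with the translation
  by \<open>N\<close>; the generator \<open>s\<^sub>i\<close> exchanges \<open>z - 1\<close> and \<open>z\<close> for every \<open>z\<close> congruent to \<open>i\<close>.
\<close>

definition sref :: "int \<Rightarrow> int \<Rightarrow> int" where
  "sref i z = (if (z - i) mod N = 0 then z - 1 else if (z - i + 1) mod N = 0 then z + 1 else z)"

definition periodic :: "(int \<Rightarrow> int) \<Rightarrow> bool" where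
  "periodic f \<longleftrightarrow> bij f \<and> (\<forall>z. f (z + N) = f z + N)"

text \<open>The zero total displacement cuts the affine Weyl group out of all periodic permutations,
  which include the translations; \<open>act_surj\<close> shows that the reflections generate
  it.\<close>

definition aff :: "(int \<Rightarrow> int) \<Rightarrow> bool" where
  "aff f \<longleftrightarrow> periodic f \<and> (\<Sum>z\<in>{0..<N}. f z - z) = 0"

text \<open>With offsets counted from \<open>i - 1\<close>, the reflection swaps the offsets 0 and 1
  in every window of length \<open>N\<close>. Identities between reflections thereby become case
  distinctions on \<open>r\<close>.\<close>

lemma sref_offset:
  assumes "0 \<le> r" "r < N"
  shows "sref i (i - 1 + N * q + r) =
    i - 1 + N * q + (if r = 0 then 1 else if r = 1 then 0 else r)"
proof -
  have a: "(i - 1 + N * q + r - i) mod N = (r - 1) mod N"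
  proof -
    have "i - 1 + N * q + r - i = (r - 1) + N * q" by simp
    then show ?thesis by (metis mod_mult_self2)
  qed
  have b: "(i - 1 + N * q + r - i + 1) mod N = r"
  proof -
    have "i - 1 + N * q + r - i + 1 = r + N * q" by simp
    then have "(i - 1 + N * q + r - i + 1) mod N = r mod N" by (metis mod_mult_self2)
    then show ?thesis using assms by simp
  qed
  have c: "(r - 1) mod N = 0 \<longleftrightarrow> r = 1"
  proof (cases "r = 0")
    case True
    have "(-1::int) mod N = N - 1" using N_gt_1 by (simp add: zmod_minus1)
    then show ?thesis using True N_gt_1 by auto
  next
    case False
    then show ?thesis using assms by simp
  qed
  show ?thesis unfolding sref_def a b c by auto
qed

lemma offset_cases:
  obtains q r where "z = i - 1 + N * q + r" "0 \<le> r" "r < N"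
proof
  show "z = i - 1 + N * ((z - (i - 1)) div N) + (z - (i - 1)) mod N" by simp
  show "0 \<le> (z - (i - 1)) mod N" "(z - (i - 1)) mod N < N"
    by (rule pos_mod_sign[OF N_pos], rule pos_mod_bound[OF N_pos])
qed

lemma sref_sref [simp]: "sref i (sref i z) = z"
proof -
  obtain q r where z: "z = i - 1 + N * q + r" "0 \<le> r" "r < N" by (rule offset_cases)
  define c where "c = i - 1 + N * q"
  have s: "sref i (c + r) = c + (if r = 0 then 1 else if r = 1 then 0 else r)" if "0 \<le> r" "r < N" for r
    unfolding c_def using that by (rule sref_offset)
  show ?thesis
    using z(2,3) N_gt_1 s[of 0] s[of 1] s[of r] unfolding z(1) c_def[symmetric]
    by (cases "r = 0"; cases "r = 1") simp_all
qed

lemma sref_o_sref [simp]: "sref i \<circ> sref i = id"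
  by auto

lemma sref_left [simp]: "sref i (i - 1) = i" and sref_right [simp]: "sref i i = i - 1"
  using sref_offset[of 0 i 0] sref_offset[of 1 i 0] N_gt_1 by auto

lemma sref_fix: "(z - i) mod N \<noteq> 0 \<Longrightarrow> (z - i + 1) mod N \<noteq> 0 \<Longrightarrow> sref i z = z"
  by (simp add: sref_def)

lemma sref_fix': "i < z \<Longrightarrow> z < i - 1 + N \<Longrightarrow> sref i z = z"
proof -
  assume "i < z" "z < i - 1 + N"
  then have r: "0 \<le> z - i + 1" "z - i + 1 < N" "z - i + 1 \<noteq> 0" "z - i + 1 \<noteq> 1" by auto
  have "i - 1 + N * 0 + (z - i + 1) = z" by simp
  then show ?thesis using sref_offset[OF r(1,2), of i 0] r(3,4) by (simp only: if_False)
qed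

lemma sref_shift: "sref i (z + N) = sref i z + N"
proof -
  have "z + N - i = (z - i) + N" "z + N - i + 1 = (z - i + 1) + N" by auto
  then have "(z + N - i) mod N = (z - i) mod N" "(z + N - i + 1) mod N = (z - i + 1) mod N"
    by (simp_all only: mod_add_self2)
  moreover have "(if a then z + N - 1 else if b then z + N + 1 else z + N) =
      (if a then z - 1 else if b then z + 1 else z) + N" for a b by simp
  ultimately show ?thesis by (simp only: sref_def)
qed

lemma sref_mod: "i mod N = j mod N \<Longrightarrow> sref i = sref j"
proof
  fix z assume ij: "i mod N = j mod N"
  then have "(z - i) mod N = (z - j) mod N" by (intro mod_diff_cong refl)
  moreover from this have "(z - i + 1) mod N = (z - j + 1) mod N" by (intro mod_add_cong refl)
  ultimately show "sref i z = sref j z" by (simp add: sref_def)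
qed

text \<open>In a window starting at \<open>k - 1\<close> the two reflections swap the offsets 0, 1
  and the offsets 1, 2, which are distinct since \<open>N \<ge> 3\<close>. The identity is that of
  the symmetric group on three letters.\<close>

lemma braid:
  assumes "n \<ge> 2"
  shows "sref k \<circ> sref (k + 1) \<circ> sref k = sref (k + 1) \<circ> sref k \<circ> sref (k + 1)"
proof
  fix z
  obtain q r where z: "z = k - 1 + N * q + r" "0 \<le> r" "r < N" by (rule offset_cases)
  have N3: "N \<ge> 3" using assms by (simp add: N_def)
  have s1: "sref k (k - 1 + N * q + r) = k - 1 + N * q + (if r = 0 then 1 else if r = 1 then 0 else r)"
    if "0 \<le> r" "r < N" for r using sref_offset[OF that] .
  have s2: "sref (k+1) (k - 1 + N * q + r) = k - 1 + N * q + (if r = 1 then 2 else if r = 2 then 1 else r)"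
    if "0 \<le> r" "r < N" for r
  proof (cases "r = 0")
    case True
    \<comment> \<open>Offset 0 from \<open>k - 1\<close> is the last offset of the preceding window
      counted from \<open>k\<close>, hence \<open>q - 1\<close>.\<close>
    then show ?thesis using sref_offset[of "N - 1" "k + 1" "q - 1"] N3 by (simp add: algebra_simps)
  next
    case False
    then show ?thesis using sref_offset[of "r - 1" "k + 1" "q"] N3 that by (auto simp: algebra_simps)
  qed
  define c where "c = k - 1 + N * q"
  note s1 = s1[folded c_def] and s2 = s2[folded c_def]
  have v: "sref k c = c + 1" "sref k (c + 1) = c" "sref k (c + 2) = c + 2"
    "sref (k + 1) c = c" "sref (k + 1) (c + 1) = c + 2" "sref (k + 1) (c + 2) = c + 1"
    using s1[of 0] s1[of 1] s1[of 2] s2[of 0] s2[of 1] s2[of 2] N3 by simp_all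
  have g: "sref k (c + r) = c + r" "sref (k + 1) (c + r) = c + r" if "r > 2"
    using s1[of r] s2[of r] z that by simp_all
  consider "r = 0" | "r = 1" | "r = 2" | "r > 2" using z by linarith
  then show "(sref k \<circ> sref (k + 1) \<circ> sref k) z = (sref (k + 1) \<circ> sref k \<circ> sref (k + 1)) z"
    unfolding o_def z(1) c_def[symmetric]
    by cases (simp_all only: v g add_0_right)
qed

lemma sref_commute:
  assumes "i mod N \<noteq> j mod N" "(i + 1) mod N \<noteq> j mod N" "(j + 1) mod N \<noteq> i mod N"
  shows "sref i \<circ> sref j = sref j \<circ> sref i"
proof
  fix z
  define e where "e a b \<longleftrightarrow> a mod N = b mod N" for a b
  have e0: "e a b \<longleftrightarrow> (a - b) mod N = 0" for a b
    unfolding e_def by (simp add: mod_eq_dvd_iff mod_0_imp_dvd dvd_eq_mod_eq_0)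
  have s: "sref i z = (if e z i then z - 1 else if e (z + 1) i then z + 1 else z)" for i z
    unfolding sref_def e0 by (simp add: algebra_simps)
  have e_trans: "e a b \<Longrightarrow> e a c \<Longrightarrow> e b c" for a b c by (simp add: e_def)
  have e_minus: "e (a - 1) b \<longleftrightarrow> e a (b + 1)" and e_plus: "e (a + 1) (b + 1) \<longleftrightarrow> e a b" for a b
    unfolding e0 by (simp_all add: algebra_simps)
  have "\<not> e i j" "\<not> e j i" "\<not> e (i + 1) j" "\<not> e (j + 1) i" "\<not> e i (j + 1)" "\<not> e j (i + 1)"
    using assms unfolding e_def by metis+
  then have imps: "e z i \<Longrightarrow> \<not> e z j \<and> \<not> e (z + 1) j \<and> \<not> e z (j + 1)"
     "e z j \<Longrightarrow> \<not> e z i \<and> \<not> e (z + 1) i \<and> \<not> e z (i + 1)"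
     "e (z + 1) i \<Longrightarrow> \<not> e z j \<and> \<not> e (z + 1) j \<and> \<not> e (z + 1 + 1) j"
     "e (z + 1) j \<Longrightarrow> \<not> e z i \<and> \<not> e (z + 1) i \<and> \<not> e (z + 1 + 1) i"
    using e_trans e_plus by metis+
  show "(sref i \<circ> sref j) z = (sref j \<circ> sref i) z"
    unfolding o_def s by (auto simp: e_minus dest: imps)
qed

lemma mod_eq_offset: "(a::int) mod N = b mod N \<Longrightarrow> \<exists>q. a = b + N * q"
  by (metis mod_eqE add.commute diff_add_cancel mod_eq_dvd_iff dvdE)

lemma periodic_mult: "periodic f \<Longrightarrow> f (z + N * q) = f z + N * q"
proof -
  assume p: "periodic f"
  have nat: "f (z + N * int m) = f z + N * int m" for m z
  proof (induction m)
    case (Suc m)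
    have "f (z + N * int (Suc m)) = f ((z + N * int m) + N)" by (simp add: algebra_simps)
    also have "\<dots> = f (z + N * int m) + N" using p by (simp add: periodic_def)
    finally show ?case using Suc by (simp add: algebra_simps)
  qed simp
  show ?thesis
  proof (cases "q \<ge> 0")
    case True
    then show ?thesis using nat[of z "nat q"] by simp
  next
    case False
    then show ?thesis using nat[of "z + N * q" "nat (-q)"] by (simp add: algebra_simps)
  qed
qed

lemma periodic_id [simp]: "periodic id" by (simp add: periodic_def)

lemma periodic_comp: "periodic f \<Longrightarrow> periodic g \<Longrightarrow> periodic (f \<circ> g)"
  by (auto simp: periodic_def intro: bij_comp)

lemma periodic_inv: "periodic f \<Longrightarrow> periodic (inv_into UNIV f)"
  unfolding periodic_def
  by (metis bij_imp_bij_inv bij_inv_eq_iff)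

lemma periodic_sref [simp]: "periodic (sref i)"
  unfolding periodic_def using sref_shift by (metis o_bij sref_o_sref)

lemma periodic_plus: "periodic ((+) c)"
  unfolding periodic_def by (auto simp: bij_plus_right algebra_simps bij_def)

lemma window_sum:
  fixes f :: "int \<Rightarrow> int"
  assumes "\<And>z. f (z + N) = f z"
  shows "sum f {a..<a + N} = sum f {0..<N}"
proof -
  have step: "sum f {a + 1..<a + 1 + N} = sum f {a..<a + N}" for a
  proof -
    have "{a + 1..<a + 1 + N} = insert (a + N) {a+1..<a + N}" using N_gt_1 by auto
    moreover have "{a..<a + N} = insert a {a+1..<a + N}" using N_gt_1 by auto
    ultimately show ?thesis using assms by simp
  qed
  show ?thesis
  proof (induction a rule: int_induct[where k = 0])
    case (step1 i) then show ?case using step[of i] by (simp add: algebra_simps)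
  next
    case (step2 i) then show ?case using step[of "i - 1"] by (simp add: algebra_simps)
  qed simp
qed

text \<open>A periodic bijection permutes the residues modulo \<open>N\<close>, and \<open>g\<close>
  depends on residues only.\<close>

lemma sum_periodic_reindex:
  fixes g :: "int \<Rightarrow> int"
  assumes f: "periodic f" and g: "\<And>z q. g (z + N * q) = g z"
  shows "(\<Sum>z\<in>{0..<N}. g (f z)) = sum g {0..<N}"
proof -
  have inj: "inj_on (\<lambda>z. f z mod N) {0..<N}"
  proof (rule inj_onI)
    fix x y assume xy: "x \<in> {0..<N}" "y \<in> {0..<N}" "f x mod N = f y mod N"
    then obtain q where "f x = f y + N * q" using mod_eq_offset by blast
    then have "f x = f (y + N * q)" using periodic_mult[OF f] by simp
    then have "x = y + N * q" using f by (auto simp: periodic_def bij_def inj_def)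
    then have "x mod N = y mod N" by simp
    then show "x = y" using xy by simp
  qed
  have "(\<lambda>z. f z mod N) ` {0..<N} \<subseteq> {0..<N}" using N_pos by auto
  then have im: "(\<lambda>z. f z mod N) ` {0..<N} = {0..<N}"
    using inj by (simp add: endo_inj_surj)
  have "g (f z) = g (f z mod N)" for z
    using g[of "f z mod N" "f z div N"] by simp
  then have "(\<Sum>z\<in>{0..<N}. g (f z)) = (\<Sum>z\<in>{0..<N}. g (f z mod N))" by simp
  also have "\<dots> = sum g ((\<lambda>z. f z mod N) ` {0..<N})" using inj by (simp add: sum.reindex)
  finally show ?thesis using im by simp
qed

text \<open>A homomorphism from the periodic permutations to the integers with kernel
  \<open>aff\<close>; for monomial matrices it turns out to be \<open>N\<close> times the value of
  the determinant.\<close>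

definition defect :: "(int \<Rightarrow> int) \<Rightarrow> int" where
  "defect f = (\<Sum>z\<in>{0..<N}. f z - z)"

lemma aff_iff: "aff f \<longleftrightarrow> periodic f \<and> defect f = 0"
  by (simp add: aff_def defect_def)

lemma defect_comp:
  assumes "periodic f" "periodic g"
  shows "defect (f \<circ> g) = defect f + defect g"
proof -
  have "(\<Sum>z\<in>{0..<N}. f (g z) - g z) = (\<Sum>z\<in>{0..<N}. f z - z)"
    using assms(1) by (intro sum_periodic_reindex[OF assms(2), of "\<lambda>z. f z - z"]) (simp add: periodic_mult)
  then show ?thesis by (simp add: defect_def sum_subtractf)
qed

lemma defect_plus: "defect ((+) c) = N * c"
  using N_gt_1 by (simp add: defect_def)

lemma aff_id [simp]: "aff id" by (simp add: aff_def)

lemma aff_comp: "aff f \<Longrightarrow> aff g \<Longrightarrow> aff (f \<circ> g)"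
  by (simp add: aff_iff periodic_comp defect_comp)

lemma aff_inv:
  assumes "aff f"
  shows "aff (inv_into UNIV f)"
proof -
  have "f \<circ> inv_into UNIV f = id" using assms by (simp add: aff_def periodic_def bij_def surj_iff)
  then have "defect f + defect (inv_into UNIV f) = 0"
    using defect_comp[of f "inv_into UNIV f"] assms periodic_inv[of f] by (simp add: aff_iff defect_def)
  then show ?thesis using assms periodic_inv[of f] by (simp add: aff_iff)
qed

lemma aff_periodic: "aff f \<Longrightarrow> periodic f" by (simp add: aff_def)

lemma window_split:
  fixes f :: "int \<Rightarrow> int"
  assumes "\<And>z. f (z + N) = f z"
  shows "sum f {0..<N} = f (i - 1) + f i + sum f {i + 1..<i - 1 + N}"
proof -
  have "{i - 1..<i - 1 + N} = insert (i - 1) (insert i {i + 1..<i - 1 + N})" using N_gt_1 by auto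
  then show ?thesis using window_sum[of f "i - 1"] assms by simp
qed

lemma aff_sref [simp]: "aff (sref i)"
proof -
  have "sum (\<lambda>z. sref i z - z) {i + 1..<i - 1 + N} = 0"
    by (intro sum.neutral) (auto simp: sref_fix')
  then show ?thesis
    using window_split[of "\<lambda>z. sref i z - z" i] by (simp add: aff_def sref_shift)
qed

text \<open>Replaces the Coxeter length as induction measure: removing a descent \<open>i\<close>
  lowers it by \<open>2 * (f (i - 1) - f i)\<close>, since only two squares of a suitable window
  change.\<close>

definition energy :: "(int \<Rightarrow> int) \<Rightarrow> nat" where
  "energy f = nat (\<Sum>z\<in>{0..<N}. (f z - z)\<^sup>2)"

definition desc :: "(int \<Rightarrow> int) \<Rightarrow> int \<Rightarrow> bool" where
  "desc f i \<longleftrightarrow> f i < f (i - 1)"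

lemma energy_decreases:
  assumes f: "periodic f" and d: "desc f i"
  shows "energy (f \<circ> sref i) < energy f"
proof -
  have p: "f (z + N) = f z + N" for z using f by (simp add: periodic_def)
  have rest: "(\<Sum>z\<in>{i + 1..<i - 1 + N}. ((f \<circ> sref i) z - z)\<^sup>2) = (\<Sum>z\<in>{i + 1..<i - 1 + N}. (f z - z)\<^sup>2)"
    by (intro sum.cong) (auto simp: sref_fix')
  have "(\<Sum>z\<in>{0..<N}. ((f \<circ> sref i) z - z)\<^sup>2) < (\<Sum>z\<in>{0..<N}. (f z - z)\<^sup>2)"
    using window_split[of "\<lambda>z. (f z - z)\<^sup>2" i] window_split[of "\<lambda>z. ((f \<circ> sref i) z - z)\<^sup>2" i] rest d
    by (simp add: p sref_shift desc_def) (simp add: power2_eq_square algebra_simps)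
  moreover have "(\<Sum>z\<in>{0..<N}. ((f \<circ> sref i) z - z)\<^sup>2) \<ge> 0" by (intro sum_nonneg) simp
  ultimately show ?thesis by (simp add: energy_def)
qed

lemma desc_mod:
  assumes "periodic f" "i mod N = j mod N"
  shows "desc f i \<longleftrightarrow> desc f j"
proof -
  obtain q where q: "i = j + N * q" using mod_eq_offset[OF assms(2)] by blast
  have "f i = f j + N * q" "f (i - 1) = f (j - 1) + N * q"
    using periodic_mult[OF assms(1), of j q] periodic_mult[OF assms(1), of "j - 1" q] by (simp_all add: q algebra_simps)
  then show ?thesis by (simp add: desc_def)
qed

text \<open>Without descents \<open>f\<close> is strictly increasing, and periodicity leaves room
  only for steps of size 1. So \<open>f\<close> is a translation, and the zero total displacement
  makes it the identity.\<close>

lemma no_desc_id: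
  assumes f: "aff f" and nd: "\<And>i. 0 \<le> i \<Longrightarrow> i \<le> int n \<Longrightarrow> \<not> desc f i"
  shows "f = id"
proof -
  have per: "periodic f" using f aff_periodic by auto
  have nd': "\<not> desc f i" for i
    using nd[of "i mod N"] desc_mod[OF per, of i "i mod N"] pos_mod_bound[of N i] by (auto simp: N_def)
  have step: "f (z + 1) \<ge> f z + 1" for z
  proof -
    have "f (z + 1) \<noteq> f z" using per unfolding periodic_def by (metis bij_pointE add_cancel_right_right zero_neq_one)
    then show ?thesis using nd'[of "z + 1"] by (simp add: desc_def)
  qed
  have mono: "f (z + int m) \<ge> f z + int m" for z m
  proof (induction m)
    case (Suc m)
    then show ?case using step[of "z + int m"] by (simp add: algebra_simps)
  qed simp
  have one: "f (z + 1) = f z + 1" for z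
  proof -
    have "f (z + 1 + int n) \<ge> f (z + 1) + int n" by (rule mono)
    moreover have "z + 1 + int n = z + N" by (simp add: N_def)
    then have "f (z + 1 + int n) = f z + N" using per by (simp only: periodic_def)
    ultimately show ?thesis using step[of z] by (simp add: N_def)
  qed
  have "f z - z = f 0" for z
  proof (induction z rule: int_induct[where k = 0])
    case (step1 i) then show ?case using one[of i] by simp
  next
    case (step2 i) then show ?case using one[of "i - 1"] by simp
  qed simp
  then have "(\<Sum>z\<in>{0..<N}. f 0) = 0" using f by (simp add: aff_def)
  then have "f 0 = 0" using N_gt_1 by simp
  then show ?thesis using \<open>\<And>z. f z - z = f 0\<close> by (auto simp: fun_eq_iff)
qed

primrec act :: "nat list \<Rightarrow> int \<Rightarrow> int" where
  "act [] = id"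
| "act (i # u) = sref (int i) \<circ> act u"

lemma act_append: "act (u @ v) = act u \<circ> act v"
  by (induction u) auto

lemma aff_act [simp]: "aff (act u)"
  by (induction u) (simp_all add: aff_comp del: o_apply id_apply)

lemma nat_mod_N: "int ((i + 1) mod (n + 1)) mod N = (int i + 1) mod N"
  by (simp add: of_nat_mod N_def add.commute)

lemma act_relator:
  assumes "r \<in> relators n"
  shows "act r = id"
proof -
  consider i where "r = [i, i]"
    | i j where "n \<ge> 2" "r = [i, j, i, j, i, j]" "j = (i + 1) mod (n + 1)"
    | i j where "n \<ge> 2" "r = [i, j, i, j]" "i \<le> n" "j \<le> n" "j \<noteq> i" "\<not> adjacent n i j"
    using assms by (auto simp: relators_def split: if_splits)
  then show ?thesis
  proof cases
    case 2
    have s: "sref (int j) = sref (int i + 1)"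
      unfolding 2 using nat_mod_N by (rule sref_mod)
    have "act r = (sref (int i) \<circ> sref (int i + 1) \<circ> sref (int i)) \<circ> (sref (int i + 1) \<circ> sref (int i) \<circ> sref (int i + 1))"
      by (simp add: 2(2) s o_assoc)
    also have "\<dots> = id" unfolding braid[OF 2(1)] by (auto simp: fun_eq_iff)
    finally show ?thesis .
  next
    case 3
    have "sref (int i) \<circ> sref (int j) = sref (int j) \<circ> sref (int i)"
    proof (rule sref_commute)
      show "int i mod N \<noteq> int j mod N" using 3 by (simp add: N_def)
      have "int ((i + 1) mod (n + 1)) \<noteq> int j" "int ((j + 1) mod (n + 1)) \<noteq> int i" using 3(6) by (auto simp: adjacent_def)
      then show "(int i + 1) mod N \<noteq> int j mod N" "(int j + 1) mod N \<noteq> int i mod N"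
        using 3 nat_mod_N[of i] nat_mod_N[of j] by (auto simp: N_def of_nat_mod add.commute)
    qed
    then have "act r = sref (int i) \<circ> (sref (int j) \<circ> (sref (int j) \<circ> sref (int i)))"
      by (simp add: 3)
    then show ?thesis by (simp add: fun_eq_iff)
  qed auto
qed

lemma word_equiv_act: "word_equiv n u v \<Longrightarrow> act u = act v"
  by (induction rule: word_equiv.induct) (auto simp: act_append act_relator)


section \<open>The affine permutations have the Coxeter presentation\<close>

text \<open>A word for \<open>f\<close>, obtained by stripping arbitrarily chosen descents from the
  right. As it depends on \<open>f\<close> alone, it becomes a normal form once
  \<open>cw_desc\<close> shows that the choice is immaterial modulo the relations. The test for
  periodicity secures termination.\<close>

function cw :: "(int \<Rightarrow> int) \<Rightarrow> nat list" where
  "cw f = (if periodic f \<and> (\<exists>i\<le>n. desc f (int i))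
    then cw (f \<circ> sref (int (SOME i. i \<le> n \<and> desc f (int i)))) @ [SOME i. i \<le> n \<and> desc f (int i)]
    else [])"
  by auto
termination
proof (relation "measure energy")
  fix f assume a: "periodic f \<and> (\<exists>i\<le>n. desc f (int i))"
  then have "desc f (int (SOME i. i \<le> n \<and> desc f (int i)))"
    by (metis (mono_tags, lifting) someI_ex)
  then show "(f \<circ> sref (int (SOME i. i \<le> n \<and> desc f (int i))), f) \<in> measure energy"
    using energy_decreases a by simp
qed simp

declare cw.simps [simp del]

lemma cw_step:
  assumes "periodic f" "\<exists>i\<le>n. desc f (int i)"
  obtains i where "i \<le> n" "desc f (int i)" "cw f = cw (f \<circ> sref (int i)) @ [i]"
proof
  let ?i = "SOME i. i \<le> n \<and> desc f (int i)"
  show "?i \<le> n" "desc f (int ?i)" using assms(2) by (metis (mono_tags, lifting) someI_ex)+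
  show "cw f = cw (f \<circ> sref (int ?i)) @ [?i]" using assms by (simp add: cw.simps[of f])
qed

lemma cw_lists: "periodic f \<Longrightarrow> cw f \<in> lists {0..n}"
proof (induction "energy f" arbitrary: f rule: less_induct)
  case less
  show ?case
  proof (cases "\<exists>i\<le>n. desc f (int i)")
    case True
    then obtain i where i: "i \<le> n" "desc f (int i)" "cw f = cw (f \<circ> sref (int i)) @ [i]"
      using cw_step less.prems by metis
    have "cw (f \<circ> sref (int i)) \<in> lists {0..n}"
      using less i energy_decreases by (simp add: periodic_comp)
    then show ?thesis using i by simp
  next
    case False
    then have "cw f = []" by (subst cw.simps) auto
    then show ?thesis by simp
  qed
qed

lemma word_equiv_sqr: "u \<in> lists {0..n} \<Longrightarrow> i \<le> n \<Longrightarrow> word_equiv n (u @ [i, i]) u"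
  using word_equiv_relator[of u n "[]" "[i, i]"] by (auto simp: relators_def)

lemma word_equiv_sqr': "u \<in> lists {0..n} \<Longrightarrow> v \<in> lists {0..n} \<Longrightarrow> i \<le> n \<Longrightarrow> word_equiv n (u @ i # i # v) (u @ v)"
  using word_equiv_relator[of u n v "[i, i]"] by (auto simp: relators_def)

text \<open>The word \<open>[i, j, i, j, i, j, j, i, j]\<close> reduces in two ways: by deleting the
  relator at its front, or by cancelling the squares that appear one after another at the
  junction.\<close>

lemma braid_equiv1:
  assumes "n \<ge> 2" "i \<le> n" "j = (i + 1) mod (n + 1)"
  shows "word_equiv n [i, j, i] [j, i, j]"
proof -
  have j: "j \<le> n" using assms(3) mod_less_divisor[of "n + 1" "i + 1"] by linarith
  have r: "[i, j, i, j, i, j] \<in> relators n" using assms by (auto simp: relators_def)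
  have 1: "word_equiv n ([i, j, i, j, i, j] @ [j, i, j]) [j, i, j]"
    using word_equiv_relator[of "[]" n "[j, i, j]", OF _ _ r] assms(2) j by simp
  have "word_equiv n ([i, j, i, j, i] @ j # j # [i, j]) ([i, j, i, j, i] @ [i, j])"
    using assms(2) j by (intro word_equiv_sqr') auto
  moreover have "word_equiv n ([i, j, i, j] @ i # i # [j]) ([i, j, i, j] @ [j])"
    using assms(2) j by (intro word_equiv_sqr') auto
  moreover have "word_equiv n ([i, j, i] @ j # j # []) ([i, j, i] @ [])"
    using assms(2) j by (intro word_equiv_sqr') auto
  ultimately have "word_equiv n ([i, j, i, j, i, j] @ [j, i, j]) [i, j, i]"
    by (simp) (meson word_equiv_trans)
  then show ?thesis using 1 by (meson word_equiv_trans word_equiv_sym)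
qed

lemma commute_equiv:
  assumes "n \<ge> 2" "i \<le> n" "j \<le> n" "i \<noteq> j" "\<not> adjacent n i j"
  shows "word_equiv n [i, j] [j, i]"
proof -
  have r: "[i, j, i, j] \<in> relators n" using assms by (auto simp: relators_def)
  have 1: "word_equiv n ([i, j, i, j] @ [j, i]) [j, i]"
    using word_equiv_relator[of "[]" n "[j, i]", OF _ _ r] assms by simp
  have "word_equiv n ([i, j, i] @ j # j # [i]) ([i, j, i] @ [i])"
    using assms by (intro word_equiv_sqr') auto
  moreover have "word_equiv n ([i, j] @ i # i # []) ([i, j] @ [])"
    using assms by (intro word_equiv_sqr') auto
  ultimately have "word_equiv n ([i, j, i, j] @ [j, i]) [i, j]"
    by (simp) (meson word_equiv_trans)
  then show ?thesis using 1 by (meson word_equiv_trans word_equiv_sym)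
qed

lemma desc_sref_commuting:
  assumes "i mod N \<noteq> j mod N" "(i + 1) mod N \<noteq> j mod N" "(j + 1) mod N \<noteq> i mod N"
  shows "desc (f \<circ> sref i) j \<longleftrightarrow> desc f j"
proof -
  have e0: "(a - b) mod N = 0 \<longleftrightarrow> a mod N = b mod N" for a b
    by (simp add: mod_eq_dvd_iff mod_0_imp_dvd dvd_eq_mod_eq_0)
  have "sref i j = j" using assms e0[of j i] e0[of "j + 1" i]
    by (intro sref_fix) (auto simp: algebra_simps)
  moreover have "sref i (j - 1) = j - 1" using assms e0[of j i] e0[of j "i + 1"]
    by (intro sref_fix) (auto simp: algebra_simps)
  ultimately show ?thesis by (simp add: desc_def)
qed

text \<open>Two adjacent descents mean \<open>f (k - 1) > f k > f (k + 1)\<close>; the three values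
  can be sorted starting with either swap, and every intermediate swap removes a descent.\<close>

lemma desc_braid:
  assumes "n \<ge> 2" "desc f k" "desc f (k + 1)"
  shows "desc (f \<circ> sref k) (k + 1)" "desc (f \<circ> sref k \<circ> sref (k + 1)) k"
    "desc (f \<circ> sref (k + 1)) k" "desc (f \<circ> sref (k + 1) \<circ> sref k) (k + 1)"
proof -
  have "sref k (k + 1) = k + 1" "sref (k + 1) (k - 1) = k - 1"
    \<comment> \<open>The index is lowered by \<open>N\<close> so that \<open>k - 1\<close> falls
      into the range covered by \<open>sref_fix'\<close>.\<close>
    using sref_fix'[of k "k + 1"] sref_fix'[of "k + 1 - N" "k - 1"] sref_mod[of "k + 1 - N" "k + 1"] assms(1)
      minus_mod_self2[of "k + 1" N]
    by (simp_all add: N_def)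
  moreover have "sref (k + 1) k = k + 1" "sref (k + 1) (k + 1) = k"
    using sref_left[of "k + 1"] sref_right[of "k + 1"] by simp_all
  ultimately show "desc (f \<circ> sref k) (k + 1)" "desc (f \<circ> sref k \<circ> sref (k + 1)) k"
    "desc (f \<circ> sref (k + 1)) k" "desc (f \<circ> sref (k + 1) \<circ> sref k) (k + 1)"
    using assms(2,3) by (simp_all add: desc_def)
qed

text \<open>A diamond argument by induction on the energy: if \<open>cw\<close> strips
  \<open>i\<close> while \<open>j\<close> is also a descent, both continuations are led to a common
  permutation by a square or a hexagon, and the letters collected on the two sides differ by a
  commutation or a braid relation.\<close>

lemma cw_desc:
  assumes "periodic f" "j \<le> n" "desc f (int j)"
  shows "word_equiv n (cw f) (cw (f \<circ> sref (int j)) @ [j])"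
  using assms
proof (induction "energy f" arbitrary: f j rule: less_induct)
  case less
  note per = less.prems(1)
  obtain i where i: "i \<le> n" "desc f (int i)" "cw f = cw (f \<circ> sref (int i)) @ [i]"
    using cw_step less.prems by metis
  let ?s = "\<lambda>i. sref (int i)"
  have per1 [simp]: "periodic (f \<circ> ?s i)" "periodic (f \<circ> ?s j)" for i j using per by (simp_all add: periodic_comp)
  have per2 [simp]: "periodic (f \<circ> ?s i \<circ> ?s j)" for i j
    using per by (simp add: periodic_comp)
  have per3 [simp]: "periodic (f \<circ> ?s i \<circ> ?s j \<circ> ?s k)" for i j k
    using per by (simp add: periodic_comp)
  have lt: "energy (f \<circ> ?s i) < energy f" "energy (f \<circ> ?s j) < energy f"
    using per i less.prems energy_decreases by auto
  have IH: "word_equiv n (cw (f \<circ> ?s a)) (cw (f \<circ> ?s a \<circ> ?s b) @ [b])"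
    if "a = i \<or> a = j" "b \<le> n" "desc (f \<circ> ?s a) (int b)" for a b
    using less.hyps[of "f \<circ> ?s a" b] that lt by auto
  have IH2: "word_equiv n (cw (f \<circ> ?s a \<circ> ?s b)) (cw (f \<circ> ?s a \<circ> ?s b \<circ> ?s c) @ [c])"
    if "a = i \<or> a = j" "desc (f \<circ> ?s a) (int b)" "c \<le> n" "desc (f \<circ> ?s a \<circ> ?s b) (int c)" for a b c
  proof (rule less.hyps)
    have "energy (f \<circ> ?s a \<circ> ?s b) < energy (f \<circ> ?s a)" using that by (intro energy_decreases) auto
    also have "\<dots> < energy f" using that lt by auto
    finally show "energy (f \<circ> ?s a \<circ> ?s b) < energy f" .
  qed (use that in auto)
  have ap: "word_equiv n (u @ w) (v @ w)" if "word_equiv n u v" "w \<in> lists {0..n}" for u v w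
    using that by (rule word_equiv_append_right)
  show ?case
  proof (cases "i = j")
    case True
    have "cw f \<in> lists {0..n}" using per by (rule cw_lists)
    then show ?thesis using i True by (simp add: word_equiv_refl)
  next
    case ij: False
    show ?thesis
    proof (cases "n \<ge> 2")
      case n2: True
      show ?thesis
      proof (cases "adjacent n i j")
        case False
        have m: "int i mod N \<noteq> int j mod N" "(int i + 1) mod N \<noteq> int j mod N" "(int j + 1) mod N \<noteq> int i mod N"
        proof -
          show "int i mod N \<noteq> int j mod N" using i less.prems ij by (simp add: N_def)
          have "int ((i + 1) mod (n + 1)) \<noteq> int j" "int ((j + 1) mod (n + 1)) \<noteq> int i" using False by (auto simp: adjacent_def)
          then show "(int i + 1) mod N \<noteq> int j mod N" "(int j + 1) mod N \<noteq> int i mod N"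
            using i less.prems by (auto simp: of_nat_mod add.commute N_def)
        qed
        have c: "f \<circ> ?s i \<circ> ?s j = f \<circ> ?s j \<circ> ?s i" using sref_commute[OF m] by (simp add: comp_assoc)
        have dj: "desc (f \<circ> ?s i) (int j)" using desc_sref_commuting[OF m] less.prems by simp
        have di: "desc (f \<circ> ?s j) (int i)"
          using desc_sref_commuting[of "int j" "int i" f] m i by metis
        have 1: "word_equiv n (cw f) ((cw (f \<circ> ?s i \<circ> ?s j) @ [j]) @ [i])"
          using ap[OF IH[of i j], of "[i]"] dj less.prems i by simp
        have 2: "word_equiv n (cw (f \<circ> ?s j) @ [j]) ((cw (f \<circ> ?s i \<circ> ?s j) @ [i]) @ [j])"
          using ap[OF IH[of j i], of "[j]"] di less.prems i unfolding c by simp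
        have "\<not> adjacent n j i" using False by (auto simp: adjacent_def)
        then have "word_equiv n [j, i] [i, j]" using commute_equiv n2 i less.prems ij by auto
        then have "word_equiv n (cw (f \<circ> ?s i \<circ> ?s j) @ [j, i]) (cw (f \<circ> ?s i \<circ> ?s j) @ [i, j])"
          by (intro word_equiv_append_left cw_lists) auto
        then show ?thesis using 1 2 by simp (meson word_equiv_trans word_equiv_sym)
      next
        case True
        have "desc (f \<circ> ?s i) (int j) \<and> desc (f \<circ> ?s i \<circ> ?s j) (int i) \<and> desc (f \<circ> ?s j) (int i) \<and> desc (f \<circ> ?s j \<circ> ?s i) (int j)
          \<and> ?s i \<circ> ?s j \<circ> ?s i = ?s j \<circ> ?s i \<circ> ?s j \<and> word_equiv n [i, j, i] [j, i, j]"
        proof -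
          have main: "desc (f \<circ> ?s i) (int j) \<and> desc (f \<circ> ?s i \<circ> ?s j) (int i) \<and> desc (f \<circ> ?s j) (int i) \<and> desc (f \<circ> ?s j \<circ> ?s i) (int j)
            \<and> ?s i \<circ> ?s j \<circ> ?s i = ?s j \<circ> ?s i \<circ> ?s j"
            if "j = (i + 1) mod (n + 1)" "desc f (int i)" "desc f (int j)" for i j
          proof -
            have m: "int j mod N = (int i + 1) mod N" using that nat_mod_N by simp
            have s: "?s j = sref (int i + 1)" using m by (rule sref_mod)
            have d: "desc g (int j) \<longleftrightarrow> desc g (int i + 1)" if "periodic g" for g using desc_mod[OF that m] .
            have "desc f (int i + 1)" using that d[OF per] by simp
            note db = desc_braid[OF n2 that(2) this, folded s]
            show ?thesis using db d braid[OF n2, of "int i"] by (simp add: s[symmetric])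
          qed
          have "j = (i + 1) mod (n + 1) \<or> i = (j + 1) mod (n + 1)" using True by (simp add: adjacent_def)
          then show ?thesis
          proof
            assume j: "j = (i + 1) mod (n + 1)"
            then show ?thesis using main[OF j i(2) less.prems(3)] braid_equiv1[OF n2 i(1) j] by simp
          next
            assume j: "i = (j + 1) mod (n + 1)"
            then show ?thesis using main[OF j less.prems(3) i(2)] braid_equiv1[OF n2 less.prems(2) j]
              by (auto intro: word_equiv_sym)
          qed
        qed
        then have d: "desc (f \<circ> ?s i) (int j)" "desc (f \<circ> ?s i \<circ> ?s j) (int i)" "desc (f \<circ> ?s j) (int i)" "desc (f \<circ> ?s j \<circ> ?s i) (int j)"
          and br: "?s i \<circ> ?s j \<circ> ?s i = ?s j \<circ> ?s i \<circ> ?s j" and we: "word_equiv n [i, j, i] [j, i, j]" by auto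
        \<comment> \<open>The bottom of the hexagon: both sides strip three descents, and the braid
          relation makes the results equal. This is why the induction hypothesis is also needed two
          steps down, in \<open>IH2\<close>.\<close>
        let ?g = "f \<circ> ?s i \<circ> ?s j \<circ> ?s i"
        have g: "f \<circ> ?s j \<circ> ?s i \<circ> ?s j = ?g" using br by (simp add: comp_assoc)
        have a1: "word_equiv n (cw f) ((cw (f \<circ> ?s i \<circ> ?s j) @ [j]) @ [i])"
          using ap[OF IH[of i j], of "[i]"] d less.prems i by simp
        have a2: "word_equiv n (cw (f \<circ> ?s i \<circ> ?s j) @ [j, i]) ((cw ?g @ [i]) @ [j, i])"
          using IH2[of i j i] d less.prems i by (intro ap) auto
        have b1: "word_equiv n (cw (f \<circ> ?s j) @ [j]) ((cw (f \<circ> ?s j \<circ> ?s i) @ [i]) @ [j])"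
          using IH[of j i] d less.prems i by (intro ap) auto
        have b2: "word_equiv n (cw (f \<circ> ?s j \<circ> ?s i) @ [i, j]) ((cw ?g @ [j]) @ [i, j])"
          using IH2[of j i j] d less.prems i g by (intro ap) auto
        have c: "word_equiv n (cw ?g @ [i, j, i]) (cw ?g @ [j, i, j])"
          using we by (intro word_equiv_append_left cw_lists) auto
        show ?thesis using a1 a2 b1 b2 c by simp (meson word_equiv_trans word_equiv_sym)
      qed
    next
      case False
      \<comment> \<open>In the infinite dihedral case two descents never coexist:
        \<open>f 1 < f 0 < f (-1)\<close> contradicts \<open>f 1 = f (-1) + 2\<close>.\<close>
      then have n1: "n = 1" using n_pos by simp
      have "(i = 0 \<and> j = 1) \<or> (i = 1 \<and> j = 0)" using ij i less.prems n1 by auto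
      then have "desc f 0" "desc f 1" using i less.prems by auto
      have "f (-1 + N) = f (-1) + N" using per by (simp only: periodic_def)
      moreover have "N = 2" unfolding N_def by (simp add: n1)
      ultimately have "f 1 = f (-1) + 2" by simp
      with \<open>desc f 0\<close> \<open>desc f 1\<close> show ?thesis by (simp add: desc_def)
    qed
  qed
qed

text \<open>Since \<open>f\<close> takes different values at \<open>j - 1\<close> and
  \<open>j\<close>, either \<open>f\<close> or the composite has the descent \<open>j\<close>; both
  cases reduce to \<open>cw_desc\<close>.\<close>

lemma cw_sref:
  assumes f: "periodic f" and j: "j \<le> n"
  shows "word_equiv n (cw (f \<circ> sref (int j))) (cw f @ [j])"
proof (cases "desc f (int j)")
  case True
  have "word_equiv n (cw f @ [j]) ((cw (f \<circ> sref (int j)) @ [j]) @ [j])"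
    using cw_desc[OF f j True] j by (intro word_equiv_append_right) auto
  moreover have "word_equiv n (cw (f \<circ> sref (int j)) @ [j, j]) (cw (f \<circ> sref (int j)))"
    using j f by (intro word_equiv_sqr cw_lists periodic_comp) auto
  ultimately show ?thesis by simp (meson word_equiv_trans word_equiv_sym)
next
  case False
  have "f (int j) \<noteq> f (int j - 1)" using f unfolding periodic_def
    by (metis bij_pointE add_cancel_right_right diff_add_cancel zero_neq_one)
  then have d: "desc (f \<circ> sref (int j)) (int j)" using False by (simp add: desc_def)
  have "f \<circ> sref (int j) \<circ> sref (int j) = f" by (simp add: comp_assoc)
  then show ?thesis using cw_desc[OF _ j d] f by (simp add: periodic_comp)
qed

lemma word_equiv_cw: "u \<in> lists {0..n} \<Longrightarrow> word_equiv n (cw (act u)) u"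
proof (induction u rule: rev_induct)
  case Nil
  have "cw id = []" by (simp add: cw.simps[of id] desc_def)
  then show ?case by (simp add: word_equiv_refl del: id_apply flip: id_def)
next
  case (snoc j u)
  then have "word_equiv n (cw (act u \<circ> sref (int j))) (cw (act u) @ [j])"
    by (intro cw_sref) (auto simp: aff_periodic)
  moreover have "word_equiv n (cw (act u) @ [j]) (u @ [j])"
    using snoc by (intro word_equiv_append_right) auto
  ultimately have "word_equiv n (cw (act u \<circ> sref (int j))) (u @ [j])" by (rule word_equiv_trans)
  moreover have "act (u @ [j]) = act u \<circ> sref (int j)" by (simp add: act_append)
  ultimately show ?case by (simp only:)
qed

text \<open>The word \<open>cw (act u)\<close> is equivalent to \<open>u\<close> and yet a function
  of the permutation alone, so the action on the integers is faithful.\<close>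

theorem act_eq_iff:
  assumes "u \<in> lists {0..n}" "v \<in> lists {0..n}"
  shows "act u = act v \<longleftrightarrow> word_equiv n u v"
  using word_equiv_cw[OF assms(1)] word_equiv_cw[OF assms(2)] word_equiv_act
  by (metis word_equiv_sym word_equiv_trans)

text \<open>The reflection exchanges neighbours \<open>z - 1\<close> and \<open>z\<close>; such a
  pair straddles the boundary of the half-line only if \<open>z = k\<close>.\<close>

lemma sref_image:
  assumes "k mod N \<noteq> i mod N"
  shows "sref i ` {k..} = {k..}"
proof -
  have e0: "(a - b) mod N = 0 \<longleftrightarrow> a mod N = b mod N" for a b
    by (simp add: mod_eq_dvd_iff mod_0_imp_dvd dvd_eq_mod_eq_0)
  have "sref i z \<ge> k" if "z \<ge> k" for z
    using that assms e0[of z i] unfolding sref_def by (cases "z = k") auto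
  then have "sref i ` {k..} \<subseteq> {k..}" by auto
  moreover have "z \<in> sref i ` {k..}" if "z \<in> {k..}" for z
    using that \<open>sref i ` {k..} \<subseteq> {k..}\<close> by (intro image_eqI[of _ _ "sref i z"]) auto
  ultimately show ?thesis by blast
qed

text \<open>Identifies the stabiliser of half-lines with the parabolic subgroup of the remaining
  generators: a permutation preserving \<open>{k..}\<close> has no descent at \<open>k\<close>, so
  stripping descents never uses a letter from \<open>T\<close>.\<close>

lemma act_stabilizer:
  assumes "aff f" "\<And>k. k \<in> T \<Longrightarrow> f ` {int k..} = {int k..}"
    and "T \<subseteq> {0..n}"
  shows "\<exists>u. u \<in> lists ({0..n} - T) \<and> act u = f"
  using assms
proof (induction "energy f" arbitrary: f rule: less_induct)
  case less
  show ?case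
  proof (cases "\<exists>i\<le>n. desc f (int i)")
    case False
    then have "f = id" using less.prems no_desc_id[of f] by (metis nat_int nat_le_iff of_nat_0_le_iff int_nat_eq)
    then show ?thesis by (intro exI[of _ "[]"]) auto
  next
    case True
    then obtain i where i: "i \<le> n" "desc f (int i)" by auto
    \<comment> \<open>Preserving \<open>{i..}\<close> gives \<open>f (i - 1) < i \<le> f i\<close>,
      which is no descent.\<close>
    have nT: "k \<noteq> i" if "k \<in> T" for k
    proof
      assume "k = i"
      then have e: "f ` {int i..} = {int i..}" using less.prems that by auto
      have "f (int i) \<ge> int i" using e by blast
      moreover have "f (int i - 1) < int i"
      proof (rule ccontr)
        assume "\<not> f (int i - 1) < int i"
        then have "f (int i - 1) \<in> f ` {int i..}" using e by auto
        moreover have "inj f" using less.prems by (simp add: aff_def periodic_def bij_def)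
        ultimately show False by (simp add: inj_image_mem_iff)
      qed
      ultimately show False using i by (simp add: desc_def)
    qed
    have inv: "sref (int i) ` {int k..} = {int k..}" if "k \<in> T" for k
      using nT[OF that] i that less.prems(3) by (intro sref_image) (auto simp: N_def)
    have "(f \<circ> sref (int i)) ` {int k..} = {int k..}" if "k \<in> T" for k
      using inv[OF that] less.prems(2)[OF that] by (metis image_comp)
    moreover have "energy (f \<circ> sref (int i)) < energy f" "aff (f \<circ> sref (int i))"
      using less.prems i energy_decreases aff_periodic by (auto intro: aff_comp)
    ultimately obtain u where u: "u \<in> lists ({0..n} - T)" "act u = f \<circ> sref (int i)" using less.hyps less.prems(3) by blast
    have "act (u @ [i]) = f" using u by (simp add: act_append comp_assoc)
    moreover have "u @ [i] \<in> lists ({0..n} - T)" using u i nT by auto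
    ultimately show ?thesis by blast
  qed
qed

end

section \<open>The standard apartment and its isomorphism with the Coxeter complex\<close>

context affine_type begin

lemma sref_moves: "sref i ` {i..} \<noteq> {i..}"
proof
  assume "sref i ` {i..} = {i..}"
  moreover have "sref i i \<in> sref i ` {i..}" by (rule imageI) simp
  ultimately have "sref i i \<in> {i..}" by (simp only:)
  then show False by simp
qed

text \<open>
  The chamber of the affine permutation \<open>f\<close> is the periodic chain of the sets \<open>f ` {k..}\<close>; its
  vertices are the members of the chain up to translation by multiples of \<open>N\<close>.
\<close>

definition vcl :: "int set \<Rightarrow> int set set" where
  "vcl X = range (\<lambda>t. (+) (N * t) ` X)"

lemma aff_bij: "aff f \<Longrightarrow> bij f"
  unfolding aff_def periodic_def by blast

definition stdch :: "(int \<Rightarrow> int) \<Rightarrow> int set set set" where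
  "stdch f = range (\<lambda>k. vcl (f ` {k..}))"

definition std :: "int set set set set" where
  "std = {A. A \<noteq> {} \<and> (\<exists>f. aff f \<and> A \<subseteq> stdch f)}"

lemma periodic_shift_image:
  assumes "periodic f"
  shows "(+) (N * t) ` f ` X = f ` (+) (N * t) ` X"
  using periodic_mult[OF assms, of _ t] by (auto simp: image_iff add.commute)

lemma shift_atLeast: "(+) (c::int) ` {k..} = {c + k..}"
  by (auto simp: image_iff)

lemma image_o: "(f \<circ> g) ` X = f ` g ` X"
  by (simp add: image_comp)

lemma vcl_self: "X \<in> vcl X"
  unfolding vcl_def by (rule range_eqI[of _ _ 0]) auto

lemma vcl_shift [simp]: "vcl ((+) (N * t) ` X) = vcl X"
proof -
  have "(+) (N * s) ` (+) (N * t) ` X = (+) (N * (s + t)) ` X" for s t X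
    by (auto simp: image_image algebra_simps)
  then show ?thesis unfolding vcl_def
    by (auto simp: image_iff) (metis diff_add_cancel)
qed

lemma vcl_eqD: "vcl X = vcl Y \<Longrightarrow> \<exists>t. X = (+) (N * t) ` Y"
  using vcl_self[of X] by (auto simp: vcl_def)

lemma vcl_stdch_mod:
  assumes "periodic f" "k mod N = j mod N"
  shows "vcl (f ` {k..}) = vcl (f ` {j..})"
proof -
  obtain q where "k = j + N * q" using mod_eq_offset[OF assms(2)] by blast
  then have "{k..} = (+) (N * q) ` {j..}" by (simp only: shift_atLeast add.commute)
  then have "f ` {k..} = (+) (N * q) ` f ` {j..}"
    by (simp only: periodic_shift_image[OF assms(1)])
  then show ?thesis by simp
qed

text \<open>Subtracting the half-line shifted by \<open>N\<close> shows that \<open>f\<close>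
  carries the window at \<open>k\<close> onto the window at \<open>j\<close>. Zero displacement
  gives both windows the same sum, and the sum of a window determines where it starts.\<close>

lemma aff_atLeast_eq:
  assumes "aff f" "f ` {k..} = {j..}"
  shows "k = j"
proof -
  have per: "periodic f" and inj: "inj f"
    using assms aff_periodic aff_bij bij_is_inj by auto
  have "f ` {N * 1 + k..} = {N * 1 + j..}"
    using periodic_shift_image[OF per, of 1 "{k..}"] unfolding assms shift_atLeast by simp
  then have "f ` {k + N..} = {j + N..}" by (simp add: add.commute)
  moreover have "{k..<k + N} = {k..} - {k + N..}" "{j..<j + N} = {j..} - {j + N..}" by auto
  ultimately have im: "f ` {k..<k + N} = {j..<j + N}"
    using assms inj by (simp add: image_set_diff)
  have "(\<Sum>z\<in>{k..<k + N}. f z) = \<Sum>{j..<j + N}"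
    using im inj by (metis (no_types, lifting) inj_on_subset subset_UNIV sum.reindex_cong)
  moreover have "(\<Sum>z\<in>{k..<k + N}. f z - z) = 0"
    using window_sum[of "\<lambda>z. f z - z" k] assms per by (simp add: aff_def periodic_def)
  ultimately have "\<Sum>{k..<k + N} = \<Sum>{j..<j + N}" by (simp add: sum_subtractf)
  moreover have "\<Sum>{c..<c + N} = (\<Sum>z\<in>{0..<N}. z) + N * c" for c
  proof -
    have "{c..<c + N} = (+) c ` {0..<N}" by (simp add: add.commute)
    then have "\<Sum>{c..<c + N} = (\<Sum>z\<in>{0..<N}. c + z)" by (simp only: sum.reindex[OF inj_on_add] o_def)
    then show ?thesis by (simp add: sum.distrib N_pos less_imp_le)
  qed
  ultimately show ?thesis using N_gt_1 by simp
qed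

lemma aff_image_eq:
  assumes "aff f" "aff g" "f ` {k..} = g ` {j..}"
  shows "k = j"
proof -
  have b: "bij g" using assms by (simp add: aff_bij)
  have "(inv_into UNIV g \<circ> f) ` {k..} = inv_into UNIV g ` g ` {j..}" unfolding image_o assms ..
  also have "\<dots> = {j..}" using b by (simp add: bij_is_inj)
  finally show ?thesis using assms by (intro aff_atLeast_eq[of "inv_into UNIV g \<circ> f"] aff_comp aff_inv)
qed

text \<open>Makes types well defined: a vertex common to two chambers has the same index modulo
  \<open>N\<close> in both, and even the half-line images at that index agree on the nose.\<close>

lemma vcl_image_eq:
  assumes "aff f" "aff g" "vcl (f ` {k..}) = vcl (g ` {j..})"
  shows "k mod N = j mod N" "f ` {k..} = g ` {k..}"
proof -
  obtain t where t: "f ` {k..} = (+) (N * t) ` g ` {j..}" using assms vcl_eqD by blast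
  also have "\<dots> = g ` {N * t + j..}" using assms by (simp add: periodic_shift_image aff_periodic shift_atLeast)
  finally have eq: "f ` {k..} = g ` {N * t + j..}" .
  then have "k = N * t + j" using assms aff_image_eq by blast
  then show "k mod N = j mod N" "f ` {k..} = g ` {k..}"
    using eq by auto
qed

lemma stdch_eq: "periodic f \<Longrightarrow> stdch f = (\<lambda>k. vcl (f ` {int k..})) ` {0..n}"
proof -
  assume f: "periodic f"
  have "vcl (f ` {k..}) \<in> (\<lambda>k. vcl (f ` {int k..})) ` {0..n}" for k
  proof -
    have b: "0 \<le> k mod N" "k mod N < N" by (auto intro: pos_mod_sign pos_mod_bound)
    have "vcl (f ` {k..}) = vcl (f ` {int (nat (k mod N))..})"
      using b by (intro vcl_stdch_mod[OF f]) simp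
    moreover have "nat (k mod N) \<in> {0..n}" using b by (auto simp: N_def)
    ultimately show ?thesis by blast
  qed
  then show ?thesis unfolding stdch_def by blast
qed

lemma stdch_nth_inj:
  assumes "aff f" "k \<le> n" "j \<le> n" "vcl (f ` {int k..}) = vcl (f ` {int j..})"
  shows "k = j"
  using vcl_image_eq(1)[OF assms(1,1,4)] assms by (simp add: N_def)

lemma finite_stdch: "periodic f \<Longrightarrow> finite (stdch f)"
  by (simp add: stdch_eq)

lemma simplicial_std: "simplicial_cplx std"
  unfolding simplicial_cplx_def std_def
  by (auto 0 4 dest: finite_subset[OF _ finite_stdch[OF aff_periodic]])

lemma std_nonempty: "std \<noteq> {}" and stdch_in_std: "aff f \<Longrightarrow> stdch f \<in> std"
proof -
  show c: "stdch f \<in> std" if "aff f" for f using that unfolding std_def stdch_def by blast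
  show "std \<noteq> {}" using c[of id] by auto
qed

lemma gen_in_carrier: "i \<le> n \<Longrightarrow> word_class n [i] \<in> carrier (coxeter_group n)"
  by (auto simp: coxeter_group_def)

lemma word_class_act: "u \<in> lists {0..n} \<Longrightarrow> v \<in> lists {0..n} \<Longrightarrow> word_class n u = word_class n v \<longleftrightarrow> act u = act v"
  using act_eq_iff word_class_eq_iff by metis

lemma act_surj: "aff f \<Longrightarrow> \<exists>u. u \<in> lists {0..n} \<and> act u = f"
  using act_stabilizer[of f "{}"] by auto

lemma generate_words:
  assumes "T \<subseteq> {0..n}"
  shows "generate (coxeter_group n) ((\<lambda>i. word_class n [i]) ` T) = word_class n ` lists T"
proof
  interpret W: group "coxeter_group n" by (rule group_coxeter_group)
  have W_one: "\<one>\<^bsub>coxeter_group n\<^esub> = word_class n []" by (simp add: coxeter_group_def)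
  have sub: "lists T \<subseteq> lists {0..n}" using assms by (rule lists_mono)
  show "word_class n ` lists T \<subseteq> generate (coxeter_group n) ((\<lambda>i. word_class n [i]) ` T)"
  proof
    fix x assume "x \<in> word_class n ` lists T"
    then obtain u where u: "u \<in> lists T" "x = word_class n u" by auto
    have "word_class n u \<in> generate (coxeter_group n) ((\<lambda>i. word_class n [i]) ` T)"
      using u(1)
    proof (induction u)
      case Nil
      then show ?case using generate.one[of "coxeter_group n"] by (simp add: W_one)
    next
      case (Cons i u)
      have "word_class n [i] \<in> generate (coxeter_group n) ((\<lambda>i. word_class n [i]) ` T)"
        using Cons by (auto intro: generate.incl)
      moreover have "word_class n (i # u) = word_class n [i] \<otimes>\<^bsub>coxeter_group n\<^esub> word_class n u"
        using coxeter_group_mult[of "[i]" n u] Cons(1,2) assms sub by (simp add: subset_iff)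
      ultimately show ?case using Cons by (auto intro: generate.eng)
    qed
    then show "x \<in> generate (coxeter_group n) ((\<lambda>i. word_class n [i]) ` T)" using u by simp
  qed
  show "generate (coxeter_group n) ((\<lambda>i. word_class n [i]) ` T) \<subseteq> word_class n ` lists T"
  proof
    fix x assume "x \<in> generate (coxeter_group n) ((\<lambda>i. word_class n [i]) ` T)"
    then show "x \<in> word_class n ` lists T"
    proof (induction rule: generate.induct)
      case one
      have "word_class n [] \<in> word_class n ` lists T" by auto
      then show ?case by (simp only: W_one)
    next
      case (incl h)
      then show ?case by auto
    next
      case (inv h)
      then obtain i where i: "i \<in> T" "h = word_class n [i]" by auto
      have "h \<otimes>\<^bsub>coxeter_group n\<^esub> h = \<one>\<^bsub>coxeter_group n\<^esub>"
        using coxeter_group_mult[of "[i]" n "[i]"] i assms word_class_act[of "[i, i]" "[]"] by (auto simp: W_one)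
      then have "inv\<^bsub>coxeter_group n\<^esub> h = h"
        using gen_in_carrier i assms by (intro W.inv_equality) auto
      then show ?case using i by auto
    next
      case (eng h1 h2)
      then obtain u v where "h1 = word_class n u" "h2 = word_class n v" "u \<in> lists T" "v \<in> lists T" by auto
      moreover from this have "h1 \<otimes>\<^bsub>coxeter_group n\<^esub> h2 = word_class n (u @ v)"
        using sub by (auto intro!: coxeter_group_mult)
      ultimately show ?case by auto
    qed
  qed
qed

text \<open>The coset belonging to a simplex, described as the set of group elements whose chamber
  contains it. No chamber has to be chosen, and reversal of inclusions is immediate.\<close>

definition wcos :: "int set set set \<Rightarrow> nat list set set" where
  "wcos A = {word_class n u | u. u \<in> lists {0..n} \<and> A \<subseteq> stdch (act u)}"

definition types :: "(int \<Rightarrow> int) \<Rightarrow> int set set set \<Rightarrow> nat set" where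
  "types f A = {k. k \<le> n \<and> vcl (f ` {int k..}) \<in> A}"

lemma subset_stdch_iff:
  assumes f: "aff f" and g: "aff g" and A: "A \<subseteq> stdch f"
  shows "A \<subseteq> stdch g \<longleftrightarrow> (\<forall>k\<in>types f A. f ` {int k..} = g ` {int k..})"
proof
  assume Ag: "A \<subseteq> stdch g"
  show "\<forall>k\<in>types f A. f ` {int k..} = g ` {int k..}"
  proof
    fix k assume "k \<in> types f A"
    then have "vcl (f ` {int k..}) \<in> stdch g" using Ag by (auto simp: types_def)
    then obtain j where "vcl (f ` {int k..}) = vcl (g ` {j..})" by (auto simp: stdch_def)
    then show "f ` {int k..} = g ` {int k..}" using vcl_image_eq(2)[OF f g] by blast
  qed
next
  assume r: "\<forall>k\<in>types f A. f ` {int k..} = g ` {int k..}"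
  show "A \<subseteq> stdch g"
  proof
    fix a assume a: "a \<in> A"
    then obtain k where k: "k \<le> n" "a = vcl (f ` {int k..})" using A stdch_eq[OF aff_periodic[OF f]] by auto
    then have "k \<in> types f A" using a by (simp add: types_def)
    then have "a = vcl (g ` {int k..})" using r k(2) by simp
    then show "a \<in> stdch g" by (simp add: stdch_def)
  qed
qed

text \<open>If the chambers of \<open>u\<close> and \<open>v\<close> both contain \<open>A\<close>,
  then \<open>u\<close> and \<open>v\<close> agree on the half-lines of the types of
  \<open>A\<close>; the quotient stabilises these half-lines and is a word in the other generators
  by \<open>act_stabilizer\<close>.\<close>

lemma wcos_eq:
  assumes u: "u \<in> lists {0..n}" and A: "A \<subseteq> stdch (act u)"
  shows "wcos A = word_class n u <#\<^bsub>coxeter_group n\<^esub>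
    generate (coxeter_group n) ((\<lambda>i. word_class n [i]) ` ({0..n} - types (act u) A))"
proof -
  let ?T = "types (act u) A"
  have T: "?T \<subseteq> {0..n}" by (auto simp: types_def)
  have sub: "lists ({0..n} - ?T) \<subseteq> lists {0..n}" by (rule lists_mono) auto
  have mult: "word_class n u \<otimes>\<^bsub>coxeter_group n\<^esub> word_class n v = word_class n (u @ v)"
    if "v \<in> lists ({0..n} - ?T)" for v
    using u that sub by (intro coxeter_group_mult) auto
  have rhs: "word_class n u <#\<^bsub>coxeter_group n\<^esub>
    generate (coxeter_group n) ((\<lambda>i. word_class n [i]) ` ({0..n} - ?T)) =
    {word_class n (u @ v) | v. v \<in> lists ({0..n} - ?T)}"
    unfolding l_coset_def using mult by (subst generate_words) auto
  have fixT: "act v ` {int k..} = {int k..}" if "v \<in> lists ({0..n} - ?T)" "k \<in> ?T" for v k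
    using that(1)
  proof (induction v)
    case (Cons i v)
    have "sref (int i) ` {int k..} = {int k..}"
      using Cons that(2) T by (intro sref_image) (auto simp: N_def)
    then show ?case using Cons by (simp only: act.simps image_o)
  qed simp
  show ?thesis unfolding rhs
  proof (intro equalityI subsetI)
    fix x assume "x \<in> wcos A"
    then obtain v where v: "v \<in> lists {0..n}" "x = word_class n v" "A \<subseteq> stdch (act v)" by (auto simp: wcos_def)
    have bu: "bij (act u)" by (simp add: aff_bij)
    define f where "f = inv_into UNIV (act u) \<circ> act v"
    have f: "aff f" unfolding f_def by (intro aff_comp aff_inv) auto
    have "f ` {int k..} = {int k..}" if "k \<in> ?T" for k
    proof -
      have "act u ` {int k..} = act v ` {int k..}"
        using subset_stdch_iff[of "act u" "act v" A] A v that by auto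
      then have "f ` {int k..} = inv_into UNIV (act u) ` act u ` {int k..}" by (simp only: f_def image_o)
      then show ?thesis using bu by (simp add: bij_is_inj)
    qed
    then obtain w where w: "w \<in> lists ({0..n} - ?T)" "act w = f" using act_stabilizer[OF f _ T] by blast
    have "act (u @ w) = act v" unfolding act_append w f_def using bu
      by (auto simp: fun_eq_iff bij_is_surj surj_f_inv_f)
    then have "word_class n (u @ w) = word_class n v" using u v w sub by (subst word_class_act) auto
    then show "x \<in> {word_class n (u @ v) | v. v \<in> lists ({0..n} - ?T)}" using v w by auto
  next
    fix x assume "x \<in> {word_class n (u @ v) | v. v \<in> lists ({0..n} - ?T)}"
    then obtain v where v: "v \<in> lists ({0..n} - ?T)" "x = word_class n (u @ v)" by auto
    have "\<forall>k\<in>?T. act u ` {int k..} = act (u @ v) ` {int k..}"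
    proof
      fix k assume "k \<in> ?T"
      then show "act u ` {int k..} = act (u @ v) ` {int k..}"
        by (simp only: act_append image_o fixT[OF v(1)])
    qed
    then have "A \<subseteq> stdch (act (u @ v))"
      using subset_stdch_iff[of "act u" "act (u @ v)" A] A by simp
    moreover have "u @ v \<in> lists {0..n}" using u v sub by auto
    ultimately show "x \<in> wcos A" unfolding wcos_def using v by blast
  qed
qed

lemma stdE:
  assumes "A \<in> std"
  obtains u where "u \<in> lists {0..n}" "A \<subseteq> stdch (act u)" "types (act u) A \<noteq> {}"
proof -
  obtain f where f: "aff f" "A \<subseteq> stdch f" "A \<noteq> {}" using assms by (auto simp: std_def)
  obtain u where u: "u \<in> lists {0..n}" "act u = f" using act_surj[OF f(1)] by blast
  have "types (act u) A \<noteq> {}" using f u by (auto simp: types_def stdch_eq[OF aff_periodic[OF f(1)]])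
  then show ?thesis using that[OF u(1)] u(2) f(2) by simp
qed

lemma wcos_mono: "A \<subseteq> B \<Longrightarrow> wcos B \<subseteq> wcos A"
  by (auto simp: wcos_def)

text \<open>If a vertex \<open>a\<close> of type \<open>k\<close> in \<open>A\<close> were missing
  from \<open>B\<close>, passing to the neighbouring chamber across the panel of type
  \<open>k\<close> would keep \<open>B\<close> and lose \<open>a\<close>.\<close>

lemma wcos_mono_rev:
  assumes A: "A \<in> std" and B: "B \<in> std" and le: "wcos B \<subseteq> wcos A"
  shows "A \<subseteq> B"
proof
  fix a assume a: "a \<in> A"
  obtain u where u: "u \<in> lists {0..n}" "B \<subseteq> stdch (act u)" using B by (rule stdE)
  have Av: "A \<subseteq> stdch (act v)" if v: "v \<in> lists {0..n}" "B \<subseteq> stdch (act v)" for v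
  proof -
    have "word_class n v \<in> wcos A" using le v by (auto simp: wcos_def)
    then obtain v' where v': "v' \<in> lists {0..n}" "word_class n v = word_class n v'" "A \<subseteq> stdch (act v')" by (auto simp: wcos_def)
    then have "act v = act v'" using word_class_act[OF v(1) v'(1)] by simp
    then show ?thesis using v' by simp
  qed
  obtain k where k: "k \<le> n" "a = vcl (act u ` {int k..})"
    using Av[OF u] a stdch_eq[OF aff_periodic[OF aff_act[of u]]] by auto
  show "a \<in> B"
  proof (rule ccontr)
    assume aB: "a \<notin> B"
    have "B \<subseteq> stdch (act (u @ [k]))"
    proof (subst subset_stdch_iff[of "act u"])
      show "\<forall>j\<in>types (act u) B. act u ` {int j..} = act (u @ [k]) ` {int j..}"
      proof
        fix j assume j: "j \<in> types (act u) B"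
        then have "j \<noteq> k" using aB k by (auto simp: types_def)
        then have "sref (int k) ` {int j..} = {int j..}"
          using j k by (intro sref_image) (auto simp: N_def types_def)
        then show "act u ` {int j..} = act (u @ [k]) ` {int j..}" by (simp only: act_append image_o act.simps comp_id)
      qed
    qed (use u in auto)
    then have "A \<subseteq> stdch (act (u @ [k]))" using Av[of "u @ [k]"] u k by auto
    then have "act u ` {int k..} = act (u @ [k]) ` {int k..}"
    proof -
      have "k \<in> types (act u) A" using a k by (simp add: types_def)
      then show ?thesis
        using subset_stdch_iff[OF aff_act[of u] aff_act[of "u @ [k]"] Av[OF u]] \<open>A \<subseteq> stdch (act (u @ [k]))\<close> by blast
    qed
    also have "\<dots> = act u ` sref (int k) ` {int k..}" by (simp only: act_append image_o act.simps id_o o_id comp_id)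
    finally have eq: "act u ` {int k..} = act u ` sref (int k) ` {int k..}" .
    have "inj (act u)" using aff_bij[OF aff_act] by (rule bij_is_inj)
    then have "{int k..} = sref (int k) ` {int k..}" using eq by (rule inj_image_eq_iff[THEN iffD1])
    then show False using sref_moves[of "int k"] by (rule notE[OF _ sym, rotated])
  qed
qed

theorem iso_coxeter_std: "iso_coxeter_complex n std"
  unfolding iso_coxeter_complex_def
proof (intro exI[of _ wcos] conjI ballI)
  show "A \<subseteq> B \<longleftrightarrow> wcos B \<subseteq> wcos A" if "A \<in> std" "B \<in> std" for A B
    using wcos_mono[of A B] wcos_mono_rev[OF that] by (rule iffI)
  have inj: "inj_on wcos std"
  proof (rule inj_onI)
    fix A B assume A: "A \<in> std" and B: "B \<in> std" and eq: "wcos A = wcos B"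
    show "A = B" using wcos_mono_rev[OF A B] wcos_mono_rev[OF B A] eq by simp
  qed
  have "wcos ` std = coxeter_complex n"
  proof (intro equalityI subsetI)
    fix x assume "x \<in> wcos ` std"
    then obtain A where A: "A \<in> std" "x = wcos A" by auto
    obtain u where u: "u \<in> lists {0..n}" "A \<subseteq> stdch (act u)" "types (act u) A \<noteq> {}" using A(1) by (rule stdE)
    obtain k where k: "k \<in> types (act u) A" using u by auto
    have kn: "k \<le> n" using k by (simp add: types_def)
    let ?J = "(\<lambda>i. word_class n [i]) ` ({0..n} - types (act u) A)"
    \<comment> \<open>Properness of the subset comes from nonemptiness of the simplex; it needs the
      generators to be pairwise distinct in the group, which their action on half-lines
      shows.\<close>
    have "word_class n [k] \<notin> ?J"
    proof
      assume "word_class n [k] \<in> ?J"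
      then obtain i where "word_class n [k] = word_class n [i]" "i \<in> {0..n} - types (act u) A" by (rule imageE)
      then have i: "i \<le> n" "i \<noteq> k" "word_class n [k] = word_class n [i]" using k by auto
      then have "sref (int k) = sref (int i)" using word_class_act[of "[k]" "[i]"] kn by simp
      moreover have "sref (int i) ` {int k..} = {int k..}"
        using i kn by (intro sref_image) (auto simp: N_def)
      ultimately show False using sref_moves[of "int k"] by simp
    qed
    moreover have "word_class n [k] \<in> coxeter_gens n" using kn by (auto simp: coxeter_gens_def)
    moreover have "?J \<subseteq> coxeter_gens n" by (auto simp: coxeter_gens_def)
    ultimately have "?J \<subset> coxeter_gens n" by blast
    moreover have "word_class n u \<in> carrier (coxeter_group n)" using u by (simp add: coxeter_group_def)
    ultimately show "x \<in> coxeter_complex n"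
      unfolding coxeter_complex_def mem_Collect_eq A(2) wcos_eq[OF u(1,2)]
      by (intro exI conjI) (rule refl)
  next
    fix x assume "x \<in> coxeter_complex n"
    then obtain w J where wJ: "w \<in> carrier (coxeter_group n)" "J \<subset> coxeter_gens n"
      "x = w <#\<^bsub>coxeter_group n\<^esub> generate (coxeter_group n) J" by (auto simp: coxeter_complex_def)
    then obtain u where u: "u \<in> lists {0..n}" "w = word_class n u" by (auto simp: coxeter_group_def)
    \<comment> \<open>A generator outside \<open>J\<close> moves the chamber across the panel
      opposite the vertex of its type, so the simplex keeps exactly the vertices whose generators
      are missing from \<open>J\<close>.\<close>
    define T where "T = {i. i \<le> n \<and> word_class n [i] \<notin> J}"
    define A where "A = (\<lambda>k. vcl (act u ` {int k..})) ` T"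
    have "T \<noteq> {}" using wJ(2) by (auto simp: coxeter_gens_def T_def)
    then have "A \<in> std" unfolding std_def A_def stdch_def using aff_act by blast
    moreover have Au: "A \<subseteq> stdch (act u)" by (auto simp: A_def stdch_def)
    moreover have "types (act u) A = T"
      unfolding types_def A_def using stdch_nth_inj[OF aff_act[of u]] by (auto simp: T_def)
    moreover have "J = (\<lambda>i. word_class n [i]) ` ({0..n} - T)"
      using wJ(2) by (auto simp: T_def coxeter_gens_def)
    ultimately have "x = wcos A" using wJ u wcos_eq[OF u(1) Au] by simp
    then show "x \<in> wcos ` std" using \<open>A \<in> std\<close> by blast
  qed
  then show "bij_betw wcos std (coxeter_complex n)" using inj by (simp add: bij_betw_def)
qed

end

section \<open>Subrings and subfields of a field, and matrices over them\<close>

definition subring_set :: "'k::field set \<Rightarrow> bool" where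
  "subring_set R \<longleftrightarrow> 0 \<in> R \<and> 1 \<in> R \<and> (\<forall>x\<in>R. - x \<in> R) \<and> (\<forall>x\<in>R. \<forall>y\<in>R. x + y \<in> R \<and> x * y \<in> R)"

definition subfield_set :: "'k::field set \<Rightarrow> bool" where
  "subfield_set F \<longleftrightarrow> subring_set F \<and> (\<forall>x\<in>F. inverse x \<in> F)"

lemma subring_closed:
  assumes "subring_set R"
  shows "0 \<in> R" "1 \<in> R" "x \<in> R \<Longrightarrow> - x \<in> R" "x \<in> R \<Longrightarrow> y \<in> R \<Longrightarrow> x + y \<in> R"
    "x \<in> R \<Longrightarrow> y \<in> R \<Longrightarrow> x * y \<in> R" "x \<in> R \<Longrightarrow> y \<in> R \<Longrightarrow> x - y \<in> R" "x \<in> R \<Longrightarrow> x ^ m \<in> R"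
proof -
  show *: "0 \<in> R" "1 \<in> R" "x \<in> R \<Longrightarrow> - x \<in> R" "x \<in> R \<Longrightarrow> y \<in> R \<Longrightarrow> x + y \<in> R"
    "x \<in> R \<Longrightarrow> y \<in> R \<Longrightarrow> x * y \<in> R" for x y using assms by (auto simp: subring_set_def)
  show "x \<in> R \<Longrightarrow> y \<in> R \<Longrightarrow> x - y \<in> R" using *(3)[of y] *(4)[of x "- y"] by simp
  show "x \<in> R \<Longrightarrow> x ^ m \<in> R" by (induction m) (auto intro: *)
qed

lemma subring_sum: "subring_set R \<Longrightarrow> (\<And>i. i \<in> I \<Longrightarrow> f i \<in> R) \<Longrightarrow> sum f I \<in> R"
  by (induction I rule: infinite_finite_induct) (auto intro: subring_closed)

lemma subring_prod: "subring_set R \<Longrightarrow> (\<And>i. i \<in> I \<Longrightarrow> f i \<in> R) \<Longrightarrow> prod f I \<in> R"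
  by (induction I rule: infinite_finite_induct) (auto intro: subring_closed)

lemma subfield_subring: "subfield_set F \<Longrightarrow> subring_set F"
  by (simp add: subfield_set_def)

lemma subfield_inverse: "subfield_set F \<Longrightarrow> x \<in> F \<Longrightarrow> inverse x \<in> F"
  by (simp add: subfield_set_def)

lemma subfield_divide: "subfield_set F \<Longrightarrow> x \<in> F \<Longrightarrow> y \<in> F \<Longrightarrow> x / y \<in> F"
  by (simp add: subfield_set_def subring_closed(5) divide_inverse)

definition mats :: "'k::field set \<Rightarrow> nat \<Rightarrow> 'k mat set" where
  "mats R m = {A \<in> carrier_mat m m. \<forall>i<m. \<forall>j<m. A $$ (i, j) \<in> R}"

lemma matsI: "A \<in> carrier_mat m m \<Longrightarrow> (\<And>i j. i < m \<Longrightarrow> j < m \<Longrightarrow> A $$ (i, j) \<in> R) \<Longrightarrow> A \<in> mats R m"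
  by (simp add: mats_def)

lemma mats_carrier: "A \<in> mats R m \<Longrightarrow> A \<in> carrier_mat m m"
  by (simp add: mats_def)

lemma mats_entry: "A \<in> mats R m \<Longrightarrow> i < m \<Longrightarrow> j < m \<Longrightarrow> A $$ (i, j) \<in> R"
  by (simp add: mats_def)

lemma mats_one: "subring_set R \<Longrightarrow> 1\<^sub>m m \<in> mats R m"
  by (auto simp: mats_def subring_closed)

lemma mats_mult:
  assumes "subring_set R" "A \<in> mats R m" "B \<in> mats R m"
  shows "A * B \<in> mats R m"
  using assms by (auto simp: mats_def scalar_prod_def intro!: subring_sum subring_closed(5))

lemma mats_smult:
  assumes "subring_set R" "A \<in> mats R m" "c \<in> R"
  shows "c \<cdot>\<^sub>m A \<in> mats R m"
  using assms by (auto simp: mats_def intro!: subring_closed(5))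

lemma signof_in_subring: "subring_set R \<Longrightarrow> signof p \<in> R"
  by (cases "signof p = (1 :: 'a)") (auto simp: sign_def intro: subring_closed)

lemma det_in_subring:
  assumes "subring_set R" "A \<in> mats R m"
  shows "det A \<in> R"
  unfolding det_def'[OF mats_carrier[OF assms(2)]]
proof (rule subring_sum[OF assms(1)], rule subring_closed(5)[OF assms(1)])
  fix p assume p: "p \<in> {p. p permutes {0..<m}}"
  show "signof p \<in> R" using assms(1) by (rule signof_in_subring)
  show "(\<Prod>i = 0..<m. A $$ (i, p i)) \<in> R"
    using p by (intro subring_prod[OF assms(1)] mats_entry[OF assms(2)]) (auto simp: permutes_in_image)
qed

lemma adj_mat_in_subring:
  assumes "subring_set R" "A \<in> mats R m"
  shows "adj_mat A \<in> mats R m"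
proof (rule matsI)
  have A: "A \<in> carrier_mat m m" using assms(2) by (rule mats_carrier)
  show "adj_mat A \<in> carrier_mat m m" using adj_mat(1)[OF A] .
  fix i j assume ij: "i < m" "j < m"
  have "mat_delete A j i \<in> mats R (m - 1)"
  proof (rule matsI)
    show "mat_delete A j i \<in> carrier_mat (m - 1) (m - 1)" using A by (simp add: mat_delete_def)
    fix k l assume "k < m - 1" "l < m - 1"
    then show "mat_delete A j i $$ (k, l) \<in> R"
      using A assms(2) by (auto simp: mat_delete_def intro!: mats_entry[OF assms(2)])
  qed
  then have "det (mat_delete A j i) \<in> R" by (rule det_in_subring[OF assms(1)])
  moreover have "(- 1) ^ (j + i) \<in> R" using assms(1) by (intro subring_closed(7) subring_closed(3) subring_closed(2))
  ultimately show "adj_mat A $$ (i, j) \<in> R"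
    using A ij assms(1) by (auto simp: adj_mat_def cofactor_def intro: subring_closed(5))
qed

text \<open>The inverse through the adjugate, so that the entries visibly stay in any subfield
  containing those of \<open>A\<close>.\<close>

definition minv :: "'k::field mat \<Rightarrow> 'k mat" where
  "minv A = inverse (det A) \<cdot>\<^sub>m adj_mat A"

lemma minv:
  assumes "A \<in> carrier_mat m m" "det A \<noteq> 0"
  shows "minv A \<in> carrier_mat m m" "A * minv A = 1\<^sub>m m" "minv A * A = 1\<^sub>m m"
proof -
  note a = adj_mat[OF assms(1)]
  show "minv A \<in> carrier_mat m m" using a by (simp add: minv_def)
  have "A * minv A = inverse (det A) \<cdot>\<^sub>m (A * adj_mat A)"
    unfolding minv_def using assms(1) a by (intro mult_smult_distrib)
  then show "A * minv A = 1\<^sub>m m" using a assms(2) by (auto simp: a(2))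
  have "minv A * A = inverse (det A) \<cdot>\<^sub>m (adj_mat A * A)"
    unfolding minv_def using assms(1) a by (intro mult_smult_assoc_mat)
  then show "minv A * A = 1\<^sub>m m" using a assms(2) by (auto simp: a(3))
qed

lemma minv_in_subfield:
  assumes "subfield_set F" "A \<in> mats F m"
  shows "minv A \<in> mats F m"
  unfolding minv_def
  using assms by (intro mats_smult subfield_inverse det_in_subring adj_mat_in_subring subfield_subring)

section \<open>Valued fields and lattices\<close>

text \<open>The value \<open>w 0\<close> is junk: no axiom mentions it.\<close>

locale valued_field =
  fixes F :: "'k::field set" and w :: "'k \<Rightarrow> int"
  assumes subfield: "subfield_set F"
    and w_mult: "x \<in> F \<Longrightarrow> y \<in> F \<Longrightarrow> x \<noteq> 0 \<Longrightarrow> y \<noteq> 0 \<Longrightarrow> w (x * y) = w x + w y"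
    and w_add: "x \<in> F \<Longrightarrow> y \<in> F \<Longrightarrow> x \<noteq> 0 \<Longrightarrow> y \<noteq> 0 \<Longrightarrow> x + y \<noteq> 0 \<Longrightarrow> min (w x) (w y) \<le> w (x + y)"
begin

lemmas subring = subfield_subring[OF subfield]
lemmas F_closed = subring_closed[OF subring] subfield_inverse[OF subfield] subfield_divide[OF subfield]

lemma w_one: "w 1 = 0"
  using w_mult[of 1 1] F_closed by simp

lemma w_minus_one: "w (- 1) = 0"
  using w_mult[of "-1" "-1"] F_closed w_one by simp

lemma w_uminus: "x \<in> F \<Longrightarrow> w (- x) = w x"
  using w_mult[of "-1" x] F_closed w_minus_one by (cases "x = 0") auto

lemma w_inverse: "x \<in> F \<Longrightarrow> x \<noteq> 0 \<Longrightarrow> w (inverse x) = - w x"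
  using w_mult[of x "inverse x"] F_closed(8)[of x] w_one by simp

lemma w_divide: "x \<in> F \<Longrightarrow> y \<in> F \<Longrightarrow> x \<noteq> 0 \<Longrightarrow> y \<noteq> 0 \<Longrightarrow> w (x / y) = w x - w y"
  using w_mult[of x "inverse y"] w_inverse[of y] F_closed(8)[of y] by (simp add: divide_inverse)

lemma w_power: "x \<in> F \<Longrightarrow> x \<noteq> 0 \<Longrightarrow> w (x ^ m) = int m * w x"
  by (induction m) (auto simp: w_one w_mult F_closed algebra_simps)

lemma F_power_int: "x \<in> F \<Longrightarrow> x powi m \<in> F"
  by (auto simp: power_int_def F_closed)

lemma w_power_int: "x \<in> F \<Longrightarrow> x \<noteq> 0 \<Longrightarrow> w (x powi m) = m * w x"
  by (auto simp: power_int_def w_power w_inverse F_closed)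

lemma w_prod: "(\<And>i. i \<in> I \<Longrightarrow> f i \<in> F \<and> f i \<noteq> 0) \<Longrightarrow> w (prod f I) = (\<Sum>i\<in>I. w (f i))"
proof (induction I rule: infinite_finite_induct)
  case (insert x I)
  have "prod f I \<in> F" using insert by (intro subring_prod[OF subring]) auto
  moreover have "prod f I \<noteq> 0" using insert by auto
  ultimately show ?case using insert by (simp add: w_mult)
qed (auto simp: w_one)

text \<open>Gives 0 the value infinity, which an integer-valued \<open>w\<close> cannot express.
  Carrying \<open>x \<in> F\<close> along frees the closure rules of side conditions.\<close>

definition vge :: "'k \<Rightarrow> int \<Rightarrow> bool" where
  "vge x m \<longleftrightarrow> x \<in> F \<and> (x = 0 \<or> m \<le> w x)"

lemma vge_zero [simp]: "vge 0 m" by (simp add: vge_def F_closed)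

lemma vge_mono: "vge x m \<Longrightarrow> l \<le> m \<Longrightarrow> vge x l" by (auto simp: vge_def)

lemma vge_add: "vge x m \<Longrightarrow> vge y m \<Longrightarrow> vge (x + y) m"
  unfolding vge_def using w_add[of x y] F_closed(4)[of x y]
  by (cases "x = 0"; cases "y = 0"; cases "x + y = 0") (auto simp: min_def split: if_splits)

lemma vge_uminus: "vge x m \<Longrightarrow> vge (- x) m"
  by (auto simp: vge_def w_uminus F_closed)

lemma vge_mult: "vge x l \<Longrightarrow> vge y m \<Longrightarrow> vge (x * y) (l + m)"
  unfolding vge_def using F_closed(5)[of x y] w_mult[of x y] by (cases "x = 0 \<or> y = 0") auto

lemma vge_sum: "(\<And>i. i \<in> I \<Longrightarrow> vge (f i) m) \<Longrightarrow> vge (sum f I) m"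
  by (induction I rule: infinite_finite_induct) (auto intro: vge_add)

lemma vge_prod: "finite I \<Longrightarrow> (\<And>i. i \<in> I \<Longrightarrow> vge (f i) (m i)) \<Longrightarrow> vge (prod f I) (sum m I)"
proof (induction I rule: finite_induct)
  case empty
  then show ?case by (simp add: vge_def w_one F_closed)
next
  case (insert x I)
  then show ?case using vge_mult[of "f x" "m x" "prod f I" "sum m I"] by simp
qed

definition vring :: "'k set" where
  "vring = {x. vge x 0}"

lemma subring_vring: "subring_set vring"
  unfolding subring_set_def vring_def
  using vge_mult[of _ 0 _ 0] by (auto intro: vge_add vge_uminus) (simp add: vge_def w_one F_closed)

text \<open>A summand of strictly smallest value decides the value of the sum: if the sum had a
  larger value, subtracting \<open>y\<close> would give \<open>x\<close> a larger value too.\<close>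

lemma w_add_exact:
  assumes "x \<in> F" "x \<noteq> 0" "vge y (w x + 1)"
  shows "x + y \<noteq> 0" "w (x + y) = w x"
proof -
  have y: "y \<in> F" using assms by (simp add: vge_def)
  show 1: "x + y \<noteq> 0"
  proof
    assume "x + y = 0"
    then have "y = - x" by (simp add: eq_neg_iff_add_eq_0 add.commute)
    then show False using assms w_uminus by (auto simp: vge_def)
  qed
  have "vge (x + y) (w x)" using assms by (intro vge_add) (auto simp: vge_def)
  moreover have "\<not> vge (x + y) (w x + 1)"
  proof
    assume "vge (x + y) (w x + 1)"
    then have "vge (x + y + - y) (w x + 1)" using vge_uminus[OF assms(3)] by (rule vge_add)
    then have "vge x (w x + 1)" by simp
    then show False using assms(2) by (simp add: vge_def)
  qed
  ultimately show "w (x + y) = w x" using 1 by (auto simp: vge_def)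
qed

end

locale lattices = affine_type n + valued_field F w
  for n :: nat and F :: "'k::field set" and w :: "'k \<Rightarrow> int" +
  fixes unif :: 'k
  assumes unif: "unif \<in> F" "unif \<noteq> 0" "w unif = 1"
begin

abbreviation dm :: nat where "dm \<equiv> Suc n"

lemma N_dm: "N = int dm" by (simp add: N_def)

definition fvec :: "'k vec set" where
  "fvec = {a \<in> carrier_vec dm. \<forall>i<dm. a $ i \<in> F}"

text \<open>
  The integer \<open>i + N * m\<close> stands for the vector \<open>unif ^ m\<close> times the \<open>i\<close>-th basis vector; \<open>D X\<close> is
  the span of the vectors indexed by \<open>X\<close>, a lattice when \<open>X = f ` {k..}\<close> for an affine permutation \<open>f\<close>.
\<close>

definition D :: "int set \<Rightarrow> 'k vec set" where
  "D X = {a \<in> fvec. \<forall>i<dm. a $ i = 0 \<or> int i + N * w (a $ i) \<in> X}"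

definition GLF :: "'k mat set" where
  "GLF = {A \<in> mats F dm. det A \<noteq> 0}"

text \<open>Value 0 of the determinant fixes the level of a frame within its lattice classes. The
  same condition later singles out the matrices whose action preserves types.\<close>

definition frame :: "'k mat \<Rightarrow> bool" where
  "frame P \<longleftrightarrow> P \<in> GLF \<and> w (det P) = 0"

definition L :: "'k mat \<Rightarrow> int set \<Rightarrow> 'k vec set" where
  "L P X = (\<lambda>a. P *\<^sub>v a) ` D X"

lemma GLF_D: "A \<in> GLF \<Longrightarrow> A \<in> carrier_mat dm dm" "A \<in> GLF \<Longrightarrow> A \<in> mats F dm" "A \<in> GLF \<Longrightarrow> det A \<noteq> 0"
  by (auto simp: GLF_def mats_def)

lemma GLF_det_F: "A \<in> GLF \<Longrightarrow> det A \<in> F"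
  using det_in_subring[OF subring] GLF_D by blast

lemma GLF_mult: "A \<in> GLF \<Longrightarrow> B \<in> GLF \<Longrightarrow> A * B \<in> GLF"
  by (auto simp: GLF_def mats_mult[OF subring] det_mult[of _ dm] mats_carrier)

lemma w_det_mult: "A \<in> GLF \<Longrightarrow> B \<in> GLF \<Longrightarrow> w (det (A * B)) = w (det A) + w (det B)"
  by (simp add: det_mult[of _ dm] GLF_D GLF_det_F w_mult)

lemma GLF_minv: "A \<in> GLF \<Longrightarrow> minv A \<in> GLF"
proof -
  assume A: "A \<in> GLF"
  have "det (minv A) * det A = 1"
    using minv[OF GLF_D(1)[OF A] GLF_D(3)[OF A]] GLF_D(1)[OF A] by (metis det_mult det_one)
  then have "det (minv A) \<noteq> 0" by auto
  then show ?thesis using A minv_in_subfield[OF subfield] by (auto simp: GLF_def)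
qed

lemma w_det_minv: "A \<in> GLF \<Longrightarrow> w (det (minv A)) = - w (det A)"
  using w_det_mult[OF GLF_minv] minv(3)[of A dm] GLF_D w_one by fastforce

lemma fvec_carrier: "a \<in> fvec \<Longrightarrow> a \<in> carrier_vec dm" by (simp add: fvec_def)

lemma mats_fvec:
  assumes "A \<in> mats F dm" "a \<in> fvec"
  shows "A *\<^sub>v a \<in> fvec"
  using assms by (auto simp: fvec_def mats_def scalar_prod_def intro!: subring_sum[OF subring] F_closed)

lemma D_fvec: "a \<in> D X \<Longrightarrow> a \<in> fvec" by (simp add: D_def)

lemma D_mono: "X \<subseteq> Y \<Longrightarrow> D X \<subseteq> D Y" by (auto simp: D_def)

lemma L_mono: "X \<subseteq> Y \<Longrightarrow> L P X \<subseteq> L P Y"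
  unfolding L_def using D_mono by blast

lemma minv_mult_vec:
  assumes "P \<in> GLF" "a \<in> fvec"
  shows "minv P *\<^sub>v (P *\<^sub>v a) = a" "P *\<^sub>v (minv P *\<^sub>v a) = a"
proof -
  have P: "P \<in> carrier_mat dm dm" "minv P \<in> carrier_mat dm dm" and a: "a \<in> carrier_vec dm"
    using GLF_D(1)[OF assms(1)] minv(1)[OF GLF_D(1)[OF assms(1)] GLF_D(3)[OF assms(1)]] fvec_carrier[OF assms(2)] by auto
  have m: "minv P * P = 1\<^sub>m dm" "P * minv P = 1\<^sub>m dm"
    using minv[OF GLF_D(1)[OF assms(1)] GLF_D(3)[OF assms(1)]] by auto
  show "minv P *\<^sub>v (P *\<^sub>v a) = a" using assoc_mult_mat_vec[OF P(2,1) a] m a by simp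
  show "P *\<^sub>v (minv P *\<^sub>v a) = a" using assoc_mult_mat_vec[OF P a] m a by simp
qed

lemma L_iff: "P \<in> GLF \<Longrightarrow> x \<in> L P X \<longleftrightarrow> x \<in> fvec \<and> minv P *\<^sub>v x \<in> D X"
proof -
  assume P: "P \<in> GLF"
  show ?thesis
  proof
    assume "x \<in> L P X"
    then obtain a where a: "a \<in> D X" "x = P *\<^sub>v a" by (auto simp: L_def)
    show "x \<in> fvec \<and> minv P *\<^sub>v x \<in> D X"
      using a minv_mult_vec(1)[OF P D_fvec[OF a(1)]] mats_fvec[OF GLF_D(2)[OF P] D_fvec[OF a(1)]] by simp
  next
    assume x: "x \<in> fvec \<and> minv P *\<^sub>v x \<in> D X"
    then have "x = P *\<^sub>v (minv P *\<^sub>v x)" using minv_mult_vec(2)[OF P] by simp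
    then show "x \<in> L P X" unfolding L_def using x by (rule_tac image_eqI) auto
  qed
qed

lemma L_mult: "P \<in> carrier_mat dm dm \<Longrightarrow> Q \<in> carrier_mat dm dm \<Longrightarrow> L (P * Q) X = (\<lambda>a. P *\<^sub>v a) ` L Q X"
  unfolding L_def image_image
  by (intro image_cong refl) (auto dest!: D_fvec fvec_carrier)

text \<open>The ceiling of \<open>(k - i) / N\<close>, that is, the least value that a nonzero
  \<open>i\<close>-th coordinate may have in \<open>D {k..}\<close>.\<close>

definition cut :: "int \<Rightarrow> nat \<Rightarrow> int" where
  "cut k i = - ((int i - k) div N)"

lemma cut_le_iff: "cut k i \<le> m \<longleftrightarrow> k \<le> int i + N * m"
proof -
  have "cut k i \<le> m \<longleftrightarrow> - m \<le> (int i - k) div N" by (auto simp: cut_def)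
  also have "\<dots> \<longleftrightarrow> - m * N \<le> int i - k" 
  proof
    assume "- m \<le> (int i - k) div N"
    then have "- m * N \<le> (int i - k) div N * N" by (rule mult_right_mono) (rule less_imp_le[OF N_pos])
    also have "\<dots> \<le> int i - k" using N_pos by (simp add: minus_mod_eq_div_mult[symmetric])
    finally show "- m * N \<le> int i - k" .
  next
    assume "- m * N \<le> int i - k"
    then have "(- m * N) div N \<le> (int i - k) div N" by (rule zdiv_mono1) simp
    then show "- m \<le> (int i - k) div N" using N_gt_1 by (simp del: mult_minus_left)
  qed
  finally show ?thesis by (simp add: algebra_simps)
qed

lemma cut_ge: "k \<le> int i + N * cut k i"
  using cut_le_iff[of k i "cut k i"] by simp

lemma D_atLeast_iff: "a \<in> D {k..} \<longleftrightarrow> a \<in> carrier_vec dm \<and> (\<forall>i<dm. vge (a $ i) (cut k i))"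
  by (auto simp: D_def fvec_def vge_def cut_le_iff)

lemma D_add: "a \<in> D {k..} \<Longrightarrow> b \<in> D {k..} \<Longrightarrow> a + b \<in> D {k..}"
proof -
  assume a: "a \<in> D {k..}" and b: "b \<in> D {k..}"
  have "vge ((a + b) $ i) (cut k i)" if "i < dm" for i
    using a b that vge_add[of "a $ i" "cut k i" "b $ i"] by (auto simp: D_atLeast_iff)
  then show ?thesis using a b by (auto simp: D_atLeast_iff)
qed

lemma fvec_smult: "a \<in> fvec \<Longrightarrow> c \<in> F \<Longrightarrow> c \<cdot>\<^sub>v a \<in> fvec"
  by (auto simp: fvec_def F_closed)

lemma fvec_add: "a \<in> fvec \<Longrightarrow> b \<in> fvec \<Longrightarrow> a + b \<in> fvec"
  by (auto simp: fvec_def F_closed)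

lemma fvec_minus: "a \<in> fvec \<Longrightarrow> b \<in> fvec \<Longrightarrow> a - b \<in> fvec"
  by (auto simp: fvec_def F_closed)

lemma D_smult:
  assumes "a \<in> D {k..}" "c \<in> F" "c \<noteq> 0"
  shows "c \<cdot>\<^sub>v a \<in> D {k + N * w c..}"
proof -
  have "vge (c * a $ i) (cut (k + N * w c) i)" if "i < dm" for i
  proof (rule vge_mono)
    show "vge (c * a $ i) (w c + cut k i)"
      using assms that by (intro vge_mult) (auto simp: D_atLeast_iff vge_def)
    show "cut (k + N * w c) i \<le> w c + cut k i"
      unfolding cut_le_iff using cut_ge[of k i] by (simp add: algebra_simps)
  qed
  then show ?thesis using assms by (auto simp: D_atLeast_iff)
qed

lemma D_uminus: "a \<in> D {k..} \<Longrightarrow> - a \<in> D {k..}"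
proof -
  assume a: "a \<in> D {k..}"
  have "vge ((- a) $ i) (cut k i)" if "i < dm" for i
    using a that vge_uminus[of "a $ i" "cut k i"] by (auto simp: D_atLeast_iff)
  then show ?thesis using a by (auto simp: D_atLeast_iff)
qed

text \<open>Vectors of exact level \<open>z\<close> in the chain of \<open>P\<close>. Successive
  lattices of the chain differ in one coordinate and one exponent only, so their quotient is a line
  over the residue field; \<open>gr_exact\<close> is the usable form of this.\<close>

definition gr :: "'k mat \<Rightarrow> int \<Rightarrow> 'k vec set" where
  "gr P z = L P {z..} - L P {z + 1..}"

lemma gr_iff: "P \<in> GLF \<Longrightarrow> x \<in> gr P z \<longleftrightarrow> x \<in> fvec \<and> minv P *\<^sub>v x \<in> D {z..} - D {z + 1..}"
  by (auto simp: gr_def L_iff)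

lemma Dgr_coord:
  assumes "a \<in> D {z..} - D {z + 1..}"
  obtains i where "i < dm" "a $ i \<noteq> 0" "int i + N * w (a $ i) = z"
  using assms by (fastforce simp: D_def)

text \<open>A level determines its coordinate as the residue and its exponent as the quotient modulo
  \<open>N\<close>; hence distinct coordinates never compete at the same level.\<close>

lemma index_unique:
  assumes "i < dm" "j < dm" "int i + N * p = int j + N * q"
  shows "i = j" "p = q"
proof -
  have "(int i + N * p) mod N = int i" "(int j + N * q) mod N = int j"
    using assms(1,2) by (simp_all only: mod_mult_self2) (simp_all add: N_def)
  then show ij: "i = j" using assms(3) by (metis of_nat_eq_iff)
  then have "N * p = N * q" using assms(3) by linarith
  then show "p = q" using N_gt_1 by simp
qed

lemma gr_exists:
  assumes "P \<in> GLF" "x \<in> fvec" "x \<noteq> 0\<^sub>v dm"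
  obtains z where "x \<in> gr P z"
proof -
  define a where "a = minv P *\<^sub>v x"
  have a: "a \<in> fvec" unfolding a_def using assms GLF_minv[OF assms(1)] by (intro mats_fvec) (auto simp: GLF_def)
  have "a \<noteq> 0\<^sub>v dm"
  proof
    assume "a = 0\<^sub>v dm"
    then have "P *\<^sub>v a = 0\<^sub>v dm" using GLF_D(1)[OF assms(1)] by auto
    then show False using minv_mult_vec(2)[OF assms(1,2)] assms(3) by (simp add: a_def)
  qed
  then obtain i0 where i0: "i0 < dm" "a $ i0 \<noteq> 0" using a by (auto simp: fvec_def vec_eq_iff)
  define S where "S = (\<lambda>i. int i + N * w (a $ i)) ` {i. i < dm \<and> a $ i \<noteq> 0}"
  have S: "finite S" "S \<noteq> {}" using i0 by (auto simp: S_def)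
  define z where "z = Min S"
  have zle: "z \<le> s" if "s \<in> S" for s using Min_le[OF S(1) that] by (simp add: z_def)
  have "int i + N * w (a $ i) \<in> S" if "i < dm" "a $ i \<noteq> 0" for i using that by (auto simp: S_def)
  then have "a \<in> D {z..}" using a zle by (auto simp: D_def)
  moreover have "z \<in> S" using Min_in[OF S] by (simp add: z_def)
  then obtain j where "j < dm" "a $ j \<noteq> 0" "z = int j + N * w (a $ j)" by (auto simp: S_def)
  then have "a \<notin> D {z + 1..}" by (auto simp: D_def intro!: exI[of _ j])
  ultimately have "x \<in> gr P z" using assms by (simp add: gr_iff a_def)
  then show ?thesis by (rule that)
qed

lemma gr_nonempty:
  assumes "P \<in> GLF"
  shows "\<exists>x. x \<in> gr P z \<and> (\<forall>X. z \<in> X \<longrightarrow> x \<in> L P X)"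
proof -
  define i where "i = nat (z mod N)"
  have i: "int i = z mod N" using pos_mod_sign[of N z] N_pos by (simp add: i_def)
  then have "int i < N" using pos_mod_bound[of N z] N_pos by simp
  then have idm: "i < dm" by (simp add: N_def)
  \<comment> \<open>The vector that the integer \<open>z\<close> stands for. Its only nonzero
    coordinate has level \<open>z\<close>, so it lies in \<open>D X\<close> for all \<open>X\<close>
    containing \<open>z\<close> at once.\<close>
  define a where "a = (unif powi (z div N)) \<cdot>\<^sub>v unit_vec dm i"
  have w: "w (unif powi (z div N)) = z div N" "unif powi (z div N) \<in> F" "unif powi (z div N) \<noteq> 0"
    using unif by (auto simp: w_power_int F_power_int)
  have a: "a \<in> carrier_vec dm" "\<And>j. j < dm \<Longrightarrow> a $ j = (if j = i then unif powi (z div N) else 0)"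
    by (auto simp: a_def unit_vec_def)
  have z: "int i + N * (z div N) = z" using i by simp
  have fv: "a \<in> fvec" using a w by (auto simp: fvec_def F_closed)
  have "a \<in> D X" if "z \<in> X" for X using fv a w z that by (auto simp: D_def)
  moreover have "a \<notin> D {z + 1..}" using fv a w z idm by (auto simp: D_def intro!: exI[of _ i])
  moreover have "minv P *\<^sub>v (P *\<^sub>v a) = a" using minv_mult_vec(1)[OF assms fv] .
  moreover have "P *\<^sub>v a \<in> fvec" using assms fv by (intro mats_fvec GLF_D)
  ultimately show ?thesis using assms by (intro exI[of _ "P *\<^sub>v a"]) (auto simp: gr_iff L_iff)
qed

lemma mem_iff_L:
  assumes "P \<in> GLF"
  shows "z \<in> X \<longleftrightarrow> (\<exists>x\<in>L P X. x \<in> gr P z)"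
proof
  show "z \<in> X \<Longrightarrow> \<exists>x\<in>L P X. x \<in> gr P z" using gr_nonempty[OF assms, of z] by blast
  assume "\<exists>x\<in>L P X. x \<in> gr P z"
  then obtain x where "minv P *\<^sub>v x \<in> D X" "minv P *\<^sub>v x \<in> D {z..} - D {z + 1..}"
    using assms by (auto simp: L_iff gr_iff)
  then show "z \<in> X" by (elim Dgr_coord) (auto simp: D_def)
qed

text \<open>The set of values on a lattice depends only on the base chain, not on the frame.\<close>

lemma L_eq_imp:
  assumes "P \<in> GLF" "Q \<in> GLF" "\<And>k. L P {k..} = L Q {k..}" "L P X = L Q Y"
  shows "X = Y"
proof -
  have "gr P z = gr Q z" for z using assms(3) by (simp add: gr_def)
  then show ?thesis using mem_iff_L[OF assms(1), of _ X] mem_iff_L[OF assms(2), of _ Y] assms(4) by blast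
qed

end

context lattices begin

section \<open>Iwahori matrices and monomial matrices\<close>

text \<open>The Iwahori subgroup, the stabiliser of every \<open>D {k..}\<close>. Entries above the
  diagonal have positive value because the basis vector with index \<open>j\<close> must not acquire
  a component of level \<open>i < j\<close>.\<close>

definition iwahori :: "'k mat \<Rightarrow> bool" where
  "iwahori T \<longleftrightarrow> T \<in> carrier_mat dm dm \<and> (\<forall>i<dm. T $$ (i, i) \<noteq> 0 \<and> w (T $$ (i, i)) = 0) \<and>
     (\<forall>i<dm. \<forall>j<dm. vge (T $$ (i, j)) (if i < j then 1 else 0))"

lemma iwahori_mats: "iwahori T \<Longrightarrow> T \<in> mats F dm"
  by (auto simp: iwahori_def mats_def vge_def)

text \<open>In the expansion of the determinant the identity contributes a unit, and every other
  permutation moves some index up and so picks up a factor of positive value.\<close>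

lemma iwahori_det:
  assumes T: "iwahori T"
  shows "det T \<noteq> 0" "w (det T) = 0"
proof -
  let ?f = "\<lambda>p. signof p * (\<Prod>i = 0..<dm. T $$ (i, p i))"
  have c: "T \<in> carrier_mat dm dm" using T by (simp add: iwahori_def)
  have fin: "finite {p. p permutes {0..<dm}}" by (simp add: finite_permutations)
  have "det T = sum ?f {p. p permutes {0..<dm}}" by (rule det_def'[OF c])
  also have "\<dots> = ?f id + sum ?f ({p. p permutes {0..<dm}} - {id})"
    using fin by (intro sum.remove) (auto simp: permutes_id)
  finally have det: "det T = ?f id + sum ?f ({p. p permutes {0..<dm}} - {id})" .
  have d: "T $$ (i, i) \<in> F \<and> T $$ (i, i) \<noteq> 0" "w (T $$ (i, i)) = 0" if "i \<in> {0..<dm}" for i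
    using T that by (auto simp: iwahori_def vge_def)
  have "(\<Prod>i = 0..<dm. T $$ (i, i)) \<in> F" "(\<Prod>i = 0..<dm. T $$ (i, i)) \<noteq> 0"
    using d by (auto intro!: subring_prod[OF subring] simp del: prod.op_ivl_Suc prod.atLeast0_lessThan_Suc)
  moreover have "w (\<Prod>i = 0..<dm. T $$ (i, i)) = 0"
    using w_prod[of "{0..<dm}" "\<lambda>i. T $$ (i, i)"] d by simp
  ultimately have id: "?f id \<in> F" "?f id \<noteq> 0" "w (?f id) = 0" by (simp_all add: sign_id)
  have "vge (?f p) 1" if p: "p \<in> {p. p permutes {0..<dm}} - {id}" for p
  proof -
    have pp: "p permutes {0..<dm}" "p \<noteq> id" using p by auto
    let ?m = "\<lambda>i. if i < p i then 1 else 0 :: int"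
    have "\<not> (\<forall>i\<in>{0..<dm}. p i \<le> i)" using permutes_natset_le[OF pp(1)] pp(2) by blast
    then obtain i where i: "i \<in> {0..<dm}" "i < p i" by auto
    have "1 = ?m i" using i by simp
    also have "\<dots> \<le> sum ?m {0..<dm}" using i by (intro member_le_sum) auto
    finally have ge: "1 \<le> sum ?m {0..<dm}" .
    have "vge (\<Prod>i = 0..<dm. T $$ (i, p i)) (sum ?m {0..<dm})"
    proof (rule vge_prod)
      fix i assume i: "i \<in> {0..<dm}"
      then have "p i < dm" using pp(1) by (metis atLeastLessThan_iff permutes_in_image)
      then show "vge (T $$ (i, p i)) (?m i)" using T i by (auto simp: iwahori_def)
    qed simp
    then have "vge (\<Prod>i = 0..<dm. T $$ (i, p i)) 1" using ge by (rule vge_mono)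
    moreover have "vge (signof p) 0"
      using w_one w_minus_one F_closed by (auto simp: sign_def vge_def)
    ultimately show ?thesis using vge_mult by fastforce
  qed
  then have "vge (sum ?f ({p. p permutes {0..<dm}} - {id})) 1" by (rule vge_sum)
  then show "det T \<noteq> 0" "w (det T) = 0"
    using w_add_exact[OF id(1,2)] id(3) unfolding det by auto
qed

lemma mult_vec_coord:
  assumes "T \<in> carrier_mat dm dm" "a \<in> carrier_vec dm" "i < dm"
  shows "(T *\<^sub>v a) $ i = (\<Sum>j = 0..<dm. T $$ (i, j) * a $ j)"
  using assms by (simp add: scalar_prod_def)

text \<open>The converse direction holds because exact levels are preserved: in the unique
  coordinate that realises the lowest level of \<open>a\<close>, the diagonal term dominates all
  others.\<close>

lemma iwahori_D:
  assumes T: "iwahori T" and a: "a \<in> fvec"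
  shows "T *\<^sub>v a \<in> D {k..} \<longleftrightarrow> a \<in> D {k..}"
proof
  note c = iwahori_mats[OF T, THEN mats_carrier]
  assume aD: "a \<in> D {k..}"
  have "vge ((T *\<^sub>v a) $ i) (cut k i)" if i: "i < dm" for i
    unfolding mult_vec_coord[OF c fvec_carrier[OF a] i]
  proof (rule vge_sum)
    fix j assume "j \<in> {0..<dm}"
    then have j: "j < dm" by simp
    have "vge (T $$ (i, j) * a $ j) ((if i < j then 1 else 0) + cut k j)"
      using T i j aD by (intro vge_mult) (auto simp: iwahori_def D_atLeast_iff)
    moreover have "cut k i \<le> (if i < j then 1 else 0) + cut k j"
    proof -
      have "int j + N * cut k j \<le> int i + N * ((if i < j then 1 else 0) + cut k j)"
        using i j by (auto simp: N_dm algebra_simps)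
      then show ?thesis unfolding cut_le_iff using cut_ge[of k j] by linarith
    qed
    ultimately show "vge (T $$ (i, j) * a $ j) (cut k i)" by (rule vge_mono)
  qed
  moreover have "T *\<^sub>v a \<in> carrier_vec dm" using c fvec_carrier[OF a] by simp
  ultimately show "T *\<^sub>v a \<in> D {k..}" by (simp add: D_atLeast_iff)
next
  note c = iwahori_mats[OF T, THEN mats_carrier]
  assume Ta: "T *\<^sub>v a \<in> D {k..}"
  show "a \<in> D {k..}"
  proof (cases "a = 0\<^sub>v dm")
    case True
    then show ?thesis using a by (simp add: D_def)
  next
    case False
    have one: "1\<^sub>m dm \<in> GLF" by (simp add: GLF_def mats_one[OF subring])
    have "minv (1\<^sub>m dm) *\<^sub>v a = a" using minv_mult_vec(1)[OF one a] fvec_carrier[OF a] by simp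
    then obtain m where m: "a \<in> D {m..} - D {m + 1..}"
      using gr_exists[OF one a False] gr_iff[OF one] by metis
    then obtain i where i: "i < dm" "a $ i \<noteq> 0" "int i + N * w (a $ i) = m" by (rule Dgr_coord)
    define e where "e = w (a $ i)"
    have Tii: "T $$ (i, i) \<in> F" "T $$ (i, i) \<noteq> 0" "w (T $$ (i, i)) = 0" "a $ i \<in> F"
      using T i a by (auto simp: iwahori_def vge_def fvec_def)
    then have main: "T $$ (i, i) * a $ i \<in> F" "T $$ (i, i) * a $ i \<noteq> 0" "w (T $$ (i, i) * a $ i) = e"
      using i by (auto simp: w_mult F_closed e_def)
    have other: "vge (\<Sum>j\<in>{0..<dm} - {i}. T $$ (i, j) * a $ j) (e + 1)"
    proof (rule vge_sum)
      fix j assume "j \<in> {0..<dm} - {i}"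
      then have j: "j < dm" "j \<noteq> i" by auto
      show "vge (T $$ (i, j) * a $ j) (e + 1)"
      proof (cases "a $ j = 0")
        case True
        then show ?thesis by simp
      next
        case nz: False
        \<comment> \<open>The extra value above the diagonal compensates exactly for
          \<open>a $ j\<close> having a higher level merely because of \<open>j > i\<close>.\<close>
        define s :: int where "s = (if i < j then 1 else 0)"
        have "int j + N * w (a $ j) \<ge> m" using m j nz by (auto simp: D_def)
        moreover have "int j + N * w (a $ j) \<noteq> int i + N * e" using index_unique(1) i(1) j by blast
        ultimately have gt: "int j + N * w (a $ j) > int i + N * e" using i by (simp add: e_def)
        have "N * (s + w (a $ j)) > N * e"
          using gt i(1) j by (auto simp: s_def N_dm algebra_simps)
        then have "s + w (a $ j) \<ge> e + 1" using N_gt_1 by simp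
        moreover have "vge (T $$ (i, j) * a $ j) (s + w (a $ j))"
          using T i j a by (intro vge_mult) (auto simp: iwahori_def s_def vge_def fvec_def)
        ultimately show ?thesis using vge_mono by blast
      qed
    qed
    have "(T *\<^sub>v a) $ i = T $$ (i, i) * a $ i + (\<Sum>j\<in>{0..<dm} - {i}. T $$ (i, j) * a $ j)"
      unfolding mult_vec_coord[OF c fvec_carrier[OF a] i(1)] using i by (intro sum.remove) auto
    then have "(T *\<^sub>v a) $ i \<noteq> 0" "w ((T *\<^sub>v a) $ i) = e"
      using w_add_exact[OF main(1,2)] other main(3) by auto
    then have "k \<le> m" using Ta i by (auto simp: D_def e_def)
    then show ?thesis using m D_mono[of "{m..}" "{k..}"] by auto
  qed
qed

lemma L_iwahori:
  assumes P: "P \<in> GLF" and T: "iwahori T"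
  shows "P * T \<in> GLF" "w (det (P * T)) = w (det P)" "L (P * T) {k..} = L P {k..}"
proof -
  have TG: "T \<in> GLF" using iwahori_det[OF T] iwahori_mats[OF T] by (simp add: GLF_def)
  show "P * T \<in> GLF" using P TG by (rule GLF_mult)
  show "w (det (P * T)) = w (det P)" using w_det_mult[OF P TG] iwahori_det[OF T] by simp
  have "L T {k..} = D {k..}"
  proof
    show "L T {k..} \<subseteq> D {k..}" unfolding L_def using iwahori_D[OF T] D_fvec by blast
    show "D {k..} \<subseteq> L T {k..}"
    proof
      fix x assume x: "x \<in> D {k..}"
      have f: "minv T *\<^sub>v x \<in> fvec" using mats_fvec[OF GLF_D(2)[OF GLF_minv[OF TG]] D_fvec[OF x]] .
      have "T *\<^sub>v (minv T *\<^sub>v x) = x" using minv_mult_vec(2)[OF TG D_fvec[OF x]] .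
      then have "minv T *\<^sub>v x \<in> D {k..}" using iwahori_D[OF T f, of k] x by simp
      then show "x \<in> L T {k..}" using L_iff[OF TG] D_fvec[OF x] by simp
    qed
  qed
  then show "L (P * T) {k..} = L P {k..}"
    using L_mult[OF GLF_D(1)[OF P] GLF_D(1)[OF TG]] by (simp add: L_def)
qed

text \<open>The transition matrix \<open>minv P * Q\<close> is Iwahori: its \<open>j\<close>-th
  column has exact level \<open>j\<close>, and only the diagonal entry, with exponent 0, can realise
  that level.\<close>

lemma frame_from_columns:
  assumes P: "P \<in> GLF" and Q: "Q \<in> carrier_mat dm dm" and g: "\<And>j. j < dm \<Longrightarrow> col Q j \<in> gr P (int j)"
  shows "Q \<in> GLF" "w (det Q) = w (det P)" "L Q {k..} = L P {k..}"
proof -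
  define T where "T = minv P * Q"
  have mP: "minv P \<in> carrier_mat dm dm" "P * minv P = 1\<^sub>m dm"
    using minv[OF GLF_D(1)[OF P] GLF_D(3)[OF P]] by auto
  have c: "T \<in> carrier_mat dm dm" using mP Q by (simp add: T_def)
  have "P * T = (P * minv P) * Q" unfolding T_def
    using GLF_D(1)[OF P] mP(1) Q by (simp add: assoc_mult_mat)
  then have PT: "P * T = Q" using mP Q by simp
  have colT: "col T j \<in> D {int j..} - D {int j + 1..}" if "j < dm" for j
  proof -
    have "col T j = minv P *\<^sub>v col Q j" unfolding T_def using mP Q that by (intro col_mult2)
    then show ?thesis using g[OF that] gr_iff[OF P] by simp
  qed
  have ent: "T $$ (i, j) \<in> F" "T $$ (i, j) \<noteq> 0 \<Longrightarrow> int j \<le> int i + N * w (T $$ (i, j))" if "i < dm" "j < dm" for i j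
    using colT[OF that(2)] that c by (auto simp: D_def fvec_def)
  have "T $$ (j, j) \<noteq> 0 \<and> w (T $$ (j, j)) = 0" if j: "j < dm" for j
  proof -
    obtain i where i: "i < dm" "col T j $ i \<noteq> 0" "int i + N * w (col T j $ i) = int j"
      using colT[OF j] by (rule Dgr_coord)
    have "i = j" "w (col T j $ i) = 0" using index_unique[of i j "w (col T j $ i)" 0] i j by auto
    then show ?thesis using i c j by auto
  qed
  moreover have "vge (T $$ (i, j)) (if i < j then 1 else 0)" if "i < dm" "j < dm" for i j
  proof (cases "T $$ (i, j) = 0")
    case False
    let ?e = "w (T $$ (i, j))"
    have le: "int j - int i \<le> N * ?e" using ent(2)[OF that False] by simp
    have "(if i < j then 1 else 0) \<le> ?e"
    proof (cases "i < j")
      case True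
      then have "0 < N * ?e" using le by simp
      then show ?thesis using True N_pos by (simp add: zero_less_mult_iff)
    next
      case False
      \<comment> \<open>Indices differ by less than \<open>N\<close>, so on and below the diagonal
        the inequality of levels still excludes negative values.\<close>
      then have "- N < N * ?e" using le that by (simp add: N_dm)
      then have "N * (-1) < N * ?e" by simp
      then have "-1 < ?e" using N_pos mult_less_cancel_left_pos by blast
      then show ?thesis using False by simp
    qed
    then show ?thesis using ent(1)[OF that] by (simp add: vge_def)
  qed simp
  ultimately have "iwahori T" using c by (simp add: iwahori_def)
  from L_iwahori[OF P this] show "Q \<in> GLF" "w (det Q) = w (det P)" "L Q {k..} = L P {k..}" by (simp_all add: PT)
qed

text \<open>For periodic \<open>f\<close>, the matrix that carries the vector indexed by
  \<open>z\<close> to the vector indexed by \<open>f z\<close>. These matrices lift the extended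
  affine Weyl group.\<close>

definition monomial :: "(int \<Rightarrow> int) \<Rightarrow> 'k mat" where
  "monomial f = mat dm dm (\<lambda>(i, j). if f (int j) mod N = int i then unif powi (f (int j) div N) else 0)"

lemma monomial_carrier [simp]: "monomial f \<in> carrier_mat dm dm"
  by (simp add: monomial_def)

lemma unif_powi: "unif powi m \<in> F" "unif powi m \<noteq> 0" "w (unif powi m) = m"
  using unif by (auto simp: F_power_int w_power_int)

lemma monomial_mats: "monomial f \<in> mats F dm"
  by (auto simp: monomial_def mats_def unif_powi F_closed)

lemma mod_index: "nat (z mod N) < dm" "int (nat (z mod N)) = z mod N"
proof -
  show i: "int (nat (z mod N)) = z mod N" using pos_mod_sign[of N z] by simp
  then have "int (nat (z mod N)) < N" using pos_mod_bound[of N z] by simp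
  then show "nat (z mod N) < dm" by (simp add: N_def)
qed

lemma monomial_mult:
  assumes f: "periodic f"
  shows "monomial f * monomial g = monomial (f \<circ> g)"
proof (rule eq_matI)
  fix i k assume "i < dim_row (monomial (f \<circ> g))" "k < dim_col (monomial (f \<circ> g))"
  then have ik: "i < dm" "k < dm" by (auto simp: monomial_def)
  define j0 where "j0 = nat (g (int k) mod N)"
  define q where "q = g (int k) div N"
  have j0: "j0 < dm" "int j0 = g (int k) mod N" using mod_index by (simp_all add: j0_def)
  have "f (g (int k)) = f (int j0 + N * q)" by (simp add: j0 q_def)
  then have fg: "f (g (int k)) = f (int j0) + N * q" using periodic_mult[OF f] by simp
  have m: "f (g (int k)) mod N = f (int j0) mod N" and dv: "f (g (int k)) div N = f (int j0) div N + q"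
    using N_gt_1 by (simp_all add: fg)
  have "(monomial f * monomial g) $$ (i, k) = (\<Sum>j = 0..<dm. monomial f $$ (i, j) * monomial g $$ (j, k))"
    using ik by (simp add: monomial_def scalar_prod_def)
  also have "\<dots> = (\<Sum>j = 0..<dm. if j = j0 then monomial f $$ (i, j0) * unif powi q else 0)"
  proof (rule sum.cong)
    fix j assume "j \<in> {0..<dm}"
    then have j: "j < dm" by simp
    have "g (int k) mod N = int j \<longleftrightarrow> j = j0" using j0(2) by auto
    then show "monomial f $$ (i, j) * monomial g $$ (j, k) = (if j = j0 then monomial f $$ (i, j0) * unif powi q else 0)"
      using ik j by (simp add: monomial_def q_def)
  qed simp
  also have "\<dots> = monomial f $$ (i, j0) * unif powi q" using j0 by simp
  also have "\<dots> = monomial (f \<circ> g) $$ (i, k)"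
    using ik j0(1) unif(2) by (simp add: monomial_def m dv power_int_add)
  finally show "(monomial f * monomial g) $$ (i, k) = monomial (f \<circ> g) $$ (i, k)" .
qed (auto simp: monomial_def)

lemma monomial_id: "monomial id = 1\<^sub>m dm"
  by (rule eq_matI) (auto simp: monomial_def N_def div_pos_pos_trivial mod_pos_pos_trivial)

lemma monomial_D_subset:
  assumes f: "periodic f" and a: "a \<in> D X"
  shows "monomial f *\<^sub>v a \<in> D (f ` X)"
proof -
  have fv: "monomial f *\<^sub>v a \<in> fvec" using mats_fvec[OF monomial_mats D_fvec[OF a]] .
  have "(monomial f *\<^sub>v a) $ i = 0 \<or> int i + N * w ((monomial f *\<^sub>v a) $ i) \<in> f ` X" if i: "i < dm" for i
  proof (cases "\<exists>j<dm. f (int j) mod N = int i")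
    case False
    have "(monomial f *\<^sub>v a) $ i = (\<Sum>j = 0..<dm. 0)"
      unfolding mult_vec_coord[OF monomial_carrier fvec_carrier[OF D_fvec[OF a]] i]
      using False i by (intro sum.cong) (auto simp: monomial_def)
    then show ?thesis by simp
  next
    case True
    then obtain j where j: "j < dm" "f (int j) mod N = int i" by auto
    have uniq: "l = j" if l: "l < dm" "f (int l) mod N = int i" for l
    proof -
      obtain q where "f (int l) = f (int j) + N * q" using mod_eq_offset[of "f (int l)" "f (int j)"] l(2) j(2) by metis
      then have "f (int l) = f (int j + N * q)" using periodic_mult[OF f] by simp
      then have "int l + N * 0 = int j + N * q" using f by (simp add: periodic_def bij_def inj_eq)
      then show ?thesis using index_unique(1) l(1) j(1) by blast
    qed
    have "(monomial f *\<^sub>v a) $ i = (\<Sum>l = 0..<dm. if l = j then unif powi (f (int j) div N) * a $ j else 0)"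
      unfolding mult_vec_coord[OF monomial_carrier fvec_carrier[OF D_fvec[OF a]] i]
    proof (rule sum.cong[OF refl])
      fix l assume "l \<in> {0..<dm}"
      then have l: "l < dm" by simp
      have "f (int l) mod N = int i \<longleftrightarrow> l = j" using uniq[OF l] j(2) by blast
      moreover have "monomial f $$ (i, l) = (if f (int l) mod N = int i then unif powi (f (int l) div N) else 0)"
        using l i by (simp add: monomial_def)
      ultimately show "monomial f $$ (i, l) * a $ l = (if l = j then unif powi (f (int j) div N) * a $ j else 0)"
        by simp
    qed
    then have v: "(monomial f *\<^sub>v a) $ i = unif powi (f (int j) div N) * a $ j" using j by simp
    show ?thesis
    proof (cases "a $ j = 0")
      case nz: False
      have aj: "a $ j \<in> F" "int j + N * w (a $ j) \<in> X" using a j nz by (auto simp: D_def fvec_def)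
      have "w ((monomial f *\<^sub>v a) $ i) = f (int j) div N + w (a $ j)"
        unfolding v using aj nz unif_powi by (simp add: w_mult)
      then have "int i + N * w ((monomial f *\<^sub>v a) $ i) = (f (int j) mod N + N * (f (int j) div N)) + N * w (a $ j)"
        using j by (simp add: algebra_simps)
      also have "\<dots> = f (int j + N * w (a $ j))" using periodic_mult[OF f, of "int j" "w (a $ j)"] by simp
      finally show ?thesis using aj by auto
    qed (simp add: v)
  qed
  then show ?thesis using fv by (simp add: D_def)
qed

lemma periodic_inv_comp: "periodic f \<Longrightarrow> f \<circ> inv_into UNIV f = id" "periodic f \<Longrightarrow> inv_into UNIV f \<circ> f = id"
  by (auto simp: periodic_def bij_def fun_eq_iff surj_f_inv_f inv_f_f)

lemma monomial_L: "periodic f \<Longrightarrow> L (monomial f) X = D (f ` X)"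
proof
  assume f: "periodic f"
  show "L (monomial f) X \<subseteq> D (f ` X)" unfolding L_def using monomial_D_subset[OF f] by blast
  show "D (f ` X) \<subseteq> L (monomial f) X"
  proof
    fix a assume a: "a \<in> D (f ` X)"
    let ?g = "inv_into UNIV f"
    have "monomial ?g *\<^sub>v a \<in> D (?g ` f ` X)" using monomial_D_subset[OF periodic_inv[OF f] a] .
    moreover have "?g ` f ` X = X" unfolding image_comp periodic_inv_comp(2)[OF f] by simp
    ultimately have g: "monomial ?g *\<^sub>v a \<in> D X" by simp
    have "monomial f *\<^sub>v (monomial ?g *\<^sub>v a) = (monomial f * monomial ?g) *\<^sub>v a"
      using fvec_carrier[OF D_fvec[OF a]] by (simp add: assoc_mult_mat_vec[OF monomial_carrier monomial_carrier])
    also have "\<dots> = a" using fvec_carrier[OF D_fvec[OF a]] by (simp add: monomial_mult[OF f] periodic_inv_comp(1)[OF f] monomial_id)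
    finally show "a \<in> L (monomial f) X" unfolding L_def using g by (metis imageI)
  qed
qed

text \<open>Only the permutation \<open>p\<close> of residues induced by \<open>f\<close>
  contributes to the determinant. Its value is the sum of the quotients \<open>f j div N\<close>;
  multiplied by \<open>N\<close> this is the displacement, since the residues are merely
  permuted.\<close>

lemma monomial_det:
  assumes f: "periodic f"
  shows "det (monomial f) \<noteq> 0" "N * w (det (monomial f)) = defect f"
proof -
  define p where "p j = (if j < dm then nat (f (int j) mod N) else j)" for j
  have pj: "p j < dm" "int (p j) = f (int j) mod N" if "j < dm" for j
    using that mod_index[of "f (int j)"] by (simp_all add: p_def)
  have inj: "inj_on p {0..<dm}"
  proof (rule inj_onI)
    fix j l assume jl: "j \<in> {0..<dm}" "l \<in> {0..<dm}" "p j = p l"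
    then have "f (int l) mod N = f (int j) mod N" using pj by (metis atLeastLessThan_iff)
    then obtain q where "f (int l) = f (int j) + N * q" using mod_eq_offset by blast
    then have "f (int l) = f (int j + N * q)" using periodic_mult[OF f] by simp
    then have "int l + N * 0 = int j + N * q" using f by (simp add: periodic_def bij_def inj_eq)
    then show "j = l" using index_unique(1)[of l j 0 q] jl by simp
  qed
  have "p ` {0..<dm} \<subseteq> {0..<dm}" using pj by auto
  then have bij: "bij_betw p {0..<dm} {0..<dm}" using inj by (simp add: bij_betw_def endo_inj_surj)
  have perm: "p permutes {0..<dm}" by (rule bij_imp_permutes[OF bij]) (simp add: p_def)
  let ?g = "\<lambda>s. signof s * (\<Prod>j = 0..<dm. monomial f $$ (s j, j))"
  have fin: "finite {s. s permutes {0..<dm}}" by (simp add: finite_permutations)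
  have "det (monomial f) = sum ?g {s. s permutes {0..<dm}}" using det_col[OF monomial_carrier, of f] by (simp add: atLeast0LessThan)
  also have "\<dots> = ?g p + sum ?g ({s. s permutes {0..<dm}} - {p})" using fin perm by (intro sum.remove) auto
  also have "sum ?g ({s. s permutes {0..<dm}} - {p}) = 0"
  proof (rule sum.neutral, rule ballI)
    fix s assume s: "s \<in> {s. s permutes {0..<dm}} - {p}"
    then have "s permutes {0..<dm}" "s \<noteq> p" by auto
    then obtain j where j: "j < dm" "s j \<noteq> p j"
      using perm by (metis atLeastLessThan_iff ext le0 permutes_not_in)
    have "s j < dm" using j s by (metis (no_types, lifting) DiffD1 atLeastLessThan_iff le0 mem_Collect_eq permutes_in_image)
    then have "monomial f $$ (s j, j) = 0" using j pj[OF j(1)] by (auto simp: monomial_def)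
    then have "(\<Prod>j = 0..<dm. monomial f $$ (s j, j)) = 0" using j by (intro prod_zero) auto
    then show "?g s = 0" by simp
  qed
  finally have det: "det (monomial f) = signof p * (\<Prod>j = 0..<dm. monomial f $$ (p j, j))" by simp
  have ent: "monomial f $$ (p j, j) = unif powi (f (int j) div N)" if "j < dm" for j
    using that pj[OF that] by (simp add: monomial_def)
  have pr: "(\<Prod>j = 0..<dm. monomial f $$ (p j, j)) = (\<Prod>j = 0..<dm. unif powi (f (int j) div N))"
    using ent by (intro prod.cong) auto
  have wp: "w (\<Prod>j = 0..<dm. unif powi (f (int j) div N)) = (\<Sum>j = 0..<dm. f (int j) div N)"
    using unif_powi by (subst w_prod) auto
  have pF: "(\<Prod>j = 0..<dm. unif powi (f (int j) div N)) \<in> F" "(\<Prod>j = 0..<dm. unif powi (f (int j) div N)) \<noteq> 0"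
    using unif_powi by (auto intro!: subring_prod[OF subring] simp del: prod.op_ivl_Suc)
  have sg: "signof p = (1 :: 'k) \<or> signof p = (- 1 :: 'k)" by (auto simp: sign_def)
  show "det (monomial f) \<noteq> 0" unfolding det pr using sg pF by auto
  have "w (det (monomial f)) = (\<Sum>j = 0..<dm. f (int j) div N)"
    unfolding det pr using sg pF wp w_uminus by auto
  then have "N * w (det (monomial f)) = (\<Sum>j = 0..<dm. N * (f (int j) div N))" by (simp add: sum_distrib_left distrib_left)
  also have "\<dots> = (\<Sum>j = 0..<dm. f (int j) - int (p j))"
    using pj by (intro sum.cong) (auto simp: minus_mod_eq_mult_div[symmetric])
  also have "\<dots> = (\<Sum>j = 0..<dm. f (int j)) - (\<Sum>j = 0..<dm. int (p j))" by (simp add: sum_subtractf)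
  also have "(\<Sum>j = 0..<dm. int (p j)) = (\<Sum>j = 0..<dm. int j)"
    using sum.reindex_bij_betw[OF bij, of int] .
  also have "(\<Sum>j = 0..<dm. f (int j)) - (\<Sum>j = 0..<dm. int j) = (\<Sum>j = 0..<dm. f (int j) - int j)"
    by (simp add: sum_subtractf)
  also have "\<dots> = defect f"
  proof -
    have "{0..<N} = int ` {0..<dm}" by (simp add: N_dm image_int_atLeastLessThan)
    then show ?thesis unfolding defect_def by (simp add: sum.reindex)
  qed
  finally show "N * w (det (monomial f)) = defect f" .
qed

lemma monomial_GLF: "periodic f \<Longrightarrow> monomial f \<in> GLF"
  using monomial_det monomial_mats by (simp add: GLF_def)

lemma monomial_col:
  assumes f: "periodic f" and P: "P \<in> GLF" and j: "j < dm"
  shows "col (P * monomial f) j = (unif powi (f (int j) div N)) \<cdot>\<^sub>v col P (nat (f (int j) mod N))"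
proof (rule eq_vecI)
  let ?r = "nat (f (int j) mod N)"
  note r = mod_index[of "f (int j)"]
  have c: "P \<in> carrier_mat dm dm" using P by (rule GLF_D)
  show "dim_vec (col (P * monomial f) j) = dim_vec (unif powi (f (int j) div N) \<cdot>\<^sub>v col P ?r)" using c by simp
  fix i assume "i < dim_vec (unif powi (f (int j) div N) \<cdot>\<^sub>v col P ?r)"
  then have i: "i < dm" using c by simp
  have "col (P * monomial f) j $ i = (\<Sum>l = 0..<dm. P $$ (i, l) * monomial f $$ (l, j))"
    using c i j by (simp add: scalar_prod_def monomial_def)
  also have "\<dots> = (\<Sum>l = 0..<dm. if l = ?r then unif powi (f (int j) div N) * P $$ (i, ?r) else 0)"
    using r j by (intro sum.cong) (auto simp: monomial_def)
  also have "\<dots> = (unif powi (f (int j) div N) \<cdot>\<^sub>v col P ?r) $ i" using r i c by simp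
  finally show "col (P * monomial f) j $ i = (unif powi (f (int j) div N) \<cdot>\<^sub>v col P ?r) $ i" .
qed

lemma L_times_monomial: "P \<in> GLF \<Longrightarrow> periodic f \<Longrightarrow> L (P * monomial f) X = L P (f ` X)"
  using L_mult[OF GLF_D(1) monomial_carrier] by (simp add: monomial_L) (simp add: L_def)

end

section \<open>Images of complexes\<close>

text \<open>Serves twice: the apartments are images of \<open>std\<close>, and the building of
  lattice classes is copied into the vertex type of the fixed point property.\<close>

definition cimg :: "('v \<Rightarrow> 'w) \<Rightarrow> 'v set set \<Rightarrow> 'w set set" where
  "cimg f \<Delta> = (\<lambda>A. f ` A) ` \<Delta>"

lemma Union_cimg: "\<Union> (cimg f \<Delta>) = f ` \<Union> \<Delta>"
  by (auto simp: cimg_def)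

lemma simplicial_cimg:
  assumes "simplicial_cplx \<Delta>"
  shows "simplicial_cplx (cimg f \<Delta>)"
  unfolding simplicial_cplx_def
proof (intro conjI ballI allI impI)
  fix A assume A: "A \<in> cimg f \<Delta>"
  then obtain A0 where A0: "A0 \<in> \<Delta>" "A = f ` A0" by (auto simp: cimg_def)
  show "finite A" "A \<noteq> {}" using assms A0 by (auto simp: simplicial_cplx_def)
  fix B assume B: "B \<subseteq> A \<and> B \<noteq> {}"
  have eq: "B = f ` (A0 \<inter> f -` B)" using B A0 by auto
  have "A0 \<inter> f -` B \<noteq> {}" using A0(2) B by blast
  then have "A0 \<inter> f -` B \<in> \<Delta>"
    using assms A0(1) unfolding simplicial_cplx_def by (meson Int_lower1)
  then show "B \<in> cimg f \<Delta>" unfolding cimg_def using eq by (rule_tac image_eqI)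
qed

lemma inj_on_cimg: "inj_on f (\<Union> \<Delta>) \<Longrightarrow> inj_on (\<lambda>A. f ` A) \<Delta>"
  by (intro inj_onI) (metis Sup_upper inj_on_image_eq_iff)

lemma simplicial_iso_cimg: "inj_on f (\<Union> \<Delta>) \<Longrightarrow> simplicial_iso \<Delta> (cimg f \<Delta>) f"
  unfolding simplicial_iso_def by (auto simp: Union_cimg bij_betw_def) (auto simp: cimg_def)

lemma simplicial_iso_comp:
  "simplicial_iso \<Delta> \<Delta>' f \<Longrightarrow> simplicial_iso \<Delta>' \<Delta>'' g \<Longrightarrow> simplicial_iso \<Delta> \<Delta>'' (g \<circ> f)"
  unfolding simplicial_iso_def by (auto intro: bij_betw_trans simp: image_comp[symmetric] image_image)

lemma simplicial_iso_inv:
  assumes "simplicial_iso \<Delta> \<Delta>' f"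
  shows "simplicial_iso \<Delta>' \<Delta> (inv_into (\<Union>\<Delta>) f)"
proof -
  have b: "bij_betw f (\<Union>\<Delta>) (\<Union>\<Delta>')" and im: "(\<lambda>A. f ` A) ` \<Delta> = \<Delta>'"
    using assms by (auto simp: simplicial_iso_def)
  have id: "inv_into (\<Union>\<Delta>) f ` f ` A = A" if "A \<in> \<Delta>" for A
    using b that by (intro inv_into_image_cancel) (auto simp: bij_betw_def)
  have "(\<lambda>A. inv_into (\<Union>\<Delta>) f ` A) ` (\<lambda>A. f ` A) ` \<Delta> = (\<lambda>A. inv_into (\<Union>\<Delta>) f ` f ` A) ` \<Delta>"
    by (rule image_image)
  also have "\<dots> = (\<lambda>A. A) ` \<Delta>" by (rule image_cong[OF refl id])
  finally have "(\<lambda>A. inv_into (\<Union>\<Delta>) f ` A) ` \<Delta>' = \<Delta>" by (simp add: im)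
  then show ?thesis using bij_betw_inv_into[OF b] by (simp add: simplicial_iso_def)
qed

lemma iso_coxeter_cimg:
  assumes "iso_coxeter_complex n \<Delta>" "inj_on f (\<Union>\<Delta>)"
  shows "iso_coxeter_complex n (cimg f \<Delta>)"
proof -
  obtain h where h: "bij_betw h \<Delta> (coxeter_complex n)" "\<forall>A\<in>\<Delta>. \<forall>B\<in>\<Delta>. A \<subseteq> B \<longleftrightarrow> h B \<subseteq> h A"
    using assms(1) by (auto simp: iso_coxeter_complex_def)
  let ?g = "inv_into \<Delta> (\<lambda>A. f ` A)"
  have b: "bij_betw (\<lambda>A. f ` A) \<Delta> (cimg f \<Delta>)"
    using inj_on_cimg[OF assms(2)] by (simp add: bij_betw_def cimg_def)
  have "bij_betw (h \<circ> ?g) (cimg f \<Delta>) (coxeter_complex n)"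
    using bij_betw_inv_into[OF b] h(1) by (rule bij_betw_trans)
  moreover have "A \<subseteq> B \<longleftrightarrow> (h \<circ> ?g) B \<subseteq> (h \<circ> ?g) A" if A: "A \<in> cimg f \<Delta>" and B: "B \<in> cimg f \<Delta>" for A B
  proof -
    obtain A0 B0 where AB: "A0 \<in> \<Delta>" "B0 \<in> \<Delta>" "A = f ` A0" "B = f ` B0" using A B by (auto simp: cimg_def)
    then have "?g A = A0" "?g B = B0" using inj_on_cimg[OF assms(2)] by auto
    moreover have "f ` A0 \<subseteq> f ` B0 \<longleftrightarrow> A0 \<subseteq> B0"
    proof
      assume le: "f ` A0 \<subseteq> f ` B0"
      show "A0 \<subseteq> B0"
      proof
        fix x assume "x \<in> A0"
        then have "f x \<in> f ` B0" "x \<in> \<Union>\<Delta>" using le AB by auto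
        then show "x \<in> B0" using inj_on_image_mem_iff[OF assms(2), of x B0] AB by blast
      qed
    qed (rule image_mono)
    ultimately show ?thesis using h(2) AB by simp
  qed
  ultimately show ?thesis unfolding iso_coxeter_complex_def by blast
qed

lemma building_cimg:
  assumes "building n \<Delta>" and inj: "inj_on f (\<Union>\<Delta>)"
  shows "building n (cimg f \<Delta>)"
proof -
  obtain \<A> where \<Delta>: "simplicial_cplx \<Delta>" "\<Delta> \<noteq> {}" "\<Delta> = \<Union>\<A>"
    and ap: "\<forall>\<Sigma>\<in>\<A>. subcplx \<Sigma> \<Delta> \<and> iso_coxeter_complex n \<Sigma>"
    and two: "\<forall>A\<in>\<Delta>. \<forall>B\<in>\<Delta>. \<exists>\<Sigma>\<in>\<A>. A \<in> \<Sigma> \<and> B \<in> \<Sigma>"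
    and iso: "\<forall>\<Sigma>\<in>\<A>. \<forall>\<Sigma>'\<in>\<A>. \<forall>A\<in>\<Sigma> \<inter> \<Sigma>'. \<forall>B\<in>\<Sigma> \<inter> \<Sigma>'. \<exists>g. simplicial_iso \<Sigma> \<Sigma>' g \<and> (\<forall>v\<in>A \<union> B. g v = v)"
    using assms(1) unfolding building_def by metis
  have sub: "\<Sigma> \<subseteq> \<Delta>" if "\<Sigma> \<in> \<A>" for \<Sigma> using that \<Delta>(3) by blast
  have injS: "inj_on f (\<Union>\<Sigma>)" if "\<Sigma> \<in> \<A>" for \<Sigma>
    using inj by (rule inj_on_subset) (use sub[OF that] in blast)
  show ?thesis unfolding building_def
  proof (intro conjI exI[of _ "cimg f ` \<A>"] ballI)
    show "simplicial_cplx (cimg f \<Delta>)" using \<Delta>(1) by (rule simplicial_cimg)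
    show "cimg f \<Delta> \<noteq> {}" using \<Delta>(2) by (simp add: cimg_def)
    show "cimg f \<Delta> = \<Union> (cimg f ` \<A>)" using \<Delta>(3) by (auto simp: cimg_def)
    show "subcplx \<Sigma> (cimg f \<Delta>)" if S: "\<Sigma> \<in> cimg f ` \<A>" for \<Sigma>
    proof -
      obtain S0 where "S0 \<in> \<A>" "\<Sigma> = cimg f S0" using S by auto
      moreover have "simplicial_cplx (cimg f S0)" using ap \<open>S0 \<in> \<A>\<close> by (intro simplicial_cimg) (simp add: subcplx_def)
      ultimately show ?thesis using sub[of S0] unfolding subcplx_def cimg_def by blast
    qed
    show "iso_coxeter_complex n \<Sigma>" if S: "\<Sigma> \<in> cimg f ` \<A>" for \<Sigma>
      using S ap injS by (auto intro: iso_coxeter_cimg)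
    show "\<exists>\<Sigma>\<in>cimg f ` \<A>. A \<in> \<Sigma> \<and> B \<in> \<Sigma>" if A: "A \<in> cimg f \<Delta>" and B: "B \<in> cimg f \<Delta>" for A B
    proof -
      obtain A0 B0 where AB: "A0 \<in> \<Delta>" "B0 \<in> \<Delta>" "A = f ` A0" "B = f ` B0" using A B by (auto simp: cimg_def)
      then obtain \<Sigma> where "\<Sigma> \<in> \<A>" "A0 \<in> \<Sigma>" "B0 \<in> \<Sigma>" using two by blast
      then show ?thesis using AB by (intro bexI[of _ "cimg f \<Sigma>"]) (auto simp: cimg_def)
    qed
    show "\<exists>h. simplicial_iso \<Sigma> \<Sigma>' h \<and> (\<forall>v\<in>A \<union> B. h v = v)"
      if S: "\<Sigma> \<in> cimg f ` \<A>" and S': "\<Sigma>' \<in> cimg f ` \<A>" and A: "A \<in> \<Sigma> \<inter> \<Sigma>'" and B: "B \<in> \<Sigma> \<inter> \<Sigma>'" for \<Sigma> \<Sigma>' A B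
    proof -
      obtain S0 S0' where SS: "S0 \<in> \<A>" "\<Sigma> = cimg f S0" "S0' \<in> \<A>" "\<Sigma>' = cimg f S0'" using S S' by auto
      \<comment> \<open>Injectivity on the whole complex, not just on each apartment, makes a
        simplex in both images come from one simplex in both apartments.\<close>
      have both: "\<exists>A0\<in>S0 \<inter> S0'. A = f ` A0" if A: "A \<in> \<Sigma> \<inter> \<Sigma>'" for A
      proof -
        obtain A0 A1 where "A0 \<in> S0" "A = f ` A0" "A1 \<in> S0'" "A = f ` A1" using A SS by (auto simp: cimg_def)
        moreover from this have "A0 = A1" using inj_onD[OF inj_on_cimg[OF inj], of A0 A1] sub SS by blast
        ultimately show ?thesis by blast
      qed
      obtain A0 B0 where AB: "A0 \<in> S0 \<inter> S0'" "A = f ` A0" "B0 \<in> S0 \<inter> S0'" "B = f ` B0"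
        using both[OF A] both[OF B] by blast
      obtain g where g: "simplicial_iso S0 S0' g" "\<forall>v\<in>A0 \<union> B0. g v = v" using iso SS AB by blast
      let ?i = "inv_into (\<Union>S0) f"
      have "simplicial_iso (cimg f S0) S0 ?i" using simplicial_iso_inv[OF simplicial_iso_cimg[OF injS[OF SS(1)]]] .
      then have "simplicial_iso \<Sigma> \<Sigma>' (f \<circ> (g \<circ> ?i))"
        unfolding SS using g(1) simplicial_iso_cimg[OF injS[OF SS(3)]] by (intro simplicial_iso_comp)
      moreover have "(f \<circ> (g \<circ> ?i)) v = v" if v: "v \<in> A \<union> B" for v
      proof -
        obtain v0 where v0: "v0 \<in> A0 \<union> B0" "v = f v0" using v AB by auto
        then have "v0 \<in> \<Union>S0" using AB by auto
        then have "?i v = v0" using v0 injS[OF SS(1)] by simp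
        then show ?thesis using g(2) v0 by simp
      qed
      ultimately show ?thesis by blast
    qed
  qed
qed

section \<open>Two lattice chains have a common frame\<close>

context lattices begin

lemma L_zero_based: "P \<in> GLF \<Longrightarrow> L P {k..} = L (P * monomial ((+) k)) {0..}"
  using L_times_monomial[of P "(+) k" "{0..}"] periodic_plus[of k] by (simp add: shift_atLeast)

text \<open>The columns of \<open>A\<close> lie in the lattice of \<open>B\<close>, so the
  transition matrix is integral, and so is its determinant.\<close>

lemma L_subset_factor:
  assumes A: "A \<in> GLF" and B: "B \<in> GLF" and sub: "L A {0..} \<subseteq> L B {0..}"
  shows "minv B * A \<in> mats vring dm" "w (det B) \<le> w (det A)"
proof -
  have mB: "minv B \<in> carrier_mat dm dm" "B * minv B = 1\<^sub>m dm"
    using minv[OF GLF_D(1)[OF B] GLF_D(3)[OF B]] by auto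
  have cA: "A \<in> carrier_mat dm dm" using A by (rule GLF_D)
  show S: "minv B * A \<in> mats vring dm"
  proof (rule matsI)
    show "minv B * A \<in> carrier_mat dm dm" using mB cA by simp
    fix i j assume ij: "i < dm" "j < dm"
    have u: "unit_vec dm j \<in> D {0..}"
      using ij by (auto simp: D_def fvec_def unit_vec_def F_closed w_one)
    have "A *\<^sub>v unit_vec dm j \<in> L B {0..}" using sub u by (auto simp: L_def)
    then have d: "minv B *\<^sub>v (A *\<^sub>v unit_vec dm j) \<in> D {0..}" using L_iff[OF B] by simp
    have "minv B *\<^sub>v (A *\<^sub>v unit_vec dm j) = (minv B * A) *\<^sub>v unit_vec dm j"
      using mB cA by (simp add: assoc_mult_mat_vec)
    also have "\<dots> = col (minv B * A) j" 
    proof (rule eq_vecI)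
      fix l assume "l < dim_vec (col (minv B * A) j)"
      then have l: "l < dm" using mB cA by simp
      have c: "minv B * A \<in> carrier_mat dm dm" using mB cA by simp
      have "((minv B * A) *\<^sub>v unit_vec dm j) $ l = (\<Sum>k = 0..<dm. if k = j then (minv B * A) $$ (l, j) else 0)"
        unfolding mult_vec_coord[OF c unit_vec_carrier l] by (intro sum.cong) (auto simp: unit_vec_def)
      also have "\<dots> = (minv B * A) $$ (l, j)" using ij by simp
      also have "\<dots> = col (minv B * A) j $ l" by (subst index_col) (use c l ij in auto)
      finally show "((minv B * A) *\<^sub>v unit_vec dm j) $ l = col (minv B * A) j $ l" .
    qed (use mB cA in simp)
    finally have "col (minv B * A) j \<in> D {0..}" using d by simp
    then have "vge ((minv B * A) $$ (i, j)) (cut 0 i)" using mB cA ij by (simp add: D_atLeast_iff)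
    moreover have "0 \<le> cut 0 i"
    proof (rule ccontr)
      assume "\<not> 0 \<le> cut 0 i"
      then have "cut 0 i \<le> -1" by simp
      then show False using cut_le_iff[of 0 i "-1"] ij by (simp add: N_dm)
    qed
    ultimately show "(minv B * A) $$ (i, j) \<in> vring" unfolding vring_def using vge_mono by blast
  qed
  have "det (minv B * A) \<in> vring" using det_in_subring[OF subring_vring S] .
  moreover have "det (minv B * A) \<noteq> 0" using GLF_mult[OF GLF_minv[OF B] A] GLF_D(3) by blast
  moreover have "w (det (minv B * A)) = w (det A) - w (det B)"
    using w_det_mult[OF GLF_minv[OF B] A] w_det_minv[OF B] by simp
  ultimately show "w (det B) \<le> w (det A)" by (simp add: vring_def vge_def)
qed

text \<open>The value of the determinant of a basis is an invariant of the lattice, by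
  \<open>L_subset_factor\<close> in both directions; moving up the chain by \<open>k\<close> steps
  adds \<open>k\<close> to it.\<close>

lemma L_level:
  assumes P: "P \<in> GLF" and Q: "Q \<in> GLF" and eq: "L P {k..} = L Q {j..}"
  shows "w (det P) + k = w (det Q) + j"
proof -
  have m: "monomial ((+) c) \<in> GLF" "w (det (monomial ((+) c))) = c" for c
    using monomial_GLF[OF periodic_plus] monomial_det(2)[OF periodic_plus, of c] N_gt_1 by (auto simp: defect_plus)
  have "L (P * monomial ((+) k)) {0..} = L (Q * monomial ((+) j)) {0..}"
    using eq by (simp add: L_zero_based[OF P] L_zero_based[OF Q])
  then have "w (det (P * monomial ((+) k))) = w (det (Q * monomial ((+) j)))"
    using L_subset_factor(2)[OF GLF_mult[OF P m(1)] GLF_mult[OF Q m(1)]]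
      L_subset_factor(2)[OF GLF_mult[OF Q m(1)] GLF_mult[OF P m(1)]] by (metis order_refl antisym)
  then show ?thesis using w_det_mult[OF P m(1)] w_det_mult[OF Q m(1)] m(2) by simp
qed

lemma Dgr_smult:
  assumes "a \<in> D {z..} - D {z + 1..}" "c \<in> F" "c \<noteq> 0"
  shows "c \<cdot>\<^sub>v a \<in> D {z + N * w c..} - D {z + N * w c + 1..}"
proof -
  have "c \<cdot>\<^sub>v a \<notin> D {z + N * w c + 1..}"
  proof
    assume "c \<cdot>\<^sub>v a \<in> D {z + N * w c + 1..}"
    then have "inverse c \<cdot>\<^sub>v (c \<cdot>\<^sub>v a) \<in> D {z + N * w c + 1 + N * w (inverse c)..}"
      using assms by (intro D_smult) (auto simp: F_closed)
    moreover have "inverse c \<cdot>\<^sub>v (c \<cdot>\<^sub>v a) = a" using assms by (simp add: smult_smult_assoc)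
    ultimately show False using assms by (simp add: w_inverse algebra_simps)
  qed
  then show ?thesis using D_smult[of a z c] assms by auto
qed

lemma gr_smult:
  assumes "P \<in> GLF" "x \<in> gr P z" "c \<in> F" "c \<noteq> 0"
  shows "c \<cdot>\<^sub>v x \<in> gr P (z + N * w c)"
proof -
  have x: "x \<in> fvec" "minv P *\<^sub>v x \<in> D {z..} - D {z + 1..}" using assms gr_iff by auto
  have "minv P *\<^sub>v (c \<cdot>\<^sub>v x) = c \<cdot>\<^sub>v (minv P *\<^sub>v x)"
    using GLF_D(1)[OF GLF_minv[OF assms(1)]] fvec_carrier[OF x(1)] by (simp add: mult_mat_vec)
  then show ?thesis using Dgr_smult[OF x(2) assms(3,4)] fvec_smult[OF x(1) assms(3)] assms(1) by (simp add: gr_iff)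
qed

lemma L_add: "P \<in> GLF \<Longrightarrow> x \<in> L P {k..} \<Longrightarrow> y \<in> L P {k..} \<Longrightarrow> x + y \<in> L P {k..}"
  using mult_add_distrib_mat_vec[OF GLF_D(1)[OF GLF_minv[of P]], of x y]
  by (auto simp: L_iff D_add fvec_add fvec_carrier)

lemma L_uminus:
  assumes P: "P \<in> GLF" and x: "x \<in> L P {k..}"
  shows "- x \<in> L P {k..}"
proof -
  have f: "x \<in> fvec" "minv P *\<^sub>v x \<in> D {k..}" using x L_iff[OF P] by auto
  have "minv P *\<^sub>v (- x) = - (minv P *\<^sub>v x)"
    using GLF_D(1)[OF GLF_minv[OF P]] fvec_carrier[OF f(1)] by (auto simp: scalar_prod_def sum_negf)
  moreover have "- x \<in> fvec" using f(1) by (auto simp: fvec_def F_closed)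
  ultimately show ?thesis using D_uminus[OF f(2)] L_iff[OF P] by simp
qed

text \<open>Both vectors realise the level in the same coordinate, by \<open>index_unique\<close>.
  With \<open>c\<close> the quotient of these coordinates the leading terms cancel, and no other
  coordinate can have level \<open>z\<close>.\<close>

lemma gr_exact:
  assumes P: "P \<in> GLF" and x: "x \<in> gr P z" and y: "y \<in> gr P z"
  obtains c where "c \<in> F" "c \<noteq> 0" "w c = 0" "x - c \<cdot>\<^sub>v y \<in> L P {z + 1..}"
proof -
  let ?a = "minv P *\<^sub>v x" and ?b = "minv P *\<^sub>v y"
  have a: "x \<in> fvec" "?a \<in> D {z..} - D {z + 1..}" and b: "y \<in> fvec" "?b \<in> D {z..} - D {z + 1..}"
    using x y gr_iff[OF P] by auto
  obtain i where i: "i < dm" "?a $ i \<noteq> 0" "int i + N * w (?a $ i) = z" using a(2) by (rule Dgr_coord)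
  obtain i' where i': "i' < dm" "?b $ i' \<noteq> 0" "int i' + N * w (?b $ i') = z" using b(2) by (rule Dgr_coord)
  have ii: "i' = i" "w (?b $ i') = w (?a $ i)" using index_unique[OF i'(1) i(1)] i i' by auto
  have F: "?a $ i \<in> F" "?b $ i \<in> F" using a b i by (auto simp: D_def fvec_def)
  define c where "c = ?a $ i / ?b $ i"
  have c: "c \<in> F" "c \<noteq> 0" "w c = 0" using F i i' ii by (auto simp: c_def F_closed w_divide)
  have carr: "minv P \<in> carrier_mat dm dm" "x \<in> carrier_vec dm" "y \<in> carrier_vec dm"
    using GLF_D(1)[OF GLF_minv[OF P]] fvec_carrier a b by auto
  have m: "minv P *\<^sub>v (x - c \<cdot>\<^sub>v y) = ?a - c \<cdot>\<^sub>v ?b"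
    using mult_minus_distrib_mat_vec[OF carr(1,2), of "c \<cdot>\<^sub>v y"] mult_mat_vec[OF carr(1,3), of c] carr by simp
  have cb: "c \<cdot>\<^sub>v ?b \<in> D {z..}" using D_smult[of ?b z c] b c by simp
  have dim: "?a \<in> carrier_vec dm" "?b \<in> carrier_vec dm" using carr by auto
  have diff: "?a - c \<cdot>\<^sub>v ?b \<in> D {z..}"
  proof -
    have "vge ((?a - c \<cdot>\<^sub>v ?b) $ j) (cut z j)" if "j < dm" for j
    proof -
      have "?a \<in> D {z..}" using a(2) by blast
      then have "vge (?a $ j) (cut z j)" using that unfolding D_atLeast_iff by blast
      moreover have "vge ((c \<cdot>\<^sub>v ?b) $ j) (cut z j)" using cb that unfolding D_atLeast_iff by blast
      ultimately have "vge (?a $ j + - (c \<cdot>\<^sub>v ?b) $ j) (cut z j)" by (intro vge_add vge_uminus)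
      then show ?thesis using that dim carr(1) by simp
    qed
    then show ?thesis using dim unfolding D_atLeast_iff by auto
  qed
  have zero: "(?a - c \<cdot>\<^sub>v ?b) $ i = 0" using dim carr(1) i i' ii by (simp add: c_def)
  have "?a - c \<cdot>\<^sub>v ?b \<in> D {z + 1..}"
  proof -
    have "(?a - c \<cdot>\<^sub>v ?b) $ j = 0 \<or> z + 1 \<le> int j + N * w ((?a - c \<cdot>\<^sub>v ?b) $ j)" if j: "j < dm" for j
    proof (cases "j = i")
      case False
      then have "int j + N * w ((?a - c \<cdot>\<^sub>v ?b) $ j) \<noteq> z" using index_unique(1)[OF j i(1)] i(3) by metis
      moreover have "(?a - c \<cdot>\<^sub>v ?b) $ j = 0 \<or> z \<le> int j + N * w ((?a - c \<cdot>\<^sub>v ?b) $ j)"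
        using diff j unfolding D_def by auto
      ultimately show ?thesis by linarith
    qed (use zero in simp)
    then show ?thesis using diff unfolding D_def by auto
  qed
  moreover have "x - c \<cdot>\<^sub>v y \<in> fvec" using a b c by (intro fvec_minus fvec_smult)
  ultimately have "x - c \<cdot>\<^sub>v y \<in> L P {z + 1..}" using L_iff[OF P] m by simp
  then show ?thesis using c that by blast
qed

text \<open>The entries of the transition matrix have bounded poles, so passing from one chain to
  the other loses a bounded number of levels. This makes the maximum in \<open>common_frame\<close>
  exist.\<close>

lemma gr_bound:
  assumes P: "P \<in> GLF" and Q: "Q \<in> GLF"
  obtains c where "\<And>k j. gr P k \<inter> gr Q j \<noteq> {} \<Longrightarrow> j \<le> k + c"
proof -
  define S where "S = minv P * Q"
  have S: "S \<in> mats F dm" unfolding S_def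
    using GLF_D(2)[OF GLF_minv[OF P]] GLF_D(2)[OF Q] by (rule mats_mult[OF subring])
  \<comment> \<open>A crude common bound for all poles; a zero entry adds only the harmless absolute
    value of \<open>w 0\<close>.\<close>
  define m where "m = (\<Sum>p\<in>{0..<dm} \<times> {0..<dm}. \<bar>w (S $$ p)\<bar>)"
  have vS: "vge (S $$ (i, j)) (- m)" if "i < dm" "j < dm" for i j
  proof -
    have "\<bar>w (S $$ (i, j))\<bar> \<le> m" unfolding m_def
      using that by (intro member_le_sum[of "(i, j)"]) auto
    then have "- m \<le> w (S $$ (i, j))" by linarith
    then show ?thesis using mats_entry[OF S that] by (simp add: vge_def)
  qed
  \<comment> \<open>The summand \<open>N * m\<close> pays for the poles, the further
    \<open>N\<close> for the difference of the indices \<open>i\<close> and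
    \<open>j\<close>.\<close>
  have SD: "S *\<^sub>v a \<in> D {k..}" if a: "a \<in> D {k + N * m + N..}" for a k
  proof -
    have ac: "a \<in> carrier_vec dm" using a D_fvec fvec_carrier by blast
    have "vge ((S *\<^sub>v a) $ i) (cut k i)" if i: "i < dm" for i
      unfolding mult_vec_coord[OF mats_carrier[OF S] ac i]
    proof (rule vge_sum)
      fix j assume "j \<in> {0..<dm}"
      then have j: "j < dm" by simp
      have "vge (S $$ (i, j) * a $ j) (- m + cut (k + N * m + N) j)"
        using vS[OF i j] a j by (intro vge_mult) (auto simp: D_atLeast_iff)
      moreover have "cut k i \<le> - m + cut (k + N * m + N) j"
        unfolding cut_le_iff using cut_ge[of "k + N * m + N" j] j by (simp add: N_dm algebra_simps)
      ultimately show "vge (S $$ (i, j) * a $ j) (cut k i)" by (rule vge_mono)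
    qed
    then show ?thesis using mats_carrier[OF S] ac by (simp add: D_atLeast_iff)
  qed
  have sub: "L Q {k + N * m + N..} \<subseteq> L P {k..}" for k
  proof
    fix x assume "x \<in> L Q {k + N * m + N..}"
    then have x: "x \<in> fvec" "minv Q *\<^sub>v x \<in> D {k + N * m + N..}" using L_iff[OF Q] by auto
    have "S *\<^sub>v (minv Q *\<^sub>v x) = minv P *\<^sub>v (Q *\<^sub>v (minv Q *\<^sub>v x))"
      unfolding S_def using GLF_D(1)[OF GLF_minv[OF P]] GLF_D(1)[OF Q] fvec_carrier[OF D_fvec[OF x(2)]]
      by (simp add: assoc_mult_mat_vec)
    also have "\<dots> = minv P *\<^sub>v x" using minv_mult_vec(2)[OF Q x(1)] by simp
    finally show "x \<in> L P {k..}" using SD[OF x(2)] L_iff[OF P] x(1) by simp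
  qed
  show ?thesis
  proof (rule that[of "N * m + N"])
    fix k j assume "gr P k \<inter> gr Q j \<noteq> {}"
    then obtain x where x: "x \<in> gr P k" "x \<in> gr Q j" by auto
    show "j \<le> k + (N * m + N)"
    proof (rule ccontr)
      assume "\<not> j \<le> k + (N * m + N)"
      then have "{j..} \<subseteq> {k + 1 + N * m + N..}" by auto
      then have "x \<in> L Q {k + 1 + N * m + N..}" using x(2) L_mono unfolding gr_def by blast
      then have "x \<in> L P {k + 1..}" using sub by blast
      then show False using x(1) by (simp add: gr_def)
    qed
  qed
qed

text \<open>Surjectivity comes from counting: an injective shift-equivariant map induces an
  injection of the finitely many residues.\<close>

lemma periodic_inj:
  assumes p: "\<And>z. f (z + N) = f z + N" and inj: "inj f"
  shows "periodic f"
proof -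
  have "f (z + N * int m) = f z + N * int m" for z m
  proof (induction m)
    case (Suc m)
    have "f (z + N * int (Suc m)) = f ((z + N * int m) + N)" by (simp add: algebra_simps)
    then show ?case using Suc p[of "z + N * int m"] by (simp add: algebra_simps)
  qed simp
  note nat = this
  have mult: "f (z + N * q) = f z + N * q" for z q
    using nat[of z "nat q"] nat[of "z + N * q" "nat (- q)"] by (cases "q \<ge> 0") (auto simp: algebra_simps)
  have inj': "inj_on (\<lambda>z. f z mod N) {0..<N}"
  proof (rule inj_onI)
    fix x y assume xy: "x \<in> {0..<N}" "y \<in> {0..<N}" "f x mod N = f y mod N"
    then obtain q where "f x = f y + N * q" using mod_eq_offset by blast
    then have "x = y + N * q" using mult inj by (metis injD)
    then have "x mod N = y mod N" by simp
    then show "x = y" using xy by simp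
  qed
  have "(\<lambda>z. f z mod N) ` {0..<N} \<subseteq> {0..<N}" using pos_mod_sign[OF N_pos] pos_mod_bound[OF N_pos] by auto
  then have im: "(\<lambda>z. f z mod N) ` {0..<N} = {0..<N}" using inj' by (simp add: endo_inj_surj)
  have "\<exists>z. y = f z" for y
  proof -
    have "y mod N \<in> (\<lambda>z. f z mod N) ` {0..<N}" unfolding im using pos_mod_sign[OF N_pos] pos_mod_bound[OF N_pos] by auto
    then obtain z where "y mod N = f z mod N" by auto
    then obtain q where "y = f z + N * q" using mod_eq_offset by blast
    then show ?thesis using mult by metis
  qed
  then have "surj f" by (simp add: surj_def)
  then show ?thesis using inj p by (simp add: periodic_def bij_def)
qed

text \<open>Let \<open>\<tau> k\<close> be the highest level in the chain of \<open>P'\<close>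
  reached by vectors of exact level \<open>k\<close> for \<open>P\<close>. This
  \<open>\<tau>\<close> is a periodic permutation, the relative position of the two chains. Vectors
  realising it for \<open>k = 0, ..., n\<close> form a frame of the first chain; reordered and
  rescaled by the inverse of \<open>\<tau>\<close> they form one of the second. The argument plays
  the part of the Bruhat decomposition.\<close>

theorem common_frame:
  assumes P: "frame P" and P': "frame P'"
  obtains Q f where "frame Q" "aff f" "\<And>k. L Q {k..} = L P {k..}" "\<And>k. L Q (f ` {k..}) = L P' {k..}"
proof -
  have G: "P \<in> GLF" "P' \<in> GLF" and w0: "w (det P) = 0" "w (det P') = 0" using P P' by (auto simp: frame_def)
  define S where "S k = {j. gr P k \<inter> gr P' j \<noteq> {}}" for k
  obtain c where c0: "\<And>k j. gr P k \<inter> gr P' j \<noteq> {} \<Longrightarrow> j \<le> k + c"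
    by (rule gr_bound[OF G]) (rule that)
  then have c: "j \<le> k + c" if "j \<in> S k" for j k using that by (simp add: S_def)
  have zero: "x \<noteq> 0\<^sub>v dm" if "x \<in> gr R z" "R \<in> GLF" for x R z
  proof
    assume x: "x = 0\<^sub>v dm"
    have "minv R *\<^sub>v x \<in> D {z + 1..}"
      using GLF_D(1)[OF GLF_minv[OF that(2)]] unfolding x by (auto simp: D_atLeast_iff)
    then show False using that gr_iff by auto
  qed
  have ne: "S k \<noteq> {}" for k
  proof -
    obtain x where x: "x \<in> gr P k" using gr_nonempty[OF G(1)] by blast
    then obtain j where "x \<in> gr P' j" using gr_exists[OF G(2), of x] zero G gr_iff[OF G(1)] by blast
    then show ?thesis using x by (auto simp: S_def)
  qed
  have "\<exists>j. j \<in> S k \<and> (\<forall>i\<in>S k. i \<le> j)" for k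
  proof -
    obtain j0 where "j0 \<in> S k" using ne by blast
    then obtain j where j: "j \<in> S k" "\<forall>i. i \<in> S k \<longrightarrow> nat (k + c - j) \<le> nat (k + c - i)"
      using ex_has_least_nat[of "\<lambda>j. j \<in> S k" j0 "\<lambda>j. nat (k + c - j)"] by blast
    then have "i \<le> j" if "i \<in> S k" for i using c[OF that] c[OF j(1)] that by (auto simp: nat_le_eq_zle)
    then show ?thesis using j by blast
  qed
  then obtain \<tau> where tau: "\<And>k. \<tau> k \<in> S k" "\<And>k i. i \<in> S k \<Longrightarrow> i \<le> \<tau> k" by metis
  have shift: "j + N * q \<in> S (k + N * q)" if j: "j \<in> S k" for j k q
  proof -
    obtain x where "x \<in> gr P k" "x \<in> gr P' j" using j by (auto simp: S_def)
    then have "unif powi q \<cdot>\<^sub>v x \<in> gr P (k + N * q)" "unif powi q \<cdot>\<^sub>v x \<in> gr P' (j + N * q)"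
      using gr_smult[OF G(1)] gr_smult[OF G(2)] unif_powi[of q] by metis+
    then show ?thesis by (auto simp: S_def)
  qed
  have per: "\<tau> (k + N) = \<tau> k + N" for k
  proof (rule antisym)
    show "\<tau> k + N \<le> \<tau> (k + N)" using shift[OF tau(1)[of k], of 1] tau(2) by simp
    show "\<tau> (k + N) \<le> \<tau> k + N"
      using tau(2)[OF shift[OF tau(1)[of "k + N"], of "- 1", simplified]] by simp
  qed
  \<comment> \<open>If \<open>k < k'\<close> had the same image, subtracting a unit multiple of
    \<open>y\<close> from \<open>x\<close> would raise the level in the second chain without
    changing the level \<open>k\<close> in the first, against maximality.\<close>
  have lt_ne: "\<tau> k \<noteq> \<tau> k'" if "k < k'" for k k'
  proof
    assume eq: "\<tau> k = \<tau> k'"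
    obtain x where x: "x \<in> gr P k" "x \<in> gr P' (\<tau> k)" using tau(1)[of k] by (auto simp: S_def)
    obtain y where y: "y \<in> gr P k'" "y \<in> gr P' (\<tau> k)" using tau(1)[of k'] eq by (auto simp: S_def)
    obtain e where e: "e \<in> F" "e \<noteq> 0" "w e = 0" "x - e \<cdot>\<^sub>v y \<in> L P' {\<tau> k + 1..}"
      using gr_exact[OF G(2) x(2) y(2)] by blast
    have fv: "x \<in> fvec" "y \<in> fvec" using x y gr_iff[OF G(1)] by auto
    have "e \<cdot>\<^sub>v y \<in> gr P k'" using gr_smult[OF G(1) y(1) e(1,2)] e(3) by simp
    then have "e \<cdot>\<^sub>v y \<in> L P {k + 1..}" using L_mono[of "{k'..}" "{k + 1..}" P] that by (auto simp: gr_def)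
    then have ey: "- (e \<cdot>\<^sub>v y) \<in> L P {k + 1..}" by (rule L_uminus[OF G(1)])
    have dec: "x - e \<cdot>\<^sub>v y = x + - (e \<cdot>\<^sub>v y)" using fvec_carrier[OF fv(1)] fvec_carrier[OF fv(2)] by (intro eq_vecI) auto
    have "x - e \<cdot>\<^sub>v y \<in> L P {k..}" unfolding dec
      using x(1) ey L_mono[of "{k + 1..}" "{k..}" P] by (intro L_add[OF G(1)]) (auto simp: gr_def)
    moreover have "x - e \<cdot>\<^sub>v y \<notin> L P {k + 1..}"
    proof
      assume "x - e \<cdot>\<^sub>v y \<in> L P {k + 1..}"
      then have "(x - e \<cdot>\<^sub>v y) + e \<cdot>\<^sub>v y \<in> L P {k + 1..}" using \<open>e \<cdot>\<^sub>v y \<in> L P {k + 1..}\<close> by (rule L_add[OF G(1)])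
      moreover have "(x - e \<cdot>\<^sub>v y) + e \<cdot>\<^sub>v y = x" using fvec_carrier[OF fv(1)] fvec_carrier[OF fv(2)] by auto
      ultimately show False using x(1) by (simp add: gr_def)
    qed
    ultimately have k: "x - e \<cdot>\<^sub>v y \<in> gr P k" by (simp add: gr_def)
    obtain j where j: "x - e \<cdot>\<^sub>v y \<in> gr P' j"
      using gr_exists[OF G(2)] zero[OF k G(1)] k gr_iff[OF G(1)] by blast
    have "\<tau> k + 1 \<le> j"
    proof (rule ccontr)
      assume "\<not> \<tau> k + 1 \<le> j"
      then have "L P' {\<tau> k + 1..} \<subseteq> L P' {j + 1..}" by (intro L_mono) auto
      then show False using j e(4) by (auto simp: gr_def)
    qed
    moreover have "j \<le> \<tau> k" using j k by (intro tau(2)) (auto simp: S_def)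
    ultimately show False by simp
  qed
  have "inj \<tau>" using lt_ne by (intro injI) (metis linorder_neqE)
  then have ptau: "periodic \<tau>" using periodic_inj per by blast
  have "\<exists>x. x \<in> gr P (int i) \<and> x \<in> gr P' (\<tau> (int i))" for i using tau(1)[of "int i"] by (auto simp: S_def)
  then obtain d where d: "\<And>i. d i \<in> gr P (int i)" "\<And>i. d i \<in> gr P' (\<tau> (int i))" by metis
  define Q where "Q = mat dm dm (\<lambda>(i, j). d j $ i)"
  have Qc: "Q \<in> carrier_mat dm dm" by (simp add: Q_def)
  have dv: "d j \<in> carrier_vec dm" for j using d(1)[of j] gr_iff[OF G(1)] fvec_carrier by blast
  have colQ: "col Q j = d j" if "j < dm" for j
    using that dv[of j] by (intro eq_vecI) (auto simp: Q_def)
  have Q1: "Q \<in> GLF" "w (det Q) = w (det P)" "\<And>k. L Q {k..} = L P {k..}"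
    using frame_from_columns[OF G(1) Qc] colQ d(1) by auto
  \<comment> \<open>Column \<open>j\<close> of a frame for the second chain must have level
    \<open>j\<close> there, so it has to come from the vector with index \<open>f j\<close> in the
    first.\<close>
  define f where "f = inv_into UNIV \<tau>"
  have pf: "periodic f" unfolding f_def using ptau by (rule periodic_inv)
  have tf: "\<tau> (f z) = z" for z using periodic_inv_comp(1)[OF ptau] by (simp add: f_def fun_eq_iff)
  have col2: "col (Q * monomial f) j \<in> gr P' (int j)" if j: "j < dm" for j
  proof -
    let ?r = "nat (f (int j) mod N)"
    note r = mod_index[of "f (int j)"]
    have "col (Q * monomial f) j = unif powi (f (int j) div N) \<cdot>\<^sub>v d ?r"
      using monomial_col[OF pf Q1(1) j] colQ[OF r(1)] by simp
    moreover have "unif powi (f (int j) div N) \<cdot>\<^sub>v d ?r \<in> gr P' (\<tau> (int ?r) + N * (f (int j) div N))"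
      using gr_smult[OF G(2) d(2)[of ?r]] unif_powi by metis
    moreover have "\<tau> (int ?r) + N * (f (int j) div N) = int j"
    proof -
      have "\<tau> (int ?r) + N * (f (int j) div N) = \<tau> (int ?r + N * (f (int j) div N))"
        using periodic_mult[OF ptau, of "int ?r" "f (int j) div N"] by (simp only:)
      also have "int ?r + N * (f (int j) div N) = f (int j)" using r by simp
      finally show ?thesis using tf by simp
    qed
    ultimately show ?thesis by simp
  qed
  have Q2: "w (det (Q * monomial f)) = w (det P')" "\<And>k. L (Q * monomial f) {k..} = L P' {k..}"
    using frame_from_columns[OF G(2) _ col2] Qc by auto
  \<comment> \<open>Both frames have determinant of value 0; this makes \<open>f\<close> affine and
    not merely periodic.\<close>
  have "w (det (monomial f)) = 0"
    using w_det_mult[OF Q1(1) monomial_GLF[OF pf]] Q2(1) Q1(2) w0 by simp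
  then have "aff f" using monomial_det(2)[OF pf] pf by (simp add: aff_iff)
  moreover have "L Q (f ` {k..}) = L P' {k..}" for k using Q2(2) L_times_monomial[OF Q1(1) pf] by simp
  moreover have "frame Q" using Q1 w0 by (simp add: frame_def)
  ultimately show ?thesis using that Q1(3) by blast
qed

end

context lattices begin

section \<open>The building of lattice classes\<close>

definition psi :: "'k mat \<Rightarrow> int set set \<Rightarrow> 'k vec set set" where
  "psi P c = L P ` c"

definition apt :: "'k mat \<Rightarrow> 'k vec set set set set" where
  "apt P = cimg (psi P) std"

definition bld :: "'k vec set set set set" where
  "bld = \<Union> (apt ` {P. frame P})"

lemma frame_GLF: "frame P \<Longrightarrow> P \<in> GLF"
  by (simp add: frame_def)

lemma psi_eq_imp:
  assumes "P \<in> GLF" "Q \<in> GLF" "\<And>k. L P {k..} = L Q {k..}" "psi P c = psi Q c'"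
  shows "c = c'"
proof -
  have "c \<subseteq> c'" if h: "P \<in> GLF" "Q \<in> GLF" "\<And>k. L P {k..} = L Q {k..}" "psi P c = psi Q c'" for P Q c c'
  proof
    fix X assume "X \<in> c"
    then have "L P X \<in> psi Q c'" using h(4) by (auto simp: psi_def)
    then obtain Y where "Y \<in> c'" "L P X = L Q Y" by (auto simp: psi_def)
    then show "X \<in> c'" using L_eq_imp[OF h(1-3)] by blast
  qed
  from this[OF assms] this[OF assms(2,1) assms(3)[symmetric] assms(4)[symmetric]] show ?thesis by blast
qed

lemma inj_psi: "P \<in> GLF \<Longrightarrow> inj (psi P)"
  using psi_eq_imp[of P P] by (intro injI) blast

lemma image_vcl: "periodic f \<Longrightarrow> (\<lambda>X. f ` X) ` vcl X = vcl (f ` X)"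
  unfolding vcl_def by (simp add: image_image periodic_shift_image[unfolded image_image])

lemma image_stdch: "periodic f \<Longrightarrow> (\<lambda>c. (\<lambda>X. f ` X) ` c) ` stdch g = stdch (f \<circ> g)"
  unfolding stdch_def by (simp add: image_image image_vcl)

lemma psi_times_monomial:
  assumes "P \<in> GLF" "periodic f"
  shows "psi (P * monomial f) c = psi P ((\<lambda>X. f ` X) ` c)"
  using L_times_monomial[OF assms] by (simp add: psi_def image_image)

lemma apt_times_monomial_subset:
  assumes "P \<in> GLF" "aff f"
  shows "apt (P * monomial f) \<subseteq> apt P"
proof
  fix A assume "A \<in> apt (P * monomial f)"
  then obtain A0 where A0: "A0 \<in> std" "A = psi (P * monomial f) ` A0" by (auto simp: apt_def cimg_def)
  obtain g where g: "aff g" "A0 \<noteq> {}" "A0 \<subseteq> stdch g" using A0(1) by (auto simp: std_def)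
  let ?h = "\<lambda>c. (\<lambda>X. f ` X) ` c"
  have "?h ` A0 \<subseteq> ?h ` stdch g" using g(3) by (rule image_mono)
  then have "?h ` A0 \<subseteq> stdch (f \<circ> g)" using image_stdch[OF aff_periodic[OF assms(2)]] by simp
  then have "?h ` A0 \<in> std" using g(2) aff_comp[OF assms(2) g(1)] by (auto simp: std_def)
  moreover have "A = psi P ` ?h ` A0"
    unfolding A0(2) image_image using psi_times_monomial[OF assms(1) aff_periodic[OF assms(2)]] by simp
  ultimately show "A \<in> apt P" unfolding apt_def cimg_def by blast
qed

lemma monomial_inv_cancel:
  assumes "P \<in> GLF" "periodic f"
  shows "P * monomial f * monomial (inv_into UNIV f) = P"
  using assms GLF_D(1)[OF assms(1)]
  by (simp add: assoc_mult_mat[OF _ monomial_carrier monomial_carrier] monomial_mult periodic_inv_comp monomial_id)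

text \<open>An affine permutation maps the standard apartment onto itself, so the apartment of a
  frame is unchanged by monomial changes. This gives the freedom to place a given simplex in the
  base chamber.\<close>

lemma apt_times_monomial:
  assumes "P \<in> GLF" "aff f"
  shows "apt (P * monomial f) = apt P"
proof
  show "apt (P * monomial f) \<subseteq> apt P" using assms by (rule apt_times_monomial_subset)
  have "P * monomial f \<in> GLF" using assms monomial_GLF aff_periodic GLF_mult by blast
  from apt_times_monomial_subset[OF this aff_inv[OF assms(2)]]
  show "apt P \<subseteq> apt (P * monomial f)"
    using monomial_inv_cancel[OF assms(1) aff_periodic[OF assms(2)]] by simp
qed

lemma frame_times_monomial:
  assumes "frame P" "aff f"
  shows "frame (P * monomial f)"
proof -
  have "N * w (det (monomial f)) = 0" using monomial_det(2)[of f] assms(2) by (simp add: aff_iff)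
  then have "w (det (monomial f)) = 0" using N_gt_1 by simp
  then show ?thesis
    using w_det_mult[OF frame_GLF[OF assms(1)] monomial_GLF] GLF_mult[OF frame_GLF[OF assms(1)] monomial_GLF] assms
    by (simp add: frame_def aff_periodic)
qed

definition chm :: "'k mat \<Rightarrow> 'k vec set set set" where
  "chm P = psi P ` stdch id"

lemma apt_in_chamber:
  assumes "frame P" "A \<in> apt P"
  obtains Q where "frame Q" "apt Q = apt P" "A \<noteq> {}" "A \<subseteq> chm Q"
proof -
  obtain A0 where A0: "A0 \<in> std" "A = psi P ` A0" using assms by (auto simp: apt_def cimg_def)
  obtain g where g: "aff g" "A0 \<noteq> {}" "A0 \<subseteq> stdch g" using A0(1) by (auto simp: std_def)
  note G = frame_GLF[OF assms(1)]
  have e: "(\<lambda>c. (\<lambda>X. g ` X) ` c) ` stdch id = stdch g"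
    using image_stdch[OF aff_periodic[OF g(1)], of id] by simp
  have "chm (P * monomial g) = (\<lambda>c. psi P ((\<lambda>X. g ` X) ` c)) ` stdch id"
    unfolding chm_def using psi_times_monomial[OF G aff_periodic[OF g(1)]] by (intro image_cong refl)
  also have "\<dots> = psi P ` (\<lambda>c. (\<lambda>X. g ` X) ` c) ` stdch id" by (rule image_image[symmetric])
  finally have "chm (P * monomial g) = psi P ` stdch g" by (simp only: e)
  then have "A \<subseteq> chm (P * monomial g)" using g(3) A0(2) by auto
  then show ?thesis
    using that[OF frame_times_monomial[OF assms(1) g(1)] apt_times_monomial[OF G g(1)]] g(2) A0(2) by auto
qed

lemma subset_chm_apt: "A \<subseteq> chm P \<Longrightarrow> A \<noteq> {} \<Longrightarrow> A \<in> apt P"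
proof -
  assume A: "A \<subseteq> chm P" "A \<noteq> {}"
  then obtain A0 where "A0 \<subseteq> stdch id" "A = psi P ` A0" unfolding chm_def by (meson subset_imageE)
  moreover from this have "A0 \<in> std" using A(2) by (auto simp: std_def intro!: exI[of _ id])
  ultimately show ?thesis unfolding apt_def cimg_def by blast
qed

lemma chm_cong:
  assumes "\<And>k. L P {k..} = L Q {k..}"
  shows "chm P = chm Q"
proof -
  have "psi P c = psi Q c" if c: "c \<in> stdch id" for c
  proof -
    obtain k where k: "c = vcl {k..}" using c by (auto simp: stdch_def)
    have "L P X = L Q X" if "X \<in> c" for X
      using that assms unfolding k vcl_def by (auto simp: shift_atLeast simp del: image_add_atLeast)
    then show ?thesis unfolding psi_def by (intro image_cong refl)
  qed
  then show ?thesis unfolding chm_def by (intro image_cong refl)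
qed

text \<open>The map reads the index set of a lattice in one frame and realises it in the other. A
  common vertex has the same index sets in both, because they depend on the base chain only; so all
  common vertices are fixed at once.\<close>

lemma apt_iso:
  assumes P: "P \<in> GLF" and Q: "Q \<in> GLF" and eq: "\<And>k. L P {k..} = L Q {k..}"
  obtains h where "simplicial_iso (apt P) (apt Q) h" "\<And>v. v \<in> \<Union>(apt P) \<Longrightarrow> v \<in> \<Union>(apt Q) \<Longrightarrow> h v = v"
proof -
  have i: "inj_on (psi P) (\<Union>std)" "inj_on (psi Q) (\<Union>std)"
    using inj_psi[OF P] inj_psi[OF Q] by (auto intro: inj_on_subset)
  let ?h = "psi Q \<circ> inv_into (\<Union>std) (psi P)"
  have "simplicial_iso (apt P) (apt Q) ?h"
    unfolding apt_def using simplicial_iso_comp[OF simplicial_iso_inv[OF simplicial_iso_cimg[OF i(1)]] simplicial_iso_cimg[OF i(2)]] .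
  moreover have "?h v = v" if v: "v \<in> \<Union>(apt P)" "v \<in> \<Union>(apt Q)" for v
  proof -
    obtain c c' where c: "c \<in> \<Union>std" "v = psi P c" "c' \<in> \<Union>std" "v = psi Q c'"
      using v unfolding apt_def Union_cimg by auto
    then have "c = c'" using psi_eq_imp[OF P Q eq] by metis
    then show ?thesis using c i(1) by simp
  qed
  ultimately show ?thesis by (rule that)
qed

lemma apt_subset_chm: "frame P \<Longrightarrow> A \<in> apt P \<Longrightarrow> \<exists>Q. frame Q \<and> apt Q = apt P \<and> A \<noteq> {} \<and> A \<subseteq> chm Q"
  by (erule apt_in_chamber) blast+

lemma bld_subset_chm: "A \<in> bld \<Longrightarrow> \<exists>P. frame P \<and> A \<subseteq> chm P \<and> A \<noteq> {}"
  unfolding bld_def using apt_subset_chm by blast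

text \<open>Every simplex lies in the base chamber of some frame. A common frame of two base chains
  contains both chambers in its apartment, which yields the first axiom directly and the second by
  going through this apartment.\<close>

theorem building_bld: "building n bld"
  unfolding building_def
proof (intro conjI exI[of _ "apt ` {P. frame P}"] ballI)
  have sa: "simplicial_cplx (apt P)" for P unfolding apt_def using simplicial_std by (rule simplicial_cimg)
  show sb: "simplicial_cplx bld"
    unfolding simplicial_cplx_def bld_def using sa[unfolded simplicial_cplx_def] by blast
  have one: "frame (1\<^sub>m dm)" by (simp add: frame_def GLF_def mats_one[OF subring] w_one)
  have "apt (1\<^sub>m dm) \<noteq> {}" using std_nonempty by (simp add: apt_def cimg_def)
  then show "bld \<noteq> {}" using one by (auto simp: bld_def)
  show "bld = \<Union> (apt ` {P. frame P})" by (simp add: bld_def)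
  show "subcplx \<Sigma> bld" if "\<Sigma> \<in> apt ` {P. frame P}" for \<Sigma>
    using that sa by (auto simp: subcplx_def bld_def)
  show "iso_coxeter_complex n \<Sigma>" if S: "\<Sigma> \<in> apt ` {P. frame P}" for \<Sigma>
  proof -
    obtain P where P: "frame P" "\<Sigma> = cimg (psi P) std" using S by (auto simp: apt_def)
    have "inj_on (psi P) (\<Union>std)" using inj_psi[OF frame_GLF[OF P(1)]] by (rule inj_on_subset) simp
    then show ?thesis unfolding P(2) by (rule iso_coxeter_cimg[OF iso_coxeter_std])
  qed
  show "\<exists>\<Sigma>\<in>apt ` {P. frame P}. A \<in> \<Sigma> \<and> B \<in> \<Sigma>" if A: "A \<in> bld" and B: "B \<in> bld" for A B
  proof -
    obtain P where P: "frame P" "A \<noteq> {}" "A \<subseteq> chm P" using bld_subset_chm[OF A] by blast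
    obtain Q where Q: "frame Q" "B \<noteq> {}" "B \<subseteq> chm Q" using bld_subset_chm[OF B] by blast
    obtain R f where R: "frame R" "aff f" "\<And>k. L R {k..} = L P {k..}" "\<And>k. L R (f ` {k..}) = L Q {k..}"
      using common_frame[OF P(1) Q(1)] by metis
    have "chm R = chm P" using R(3) by (rule chm_cong)
    then have "A \<in> apt R" using subset_chm_apt P by simp
    moreover have "chm (R * monomial f) = chm Q"
      using L_times_monomial[OF frame_GLF[OF R(1)] aff_periodic[OF R(2)]] R(4) by (intro chm_cong) simp
    then have "B \<in> apt (R * monomial f)" using subset_chm_apt Q by simp
    then have "B \<in> apt R" using apt_times_monomial[OF frame_GLF[OF R(1)] R(2)] by simp
    ultimately show ?thesis using R(1) by blast
  qed
  show "\<exists>h. simplicial_iso \<Sigma> \<Sigma>' h \<and> (\<forall>v\<in>A \<union> B. h v = v)"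
    if S: "\<Sigma> \<in> apt ` {P. frame P}" and S': "\<Sigma>' \<in> apt ` {P. frame P}"
      and A: "A \<in> \<Sigma> \<inter> \<Sigma>'" and B: "B \<in> \<Sigma> \<inter> \<Sigma>'" for \<Sigma> \<Sigma>' A B
  proof -
    obtain P0 where P0: "frame P0" "\<Sigma> = apt P0" using S by blast
    have "A \<in> apt P0" using A P0(2) by blast
    from apt_subset_chm[OF P0(1) this]
    obtain P where P: "frame P" "\<Sigma> = apt P" "A \<noteq> {}" "A \<subseteq> chm P" using P0(2) by auto
    obtain Q0 where Q0: "frame Q0" "\<Sigma>' = apt Q0" using S' by blast
    have "B \<in> apt Q0" using B Q0(2) by blast
    from apt_subset_chm[OF Q0(1) this]
    obtain Q where Q: "frame Q" "\<Sigma>' = apt Q" "B \<noteq> {}" "B \<subseteq> chm Q" using Q0(2) by auto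
    obtain R f where R: "frame R" "aff f" "\<And>k. L R {k..} = L P {k..}" "\<And>k. L R (f ` {k..}) = L Q {k..}"
      using common_frame[OF P(1) Q(1)] by metis
    note G = frame_GLF[OF P(1)] frame_GLF[OF Q(1)] frame_GLF[OF R(1)]
    \<comment> \<open>\<open>P\<close> and \<open>R\<close> share their base chain, as do
      \<open>R'\<close> and \<open>Q\<close>, while \<open>R\<close> and \<open>R'\<close> have the
      same apartment. Since that apartment contains \<open>A\<close> and \<open>B\<close>, each half
      of the composite fixes their vertices.\<close>
    define R' where "R' = R * monomial f"
    have R': "R' \<in> GLF" "apt R' = apt R" "\<And>k. L R' {k..} = L Q {k..}"
      unfolding R'_def using frame_GLF[OF frame_times_monomial[OF R(1,2)]] apt_times_monomial[OF G(3) R(2)]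
        L_times_monomial[OF G(3) aff_periodic[OF R(2)]] R(4) by auto
    obtain h1 where h1: "simplicial_iso (apt P) (apt R) h1" "\<And>v. v \<in> \<Union>(apt P) \<Longrightarrow> v \<in> \<Union>(apt R) \<Longrightarrow> h1 v = v"
      using apt_iso[OF G(1,3)] R(3) by metis
    obtain h2 where h2: "simplicial_iso (apt R') (apt Q) h2" "\<And>v. v \<in> \<Union>(apt R') \<Longrightarrow> v \<in> \<Union>(apt Q) \<Longrightarrow> h2 v = v"
      using apt_iso[OF R'(1) G(2)] R'(3) by metis
    have "chm R = chm P" using R(3) by (rule chm_cong)
    then have AR: "A \<in> apt R" using subset_chm_apt P by simp
    have "chm R' = chm Q" using R'(3) by (rule chm_cong)
    then have BR: "B \<in> apt R" using subset_chm_apt[of B R'] Q R'(2) by simp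
    have "simplicial_iso \<Sigma> \<Sigma>' (h2 \<circ> h1)"
      using simplicial_iso_comp[OF h1(1)] h2(1) R'(2) P(2) Q(2) by simp
    moreover have "(h2 \<circ> h1) v = v" if v: "v \<in> A \<union> B" for v
    proof -
      have "v \<in> \<Union>(apt P)" "v \<in> \<Union>(apt R)" "v \<in> \<Union>(apt Q)" using v A B AR BR P(2) Q(2) by auto
      then show ?thesis using h1(2) h2(2) R'(2) by simp
    qed
    ultimately show ?thesis by blast
  qed
qed

section \<open>Types and the action\<close>

definition vx :: "'k mat \<Rightarrow> int \<Rightarrow> 'k vec set set" where
  "vx P k = psi P (vcl {k..})"

lemma vcl_atLeast: "vcl {k..} = range (\<lambda>t. {k + N * t..})"
  unfolding vcl_def by (simp only: shift_atLeast add.commute)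

lemma vx_mem_iff: "x \<in> vx P k \<longleftrightarrow> (\<exists>t. x = L P {k + N * t..})"
  unfolding vx_def psi_def vcl_atLeast by auto

lemma vx_mod: "k mod N = j mod N \<Longrightarrow> vx P k = vx P j"
  unfolding vx_def using vcl_stdch_mod[OF periodic_id, of k j] by simp

lemma chm_eq: "chm P = (\<lambda>k. vx P (int k)) ` {0..n}"
  unfolding chm_def stdch_eq[OF periodic_id] vx_def by (simp add: image_image)

lemma vx_eq_imp:
  assumes "P \<in> GLF" "Q \<in> GLF" "vx P k = vx Q j"
  shows "\<exists>t. L P {k..} = L Q {j + N * t..} \<and> w (det P) + k = w (det Q) + j + N * t"
proof -
  have "L P {k..} \<in> vx Q j" using assms(3) vx_mem_iff[of "L P {k..}" P k] by (metis add.right_neutral mult_zero_right)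
  then obtain t where "L P {k..} = L Q {j + N * t..}" using vx_mem_iff by blast
  then show ?thesis using L_level[OF assms(1,2)] by force
qed

text \<open>The index modulo \<open>N\<close>. Frames have determinants of value 0, so by
  \<open>L_level\<close> it is independent of the frame in which a vertex is written.\<close>

definition ty :: "'k vec set set \<Rightarrow> nat" where
  "ty v = (THE k. k \<le> n \<and> (\<exists>P. frame P \<and> v = vx P (int k)))"

lemma frame_vx_mod:
  assumes "frame P" "frame Q" "vx P k = vx Q j"
  shows "k mod N = j mod N"
  using vx_eq_imp[OF frame_GLF[OF assms(1)] frame_GLF[OF assms(2)] assms(3)] assms by (auto simp: frame_def)

lemma ty_vx:
  assumes "frame P" "k \<le> n"
  shows "ty (vx P (int k)) = k"
  unfolding ty_def
proof (rule the_equality)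
  fix j assume "j \<le> n \<and> (\<exists>Q. frame Q \<and> vx P (int k) = vx Q (int j))"
  then obtain Q where "j \<le> n" "frame Q" "vx P (int k) = vx Q (int j)" by blast
  then have "int k mod N = int j mod N" using frame_vx_mod assms by blast
  then show "j = k" using assms \<open>j \<le> n\<close> by (simp add: N_def)
qed (use assms in blast)

lemma chm_in_bld: "frame P \<Longrightarrow> A \<subseteq> chm P \<Longrightarrow> A \<noteq> {} \<Longrightarrow> A \<in> bld"
  unfolding bld_def using subset_chm_apt by auto

lemma Union_bld: "\<Union>bld = {vx P k | P k. frame P}"
proof (intro equalityI subsetI)
  fix v assume "v \<in> \<Union>bld"
  then show "v \<in> {vx P k | P k. frame P}" using bld_subset_chm chm_eq by blast
next
  fix v assume "v \<in> {vx P k | P k. frame P}"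
  then obtain P k where Pk: "frame P" "v = vx P k" by auto
  have "v \<in> chm P" unfolding Pk chm_def stdch_def vx_def by auto
  then have "{v} \<in> bld" using chm_in_bld[OF Pk(1), of "{v}"] by simp
  then show "v \<in> \<Union>bld" by blast
qed

lemma ty_inj_on_chm: "frame P \<Longrightarrow> inj_on ty (chm P)"
  unfolding chm_eq by (rule inj_onI) (auto simp: ty_vx)

lemma type_function_bld: "type_function n bld ty"
  unfolding type_function_def
proof (intro allI impI)
  fix C assume "chamber bld C"
  then have C: "C \<in> bld" "\<And>D. D \<in> bld \<Longrightarrow> C \<subseteq> D \<Longrightarrow> D = C" by (auto simp: chamber_def)
  obtain P where P: "frame P" "C \<subseteq> chm P" using bld_subset_chm[OF C(1)] by blast
  have "chm P \<in> bld" using chm_in_bld[OF P(1)] by (simp add: chm_eq)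
  then have "C = chm P" using C(2) P(2) by metis
  moreover have "ty ` chm P = {0..n}" unfolding chm_eq image_image using ty_vx[OF P(1)] by auto
  ultimately show "bij_betw ty C {0..n}" using ty_inj_on_chm[OF P(1)] by (simp add: bij_betw_def)
qed

definition move :: "'k mat \<Rightarrow> 'k vec set set \<Rightarrow> 'k vec set set" where
  "move g v = (\<lambda>X. (\<lambda>x. g *\<^sub>v x) ` X) ` v"

lemma frame_mult: "frame g \<Longrightarrow> frame P \<Longrightarrow> frame (g * P)"
  by (simp add: frame_def GLF_mult w_det_mult)

lemma move_vx:
  assumes "g \<in> GLF" "P \<in> GLF"
  shows "move g (vx P k) = vx (g * P) k"
  using L_mult[OF GLF_D(1)[OF assms(1)] GLF_D(1)[OF assms(2)]] by (simp add: move_def vx_def psi_def image_image)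

lemma move_ty: "frame g \<Longrightarrow> v \<in> \<Union>bld \<Longrightarrow> ty (move g v) = ty v"
proof -
  assume g: "frame g" and v: "v \<in> \<Union>bld"
  obtain P k where P: "frame P" "v = vx P k" using v by (auto simp: Union_bld)
  define j where "j = nat (k mod N)"
  have j: "int j = k mod N" "int j < N" using mod_index[of k] pos_mod_bound[OF N_pos, of k] by (auto simp: j_def)
  then have "j \<le> n" "v = vx P (int j)" using P(2) vx_mod[of k "int j" P] by (auto simp: N_def)
  then show ?thesis using ty_vx[OF P(1)] ty_vx[OF frame_mult[OF g P(1)]] move_vx[OF frame_GLF[OF g] frame_GLF[OF P(1)]] by simp
qed

lemma move_bld:
  assumes "frame g" "A \<in> bld"
  shows "move g ` A \<in> bld"
proof -
  obtain P where P: "frame P" "A \<subseteq> chm P" "A \<noteq> {}" using bld_subset_chm[OF assms(2)] by blast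
  have "move g ` chm P = chm (g * P)"
    unfolding chm_eq image_image using move_vx[OF frame_GLF[OF assms(1)] frame_GLF[OF P(1)]] by simp
  then have "move g ` A \<subseteq> chm (g * P)" using P(2) by blast
  then show ?thesis using chm_in_bld[OF frame_mult[OF assms(1) P(1)]] P(3) by simp
qed

lemma move_move:
  assumes "frame g" "frame h" "v \<in> \<Union>bld"
  shows "move g (move h v) = move (g * h) v"
proof -
  obtain P k where P: "frame P" "v = vx P k" using assms(3) by (auto simp: Union_bld)
  have "g * (h * P) = (g * h) * P"
    using GLF_D(1)[OF frame_GLF] assms(1,2) P(1) by (simp add: assoc_mult_mat[of _ dm dm _ dm _ dm])
  then show ?thesis
    using move_vx frame_GLF frame_mult assms(1,2) P by simp
qed

lemma move_one: "v \<in> \<Union>bld \<Longrightarrow> move (1\<^sub>m dm) v = v"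
proof -
  assume "v \<in> \<Union>bld"
  then obtain P k where P: "frame P" "v = vx P k" by (auto simp: Union_bld)
  have "1\<^sub>m dm \<in> GLF" by (simp add: GLF_def mats_one[OF subring])
  then show ?thesis using move_vx[OF _ frame_GLF[OF P(1)], of "1\<^sub>m dm" k] P GLF_D(1)[OF frame_GLF[OF P(1)]] by simp
qed

text \<open>A frame fixing a lattice class fixes the lattice, since its determinant is a unit.\<close>

lemma fixed_vertex_char_poly:
  assumes g: "frame g" and P: "frame P" and fixv: "move g (vx P k) = vx P k"
  shows "coeff (char_poly g) i \<in> vring"
proof -
  have G: "g \<in> GLF" "P \<in> GLF" using g P by (auto intro: frame_GLF)
  have "vx (g * P) k = vx P k" using fixv move_vx[OF G] by simp
  then obtain t where t: "L (g * P) {k..} = L P {k + N * t..}" "w (det (g * P)) + k = w (det P) + k + N * t"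
    using vx_eq_imp[OF GLF_mult[OF G] G(2)] by blast
  have "N * t = 0" using t(2) w_det_mult[OF G] g by (simp add: frame_def)
  then have eq: "L (g * P) {k..} = L P {k..}" using t(1) by (simp only: add_0_right)
  \<comment> \<open>The columns of \<open>B\<close> are a basis of the fixed lattice over the
    valuation ring; in this basis \<open>g\<close> becomes integral.\<close>
  define B where "B = P * monomial ((+) k)"
  have M: "monomial ((+) k) \<in> GLF" using monomial_GLF[OF periodic_plus] .
  have B: "B \<in> GLF" unfolding B_def using G(2) M by (rule GLF_mult)
  have gB: "g * B = (g * P) * monomial ((+) k)" unfolding B_def
    using GLF_D(1)[OF G(1)] GLF_D(1)[OF G(2)] by (simp add: assoc_mult_mat[of _ dm dm _ dm _ dm])
  have sub: "L (g * B) {0..} \<subseteq> L B {0..}"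
  proof -
    have "L (g * B) {0..} = L (g * P) {k..}" using gB L_zero_based[OF GLF_mult[OF G]] by simp
    moreover have "L B {0..} = L P {k..}" using L_zero_based[OF G(2)] by (simp add: B_def)
    ultimately show ?thesis using eq by simp
  qed
  define S where "S = minv B * (g * B)"
  have S: "S \<in> mats vring dm" unfolding S_def using L_subset_factor(1)[OF GLF_mult[OF G(1) B] B sub] .
  have carr: "g \<in> carrier_mat dm dm" "B \<in> carrier_mat dm dm" "minv B \<in> carrier_mat dm dm"
    using GLF_D(1) G B GLF_minv[OF B] by auto
  have mB: "B * minv B = 1\<^sub>m dm" "minv B * B = 1\<^sub>m dm" using minv GLF_D B by blast+
  have "B * S * minv B = (B * minv B) * g * (B * minv B)"
    unfolding S_def using carr by (simp add: assoc_mult_mat[of _ dm dm _ dm _ dm])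
  then have "g = B * S * minv B" using mB carr by simp
  then have "similar_mat g S"
    unfolding similar_mat_def similar_mat_wit_def
    using carr mats_carrier[OF S] mB by (intro exI[of _ B] exI[of _ "minv B"]) (auto simp: Let_def)
  then have cp: "char_poly g = char_poly S" by (rule char_poly_similar)
  \<comment> \<open>Polynomials over the valuation ring. Since \<open>subring_set\<close> speaks of
    subsets of fields, closure under the determinant formula is repeated for them.\<close>
  define R where "R = {p :: 'k poly. \<forall>i. coeff p i \<in> vring}"
  note vr = subring_closed[OF subring_vring]
  have Rc: "p + q \<in> R" "p * q \<in> R" "- p \<in> R" if "p \<in> R" "q \<in> R" for p q
    using that by (auto simp: R_def coeff_mult intro!: vr subring_sum[OF subring_vring])
  have R01: "0 \<in> R" "1 \<in> R" by (auto simp: R_def coeff_1 intro: vr)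
  have Rs: "sum f I \<in> R" if "\<And>i. i \<in> I \<Longrightarrow> f i \<in> R" for f :: "'z \<Rightarrow> 'k poly" and I
    using that by (induction I rule: infinite_finite_induct) (auto intro: Rc R01)
  have Rp: "prod f I \<in> R" if "\<And>i. i \<in> I \<Longrightarrow> f i \<in> R" for f :: "'z \<Rightarrow> 'k poly" and I
    using that by (induction I rule: infinite_finite_induct) (auto intro: Rc R01)
  have ent: "char_poly_matrix S $$ (i, j) \<in> R" if "i < dm" "j < dm" for i j
    using that mats_carrier[OF S] mats_entry[OF S that] vr
    by (auto simp: char_poly_matrix_def R_def coeff_pCons split: nat.splits)
  have "char_poly S \<in> R"
    unfolding char_poly_def det_def'[OF char_poly_matrix_closed[OF mats_carrier[OF S]]]
  proof (rule Rs, rule Rc(2))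
    fix p assume p: "p \<in> {p. p permutes {0..<dm}}"
    show "signof p \<in> R" using R01 Rc(3)[OF R01(2) R01(2)] by (auto simp: sign_def)
    show "(\<Prod>i = 0..<dm. char_poly_matrix S $$ (i, p i)) \<in> R"
      using p by (intro Rp ent) (auto simp: permutes_in_image)
  qed
  then show ?thesis by (simp add: cp R_def)
qed

text \<open>Allows the building to be embedded in an arbitrary infinite type. The matrices are coded
  by their entries in row-major order.\<close>

lemma countable_vertices:
  assumes "countable F"
  shows "countable (\<Union>bld)"
proof -
  have "mats F dm \<subseteq> (\<lambda>xs. mat dm dm (\<lambda>(i, j). xs ! (i * dm + j))) ` lists F"
  proof
    fix A assume A: "A \<in> mats F dm"
    define xs where "xs = map (\<lambda>k. A $$ (k div dm, k mod dm)) [0..<dm * dm]"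
    have "k div dm < dm" if "k < dm * dm" for k using that by (simp add: less_mult_imp_div_less)
    then have "xs \<in> lists F" using A by (auto simp: xs_def mats_def simp del: mult_Suc mult_Suc_right)
    moreover have "A = mat dm dm (\<lambda>(i, j). xs ! (i * dm + j))"
    proof (rule eq_matI)
      fix i j assume "i < dim_row (mat dm dm (\<lambda>(i, j). xs ! (i * dm + j)))" "j < dim_col (mat dm dm (\<lambda>(i, j). xs ! (i * dm + j)))"
      then have ij: "i < dm" "j < dm" by auto
      have "i * dm + j < i * dm + dm" using ij by simp
      also have "\<dots> = Suc i * dm" by simp
      also have "\<dots> \<le> dm * dm" using ij by (intro mult_right_mono) auto
      finally have lt: "i * dm + j < dm * dm" .
      have "(i * dm + j) div dm = i" "(i * dm + j) mod dm = j" using ij by (simp_all del: mult_Suc_right)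
      then show "A $$ (i, j) = mat dm dm (\<lambda>(i, j). xs ! (i * dm + j)) $$ (i, j)"
        using ij lt by (simp add: xs_def del: mult_Suc mult_Suc_right)
    qed (use mats_carrier[OF A] in auto)
    ultimately show "A \<in> (\<lambda>xs. mat dm dm (\<lambda>(i, j). xs ! (i * dm + j))) ` lists F" by (rule rev_image_eqI)
  qed
  moreover have "countable (lists F)" using assms by (rule countable_lists)
  ultimately have "countable (mats F dm)" by (meson countable_image countable_subset)
  then have "countable (mats F dm \<times> (UNIV :: int set))" by simp
  moreover have "\<Union>bld \<subseteq> (\<lambda>(P, k). vx P k) ` (mats F dm \<times> UNIV)"
    unfolding Union_bld frame_def GLF_def by auto
  ultimately show ?thesis by (meson countable_image countable_subset)
qed

end

section \<open>From fixed points to integral characteristic polynomials\<close>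

context lattices begin

text \<open>Valuation rings are integrally closed: at an element with a pole the leading term of a
  monic integral polynomial dominates, so the polynomial cannot vanish there.\<close>

lemma monic_root_vring:
  assumes c: "c \<in> F" and p: "\<And>i. coeff p i \<in> vring" "monic p" and root: "poly p c = 0"
  shows "c \<in> vring"
proof (rule ccontr)
  assume nv: "c \<notin> vring"
  then have c0: "c \<noteq> 0" "w c < 0" using c by (auto simp: vring_def vge_def)
  define d where "d = degree p"
  have d: "d > 0"
  proof (rule ccontr)
    assume "\<not> d > 0"
    then have "p = 1" using p(2) by (metis d_def monic_degree_0 neq0_conv)
    then show False using root by simp
  qed
  have expand: "poly p c = (\<Sum>i<d. coeff p i * c ^ i) + c ^ d"
    unfolding poly_altdef d_def[symmetric] using p(2)
    by (simp add: d_def lessThan_Suc_atMost[symmetric])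
  have "vge (\<Sum>i<d. coeff p i * c ^ i) (w (c ^ d) + 1)"
  proof (rule vge_sum)
    fix i assume "i \<in> {..<d}"
    then have i: "i < d" by simp
    have "vge (coeff p i * c ^ i) (0 + w (c ^ i))"
      using p(1)[of i] c by (intro vge_mult) (auto simp: vring_def vge_def F_closed)
    moreover have "w (c ^ d) + 1 \<le> 0 + w (c ^ i)"
    proof -
      have "int d * w c \<le> (int i + 1) * w c" using i c0 by (intro mult_right_mono_neg) auto
      also have "\<dots> < int i * w c" using c0 by (simp add: distrib_right)
      finally have "int d * w c < int i * w c" .
      then show ?thesis unfolding w_power[OF c c0(1)] by linarith
    qed
    ultimately show "vge (coeff p i * c ^ i) (w (c ^ d) + 1)" by (rule vge_mono)
  qed
  then have "c ^ d + (\<Sum>i<d. coeff p i * c ^ i) \<noteq> 0"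
    using w_add_exact(1)[of "c ^ d"] c c0 by (simp add: F_closed)
  then show False using root expand by (simp add: add.commute)
qed

text \<open>The action on lattice classes is transported to \<open>'v\<close> along an injection.
  The simplex supporting a fixed point is invariant, types separate its vertices, so each vertex is
  fixed and \<open>fixed_vertex_char_poly\<close> applies.\<close>

lemma fb_frame_integral:
  fixes G :: "('g, 'm) monoid_scheme" and \<rho> :: "'g \<Rightarrow> 'k mat"
  assumes G: "group G" and fb: "property_FB TYPE('v) n G" and inf: "infinite (UNIV :: 'v set)"
    and cF: "countable F"
    and fr: "\<And>g. g \<in> carrier G \<Longrightarrow> frame (\<rho> g)"
    and hom: "\<And>g h. g \<in> carrier G \<Longrightarrow> h \<in> carrier G \<Longrightarrow> \<rho> (g \<otimes>\<^bsub>G\<^esub> h) = \<rho> g * \<rho> h"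
    and one: "\<rho> \<one>\<^bsub>G\<^esub> = 1\<^sub>m dm"
    and g: "g \<in> carrier G"
  shows "coeff (char_poly (\<rho> g)) i \<in> vring"
proof -
  interpret G: group G by (rule G)
  let ?V = "\<Union>bld"
  obtain e :: "nat \<Rightarrow> 'v" where e: "inj e" using infinite_countable_subset[OF inf] by blast
  define \<iota> where "\<iota> = e \<circ> to_nat_on ?V"
  have inj: "inj_on \<iota> ?V" unfolding \<iota>_def
    using inj_on_to_nat_on[OF countable_vertices[OF cF]] e by (intro comp_inj_on) (auto intro: inj_on_subset)
  define \<Delta> where "\<Delta> = cimg \<iota> bld"
  define j where "j = inv_into ?V \<iota>"
  have VD: "\<Union>\<Delta> = \<iota> ` ?V" unfolding \<Delta>_def by (rule Union_cimg)
  have j\<iota>: "j (\<iota> v) = v" if "v \<in> ?V" for v using inj that by (simp add: j_def)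
  have jV: "j x \<in> ?V" "\<iota> (j x) = x" if x: "x \<in> \<Union>\<Delta>" for x
  proof -
    obtain v where "v \<in> ?V" "x = \<iota> v" using x unfolding VD by (rule imageE)
    then show "j x \<in> ?V" "\<iota> (j x) = x" using j\<iota>[of v] by simp_all
  qed
  \<comment> \<open>Restricted to the vertex set because \<open>Bij\<close> demands extensional
    maps.\<close>
  define \<phi> where "\<phi> g = (\<lambda>x\<in>\<Union>\<Delta>. \<iota> (move (\<rho> g) (j x)))" for g
  have moveV: "move (\<rho> g) v \<in> ?V" if "g \<in> carrier G" "v \<in> ?V" for g v
    using move_bld[OF fr[OF that(1)]] that(2) by blast
  have \<phi>V: "\<phi> g x \<in> \<Union>\<Delta>" "j (\<phi> g x) = move (\<rho> g) (j x)" if "g \<in> carrier G" "x \<in> \<Union>\<Delta>" for g x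
    using that moveV[OF that(1) jV(1)[OF that(2)]] j\<iota> unfolding \<phi>_def VD by auto
  have b: "building n \<Delta>" unfolding \<Delta>_def using building_bld inj by (rule building_cimg)
  have sub: "A \<subseteq> ?V" if "A \<in> bld" for A using that by blast
  have tf: "type_function n \<Delta> (ty \<circ> j)"
    unfolding type_function_def
  proof (intro allI impI)
    fix C assume "chamber \<Delta> C"
    then have C: "C \<in> \<Delta>" "\<And>D. D \<in> \<Delta> \<Longrightarrow> C \<subseteq> D \<Longrightarrow> D = C" by (auto simp: chamber_def)
    obtain C0 where C0: "C0 \<in> bld" "C = \<iota> ` C0" using C(1) by (auto simp: \<Delta>_def cimg_def)
    have "chamber bld C0" unfolding chamber_def
    proof (intro conjI ballI impI)
      fix D assume D: "D \<in> bld" "C0 \<subseteq> D"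
      then have "\<iota> ` D = \<iota> ` C0" using C(2)[of "\<iota> ` D"] C0 by (auto simp: \<Delta>_def cimg_def)
      then show "D = C0" using inj_on_image_eq_iff[OF inj sub[OF D(1)] sub[OF C0(1)]] by blast
    qed (rule C0)
    then have "bij_betw ty C0 {0..n}" using type_function_bld by (simp add: type_function_def)
    moreover have "bij_betw j C C0"
      unfolding C0(2) j_def using inj sub[OF C0(1)] by (intro bij_betw_imageI) (auto simp: inj_on_def subset_iff)
    ultimately show "bij_betw (ty \<circ> j) C {0..n}" by (rule bij_betw_trans[rotated])
  qed
  have \<phi>1: "\<phi> \<one>\<^bsub>G\<^esub> x = x" if "x \<in> \<Union>\<Delta>" for x
    using that move_one[OF jV(1)[OF that]] jV(2)[OF that] by (simp add: \<phi>_def one)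
  have \<phi>m: "\<phi> (g \<otimes>\<^bsub>G\<^esub> h) x = \<phi> g (\<phi> h x)" if "g \<in> carrier G" "h \<in> carrier G" "x \<in> \<Union>\<Delta>" for g h x
  proof -
    have "\<phi> (g \<otimes>\<^bsub>G\<^esub> h) x = \<iota> (move (\<rho> g * \<rho> h) (j x))" using that by (simp add: \<phi>_def hom)
    also have "\<dots> = \<iota> (move (\<rho> g) (move (\<rho> h) (j x)))"
      using move_move[OF fr[OF that(1)] fr[OF that(2)] jV(1)[OF that(3)]] by simp
    also have "\<dots> = \<phi> g (\<phi> h x)" using \<phi>V[OF that(2,3)] by (simp add: \<phi>_def)
    finally show ?thesis .
  qed
  have \<phi>B: "\<phi> g \<in> Bij (\<Union>\<Delta>)" if g: "g \<in> carrier G" for g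
  proof -
    have "bij_betw (\<phi> g) (\<Union>\<Delta>) (\<Union>\<Delta>)"
    proof (rule bij_betw_byWitness[where f' = "\<phi> (inv\<^bsub>G\<^esub> g)"])
      show "\<forall>a\<in>\<Union>\<Delta>. \<phi> (inv\<^bsub>G\<^esub> g) (\<phi> g a) = a" "\<forall>a\<in>\<Union>\<Delta>. \<phi> g (\<phi> (inv\<^bsub>G\<^esub> g) a) = a"
        using g \<phi>m[of "inv\<^bsub>G\<^esub> g" g] \<phi>m[of g "inv\<^bsub>G\<^esub> g"] \<phi>1 by auto
      show "\<phi> g ` \<Union>\<Delta> \<subseteq> \<Union>\<Delta>" "\<phi> (inv\<^bsub>G\<^esub> g) ` \<Union>\<Delta> \<subseteq> \<Union>\<Delta>"
        using \<phi>V(1)[OF g] \<phi>V(1)[OF G.inv_closed[OF g]] by blast+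
    qed
    then show ?thesis by (simp add: Bij_def \<phi>_def)
  qed
  have act: "group_action G (\<Union>\<Delta>) \<phi>"
    unfolding group_action_def group_hom_def group_hom_axioms_def
  proof (intro conjI)
    show "group G" by (rule G)
    show "group (BijGroup (\<Union>\<Delta>))" by (rule group_BijGroup)
    show "\<phi> \<in> Group.hom G (BijGroup (\<Union>\<Delta>))"
    proof (rule homI)
      show "\<phi> x \<in> carrier (BijGroup (\<Union>\<Delta>))" if "x \<in> carrier G" for x
        using \<phi>B[OF that] by (simp add: BijGroup_def)
      show "\<phi> (x \<otimes>\<^bsub>G\<^esub> y) = \<phi> x \<otimes>\<^bsub>BijGroup (\<Union>\<Delta>)\<^esub> \<phi> y" if "x \<in> carrier G" "y \<in> carrier G" for x y
      proof
        fix v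
        show "\<phi> (x \<otimes>\<^bsub>G\<^esub> y) v = (\<phi> x \<otimes>\<^bsub>BijGroup (\<Union>\<Delta>)\<^esub> \<phi> y) v"
          using \<phi>m[OF that, of v] \<phi>B[OF that(1)] \<phi>B[OF that(2)]
          by (cases "v \<in> \<Union>\<Delta>") (auto simp: BijGroup_def compose_def \<phi>_def[of "x \<otimes>\<^bsub>G\<^esub> y"])
      qed
    qed
  qed
  have sa: "simplicial_action G \<Delta> \<phi>"
    unfolding simplicial_action_def
  proof (intro conjI ballI act)
    fix g A assume g: "g \<in> carrier G" and "A \<in> \<Delta>"
    then obtain A0 where A0: "A0 \<in> bld" "A = \<iota> ` A0" by (auto simp: \<Delta>_def cimg_def)
    have "\<phi> g (\<iota> v) = \<iota> (move (\<rho> g) v)" if "v \<in> A0" for v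
    proof -
      have v: "v \<in> ?V" using sub[OF A0(1)] that by blast
      then have "\<iota> v \<in> \<Union>\<Delta>" unfolding VD by (rule imageI)
      then show ?thesis using j\<iota>[OF v] by (simp add: \<phi>_def)
    qed
    then have "\<phi> g ` A = \<iota> ` (move (\<rho> g) ` A0)" unfolding A0(2) image_image by (intro image_cong refl)
    then show "\<phi> g ` A \<in> \<Delta>" using move_bld[OF fr[OF g] A0(1)] by (auto simp: \<Delta>_def cimg_def)
  qed
  have tp: "type_preserving G \<Delta> (ty \<circ> j) \<phi>"
    unfolding type_preserving_def
  proof (intro ballI)
    fix g v assume "g \<in> carrier G" "v \<in> \<Union>\<Delta>"
    then show "(ty \<circ> j) (\<phi> g v) = (ty \<circ> j) v"
      using \<phi>V(2)[of g v] move_ty[OF fr jV(1)] by simp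
  qed
  have "has_fixed_point G \<Delta> \<phi>" using fb b tf sa tp unfolding property_FB_def by blast
  then obtain f where f: "f \<in> realisation \<Delta>" "\<And>g. g \<in> carrier G \<Longrightarrow> realisation_act G \<Delta> \<phi> g f = f"
    unfolding has_fixed_point_def by blast
  define A where "A = {v. f v \<noteq> 0}"
  have A: "A \<in> \<Delta>" using f(1) by (simp add: realisation_def A_def)
  then obtain A0 where A0: "A0 \<in> bld" "A = \<iota> ` A0" by (auto simp: \<Delta>_def cimg_def)
  obtain P where P: "frame P" "A0 \<subseteq> chm P" "A0 \<noteq> {}" using bld_subset_chm[OF A0(1)] by blast
  obtain v0 where v0: "v0 \<in> A0" using P(3) by blast
  define v where "v = \<iota> v0"
  have v0V: "v0 \<in> ?V" using v0 sub[OF A0(1)] by blast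
  have vA: "v \<in> A" "v \<in> \<Union>\<Delta>" using v0 A0(2) A by (auto simp: v_def)
  have fixv: "\<phi> g v = v" if g: "g \<in> carrier G" for g
  proof -
    \<comment> \<open>Coordinates are moved by the inverse element, so the fixed point equation for
      the inverse of \<open>g\<close> compares the coordinates at \<open>\<phi> g v\<close> and
      \<open>v\<close>.\<close>
    have "realisation_act G \<Delta> \<phi> (inv\<^bsub>G\<^esub> g) f v = f v" using f(2)[of "inv\<^bsub>G\<^esub> g"] g by simp
    then have "f (\<phi> g v) = f v" using vA(2) g by (simp add: realisation_act_def)
    then have "\<phi> g v \<in> A" using vA(1) by (simp add: A_def)
    then obtain u0 where u0: "u0 \<in> A0" "\<phi> g v = \<iota> u0" using A0(2) by auto
    have "u0 \<in> ?V" using u0 sub[OF A0(1)] by blast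
    then have "ty u0 = ty v0"
    proof -
      have "(ty \<circ> j) (\<phi> g v) = (ty \<circ> j) v" using tp g vA(2) unfolding type_preserving_def by blast
      then show ?thesis using u0(2) j\<iota>[OF v0V] j\<iota>[OF \<open>u0 \<in> ?V\<close>] by (simp add: v_def)
    qed
    then have "u0 = v0" using ty_inj_on_chm[OF P(1)] P(2) u0(1) v0 by (meson inj_onD subsetD)
    then show ?thesis using u0 by (simp add: v_def)
  qed
  have "move (\<rho> g) v0 = v0" using \<phi>V(2)[OF g vA(2)] fixv[OF g] j\<iota>[OF v0V] by (simp add: v_def)
  moreover obtain k where "v0 = vx P k" using v0 P(2) unfolding chm_eq by blast
  ultimately show ?thesis using fixed_vertex_char_poly[OF fr[OF g] P(1)] by blast
qed

text \<open>Its monomial matrix is diagonal with entries \<open>unif powi c\<close>,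
  \<open>unif powi (- c)\<close> and 1 otherwise: the determinant has value 0, and yet
  \<open>unif powi c\<close> is an eigenvalue. Residues 0 and 1 are distinct as
  \<open>N > 1\<close>.\<close>

definition hyp_trans :: "int \<Rightarrow> int \<Rightarrow> int" where
  "hyp_trans c z = (if z mod N = 0 then z + N * c else if z mod N = 1 then z - N * c else z)"

lemma hyp_trans_mod: "hyp_trans c z mod N = z mod N"
proof -
  have "(z - N * c) mod N = z mod N" using mod_mult_self2[of z N "- c"] by simp
  then show ?thesis by (simp add: hyp_trans_def)
qed

lemma hyp_trans_add: "hyp_trans c \<circ> hyp_trans d = hyp_trans (c + d)"
proof
  fix z show "(hyp_trans c \<circ> hyp_trans d) z = hyp_trans (c + d) z"
    using hyp_trans_mod[of d z] unfolding o_def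
    by (simp only: hyp_trans_def[of c "hyp_trans d z"] hyp_trans_def[of "c + d"]) (auto simp: hyp_trans_def algebra_simps)
qed

lemma hyp_trans_0: "hyp_trans 0 = id"
  by (auto simp: hyp_trans_def)

lemma aff_hyp_trans: "aff (hyp_trans c)"
proof -
  have "hyp_trans c \<circ> hyp_trans (- c) = id" "hyp_trans (- c) \<circ> hyp_trans c = id"
    by (simp_all add: hyp_trans_add hyp_trans_0)
  then have "bij (hyp_trans c)" by (metis o_bij)
  moreover have "hyp_trans c (z + N) = hyp_trans c z + N" for z by (simp add: hyp_trans_def)
  moreover have "(\<Sum>z\<in>{0..<N}. hyp_trans c z - z) = 0"
  proof -
    have "{0..<N} = insert 0 (insert 1 {2..<N})" using N_gt_1 by auto
    moreover have "(\<Sum>z\<in>{2..<N}. hyp_trans c z - z) = 0" by (intro sum.neutral) (auto simp: hyp_trans_def)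
    ultimately show ?thesis using N_gt_1 by (simp add: hyp_trans_def)
  qed
  ultimately show ?thesis by (simp add: aff_def periodic_def)
qed

lemma monomial_hyp_trans_root: "poly (char_poly (monomial (hyp_trans c))) (unif powi c) = 0"
proof -
  let ?M = "monomial (hyp_trans c)"
  have "?M *\<^sub>v unit_vec dm 0 = (unif powi c) \<cdot>\<^sub>v unit_vec dm 0"
  proof (rule eq_vecI)
    fix i assume "i < dim_vec ((unif powi c) \<cdot>\<^sub>v unit_vec dm 0)"
    then have i: "i < dm" by simp
    have "(?M *\<^sub>v unit_vec dm 0) $ i = (\<Sum>j = 0..<dm. if j = 0 then ?M $$ (i, 0) else 0)"
      unfolding mult_vec_coord[OF monomial_carrier unit_vec_carrier i] by (intro sum.cong) auto
    also have "\<dots> = ?M $$ (i, 0)" by simp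
    also have "\<dots> = ((unif powi c) \<cdot>\<^sub>v unit_vec dm 0) $ i"
      using i N_gt_1 by (auto simp: monomial_def hyp_trans_def)
    finally show "(?M *\<^sub>v unit_vec dm 0) $ i = ((unif powi c) \<cdot>\<^sub>v unit_vec dm 0) $ i" .
  qed (simp add: monomial_def)
  then have "eigenvector ?M (unit_vec dm 0) (unif powi c)"
    by (simp add: eigenvector_def monomial_def)
  then have "eigenvalue ?M (unif powi c)" unfolding eigenvalue_def by blast
  then show ?thesis using eigenvalue_root_char_poly[OF monomial_carrier] by blast
qed

text \<open>A nontrivial homomorphism to the integers would act through hyperbolic diagonal matrices.\<close>

lemma fb_no_hom_int:
  fixes G :: "('g, 'm) monoid_scheme" and \<chi> :: "'g \<Rightarrow> int"
  assumes G: "group G" and fb: "property_FB TYPE('v) n G" and inf: "infinite (UNIV :: 'v set)"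
    and cF: "countable F"
    and hom: "\<And>g h. g \<in> carrier G \<Longrightarrow> h \<in> carrier G \<Longrightarrow> \<chi> (g \<otimes>\<^bsub>G\<^esub> h) = \<chi> g + \<chi> h"
    and g: "g \<in> carrier G"
  shows "\<chi> g = 0"
proof -
  interpret G: group G by (rule G)
  have one: "\<chi> \<one>\<^bsub>G\<^esub> = 0" using hom[of "\<one>\<^bsub>G\<^esub>" "\<one>\<^bsub>G\<^esub>"] by simp
  define \<sigma> where "\<sigma> g = monomial (hyp_trans (\<chi> g))" for g
  have frame1: "frame (1\<^sub>m dm)" by (simp add: frame_def GLF_def mats_one[OF subring] w_one)
  have fr: "frame (\<sigma> g)" for g
  proof -
    have "1\<^sub>m dm * monomial (hyp_trans (\<chi> g)) = \<sigma> g" by (simp add: \<sigma>_def left_mult_one_mat[OF monomial_carrier])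
    then show ?thesis using frame_times_monomial[OF frame1 aff_hyp_trans] by metis
  qed
  \<comment> \<open>Integrality of the eigenvalue \<open>unif powi (\<chi> g)\<close> gives one
    sign; the inverse of \<open>g\<close> supplies the other.\<close>
  have nonneg: "0 \<le> \<chi> g" if g: "g \<in> carrier G" for g
  proof -
    have "coeff (char_poly (\<sigma> g)) i \<in> vring" for i
    proof (rule fb_frame_integral[OF G fb inf cF fr _ _ g])
      show "\<sigma> (g \<otimes>\<^bsub>G\<^esub> h) = \<sigma> g * \<sigma> h" if "g \<in> carrier G" "h \<in> carrier G" for g h
        using that by (simp add: \<sigma>_def hom hyp_trans_add monomial_mult[OF aff_periodic[OF aff_hyp_trans]])
      show "\<sigma> \<one>\<^bsub>G\<^esub> = 1\<^sub>m dm" by (simp add: \<sigma>_def one hyp_trans_0 monomial_id)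
    qed
    moreover have "monic (char_poly (\<sigma> g))" using degree_monic_char_poly[OF monomial_carrier] by (simp add: \<sigma>_def)
    ultimately have "unif powi (\<chi> g) \<in> vring"
      using monomial_hyp_trans_root[of "\<chi> g"] unfolding \<sigma>_def by (intro monic_root_vring[OF unif_powi(1)])
    then show ?thesis using unif_powi[of "\<chi> g"] unif(2) by (simp add: vring_def vge_def)
  qed
  have "\<chi> g + \<chi> (inv\<^bsub>G\<^esub> g) = 0" using hom[OF g, of "inv\<^bsub>G\<^esub> g"] g one by simp
  then show ?thesis using nonneg[OF g] nonneg[of "inv\<^bsub>G\<^esub> g"] g by simp
qed

theorem fb_integral:
  fixes G :: "('g, 'm) monoid_scheme" and \<rho> :: "'g \<Rightarrow> 'k mat"
  assumes G: "group G" and fb: "property_FB TYPE('v) n G" and inf: "infinite (UNIV :: 'v set)"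
    and cF: "countable F"
    and gl: "\<And>g. g \<in> carrier G \<Longrightarrow> \<rho> g \<in> GLF"
    and hom: "\<And>g h. g \<in> carrier G \<Longrightarrow> h \<in> carrier G \<Longrightarrow> \<rho> (g \<otimes>\<^bsub>G\<^esub> h) = \<rho> g * \<rho> h"
    and one: "\<rho> \<one>\<^bsub>G\<^esub> = 1\<^sub>m dm"
    and g: "g \<in> carrier G"
  shows "coeff (char_poly (\<rho> g)) i \<in> vring"
proof (rule fb_frame_integral[OF G fb inf cF _ hom one g])
  fix g assume g: "g \<in> carrier G"
  have "w (det (\<rho> g)) = 0"
    using gl by (intro fb_no_hom_int[OF G fb inf cF _ g]) (simp add: hom w_det_mult)
  then show "frame (\<rho> g)" using gl[OF g] by (simp add: frame_def)
qed auto

end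

section \<open>Adjoining an element to a subfield\<close>

definition cpolys :: "'k::field set \<Rightarrow> 'k poly set" where
  "cpolys F = {p. \<forall>i. coeff p i \<in> F}"

lemma cpolys_closed:
  assumes "subring_set F"
  shows "0 \<in> cpolys F" "1 \<in> cpolys F" "p \<in> cpolys F \<Longrightarrow> q \<in> cpolys F \<Longrightarrow> p + q \<in> cpolys F"
    "p \<in> cpolys F \<Longrightarrow> q \<in> cpolys F \<Longrightarrow> p * q \<in> cpolys F" "p \<in> cpolys F \<Longrightarrow> - p \<in> cpolys F"
    "c \<in> F \<Longrightarrow> [:c:] \<in> cpolys F" "c \<in> F \<Longrightarrow> p \<in> cpolys F \<Longrightarrow> pCons c p \<in> cpolys F"
    "p \<in> cpolys F \<Longrightarrow> p ^ m \<in> cpolys F" "p \<in> cpolys F \<Longrightarrow> q \<in> cpolys F \<Longrightarrow> p - q \<in> cpolys F"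
proof -
  note c = subring_closed[OF assms]
  show *: "0 \<in> cpolys F" "1 \<in> cpolys F" "p \<in> cpolys F \<Longrightarrow> q \<in> cpolys F \<Longrightarrow> p + q \<in> cpolys F"
    "p \<in> cpolys F \<Longrightarrow> q \<in> cpolys F \<Longrightarrow> p * q \<in> cpolys F" "p \<in> cpolys F \<Longrightarrow> - p \<in> cpolys F"
    "c \<in> F \<Longrightarrow> [:c:] \<in> cpolys F" "c \<in> F \<Longrightarrow> p \<in> cpolys F \<Longrightarrow> pCons c p \<in> cpolys F" for p q c
    by (auto simp: cpolys_def coeff_mult coeff_1 coeff_pCons c split: nat.splits intro!: subring_sum[OF assms] c)
  show "p \<in> cpolys F \<Longrightarrow> p ^ m \<in> cpolys F" by (induction m) (auto intro: *)
  show "p \<in> cpolys F \<Longrightarrow> q \<in> cpolys F \<Longrightarrow> p - q \<in> cpolys F" using *(3)[of p "- q"] *(5)[of q] by simp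
qed

lemma poly_in_subring: "subring_set R \<Longrightarrow> p \<in> cpolys R \<Longrightarrow> a \<in> R \<Longrightarrow> poly p a \<in> R"
  unfolding poly_altdef cpolys_def by (auto intro!: subring_sum subring_closed)

text \<open>Denominators vanishing at \<open>a\<close> only contribute \<open>0\<close>, because \<open>y / 0 = 0\<close>.\<close>

definition adjoin :: "'k::field set \<Rightarrow> 'k \<Rightarrow> 'k set" where
  "adjoin F a = {poly p a / poly q a | p q. p \<in> cpolys F \<and> q \<in> cpolys F}"

lemma adjoinI: "p \<in> cpolys F \<Longrightarrow> q \<in> cpolys F \<Longrightarrow> poly p a / poly q a \<in> adjoin F a"
  by (auto simp: adjoin_def)

lemma adjoin_poly: "subring_set F \<Longrightarrow> p \<in> cpolys F \<Longrightarrow> poly p a \<in> adjoin F a"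
  using adjoinI[of p F 1 a] by (simp add: cpolys_closed)

lemma subset_adjoin: "subring_set F \<Longrightarrow> F \<subseteq> adjoin F a"
proof
  fix c assume "subring_set F" "c \<in> F"
  then show "c \<in> adjoin F a" using adjoin_poly[of F "[:c:]" a] by (simp add: cpolys_closed)
qed

lemma mem_adjoin: "subring_set F \<Longrightarrow> a \<in> adjoin F a"
  using adjoin_poly[of F "[:0, 1:]" a] by (simp add: cpolys_closed subring_closed)

lemma subfield_adjoin:
  assumes "subfield_set F"
  shows "subfield_set (adjoin F a)"
proof -
  note R = subfield_subring[OF assms] and c = cpolys_closed[OF subfield_subring[OF assms]]
  have "x + y \<in> adjoin F a \<and> x * y \<in> adjoin F a" if xy: "x \<in> adjoin F a" "y \<in> adjoin F a" for x y
  proof -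
    obtain p q r s where pq: "p \<in> cpolys F" "q \<in> cpolys F" "r \<in> cpolys F" "s \<in> cpolys F"
      and x: "x = poly p a / poly q a" and y: "y = poly r a / poly s a"
      using xy by (auto simp: adjoin_def)
    have "x * y = poly (p * r) a / poly (q * s) a" by (simp add: x y)
    then have m: "x * y \<in> adjoin F a" using adjoinI[of "p * r" F "q * s" a] pq c by simp
    have "x + y \<in> adjoin F a"
    \<comment> \<open>A vanishing denominator makes its fraction 0, so the sum is the other
      summand.\<close>
    proof (cases "poly q a = 0 \<or> poly s a = 0")
      case True
      then show ?thesis using xy x y by auto
    next
      case False
      then have "x + y = poly (p * s + r * q) a / poly (q * s) a" by (simp add: x y add_frac_eq)
      then show ?thesis using adjoinI[of "p * s + r * q" F "q * s" a] pq c by simp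
    qed
    then show ?thesis using m by simp
  qed
  moreover have "- x \<in> adjoin F a \<and> inverse x \<in> adjoin F a" if h: "x \<in> adjoin F a" for x
  proof -
    obtain p q where pq: "p \<in> cpolys F" "q \<in> cpolys F" and x: "x = poly p a / poly q a"
      using h by (auto simp: adjoin_def)
    have "- x = poly (- p) a / poly q a" "inverse x = poly q a / poly p a" by (simp_all add: x)
    then show ?thesis using adjoinI[of "- p" F q a] adjoinI[of q F p a] pq c by simp
  qed
  moreover have "0 \<in> adjoin F a" "1 \<in> adjoin F a" using subset_adjoin[OF R] subring_closed[OF R] by auto
  ultimately show ?thesis by (simp add: subfield_set_def subring_set_def)
qed

lemma countable_adjoin:
  assumes "countable F"
  shows "countable (adjoin F a)"
proof -
  have "cpolys F \<subseteq> Poly ` lists F"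
  proof
    fix p assume "p \<in> cpolys F"
    then have "coeffs p \<in> lists F" by (auto simp: cpolys_def coeffs_def)
    then show "p \<in> Poly ` lists F" by (rule rev_image_eqI) simp
  qed
  then have c: "countable (cpolys F)" using countable_lists[OF assms] by (meson countable_image countable_subset)
  have "adjoin F a \<subseteq> (\<lambda>(p, q). poly p a / poly q a) ` (cpolys F \<times> cpolys F)" by (auto simp: adjoin_def)
  then show ?thesis using c by (meson countable_SIGMA countable_image countable_subset)
qed

section \<open>Extending a valuation along a transcendental element\<close>

context valued_field begin

text \<open>\<open>gauss \<gamma> p e\<close>: the Gauss valuation giving the variable the value \<open>\<gamma>\<close> takes the value \<open>e\<close> at \<open>p\<close>.\<close>

definition gauss :: "int \<Rightarrow> 'k poly \<Rightarrow> int \<Rightarrow> bool" where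
  "gauss \<gamma> p e \<longleftrightarrow> (\<forall>j. vge (coeff p j) (e - int j * \<gamma>)) \<and> (\<exists>j. \<not> vge (coeff p j) (e - int j * \<gamma> + 1))"

lemma gauss_exists:
  assumes "p \<in> cpolys F" "p \<noteq> 0"
  shows "\<exists>e. gauss \<gamma> p e"
proof -
  define S where "S = (\<lambda>j. w (coeff p j) + int j * \<gamma>) ` {j. j \<le> degree p \<and> coeff p j \<noteq> 0}"
  have S: "finite S" "S \<noteq> {}" using assms(2) by (auto simp: S_def intro!: exI[of _ "degree p"])
  define e where "e = Min S"
  have le: "e \<le> w (coeff p j) + int j * \<gamma>" if "coeff p j \<noteq> 0" for j
    using Min_le[OF S(1)] that le_degree[OF that] by (auto simp: e_def S_def)
  obtain j where j: "coeff p j \<noteq> 0" "e = w (coeff p j) + int j * \<gamma>"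
    using Min_in[OF S] by (auto simp: e_def S_def)
  have "vge (coeff p i) (e - int i * \<gamma>)" for i
  proof (cases "coeff p i = 0")
    case False
    then show ?thesis using le[OF False] assms(1) by (simp add: vge_def cpolys_def)
  qed simp
  moreover have "\<not> vge (coeff p j) (e - int j * \<gamma> + 1)" using j by (simp add: vge_def)
  ultimately show ?thesis unfolding gauss_def by blast
qed

lemma gauss_cpolys: "gauss \<gamma> p e \<Longrightarrow> p \<in> cpolys F \<and> p \<noteq> 0"
  by (auto simp: gauss_def vge_def cpolys_def)

lemma gauss_unique: "gauss \<gamma> p e \<Longrightarrow> gauss \<gamma> p f \<Longrightarrow> e = f"
proof -
  have "\<not> e < f" if h: "gauss \<gamma> p e" "gauss \<gamma> p f" for e f
  proof
    assume "e < f"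
    obtain j where "\<not> vge (coeff p j) (e - int j * \<gamma> + 1)" using h by (auto simp: gauss_def)
    moreover have "vge (coeff p j) (f - int j * \<gamma>)" using h by (auto simp: gauss_def)
    ultimately show False using vge_mono \<open>e < f\<close> by fastforce
  qed
  then show "gauss \<gamma> p e \<Longrightarrow> gauss \<gamma> p f \<Longrightarrow> e = f" by (metis linorder_neqE)
qed

text \<open>Gauss's lemma: take the least index at which each factor attains its minimum. In the
  coefficient of the product at the sum of these indices, the product of the two extremal
  coefficients is the only term of least value.\<close>

lemma gauss_mult:
  assumes p: "gauss \<gamma> p e" and q: "gauss \<gamma> q f"
  shows "gauss \<gamma> (p * q) (e + f)"
  unfolding gauss_def
proof
  have pv: "vge (coeff p j) (e - int j * \<gamma>)" for j using p by (auto simp: gauss_def)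
  have qv: "vge (coeff q j) (f - int j * \<gamma>)" for j using q by (auto simp: gauss_def)
  show "\<forall>j. vge (coeff (p * q) j) (e + f - int j * \<gamma>)"
    unfolding coeff_mult
  proof (intro allI vge_sum)
    fix j i :: nat assume "i \<in> {..j}"
    then have eq: "e + f - int j * \<gamma> = (e - int i * \<gamma>) + (f - int (j - i) * \<gamma>)"
      by (simp add: of_nat_diff algebra_simps)
    show "vge (coeff p i * coeff q (j - i)) (e + f - int j * \<gamma>)" unfolding eq using pv qv by (rule vge_mult)
  qed
  define i0 where "i0 = (LEAST j. \<not> vge (coeff p j) (e - int j * \<gamma> + 1))"
  define j0 where "j0 = (LEAST j. \<not> vge (coeff q j) (f - int j * \<gamma> + 1))"
  have i0: "\<not> vge (coeff p i0) (e - int i0 * \<gamma> + 1)" "\<And>i. i < i0 \<Longrightarrow> vge (coeff p i) (e - int i * \<gamma> + 1)"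
    using p LeastI_ex[of "\<lambda>j. \<not> vge (coeff p j) (e - int j * \<gamma> + 1)"] not_less_Least[of _ "\<lambda>j. \<not> vge (coeff p j) (e - int j * \<gamma> + 1)"]
    unfolding i0_def gauss_def by blast+
  have j0: "\<not> vge (coeff q j0) (f - int j0 * \<gamma> + 1)" "\<And>i. i < j0 \<Longrightarrow> vge (coeff q i) (f - int i * \<gamma> + 1)"
    using q LeastI_ex[of "\<lambda>j. \<not> vge (coeff q j) (f - int j * \<gamma> + 1)"] not_less_Least[of _ "\<lambda>j. \<not> vge (coeff q j) (f - int j * \<gamma> + 1)"]
    unfolding j0_def gauss_def by blast+
  let ?m = "i0 + j0" and ?x = "coeff p i0 * coeff q j0"
  let ?v = "e + f - int (i0 + j0) * \<gamma>"
  have a: "coeff p i0 \<in> F" "coeff p i0 \<noteq> 0" "w (coeff p i0) = e - int i0 * \<gamma>"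
    using pv[of i0] i0(1) by (auto simp: vge_def)
  have b: "coeff q j0 \<in> F" "coeff q j0 \<noteq> 0" "w (coeff q j0) = f - int j0 * \<gamma>"
    using qv[of j0] j0(1) by (auto simp: vge_def)
  have x: "?x \<in> F" "?x \<noteq> 0" "w ?x = ?v" using a b by (simp_all add: F_closed w_mult algebra_simps)
  have rest: "vge (\<Sum>i\<in>{..?m} - {i0}. coeff p i * coeff q (?m - i)) (?v + 1)"
  proof (rule vge_sum)
    fix i assume "i \<in> {..?m} - {i0}"
    then have i: "i \<le> ?m" "i \<noteq> i0" by auto
    have eq: "?v + 1 = (e - int i * \<gamma> + 1) + (f - int (?m - i) * \<gamma>)" "?v + 1 = (e - int i * \<gamma>) + (f - int (?m - i) * \<gamma> + 1)"
      using i(1) by (simp_all add: of_nat_diff algebra_simps)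
    show "vge (coeff p i * coeff q (?m - i)) (?v + 1)"
    proof (cases "i < i0")
      case True
      show ?thesis unfolding eq(1) using i0(2)[OF True] qv by (rule vge_mult)
    next
      case False
      then have lt: "?m - i < j0" using i by simp
      show ?thesis unfolding eq(2) using pv j0(2)[OF lt] by (rule vge_mult)
    qed
  qed
  have "coeff (p * q) ?m = ?x + (\<Sum>i\<in>{..?m} - {i0}. coeff p i * coeff q (?m - i))"
    unfolding coeff_mult by (subst sum.remove[of _ i0]) auto
  then have "coeff (p * q) ?m \<noteq> 0" "w (coeff (p * q) ?m) = ?v"
    using w_add_exact[OF x(1,2)] rest x(3) by auto
  then have "\<not> vge (coeff (p * q) ?m) (?v + 1)" by (simp add: vge_def)
  then show "\<exists>j. \<not> vge (coeff (p * q) j) (e + f - int j * \<gamma> + 1)" by blast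
qed

lemma gauss_add:
  assumes p: "gauss \<gamma> p e" and q: "gauss \<gamma> q f" and s: "gauss \<gamma> (p + q) h"
  shows "min e f \<le> h"
proof (rule ccontr)
  assume n: "\<not> min e f \<le> h"
  have "vge (coeff p j + coeff q j) (h - int j * \<gamma> + 1)" for j
  proof (rule vge_add)
    show "vge (coeff p j) (h - int j * \<gamma> + 1)"
      using p n by (auto simp: gauss_def intro: vge_mono[of _ "e - int j * \<gamma>"])
    show "vge (coeff q j) (h - int j * \<gamma> + 1)"
      using q n by (auto simp: gauss_def intro: vge_mono[of _ "f - int j * \<gamma>"])
  qed
  then show False using s by (simp add: gauss_def)
qed

text \<open>Transcendence of \<open>a\<close> lets fractions in \<open>a\<close> behave like
  rational functions, so the Gauss valuation is well defined on them. The parameter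
  \<open>\<gamma>\<close> is used with -1 to create a pole and with 0 for a mere extension.\<close>

lemma extend_transcendental:
  assumes tr: "\<And>p. p \<in> cpolys F \<Longrightarrow> p \<noteq> 0 \<Longrightarrow> poly p a \<noteq> 0"
  shows "\<exists>w'. valued_field (adjoin F a) w' \<and> (\<forall>x\<in>F. x \<noteq> 0 \<longrightarrow> w' x = w x) \<and> w' a = \<gamma>"
proof -
  note R = subring and c = cpolys_closed[OF subring]
  define G where "G p = (THE e. gauss \<gamma> p e)" for p
  have G: "gauss \<gamma> p (G p)" if "p \<in> cpolys F" "p \<noteq> 0" for p
    unfolding G_def using gauss_exists[OF that, of \<gamma>] gauss_unique by (metis theI)
  have Geq: "G p = e" if "gauss \<gamma> p e" for p e
    using gauss_unique[OF that G] gauss_cpolys[OF that] by simp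
  \<comment> \<open>Two representations are compared by cross multiplication: polynomials over
    \<open>F\<close> that agree at \<open>a\<close> are equal, so \<open>gauss_mult\<close> equates
    the differences of values.\<close>
  define rep where "rep x pq \<longleftrightarrow> fst pq \<in> cpolys F \<and> snd pq \<in> cpolys F \<and> fst pq \<noteq> 0 \<and> snd pq \<noteq> 0 \<and> x * poly (snd pq) a = poly (fst pq) a" for x pq
  have rep_ex: "\<exists>pq. rep x pq" if x: "x \<in> adjoin F a" "x \<noteq> 0" for x
  proof -
    obtain p q where pq: "p \<in> cpolys F" "q \<in> cpolys F" "x = poly p a / poly q a" using x by (auto simp: adjoin_def)
    then have "p \<noteq> 0" "q \<noteq> 0" "poly q a \<noteq> 0" using x(2) by auto
    then have "rep x (p, q)" using pq by (simp add: rep_def)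
    then show ?thesis by blast
  qed
  define w' where "w' x = (let pq = (SOME pq. rep x pq) in G (fst pq) - G (snd pq))" for x
  have w': "w' x = G p - G q" if r: "rep x (p, q)" for x p q
  proof -
    obtain p' q' where pq': "(SOME pq. rep x pq) = (p', q')" by (cases "SOME pq. rep x pq")
    then have r': "rep x (p', q')" using someI[of "rep x", OF r] by simp
    have "poly (p * q') a = poly (p' * q) a"
      using r r' by (simp add: rep_def) (metis mult.assoc mult.commute)
    then have "poly (p * q' - p' * q) a = 0" by simp
    moreover have "p * q' - p' * q \<in> cpolys F" using r r' by (simp add: rep_def c(4) c(9))
    ultimately have "p * q' = p' * q" using tr by fastforce
    then have "G p + G q' = G p' + G q"
      using Geq[OF gauss_mult[OF G G, of p q']] Geq[OF gauss_mult[OF G G, of p' q]] r r' by (simp add: rep_def)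
    then show ?thesis using pq' by (simp add: w'_def)
  qed
  have rep_mult: "rep (x * y) (p * r, q * s)" if "rep x (p, q)" "rep y (r, s)" for x y p q r s
    using that c by (simp add: rep_def) (metis mult.assoc mult.commute mult.left_commute)
  have vf: "valued_field (adjoin F a) w'"
  proof
    show "subfield_set (adjoin F a)" using subfield by (rule subfield_adjoin)
    fix x y assume x: "x \<in> adjoin F a" and y: "y \<in> adjoin F a" and nz: "x \<noteq> 0" "y \<noteq> 0"
    obtain p q where pq: "rep x (p, q)" using rep_ex[OF x nz(1)] by auto
    obtain r s where rs: "rep y (r, s)" using rep_ex[OF y nz(2)] by auto
    have cp: "p \<in> cpolys F" "q \<in> cpolys F" "r \<in> cpolys F" "s \<in> cpolys F" "p \<noteq> 0" "q \<noteq> 0" "r \<noteq> 0" "s \<noteq> 0"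
      using pq rs by (auto simp: rep_def)
    have Gm: "G (f * g) = G f + G g" if "f \<in> cpolys F" "g \<in> cpolys F" "f \<noteq> 0" "g \<noteq> 0" for f g
      using Geq[OF gauss_mult[OF G G]] that by blast
    show "w' (x * y) = w' x + w' y"
      using w'[OF rep_mult[OF pq rs]] w'[OF pq] w'[OF rs] cp by (simp add: Gm)
    assume nz': "x + y \<noteq> 0"
    have e: "(x + y) * poly (q * s) a = poly (p * s + r * q) a"
      using pq rs by (simp add: rep_def algebra_simps) (metis mult.assoc mult.commute)
    have qs: "poly q a \<noteq> 0" "poly s a \<noteq> 0" using tr cp by auto
    have "p * s + r * q \<noteq> 0"
    proof
      assume "p * s + r * q = 0"
      then have "(x + y) * poly (q * s) a = 0" using e by simp
      then show False using nz' qs by simp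
    qed
    then have rep: "rep (x + y) (p * s + r * q, q * s)" using e cp c by (simp add: rep_def)
    have "min (G (p * s)) (G (r * q)) \<le> G (p * s + r * q)"
      using cp c \<open>p * s + r * q \<noteq> 0\<close> by (intro gauss_add[OF G G G]) auto
    then show "min (w' x) (w' y) \<le> w' (x + y)"
      using w'[OF rep] w'[OF pq] w'[OF rs] cp by (simp add: Gm)
  qed
  have g1: "gauss \<gamma> 1 0"
    unfolding gauss_def
  proof
    show "\<forall>j. vge (coeff 1 j) (0 - int j * \<gamma>)" by (auto simp: coeff_1 vge_def F_closed w_one)
    show "\<exists>j. \<not> vge (coeff 1 j) (0 - int j * \<gamma> + 1)" by (rule exI[of _ 0]) (simp add: vge_def w_one)
  qed
  have gc: "gauss \<gamma> [:x:] (w x)" if "x \<in> F" "x \<noteq> 0" for x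
    unfolding gauss_def
  proof
    show "\<forall>j. vge (coeff [:x:] j) (w x - int j * \<gamma>)" using that by (auto simp: coeff_pCons vge_def F_closed split: nat.split)
    show "\<exists>j. \<not> vge (coeff [:x:] j) (w x - int j * \<gamma> + 1)" using that by (intro exI[of _ 0]) (simp add: vge_def)
  qed
  have ga: "gauss \<gamma> [:0, 1:] \<gamma>"
    unfolding gauss_def
  proof
    show "\<forall>j. vge (coeff [:0, 1:] j) (\<gamma> - int j * \<gamma>)" by (auto simp: coeff_pCons vge_def F_closed w_one split: nat.split)
    show "\<exists>j. \<not> vge (coeff [:0, 1:] j) (\<gamma> - int j * \<gamma> + 1)" by (rule exI[of _ 1]) (simp add: vge_def w_one)
  qed
  have "w' x = w x" if "x \<in> F" "x \<noteq> 0" for x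
    using w'[of x "[:x:]" 1] that c Geq[OF gc[OF that]] Geq[OF g1] by (simp add: rep_def)
  moreover have "w' a = \<gamma>"
    using w'[of a "[:0, 1:]" 1] c Geq[OF ga] Geq[OF g1] gauss_cpolys[OF ga] by (simp add: rep_def)
  ultimately show ?thesis using vf by blast
qed

end

section \<open>Extending a valuation along an algebraic element\<close>

text \<open>A homogeneous linear system with more unknowns than equations, solved inside the
  subfield by eliminating one unknown and one equation per step.\<close>

lemma subfield_dependence:
  assumes F: "subfield_set F" and I: "finite I" "m < card I" and c: "\<And>i l. i \<in> I \<Longrightarrow> l < m \<Longrightarrow> c i l \<in> F"
  shows "\<exists>d. (\<forall>i\<in>I. d i \<in> F) \<and> (\<exists>i\<in>I. d i \<noteq> 0) \<and> (\<forall>l<m. (\<Sum>i\<in>I. d i * c i l) = 0)"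
  using I c
proof (induction m arbitrary: I c)
  case 0
  then have "I \<noteq> {}" by auto
  then show ?case using subring_closed[OF subfield_subring[OF F]] by (intro exI[of _ "\<lambda>_. 1"]) auto
next
  case (Suc m)
  note cl = subring_closed[OF subfield_subring[OF F]] subfield_divide[OF F]
  show ?case
  proof (cases "\<forall>i\<in>I. c i m = 0")
    case True
    obtain d where "\<forall>i\<in>I. d i \<in> F" "\<exists>i\<in>I. d i \<noteq> 0" "\<forall>l<m. (\<Sum>i\<in>I. d i * c i l) = 0"
      using Suc.IH[of I c] Suc.prems by auto
    then show ?thesis using True by (intro exI[of _ d]) (auto simp: less_Suc_eq)
  next
    case False
    then obtain k where k: "k \<in> I" "c k m \<noteq> 0" by auto
    let ?I = "I - {k}"
    \<comment> \<open>Elimination with pivot \<open>c k m\<close>: the new coefficients vanish in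
      equation \<open>m\<close>.\<close>
    define c' where "c' i l = c i l - c i m / c k m * c k l" for i l
    have "m < card ?I" using Suc.prems k by simp
    moreover have "c' i l \<in> F" if "i \<in> ?I" "l < m" for i l
      unfolding c'_def using that k Suc.prems(3) by (intro cl) auto
    ultimately obtain d where d: "\<forall>i\<in>?I. d i \<in> F" "\<exists>i\<in>?I. d i \<noteq> 0" "\<forall>l<m. (\<Sum>i\<in>?I. d i * c' i l) = 0"
      using Suc.IH[of ?I c'] Suc.prems(1) by auto
    define e where "e = - (\<Sum>i\<in>?I. d i * (c i m / c k m))"
    define d' where "d' = d(k := e)"
    have eF: "e \<in> F" unfolding e_def
      using d(1) k Suc.prems(3) by (intro cl subring_sum[OF subfield_subring[OF F]]) auto
    have sum: "(\<Sum>i\<in>I. d' i * c i l) = (\<Sum>i\<in>?I. d i * c' i l)" for l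
    proof -
      have "(\<Sum>i\<in>I. d' i * c i l) = e * c k l + (\<Sum>i\<in>?I. d i * c i l)"
        using Suc.prems(1) k(1) by (subst sum.remove[of _ k]) (auto simp: d'_def intro!: sum.cong)
      also have "e * c k l = - (\<Sum>i\<in>?I. d i * (c i m / c k m * c k l))"
        by (simp add: e_def sum_distrib_right mult.assoc)
      finally show ?thesis by (simp add: c'_def right_diff_distrib sum_subtractf)
    qed
    have "(\<Sum>i\<in>I. d' i * c i l) = 0" if "l < Suc m" for l
    proof (cases "l = m")
      case True
      have "c' i m = 0" for i using k(2) by (simp add: c'_def)
      then show ?thesis unfolding sum True by simp
    qed (use that d(3) sum in auto)
    then show ?thesis using d(1,2) eF by (intro exI[of _ d']) (auto simp: d'_def)
  qed
qed

text \<open>The span of the powers below the degree \<open>m\<close> is stable under multiplication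
  by \<open>a\<close>, as \<open>f\<close> expresses \<open>a ^ m\<close> by lower powers after
  division by the leading coefficient.\<close>

lemma algebraic_span:
  assumes F: "subfield_set F" and f: "f \<in> cpolys F" "f \<noteq> 0" "poly f a = 0" and p: "p \<in> cpolys F"
  shows "\<exists>g. (\<forall>l. g l \<in> F) \<and> poly p a = (\<Sum>l<degree f. g l * a ^ l)" "0 < degree f"
proof -
  note R = subfield_subring[OF F]
  note cl = subring_closed[OF R] subfield_divide[OF F] and c = cpolys_closed[OF R]
  define m where "m = degree f"
  define Sp where "Sp = {\<Sum>l<m. g l * a ^ l | g. \<forall>l. g l \<in> F}"
  have add: "x + z \<in> Sp" if xz: "x \<in> Sp" "z \<in> Sp" for x z
  proof -
    obtain g h where g: "\<forall>l. g l \<in> F" "x = (\<Sum>l<m. g l * a ^ l)" and h: "\<forall>l. h l \<in> F" "z = (\<Sum>l<m. h l * a ^ l)"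
      using xz by (auto simp: Sp_def)
    have "x + z = (\<Sum>l<m. (g l + h l) * a ^ l)" by (simp add: g h sum.distrib distrib_right)
    then show ?thesis unfolding Sp_def using g h cl by (auto intro!: exI[of _ "\<lambda>l. g l + h l"])
  qed
  have scale: "b * x \<in> Sp" if b: "b \<in> F" and x: "x \<in> Sp" for b x
  proof -
    obtain g where g: "\<forall>l. g l \<in> F" "x = (\<Sum>l<m. g l * a ^ l)" using x by (auto simp: Sp_def)
    have "b * x = (\<Sum>l<m. (b * g l) * a ^ l)" by (simp add: g sum_distrib_left mult.assoc)
    then show ?thesis unfolding Sp_def using g b cl by (auto intro!: exI[of _ "\<lambda>l. b * g l"])
  qed
  have zero: "0 \<in> Sp" unfolding Sp_def using cl by (auto intro!: exI[of _ "\<lambda>_. 0"])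
  have sums: "(\<Sum>l\<in>I. h l) \<in> Sp" if "\<And>l. l \<in> I \<Longrightarrow> h l \<in> Sp" for I and h :: "nat \<Rightarrow> 'a"
    using that by (induction I rule: infinite_finite_induct) (auto intro: add zero)
  have pow: "a ^ l \<in> Sp" if "l < m" for l
  proof -
    have "(\<Sum>i<m. (if i = l then 1 else 0) * a ^ i) = (\<Sum>i<m. if i = l then a ^ i else 0)"
      by (intro sum.cong) auto
    also have "\<dots> = a ^ l" using that by simp
    finally have "a ^ l = (\<Sum>i<m. (if i = l then 1 else 0) * a ^ i)" ..
    then show ?thesis unfolding Sp_def using cl by (auto intro!: exI[of _ "\<lambda>i. if i = l then 1 else 0"])
  qed
  have lc: "lead_coeff f \<noteq> 0" "lead_coeff f \<in> F" using f by (auto simp: cpolys_def)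
  have am: "a ^ m \<in> Sp"
  proof -
    have "0 = (\<Sum>l<m. coeff f l * a ^ l) + lead_coeff f * a ^ m"
      using f(3) unfolding poly_altdef m_def by (simp add: lessThan_Suc_atMost[symmetric])
    then have e: "lead_coeff f * a ^ m = - (\<Sum>l<m. coeff f l * a ^ l)" by (simp add: eq_neg_iff_add_eq_0 add.commute)
    have "a ^ m = inverse (lead_coeff f) * (lead_coeff f * a ^ m)" using lc by simp
    also have "\<dots> = (- inverse (lead_coeff f)) * (\<Sum>l<m. coeff f l * a ^ l)" unfolding e by simp
    finally have "a ^ m = (- inverse (lead_coeff f)) * (\<Sum>l<m. coeff f l * a ^ l)" .
    moreover have "(\<Sum>l<m. coeff f l * a ^ l) \<in> Sp" unfolding Sp_def using f(1) by (auto simp: cpolys_def intro!: exI[of _ "coeff f"])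
    moreover have "- inverse (lead_coeff f) \<in> F" using lc(2) cl(3) subfield_inverse[OF F] by blast
    ultimately show ?thesis using scale[of "- inverse (lead_coeff f)"] by simp
  qed
  have mul: "a * x \<in> Sp" if x: "x \<in> Sp" for x
  proof -
    obtain g where g: "\<forall>l. g l \<in> F" "x = (\<Sum>l<m. g l * a ^ l)" using x by (auto simp: Sp_def)
    have "a * x = (\<Sum>l<m. g l * a ^ Suc l)" by (simp add: g sum_distrib_left mult.left_commute)
    moreover have "a ^ Suc l \<in> Sp" if "l < m" for l
      using pow[of "Suc l"] am that by (cases "Suc l = m") (auto simp del: power_Suc)
    ultimately show ?thesis using g(1) scale by (auto intro!: sums simp del: power_Suc)
  qed
  have m_pos: "0 < m"
  proof (rule ccontr)
    assume "\<not> 0 < m"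
    then have "degree f = 0" by (simp add: m_def)
    then obtain b where "f = [:b:]" by (rule degree_eq_zeroE)
    then show False using f by simp
  qed
  have polySp: "poly p a \<in> Sp" if "p \<in> cpolys F" for p
    using that
  proof (induction p)
    case (pCons b p)
    have co: "coeff (pCons b p) i \<in> F" for i using pCons.prems by (simp add: cpolys_def)
    have bp: "b \<in> F" "p \<in> cpolys F" using co[of 0] co[of "Suc _"] by (simp_all add: cpolys_def)
    have "b * a ^ 0 \<in> Sp" using scale[OF bp(1) pow[OF m_pos]] .
    then show ?case using pCons.IH[OF bp(2)] mul add by simp
  qed (simp add: zero)
  from polySp[OF p] show "\<exists>g. (\<forall>l. g l \<in> F) \<and> poly p a = (\<Sum>l<degree f. g l * a ^ l)"
    by (auto simp: Sp_def m_def)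
  show "0 < degree f" using m_pos by (simp add: m_def)
qed

text \<open>The powers of \<open>y\<close> with exponents \<open>0, ..., m\<close> become
  polynomials in \<open>a\<close> after multiplication by one common denominator, and
  \<open>m + 1\<close> elements of a span of \<open>m\<close> elements are dependent. The bound
  \<open>m\<close> is the same for all \<open>y\<close>, which \<open>extend_algebraic\<close>
  exploits.\<close>

lemma adjoin_algebraic_dependence:
  assumes F: "subfield_set F" and f: "f \<in> cpolys F" "f \<noteq> 0" "poly f a = 0" and y: "y \<in> adjoin F a"
  shows "\<exists>d. (\<forall>i. d i \<in> F) \<and> (\<exists>i\<le>degree f. d i \<noteq> 0) \<and> (\<Sum>i\<le>degree f. d i * y ^ i) = 0"
proof -
  note R = subfield_subring[OF F]
  note cl = subring_closed[OF R] and c = cpolys_closed[OF R]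
  define m where "m = degree f"
  have m_pos: "0 < m" unfolding m_def using algebraic_span(2)[OF F f c(1)] .
  obtain p q where pq: "p \<in> cpolys F" "q \<in> cpolys F" "y = poly p a / poly q a" using y by (auto simp: adjoin_def)
  show ?thesis
  proof (cases "poly q a = 0")
    case True
    then have "y = 0" using pq by simp
    \<comment> \<open>If the denominator vanishes, \<open>y\<close> is 0 and satisfies the relation
      \<open>y = 0\<close> of degree 1.\<close>
    then have "(\<Sum>i\<le>degree f. (if i = 1 then 1 else 0) * y ^ i) = 0" by (intro sum.neutral) auto
    then show ?thesis using m_pos cl by (intro exI[of _ "\<lambda>i. if i = 1 then 1 else 0"]) (auto simp: m_def intro!: exI[of _ 1])
  next
    case False
    have "\<exists>g. (\<forall>l. g l \<in> F) \<and> y ^ i * poly q a ^ m = (\<Sum>l<m. g l * a ^ l)" if "i \<le> m" for i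
    proof -
      have "y ^ i * poly q a ^ m = poly (p ^ i * q ^ (m - i)) a"
        using False that by (simp add: pq(3) power_divide power_diff)
      moreover have "p ^ i * q ^ (m - i) \<in> cpolys F" using pq c by auto
      ultimately show ?thesis using algebraic_span(1)[OF F f, of "p ^ i * q ^ (m - i)"] by (simp only: m_def)
    qed
    then obtain g where g: "\<And>i l. i \<le> m \<Longrightarrow> g i l \<in> F" "\<And>i. i \<le> m \<Longrightarrow> y ^ i * poly q a ^ m = (\<Sum>l<m. g i l * a ^ l)" by metis
    obtain d where d: "\<forall>i\<in>{..m}. d i \<in> F" "\<exists>i\<in>{..m}. d i \<noteq> 0" "\<forall>l<m. (\<Sum>i\<in>{..m}. d i * g i l) = 0"
      using subfield_dependence[OF F, of "{..m}" m g] g(1) by auto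
    have "(\<Sum>i\<le>m. d i * y ^ i) * poly q a ^ m = (\<Sum>i\<le>m. d i * (\<Sum>l<m. g i l * a ^ l))"
      unfolding sum_distrib_right using g(2) by (intro sum.cong) (auto simp: mult.assoc)
    also have "\<dots> = (\<Sum>l<m. (\<Sum>i\<le>m. d i * g i l) * a ^ l)"
      unfolding sum_distrib_left sum_distrib_right by (subst sum.swap) (simp add: mult.assoc)
    also have "\<dots> = 0" using d(3) by simp
    finally have z: "(\<Sum>i\<le>m. d i * y ^ i) = 0" using False by simp
    define d' where "d' i = (if i \<le> m then d i else 0)" for i
    have "(\<Sum>i\<le>m. d' i * y ^ i) = (\<Sum>i\<le>m. d i * y ^ i)" by (intro sum.cong) (auto simp: d'_def)
    then show ?thesis using d(1,2) z cl(1) unfolding m_def[symmetric]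
      by (intro exI[of _ d']) (auto simp: d'_def)
  qed
qed

lemma subring_powers:
  assumes B: "subring_set B"
  shows "subring_set {poly p y | p. p \<in> cpolys B}" "B \<subseteq> {poly p y | p. p \<in> cpolys B}" "y \<in> {poly p y | p. p \<in> cpolys B}"
proof -
  note c = cpolys_closed[OF B]
  have "poly p y + poly q y \<in> {poly p y | p. p \<in> cpolys B} \<and> poly p y * poly q y \<in> {poly p y | p. p \<in> cpolys B}"
    if "p \<in> cpolys B" "q \<in> cpolys B" for p q
    using c(3,4)[OF that] by (metis (mono_tags, lifting) mem_Collect_eq poly_add poly_mult)
  moreover have "- poly p y \<in> {poly p y | p. p \<in> cpolys B}" if "p \<in> cpolys B" for p
    using c(5)[OF that] by (metis (mono_tags, lifting) mem_Collect_eq poly_minus)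
  moreover have "0 \<in> {poly p y | p. p \<in> cpolys B}" "1 \<in> {poly p y | p. p \<in> cpolys B}"
    using c(1,2) by (metis (mono_tags, lifting) mem_Collect_eq poly_0, metis (mono_tags, lifting) mem_Collect_eq poly_1)
  ultimately show "subring_set {poly p y | p. p \<in> cpolys B}" unfolding subring_set_def by blast
  show "B \<subseteq> {poly p y | p. p \<in> cpolys B}"
  proof
    fix b assume "b \<in> B"
    then show "b \<in> {poly p y | p. p \<in> cpolys B}" using c(6)[of b] by (auto intro!: exI[of _ "[:b:]"])
  qed
  show "y \<in> {poly p y | p. p \<in> cpolys B}"
    using c(7)[OF subring_closed(1)[OF B] c(2)] by (auto intro!: exI[of _ "[:0, 1:]"] simp: one_pCons)
qed

text \<open>Such a subring \<open>B\<close> is a valuation ring of \<open>K\<close> (Chevalley).\<close>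

locale maximal_avoiding =
  fixes K B :: "'k::field set" and x :: 'k
  assumes K: "subfield_set K" and B: "subring_set B" and BK: "B \<subseteq> K"
    and x: "x \<in> K" "x \<notin> B" and ix: "inverse x \<in> B"
    and maximal: "\<And>C. subring_set C \<Longrightarrow> C \<subseteq> K \<Longrightarrow> x \<notin> C \<Longrightarrow> B \<subseteq> C \<Longrightarrow> C = B"
begin

lemmas Bc = subring_closed[OF B]

text \<open>Otherwise the ring generated by \<open>B\<close> and \<open>y\<close> would still avoid
  \<open>x\<close>, against maximality.\<close>

lemma adjoined: "y \<in> K \<Longrightarrow> y \<notin> B \<Longrightarrow> \<exists>p. p \<in> cpolys B \<and> x = poly p y"
proof (rule ccontr)
  assume y: "y \<in> K" "y \<notin> B" and n: "\<not> (\<exists>p. p \<in> cpolys B \<and> x = poly p y)"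
  have "{poly p y | p. p \<in> cpolys B} = B"
  proof (rule maximal)
    show "{poly p y | p. p \<in> cpolys B} \<subseteq> K"
    proof
      fix z assume "z \<in> {poly p y | p. p \<in> cpolys B}"
      then obtain p where "p \<in> cpolys B" "z = poly p y" by auto
      then show "z \<in> K" using poly_in_subring[OF subfield_subring[OF K], of p y] BK y by (auto simp: cpolys_def)
    qed
    show "x \<notin> {poly p y | p. p \<in> cpolys B}" using n by auto
  qed (use subring_powers[OF B] in auto)
  then show False using subring_powers(3)[OF B, of y] y by simp
qed

lemma x_nz: "x \<noteq> 0"
  using x Bc(1) by auto

text \<open>Puts \<open>inverse x\<close> into the Jacobson radical. If
  \<open>z = 1 - inverse x * b\<close> had no inverse in \<open>B\<close>, then \<open>x\<close>
  would be a polynomial in \<open>inverse z\<close>, so \<open>x * z ^ m \<in> B\<close> for some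
  \<open>m\<close>. But \<open>z ^ m\<close> is 1 up to a multiple of \<open>inverse x\<close>, so
  \<open>x * z ^ m\<close> differs from \<open>x\<close> by an element of \<open>B\<close>.\<close>

lemma unit_one_minus:
  assumes b: "b \<in> B"
  shows "1 - inverse x * b \<noteq> 0" "inverse (1 - inverse x * b) \<in> B"
proof -
  define z where "z = 1 - inverse x * b"
  have z: "z \<in> B" unfolding z_def using b ix by (intro Bc)
  show z0: "1 - inverse x * b \<noteq> 0"
  proof
    assume "1 - inverse x * b = 0"
    then have "x = b" using x_nz by (simp add: field_simps)
    then show False using x b by simp
  qed
  show "inverse (1 - inverse x * b) \<in> B"
  proof (rule ccontr)
    assume n: "inverse (1 - inverse x * b) \<notin> B"
    have "inverse z \<in> K" using z BK K by (auto intro: subfield_inverse)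
    then obtain p where p: "p \<in> cpolys B" "x = poly p (inverse z)" using adjoined n by (auto simp: z_def)
    define m where "m = degree p"
    have "x * z ^ m \<in> B"
    proof -
      have "x * z ^ m = (\<Sum>i\<le>m. coeff p i * z ^ (m - i))"
        unfolding p(2) poly_altdef m_def sum_distrib_right
        using z0 by (intro sum.cong) (auto simp: z_def power_diff power_inverse field_simps)
      also have "\<dots> \<in> B" using p(1) z by (intro subring_sum[OF B] Bc) (auto simp: cpolys_def)
      finally show ?thesis .
    qed
    moreover have "\<exists>b'\<in>B. z ^ m = 1 - inverse x * b'"
    proof (induction m)
      case 0
      show ?case using Bc(1) by (intro bexI[of _ 0]) auto
    next
      case (Suc m)
      then obtain b' where b': "b' \<in> B" "z ^ m = 1 - inverse x * b'" by auto
      have "z ^ Suc m = z * (1 - inverse x * b')" using b' by simp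
      also have "\<dots> = 1 - inverse x * (b + z * b')" by (simp add: z_def algebra_simps)
      finally have "z ^ Suc m = 1 - inverse x * (b + z * b')" .
      moreover have "b + z * b' \<in> B" using b b' z by (intro Bc)
      ultimately show ?case by blast
    qed
    then obtain b' where b': "b' \<in> B" "z ^ m = 1 - inverse x * b'" by auto
    have "x * z ^ m = x - b'" unfolding b'(2) using x_nz by (simp add: right_diff_distrib)
    then have "x = x * z ^ m + b'" by simp
    moreover note b'(1)
    ultimately have "x \<in> B" using Bc(4) by metis
    then show False using x by simp
  qed
qed

text \<open>The descent in Chevalley's theorem. When \<open>s \<le> r\<close>, moving the constant
  term of the relation in \<open>inverse y\<close> to the left leaves \<open>x\<close> times a unit,
  so \<open>y ^ r\<close> is expressed by lower powers and the relation in \<open>y\<close> gets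
  shorter. When \<open>r < s\<close>, \<open>y\<close> and its inverse change roles.\<close>

lemma no_two_relations:
  assumes "y \<noteq> 0" "\<And>i. b i \<in> B" "\<And>i. c i \<in> B"
    "x = (\<Sum>i\<le>r. b i * y ^ i)" "x = (\<Sum>i\<le>s. c i * inverse y ^ i)"
  shows False
  using assms
proof (induction "r + s" arbitrary: r s y b c rule: less_induct)
  case less
  have step: False if y: "y \<noteq> 0" and b: "\<And>i. b i \<in> B" and c: "\<And>i. c i \<in> B" and sr: "s \<le> r"
    and xb: "x = (\<Sum>i\<le>r. b i * y ^ i)" and xc: "x = (\<Sum>i\<le>s. c i * inverse y ^ i)"
    and IH: "\<And>b' r'. r' < r \<Longrightarrow> (\<And>i. b' i \<in> B) \<Longrightarrow> x = (\<Sum>i\<le>r'. b' i * y ^ i) \<Longrightarrow> False"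
    for y b c r s
  proof -
    have "s \<noteq> 0"
    proof
      assume "s = 0"
      then have "x = c 0" using xc by simp
      then show False using c x by metis
    qed
    then obtain r' where r': "r = Suc r'" using sr by (cases r) auto
    define z where "z = 1 - inverse x * c 0"
    have z: "z \<noteq> 0" "inverse z \<in> B" using unit_one_minus[OF c[of 0]] by (auto simp: z_def)
    have "{..s} = insert 0 {1..s}" by auto
    then have "x = c 0 + (\<Sum>i\<in>{1..s}. c i * inverse y ^ i)" unfolding xc by simp
    then have "x * z = (\<Sum>i\<in>{1..s}. c i * inverse y ^ i)" using x_nz by (simp add: z_def right_diff_distrib)
    then have "x * z * y ^ r = (\<Sum>i\<in>{1..s}. c i * y ^ (r - i))"
      unfolding sum_distrib_right using sr y
      by (simp only: sum_distrib_right) (intro sum.cong, auto simp: power_diff power_inverse field_simps)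
    then have top: "y ^ r = inverse x * inverse z * (\<Sum>i\<in>{1..s}. c i * y ^ (r - i))"
      using x_nz z by (simp add: field_simps)
    \<comment> \<open>The factor \<open>inverse x\<close> arises from solving for
      \<open>y ^ r\<close> and is harmless because it lies in \<open>B\<close>.\<close>
    define k where "k = b r * inverse x * inverse z"
    have kB: "k \<in> B" unfolding k_def using b ix z by (intro Bc)
    define b' where "b' j = b j + (if r - s \<le> j then k * c (r - j) else 0)" for j
    have b'B: "b' j \<in> B" for j unfolding b'_def using b c kB by (auto intro: Bc)
    have "(\<Sum>i\<in>{1..s}. k * c i * y ^ (r - i)) = (\<Sum>j\<in>{r - s..r'}. k * c (r - j) * y ^ j)"
      using sr r' by (intro sum.reindex_bij_witness[of _ "\<lambda>j. r - j" "\<lambda>i. r - i"]) auto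
    also have "\<dots> = (\<Sum>j\<le>r'. (if r - s \<le> j then k * c (r - j) else 0) * y ^ j)"
      by (intro sum.mono_neutral_cong_left) auto
    finally have e: "(\<Sum>i\<in>{1..s}. k * c i * y ^ (r - i)) = (\<Sum>j\<le>r'. (if r - s \<le> j then k * c (r - j) else 0) * y ^ j)" .
    have "x = (\<Sum>i\<le>r'. b i * y ^ i) + b r * y ^ r" using xb r' by simp
    also have "b r * y ^ r = (\<Sum>i\<in>{1..s}. k * c i * y ^ (r - i))"
      unfolding top k_def by (simp add: sum_distrib_left mult.assoc)
    also have "(\<Sum>i\<le>r'. b i * y ^ i) + (\<Sum>i\<in>{1..s}. k * c i * y ^ (r - i)) = (\<Sum>i\<le>r'. b' i * y ^ i)"
      unfolding e b'_def by (simp add: distrib_right sum.distrib)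
    finally show False using IH[of r' b'] b'B r' by simp
  qed
  show False
  proof (cases "s \<le> r")
    case True
    show False
    proof (rule step[OF less.prems(1-3) True less.prems(4,5)])
      fix b' r' assume "r' < r" "\<And>i. b' i \<in> B" "x = (\<Sum>i\<le>r'. b' i * y ^ i)"
      then show False using less.hyps[of r' s y b' c] less.prems by simp
    qed
  next
    case False
    show False
    proof (rule step[of "inverse y" c b r s])
      show "inverse y \<noteq> 0" "r \<le> s" using less.prems False by auto
      show "x = (\<Sum>i\<le>r. b i * inverse (inverse y) ^ i)" using less.prems by simp
      fix b' r' assume "r' < s" "\<And>i. b' i \<in> B" "x = (\<Sum>i\<le>r'. b' i * inverse y ^ i)"
      then show False using less.hyps[of r r' y b b'] less.prems by simp
    qed (use less.prems in auto)
  qed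
qed

lemma valuation_ring: "y \<in> K \<Longrightarrow> y \<notin> B \<Longrightarrow> inverse y \<in> B"
proof (rule ccontr)
  assume y: "y \<in> K" "y \<notin> B" "inverse y \<notin> B"
  obtain p where p: "p \<in> cpolys B" "x = poly p y" using adjoined y by blast
  obtain q where q: "q \<in> cpolys B" "x = poly q (inverse y)" using adjoined[of "inverse y"] y subfield_inverse[OF K] by blast
  have "y \<noteq> 0" using y Bc(1) by auto
  then show False
    using no_two_relations[of y "coeff p" "coeff q" "degree p" "degree q"] p q by (simp add: poly_altdef cpolys_def)
qed

definition bunit :: "'k \<Rightarrow> bool" where
  "bunit b \<longleftrightarrow> b \<in> B \<and> b \<noteq> 0 \<and> inverse b \<in> B"

lemma bunit_one: "bunit 1" by (simp add: bunit_def Bc)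

lemma bunit_mult: "bunit a \<Longrightarrow> bunit b \<Longrightarrow> bunit (a * b)"
  by (auto simp: bunit_def inverse_mult_distrib intro: Bc)

lemma bunit_inverse: "bunit a \<Longrightarrow> bunit (inverse a)"
  by (auto simp: bunit_def)

lemma bunit_power: "bunit a \<Longrightarrow> bunit (a ^ m)"
  by (induction m) (auto intro: bunit_mult bunit_one)

text \<open>Of two nonzero elements one divides the other. If \<open>b\<close> divides
  \<open>a\<close> and \<open>a + b\<close> is a unit, then
  \<open>(1 + a / b) * inverse (a + b)\<close> is an inverse of \<open>b\<close> in
  \<open>B\<close>.\<close>

lemma nonunit_add:
  assumes "a \<in> B" "b \<in> B" "\<not> bunit a" "\<not> bunit b"
  shows "\<not> bunit (a + b)"
proof
  assume u: "bunit (a + b)"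
  have main: False if a: "a \<in> B" and b: "b \<in> B" "b \<noteq> 0" "\<not> bunit b" and u: "bunit (a + b)" and q: "a / b \<in> B" for a b
  proof -
    have "inverse b = (1 + a / b) * inverse (a + b)" using b u by (simp add: bunit_def field_simps)
    also have "\<dots> \<in> B" using u q by (intro Bc) (auto simp: bunit_def)
    finally show False using b by (simp add: bunit_def)
  qed
  show False
  proof (cases "a = 0 \<or> b = 0")
    case True
    then show False using u assms by auto
  next
    case False
    have "a / b \<in> K" using assms BK K by (auto intro: subfield_divide)
    then have "a / b \<in> B \<or> b / a \<in> B" using valuation_ring[of "a / b"] by auto
    then show False using main[of a b] main[of b a] assms False u by (auto simp: add.commute)
  qed
qed

lemma nonunit_sum:
  assumes "finite I" "\<And>i. i \<in> I \<Longrightarrow> f i \<in> B \<and> \<not> bunit (f i)"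
  shows "sum f I \<in> B \<and> \<not> bunit (sum f I)"
  using assms
proof (induction I rule: finite_induct)
  case empty
  then show ?case using Bc(1) by (simp add: bunit_def)
next
  case (insert i I)
  then show ?case using nonunit_add[of "f i" "sum f I"] Bc(4) by simp
qed

lemma dominating:
  assumes "finite I" "I \<noteq> {}" "\<And>i. i \<in> I \<Longrightarrow> t i \<in> K \<and> t i \<noteq> 0"
  shows "\<exists>k\<in>I. \<forall>i\<in>I. t i / t k \<in> B"
  using assms
proof (induction I rule: finite_ne_induct)
  case (singleton i)
  then show ?case using Bc(2) by simp
next
  case (insert j I)
  then obtain k where k: "k \<in> I" "\<forall>i\<in>I. t i / t k \<in> B" by auto
  have tk: "t k \<in> K" "t k \<noteq> 0" "t j \<in> K" "t j \<noteq> 0" using insert.prems k by auto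
  have "t j / t k \<in> B \<or> t k / t j \<in> B"
    using valuation_ring[of "t j / t k"] subfield_divide[OF K] tk by auto
  then show ?case
  proof
    assume "t j / t k \<in> B"
    then show ?thesis using k by auto
  next
    assume kj: "t k / t j \<in> B"
    have "t i / t j \<in> B" if "i \<in> I" for i
    proof -
      have "t i / t j = (t i / t k) * (t k / t j)" using tk by simp
      then show ?thesis using k that kj Bc(5) by metis
    qed
    then show ?thesis using tk Bc(2) by (intro bexI[of _ j]) auto
  qed
qed

text \<open>In a vanishing sum the dominating value is attained twice: division by a dominating term
  would otherwise write -1 as a sum of nonunits.\<close>

lemma two_terms:
  assumes "finite I" "I \<noteq> {}" "\<And>i. i \<in> I \<Longrightarrow> t i \<in> K \<and> t i \<noteq> 0" "sum t I = 0"
  shows "\<exists>i\<in>I. \<exists>k\<in>I. i \<noteq> k \<and> bunit (t i / t k)"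
proof (rule ccontr)
  assume n: "\<not> (\<exists>i\<in>I. \<exists>k\<in>I. i \<noteq> k \<and> bunit (t i / t k))"
  have "\<exists>k\<in>I. \<forall>i\<in>I. t i / t k \<in> B" using assms(1,2) by (rule dominating) (rule assms(3))
  then obtain k where k: "k \<in> I" "\<forall>i\<in>I. t i / t k \<in> B" by (rule bexE)
  have tk: "t k \<noteq> 0" using assms(3) k by blast
  have "0 = (\<Sum>i\<in>I. t i / t k)" using assms(4) by (simp add: sum_divide_distrib[symmetric])
  also have "\<dots> = 1 + (\<Sum>i\<in>I - {k}. t i / t k)" using assms(1) k tk by (subst sum.remove[of _ k]) auto
  finally have e: "(\<Sum>i\<in>I - {k}. t i / t k) = - 1" by (simp add: eq_neg_iff_add_eq_0 add.commute)
  have "\<not> bunit (\<Sum>i\<in>I - {k}. t i / t k)"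
    using nonunit_sum[of "I - {k}" "\<lambda>i. t i / t k"] assms(1) k n by auto
  then show False unfolding e using Bc(2,3) by (simp add: bunit_def)
qed

end

context valued_field begin

text \<open>By \<open>two_terms\<close>, an equation of degree at most \<open>m\<close> for
  \<open>y\<close> makes some power \<open>y ^ e\<close> with \<open>1 \<le> e \<le> m\<close> agree
  with an element of \<open>F\<close> up to a unit of \<open>B\<close>. The exponent
  \<open>fact m\<close> works for all \<open>y\<close> and keeps the values integral; the new
  valuation takes the value \<open>fact m * w x\<close> at \<open>x\<close>, of which only the sign
  matters.\<close>

lemma extend_algebraic:
  assumes x: "x \<in> F" "x \<noteq> 0" "w x < 0" and f: "f \<in> cpolys F" "f \<noteq> 0" "poly f a = 0"
  shows "\<exists>w'. valued_field (adjoin F a) w' \<and> w' x < 0"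
proof -
  let ?K = "adjoin F a"
  have K: "subfield_set ?K" using subfield by (rule subfield_adjoin)
  have FK: "F \<subseteq> ?K" using subset_adjoin[OF subring] .
  have x0: "x \<noteq> 0" using x by simp
  \<comment> \<open>Containing \<open>vring\<close> ensures that \<open>inverse x\<close> lies in
    the maximal member, as \<open>maximal_avoiding\<close> requires.\<close>
  define \<B> where "\<B> = {B. subring_set B \<and> vring \<subseteq> B \<and> B \<subseteq> ?K \<and> x \<notin> B}"
  have vF: "vring \<subseteq> F" by (auto simp: vring_def vge_def)
  have "vring \<in> \<B>" using subring_vring vF FK x x0 by (auto simp: \<B>_def vring_def vge_def)
  then have ne: "\<B> \<noteq> {}" by blast
  have "\<exists>M\<in>\<B>. \<forall>X\<in>\<B>. M \<subseteq> X \<longrightarrow> X = M"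
  proof (rule subset_Zorn_nonempty[OF ne])
    fix \<C> assume C: "\<C> \<noteq> {}" "subset.chain \<B> \<C>"
    then have CB: "\<C> \<subseteq> \<B>" and tot: "\<And>X Y. X \<in> \<C> \<Longrightarrow> Y \<in> \<C> \<Longrightarrow> X \<subseteq> Y \<or> Y \<subseteq> X"
      by (auto simp: subset_chain_def)
    have sr: "subring_set X" if "X \<in> \<C>" for X using CB that by (auto simp: \<B>_def)
    have "a + b \<in> \<Union>\<C> \<and> a * b \<in> \<Union>\<C>" if ab: "a \<in> \<Union>\<C>" "b \<in> \<Union>\<C>" for a b
    proof -
      obtain X Y where XY: "X \<in> \<C>" "a \<in> X" "Y \<in> \<C>" "b \<in> Y" using ab by auto
      then obtain Z where "Z \<in> \<C>" "a \<in> Z" "b \<in> Z" using tot by blast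
      then show ?thesis using subring_closed(4,5)[OF sr] by blast
    qed
    moreover have "- a \<in> \<Union>\<C>" if "a \<in> \<Union>\<C>" for a using that subring_closed(3)[OF sr] by blast
    moreover have "0 \<in> \<Union>\<C>" "1 \<in> \<Union>\<C>" using C(1) subring_closed(1,2)[OF sr] by blast+
    ultimately have "subring_set (\<Union>\<C>)" by (simp add: subring_set_def)
    then show "\<Union>\<C> \<in> \<B>" using C(1) CB unfolding \<B>_def by blast
  qed
  then obtain B where B: "B \<in> \<B>" "\<And>X. X \<in> \<B> \<Longrightarrow> B \<subseteq> X \<Longrightarrow> X = B" by blast
  have vB: "vring \<subseteq> B" using B by (simp add: \<B>_def)
  have ixv: "inverse x \<in> vring" using x x0 by (simp add: vring_def vge_def F_closed w_inverse)
  interpret M: maximal_avoiding ?K B x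
  proof
    show "C = B" if "subring_set C" "C \<subseteq> ?K" "x \<notin> C" "B \<subseteq> C" for C
      using B(2)[of C] that vB by (auto simp: \<B>_def)
  qed (use B(1) K x FK vB ixv in \<open>auto simp: \<B>_def\<close>)
  \<comment> \<open>Values are integers: if \<open>b\<close> had a pole, some power of
    \<open>b\<close> would have a pole at least as deep as that of \<open>x\<close>, and then
    \<open>x\<close> would lie in \<open>B\<close>.\<close>
  have BF: "b \<in> vring" if b: "b \<in> B" "b \<in> F" for b
  proof (rule ccontr)
    assume n: "b \<notin> vring"
    then have b0: "b \<noteq> 0" "w b < 0" using b by (auto simp: vring_def vge_def)
    define k where "k = nat (- w x)"
    have "int k * w b \<le> w x" using b0(2) x(3) mult_right_mono_neg[of 1 "- w b" "w x"]
      by (simp add: k_def mult.commute)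
    then have "x / b ^ k \<in> vring"
      using x x0 b b0 by (simp add: vring_def vge_def F_closed w_divide w_power)
    then have "(x / b ^ k) * b ^ k \<in> B" using vB b by (intro M.Bc) auto
    then show False using M.x(2) b0 by simp
  qed
  have unitF: "w c = 0" if c: "c \<in> F" "M.bunit c" for c
  proof -
    have "c \<in> vring" "inverse c \<in> vring" using c BF F_closed by (auto simp: M.bunit_def)
    then show ?thesis using c by (auto simp: vring_def vge_def M.bunit_def w_inverse)
  qed
  define m where "m = degree f"
  have ex: "\<exists>c. c \<in> F \<and> c \<noteq> 0 \<and> M.bunit (y ^ fact m / c)" if y: "y \<in> ?K" "y \<noteq> 0" for y
  proof -
    obtain d where d: "\<forall>i. d i \<in> F" "\<exists>i\<le>m. d i \<noteq> 0" "(\<Sum>i\<le>m. d i * y ^ i) = 0"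
      using adjoin_algebraic_dependence[OF subfield f y(1)] by (auto simp: m_def)
    define I where "I = {i. i \<le> m \<and> d i \<noteq> 0}"
    have "(\<Sum>i\<in>I. d i * y ^ i) = (\<Sum>i\<le>m. d i * y ^ i)"
      unfolding I_def by (intro sum.mono_neutral_left) auto
    then have "(\<Sum>i\<in>I. d i * y ^ i) = 0" using d by simp
    moreover have "finite I" "I \<noteq> {}" using d(2) by (auto simp: I_def)
    moreover have "d i * y ^ i \<in> ?K \<and> d i * y ^ i \<noteq> 0" if "i \<in> I" for i
    proof
      have "d i \<in> ?K" using d(1) FK by blast
      then show "d i * y ^ i \<in> ?K" using y(1) by (intro subring_closed[OF subfield_subring[OF K]])
      show "d i * y ^ i \<noteq> 0" using that y(2) by (simp add: I_def)
    qed
    ultimately obtain i k where ik: "i \<in> I" "k \<in> I" "i \<noteq> k" "M.bunit (d i * y ^ i / (d k * y ^ k))"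
      using M.two_terms[of I "\<lambda>i. d i * y ^ i"] by blast
    have main: "\<exists>c. c \<in> F \<and> c \<noteq> 0 \<and> M.bunit (y ^ fact m / c)"
      if ik: "i \<in> I" "k \<in> I" "k < i" "M.bunit (d i * y ^ i / (d k * y ^ k))" for i k
    proof -
      define e where "e = i - k"
      have e: "1 \<le> e" "e \<le> m" using ik by (auto simp: e_def I_def)
      define c where "c = d k / d i"
      have c: "c \<in> F" "c \<noteq> 0" using ik d(1) F_closed by (auto simp: c_def I_def)
      have "d i * y ^ i / (d k * y ^ k) = y ^ e / c"
        using ik y by (simp add: e_def c_def I_def power_diff field_simps)
      then have u: "M.bunit (y ^ e / c)" using ik by simp
      obtain l where l: "fact m = e * l" using dvd_fact[OF e] by (auto simp: dvd_def)
      have "y ^ fact m / c ^ l = (y ^ e / c) ^ l" by (simp add: l power_mult power_divide)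
      then have "M.bunit (y ^ fact m / c ^ l)" using M.bunit_power[OF u] by simp
      then show ?thesis using c F_closed by (intro exI[of _ "c ^ l"]) auto
    qed
    show ?thesis
    proof (cases "k < i")
      case True
      then show ?thesis using main ik by blast
    next
      case False
      then have "i < k" using ik by simp
      moreover have "M.bunit (d k * y ^ k / (d i * y ^ i))" using M.bunit_inverse[OF ik(4)] by simp
      ultimately show ?thesis using main ik by blast
    qed
  qed
  define w' where "w' y = w (SOME c. c \<in> F \<and> c \<noteq> 0 \<and> M.bunit (y ^ fact m / c))" for y
  have w': "w' y = w c" if c: "c \<in> F" "c \<noteq> 0" "M.bunit (y ^ fact m / c)" for y c
  proof -
    define c' where "c' = (SOME c. c \<in> F \<and> c \<noteq> 0 \<and> M.bunit (y ^ fact m / c))"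
    have c': "c' \<in> F" "c' \<noteq> 0" "M.bunit (y ^ fact m / c')"
      unfolding c'_def using someI[of "\<lambda>c. c \<in> F \<and> c \<noteq> 0 \<and> M.bunit (y ^ fact m / c)" c] c by blast+
    have y: "y ^ fact m \<noteq> 0" using c(3) by (auto simp: M.bunit_def)
    have "M.bunit ((y ^ fact m / c') * inverse (y ^ fact m / c))" using c c' by (intro M.bunit_mult M.bunit_inverse)
    moreover have "(y ^ fact m / c') * inverse (y ^ fact m / c) = c / c'" using y c c' by (simp add: field_simps)
    ultimately have "w (c / c') = 0" using unitF c c' F_closed by simp
    then show ?thesis using c c' by (simp add: w_divide w'_def c'_def)
  qed
  \<comment> \<open>Monotonicity under divisibility in \<open>B\<close> yields the ultrametric
    inequality, because one of two summands always divides the other and hence the sum.\<close>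
  have mono: "w' y \<le> w' z" if y: "y \<in> ?K" "y \<noteq> 0" and z: "z \<in> ?K" "z \<noteq> 0" and q: "z / y \<in> B" for y z
  proof -
    obtain c where c: "c \<in> F" "c \<noteq> 0" "M.bunit (y ^ fact m / c)" using ex[OF y] by blast
    obtain e where e: "e \<in> F" "e \<noteq> 0" "M.bunit (z ^ fact m / e)" using ex[OF z] by blast
    have "e / c = (z / y) ^ fact m * (y ^ fact m / c) * inverse (z ^ fact m / e)"
      using y z c e by (simp add: power_divide field_simps)
    also have "\<dots> \<in> B" using q c(3) e(3) by (intro M.Bc) (auto simp: M.bunit_def)
    finally have "e / c \<in> vring" using BF c e F_closed by simp
    then have "w c \<le> w e" using c e by (simp add: vring_def vge_def w_divide)
    then show ?thesis using w'[OF c] w'[OF e] by simp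
  qed
  have "valued_field ?K w'"
  proof
    show "subfield_set ?K" by (rule K)
    fix y z assume y: "y \<in> ?K" and z: "z \<in> ?K" and nz: "y \<noteq> 0" "z \<noteq> 0"
    obtain c where c: "c \<in> F" "c \<noteq> 0" "M.bunit (y ^ fact m / c)" using ex[OF y nz(1)] by blast
    obtain e where e: "e \<in> F" "e \<noteq> 0" "M.bunit (z ^ fact m / e)" using ex[OF z nz(2)] by blast
    have "M.bunit ((y ^ fact m / c) * (z ^ fact m / e))" using c e by (intro M.bunit_mult)
    then have "M.bunit ((y * z) ^ fact m / (c * e))" by (simp add: power_mult_distrib)
    then have "w' (y * z) = w (c * e)" using c e F_closed by (intro w') auto
    then show "w' (y * z) = w' y + w' z" using w'[OF c] w'[OF e] c e by (simp add: w_mult)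
    assume s: "y + z \<noteq> 0"
    have sK: "y + z \<in> ?K" using y z subring_closed(4)[OF subfield_subring[OF K]] by blast
    have "z / y \<in> ?K" using y z K by (auto intro: subfield_divide)
    then have "z / y \<in> B \<or> y / z \<in> B" using M.valuation_ring[of "z / y"] by auto
    then show "min (w' y) (w' z) \<le> w' (y + z)"
    proof
      assume "z / y \<in> B"
      then have "1 + z / y \<in> B" by (intro M.Bc)
      then have "(y + z) / y \<in> B" using nz by (simp add: add_divide_distrib)
      then show ?thesis using mono[OF y nz(1) sK s] by simp
    next
      assume "y / z \<in> B"
      then have "1 + y / z \<in> B" by (intro M.Bc)
      then have "(y + z) / z \<in> B" using nz by (simp add: add_divide_distrib add.commute)
      then show ?thesis using mono[OF z nz(2) sK s] by simp
    qed
  qed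
  moreover have "w' x < 0"
  proof -
    have "w' x = w (x ^ fact m)" using x x0 F_closed M.bunit_one by (intro w') auto
    then show ?thesis using x x0 by (simp add: w_power mult_pos_neg)
  qed
  ultimately show ?thesis by blast
qed

end

section \<open>The algebraic closure of the prime field inside a field\<close>

definition frob_fixed :: "nat \<Rightarrow> 'k::field set" where
  "frob_fixed r = {x. x ^ (CHAR('k) ^ r) = x}"

text \<open>In positive characteristic the union of the finite subfields;
  \<open>absolutely_algebraic_root\<close> shows that it is closed under taking roots. The index
  starts at 1 because \<open>frob_fixed 0\<close> is the whole field.\<close>

definition absolutely_algebraic :: "'k::field set" where
  "absolutely_algebraic = (\<Union>r\<in>{1..}. frob_fixed r)"

context
  assumes char_pos: "CHAR('k::field) > 0"
begin

lemma prime_char: "prime CHAR('k)"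
  using char_pos by (rule prime_CHAR_semidom)

lemma frob_add: "(x + y :: 'k) ^ (CHAR('k) ^ r) = x ^ (CHAR('k) ^ r) + y ^ (CHAR('k) ^ r)"
  by (rule freshmans_dream'[OF prime_char refl])

lemma frob_inj: "x ^ (CHAR('k) ^ r) = y ^ (CHAR('k) ^ r) \<Longrightarrow> (x :: 'k) = y"
proof -
  assume e: "x ^ (CHAR('k) ^ r) = y ^ (CHAR('k) ^ r)"
  have "x ^ (CHAR('k) ^ r) = (x - y) ^ (CHAR('k) ^ r) + y ^ (CHAR('k) ^ r)"
    using frob_add[of "x - y" y r] by simp
  then have "(x - y) ^ (CHAR('k) ^ r) = 0" using e by simp
  then show "x = y" by simp
qed

lemma subfield_frob_fixed: "subfield_set (frob_fixed r :: 'k set)"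
proof -
  have q: "CHAR('k) ^ r > 0" using char_pos by simp
  have "(- x) ^ (CHAR('k) ^ r) = - (x ^ (CHAR('k) ^ r))" for x :: 'k
  proof -
    have "x ^ (CHAR('k) ^ r) + (- x) ^ (CHAR('k) ^ r) = 0"
      using frob_add[of x "- x" r] char_pos by (simp add: power_0_left)
    then show ?thesis by (simp add: eq_neg_iff_add_eq_0 add.commute)
  qed
  then show ?thesis
    using q by (auto simp: subfield_set_def subring_set_def frob_fixed_def frob_add power_mult_distrib power_inverse power_0_left)
qed

lemma frob_fixed_mult: "(frob_fixed r :: 'k set) \<subseteq> frob_fixed (r * s)"
proof
  fix x :: 'k assume x: "x \<in> frob_fixed r"
  have "x ^ (CHAR('k) ^ (r * s)) = x"
  proof (induction s)
    case (Suc s)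
    have "x ^ (CHAR('k) ^ (r * Suc s)) = (x ^ (CHAR('k) ^ r)) ^ (CHAR('k) ^ (r * s))"
      by (simp add: power_add power_mult[symmetric])
    then show ?case using Suc x by (simp add: frob_fixed_def)
  qed simp
  then show "x \<in> frob_fixed (r * s)" by (simp add: frob_fixed_def)
qed

lemma finite_frob_fixed:
  assumes "r \<ge> 1"
  shows "finite (frob_fixed r :: 'k set)"
proof -
  let ?q = "CHAR('k) ^ r"
  let ?P = "monom 1 ?q - monom 1 1 :: 'k poly"
  have "1 < ?q" using one_less_power[OF prime_gt_1_nat[OF prime_char], of r] assms by simp
  then have "coeff ?P ?q = 1" by (simp del: One_nat_def)
  then have "?P \<noteq> 0" by (metis coeff_0 zero_neq_one)
  then have "finite {x. poly ?P x = 0}" by (rule poly_roots_finite)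
  moreover have "frob_fixed r \<subseteq> {x. poly ?P x = 0}" by (auto simp: frob_fixed_def poly_monom)
  ultimately show ?thesis by (meson finite_subset)
qed

lemma frob_fixed_absolutely_algebraic: "r \<ge> 1 \<Longrightarrow> (frob_fixed r :: 'k set) \<subseteq> absolutely_algebraic"
  by (auto simp: absolutely_algebraic_def)

text \<open>By \<open>frob_fixed_mult\<close> a product of exponents serves all elements at
  once.\<close>

lemma absolutely_algebraic_finite:
  assumes "finite S" "S \<subseteq> (absolutely_algebraic :: 'k set)"
  shows "\<exists>r\<ge>1. S \<subseteq> frob_fixed r"
  using assms
proof (induction S rule: finite_induct)
  case (insert x S)
  then obtain r where r: "r \<ge> 1" "S \<subseteq> frob_fixed r" by auto
  obtain s where s: "s \<ge> 1" "x \<in> frob_fixed s" using insert.prems by (auto simp: absolutely_algebraic_def)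
  have "S \<subseteq> frob_fixed (r * s)" using r(2) frob_fixed_mult by blast
  moreover have "x \<in> frob_fixed (r * s)" using s(2) frob_fixed_mult[of s r] by (auto simp: mult.commute)
  moreover have "r * s \<ge> 1" using r s by simp
  ultimately show ?case by blast
qed auto

lemma subfield_absolutely_algebraic: "subfield_set (absolutely_algebraic :: 'k set)"
proof -
  have "\<exists>r\<ge>1. x \<in> frob_fixed r \<and> y \<in> frob_fixed r" if "x \<in> absolutely_algebraic" "y \<in> absolutely_algebraic" for x y :: 'k
    using absolutely_algebraic_finite[of "{x, y}"] that by auto
  note both = this
  have "x + y \<in> absolutely_algebraic \<and> x * y \<in> absolutely_algebraic \<and> - x \<in> absolutely_algebraic \<and> inverse x \<in> absolutely_algebraic"
    if xy: "x \<in> absolutely_algebraic" "y \<in> absolutely_algebraic" for x y :: 'k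
  proof -
    obtain r where r: "r \<ge> 1" "x \<in> frob_fixed r" "y \<in> frob_fixed r" using both[OF xy] by blast
    note c = subring_closed[OF subfield_subring[OF subfield_frob_fixed[of r]]] subfield_inverse[OF subfield_frob_fixed[of r]]
    show ?thesis
      using frob_fixed_absolutely_algebraic[OF r(1)] c(4)[OF r(2,3)] c(5)[OF r(2,3)] c(3)[OF r(2)] c(8)[OF r(2)] by blast
  qed
  moreover have "0 \<in> (absolutely_algebraic :: 'k set)" "1 \<in> (absolutely_algebraic :: 'k set)"
    using subfield_frob_fixed[of 1] frob_fixed_absolutely_algebraic[of 1] by (auto simp: subfield_set_def subring_set_def)
  ultimately show ?thesis unfolding subfield_set_def subring_set_def by blast
qed

text \<open>The coefficients of \<open>f\<close> lie in one finite field, so the powers of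
  \<open>a\<close> run through a finite set. Two Frobenius images of \<open>a\<close> therefore
  coincide, and injectivity of Frobenius makes \<open>a\<close> itself fixed by a positive Frobenius
  power.\<close>

lemma absolutely_algebraic_root:
  fixes a :: 'k
  assumes f: "f \<in> cpolys absolutely_algebraic" "f \<noteq> 0" "poly f a = 0"
  shows "a \<in> absolutely_algebraic"
proof -
  have "set (coeffs f) \<subseteq> absolutely_algebraic" using f(1) by (auto simp: cpolys_def coeffs_def)
  then obtain r where r: "r \<ge> 1" "set (coeffs f) \<subseteq> frob_fixed r" using absolutely_algebraic_finite[of "set (coeffs f)"] by auto
  note F = subfield_frob_fixed[of r]
  have fr: "f \<in> cpolys (frob_fixed r)"
    unfolding cpolys_def
  proof (intro CollectI allI)
    fix i show "coeff f i \<in> frob_fixed r"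
    proof (cases "coeff f i = 0")
      case True
      then show ?thesis using subring_closed(1)[OF subfield_subring[OF F]] by simp
    next
      case False
      then show ?thesis using r(2) coeff_in_coeffs[OF f(2), of i] le_degree[OF False] by auto
    qed
  qed
  define m where "m = degree f"
  let ?S = "(\<lambda>xs. \<Sum>l<m. xs ! l * a ^ l) ` {xs. set xs \<subseteq> frob_fixed r \<and> length xs = m}"
  have fin: "finite ?S" using finite_frob_fixed[OF r(1)] by (intro finite_imageI finite_lists_length_eq)
  have "a ^ i \<in> ?S" for i
  proof -
    have "[:0, 1:] ^ i \<in> cpolys (frob_fixed r :: 'k set)"
      using cpolys_closed[OF subfield_subring[OF F]] subring_closed(1,2)[OF subfield_subring[OF F]] by simp
    from algebraic_span(1)[OF F fr f(2,3) this]
    obtain g where g: "\<forall>l. g l \<in> frob_fixed r" "a ^ i = (\<Sum>l<m. g l * a ^ l)" by (auto simp: m_def)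
    have "(\<Sum>l<m. g l * a ^ l) = (\<Sum>l<m. map g [0..<m] ! l * a ^ l)" by (intro sum.cong) auto
    then show ?thesis using g by (intro image_eqI[of _ _ "map g [0..<m]"]) auto
  qed
  then have "finite (range (\<lambda>i. a ^ (CHAR('k) ^ i)))" using fin by (meson finite_subset image_subsetI)
  then have "\<not> inj (\<lambda>i. a ^ (CHAR('k) ^ i))" using finite_imageD by blast
  then obtain i j where "i < j" "a ^ (CHAR('k) ^ i) = a ^ (CHAR('k) ^ j)"
    unfolding inj_def by (metis linorder_neqE_nat)
  then have "(a ^ (CHAR('k) ^ (j - i))) ^ (CHAR('k) ^ i) = a ^ (CHAR('k) ^ i)"
    by (simp add: power_mult[symmetric] power_add[symmetric])
  then have "a ^ (CHAR('k) ^ (j - i)) = a" by (rule frob_inj)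
  then have "a \<in> frob_fixed (j - i)" by (simp add: frob_fixed_def)
  then show ?thesis using frob_fixed_absolutely_algebraic[of "j - i"] \<open>i < j\<close> by (simp add: subset_iff)
qed

section \<open>Valuations with a prescribed pole\<close>

text \<open>Starts with the prime field and \<open>x\<close>, which is transcendental over it, and
  adjoins the elements of \<open>A\<close> one at a time. Each step keeps the field countable and
  the value at \<open>x\<close> negative.\<close>

lemma exists_valuation:
  fixes x :: 'k
  assumes x: "x \<notin> absolutely_algebraic" and A: "finite A"
  shows "\<exists>F w. valued_field F w \<and> countable F \<and> A \<subseteq> F \<and> x \<in> F \<and> w x < (0::int)"
  using A
proof (induction A rule: finite_induct)
  case empty
  let ?F = "frob_fixed 1 :: 'k set"
  note F = subfield_frob_fixed[of 1]
  \<comment> \<open>The trivial valuation; its Gauss extension with \<open>\<gamma> = -1\<close> is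
    the valuation at infinity.\<close>
  interpret valued_field ?F "\<lambda>_. 0" by unfold_locales (use F in auto)
  have "poly p x \<noteq> 0" if p: "p \<in> cpolys ?F" "p \<noteq> 0" for p
  proof
    assume "poly p x = 0"
    moreover have "p \<in> cpolys absolutely_algebraic" using p(1) frob_fixed_absolutely_algebraic[of 1] by (auto simp: cpolys_def)
    ultimately show False using absolutely_algebraic_root p(2) x by blast
  qed
  then obtain w' where w': "valued_field (adjoin ?F x) w'" "w' x = -1"
    using extend_transcendental[of x "-1"] by blast
  have "countable (adjoin ?F x)" using finite_frob_fixed[of 1] by (intro countable_adjoin countable_finite) simp
  then show ?case using w' mem_adjoin[OF subfield_subring[OF F]] by (intro exI[of _ "adjoin ?F x"] exI[of _ w']) auto
next
  case (insert a A)
  then obtain F w where F: "valued_field F w" "countable F" "A \<subseteq> F" "x \<in> F" "w x < 0" by blast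
  interpret valued_field F w by (rule F)
  have x0: "x \<noteq> 0" using x subring_closed(1)[OF subfield_subring[OF subfield_absolutely_algebraic]] by auto
  have sub: "F \<subseteq> adjoin F a" "a \<in> adjoin F a" "countable (adjoin F a)"
    using subset_adjoin[OF subring] mem_adjoin[OF subring] countable_adjoin[OF F(2)] by auto
  have "\<exists>w'. valued_field (adjoin F a) w' \<and> w' x < 0"
  proof (cases "\<exists>f. f \<in> cpolys F \<and> f \<noteq> 0 \<and> poly f a = 0")
    case True
    then show ?thesis using extend_algebraic[OF F(4) x0 F(5)] by blast
  next
    case False
    then obtain w' where "valued_field (adjoin F a) w'" "\<forall>x\<in>F. x \<noteq> 0 \<longrightarrow> w' x = w x"
      using extend_transcendental[of a 0] by blast
    then show ?thesis using F(4,5) x0 by auto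
  qed
  then show ?case using sub F by blast
qed

text \<open>Extensions along algebraic elements rescale the values, so 1 need not be a value. The
  values form the multiples of the least positive one, by division with remainder; dividing by it
  produces a uniformiser.\<close>

lemma normalize_valuation:
  fixes F :: "'k set" and w :: "'k \<Rightarrow> int"
  assumes vf: "valued_field F w" and x: "x \<in> F" "x \<noteq> 0" "w x < 0"
  shows "\<exists>w' u. valued_field F w' \<and> u \<in> F \<and> u \<noteq> 0 \<and> w' u = (1::int) \<and> w' x < 0"
proof -
  interpret valued_field F w by (rule vf)
  define P where "P k \<longleftrightarrow> 0 < k \<and> (\<exists>u\<in>F. u \<noteq> 0 \<and> w u = int k)" for k :: nat
  define g where "g = (LEAST k. P k)"
  have "P (nat (- w x))" unfolding P_def using x by (intro conjI bexI[of _ "inverse x"]) (auto simp: w_inverse F_closed)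
  then have Pg: "P g" unfolding g_def by (rule LeastI)
  have least: "g \<le> k" if "P k" for k unfolding g_def using that by (rule Least_le)
  obtain u where u: "u \<in> F" "u \<noteq> 0" "w u = int g" and g: "g > 0" using Pg by (auto simp: P_def)
  have dv: "int g dvd w y" if y: "y \<in> F" "y \<noteq> 0" for y
  proof (rule ccontr)
    assume n: "\<not> int g dvd w y"
    define z where "z = y / u powi (w y div int g)"
    have z: "z \<in> F" "z \<noteq> 0" using y u F_power_int F_closed by (auto simp: z_def)
    have wz: "w z = w y mod int g"
      using y u F_power_int by (simp add: z_def w_divide w_power_int minus_div_mult_eq_mod)
    have "w y mod int g \<noteq> 0" using n by (simp add: dvd_eq_mod_eq_0)
    moreover have "0 \<le> w y mod int g" "w y mod int g < int g" using g by auto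
    ultimately have "P (nat (w y mod int g))" unfolding P_def using z wz by (intro conjI bexI[of _ z]) auto
    from least[OF this] show False using \<open>w y mod int g < int g\<close> \<open>0 \<le> w y mod int g\<close> by linarith
  qed
  define w' where "w' y = w y div int g" for y
  have ww: "w y = int g * w' y" if "y \<in> F" "y \<noteq> 0" for y using dv[OF that] by (simp add: w'_def)
  have "valued_field F w'"
  proof
    show "subfield_set F" by (rule subfield)
    fix y z assume yz: "y \<in> F" "z \<in> F" "y \<noteq> 0" "z \<noteq> 0"
    have "int g * w' (y * z) = int g * (w' y + w' z)"
      using w_mult[OF yz] ww yz F_closed by (simp add: distrib_left)
    then show "w' (y * z) = w' y + w' z" using g by simp
    assume "y + z \<noteq> 0"
    then have "min (w y) (w z) \<le> w (y + z)" using w_add[OF yz] by simp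
    moreover have "min (w y) (w z) div int g \<le> w (y + z) div int g" if "min (w y) (w z) \<le> w (y + z)"
      using that g by (intro zdiv_mono1) auto
    ultimately show "min (w' y) (w' z) \<le> w' (y + z)"
      unfolding w'_def min_def by (auto split: if_splits)
  qed
  moreover have "w' u = 1" using u g by (simp add: w'_def)
  moreover have "w' x < 0" unfolding w'_def using x(3) g by (intro div_neg_pos_less0) auto
  ultimately show ?thesis using u by blast
qed

end



section \<open>Burnside and Schur: finitely generated torsion matrix groups\<close>

definition mat_trace :: "'a::field mat \<Rightarrow> 'a" where
  "mat_trace A = (\<Sum>i = 0..<dim_row A. A $$ (i, i))"

lemma mat_trace_comm:
  assumes "A \<in> carrier_mat n m" "B \<in> carrier_mat m n"
  shows "mat_trace (A * B) = mat_trace (B * A)"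
proof -
  have "mat_trace (A * B) = (\<Sum>i = 0..<n. \<Sum>j = 0..<m. A $$ (i, j) * B $$ (j, i))"
    using assms by (simp add: mat_trace_def scalar_prod_def)
  also have "\<dots> = (\<Sum>j = 0..<m. \<Sum>i = 0..<n. B $$ (j, i) * A $$ (i, j))"
    by (subst sum.swap) (simp add: mult.commute)
  also have "\<dots> = mat_trace (B * A)" using assms by (simp add: mat_trace_def scalar_prod_def)
  finally show ?thesis .
qed

lemma mat_trace_mult: "A \<in> carrier_mat n n \<Longrightarrow> B \<in> carrier_mat n n \<Longrightarrow> mat_trace (A * B) = (\<Sum>i = 0..<n. \<Sum>j = 0..<n. A $$ (i, j) * B $$ (j, i))"
  by (simp add: mat_trace_def scalar_prod_def)

definition vsubspace :: "nat \<Rightarrow> 'a::field vec set \<Rightarrow> bool" where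
  "vsubspace n U \<longleftrightarrow> U \<subseteq> carrier_vec n \<and> 0\<^sub>v n \<in> U \<and> (\<forall>x\<in>U. \<forall>y\<in>U. x + y \<in> U) \<and> (\<forall>c. \<forall>x\<in>U. c \<cdot>\<^sub>v x \<in> U)"

lemma vsubspace_D:
  assumes "vsubspace n U"
  shows "x \<in> U \<Longrightarrow> x \<in> carrier_vec n" "0\<^sub>v n \<in> U" "x \<in> U \<Longrightarrow> y \<in> U \<Longrightarrow> x + y \<in> U" "x \<in> U \<Longrightarrow> c \<cdot>\<^sub>v x \<in> U"
  using assms by (auto simp: vsubspace_def)

lemma mult_vec_in_subspace:
  assumes U: "vsubspace n U" and Q: "Q \<in> carrier_mat n n" and y: "y \<in> carrier_vec n"
    and c: "\<And>j. j < n \<Longrightarrow> y $ j = 0 \<or> col Q j \<in> U"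
  shows "Q *\<^sub>v y \<in> U"
proof -
  define v where "v t = vec n (\<lambda>i. \<Sum>j = 0..<t. Q $$ (i, j) * y $ j)" for t
  have "v t \<in> U" if "t \<le> n" for t
    using that
  proof (induction t)
    case 0
    have "v 0 = 0\<^sub>v n" by (intro eq_vecI) (auto simp: v_def)
    then show ?case using vsubspace_D(2)[OF U] by simp
  next
    case (Suc t)
    then have t: "t < n" and IH: "v t \<in> U" by auto
    have e: "v (Suc t) = v t + y $ t \<cdot>\<^sub>v col Q t"
      using Q t by (intro eq_vecI) (auto simp: v_def mult.commute)
    show ?case
    proof (cases "y $ t = 0")
      case True
      then have "v (Suc t) = v t" using e Q by (intro eq_vecI) (auto simp: v_def)
      then show ?thesis using IH by simp
    next
      case False
      then show ?thesis unfolding e using c[OF t] IH vsubspace_D(3,4)[OF U] by blast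
    qed
  qed
  moreover have "Q *\<^sub>v y = v n" using Q y by (intro eq_vecI) (auto simp: v_def scalar_prod_def)
  ultimately show ?thesis by simp
qed

text \<open>Take an invertible matrix with as many leading columns in \<open>U\<close> as possible.
  If some \<open>x\<close> in \<open>U\<close> had a nonzero coordinate beyond them, exchanging that
  column for \<open>x\<close> would yield one more.\<close>

lemma adapted_basis:
  fixes U :: "'a::field vec set"
  assumes U: "vsubspace n U"
  shows "\<exists>Q r. Q \<in> carrier_mat n n \<and> det Q \<noteq> 0 \<and> r \<le> n \<and> (\<forall>j<r. col Q j \<in> U) \<and>
    (\<forall>x\<in>U. \<forall>i. r \<le> i \<longrightarrow> i < n \<longrightarrow> (minv Q *\<^sub>v x) $ i = 0)"
proof -
  define P where "P r \<longleftrightarrow> r \<le> n \<and> (\<exists>Q :: 'a mat. Q \<in> carrier_mat n n \<and> det Q \<noteq> 0 \<and> (\<forall>j<r. col Q j \<in> U))" for r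
  have "P 0" unfolding P_def by (auto intro!: exI[of _ "1\<^sub>m n"])
  moreover have "\<forall>r. P r \<longrightarrow> r \<le> n" by (simp add: P_def)
  ultimately obtain r where r: "P r" "\<And>s. P s \<Longrightarrow> s \<le> r" using Nat.ex_has_greatest_nat[of P 0 n] by blast
  obtain Q where Q: "Q \<in> carrier_mat n n" "det Q \<noteq> 0" "\<And>j. j < r \<Longrightarrow> col Q j \<in> U" and rn: "r \<le> n"
    using r(1) by (auto simp: P_def)
  have "(minv Q *\<^sub>v x) $ i = 0" if x: "x \<in> U" and i: "r \<le> i" "i < n" for x i
  proof (rule ccontr)
    assume nz: "(minv Q *\<^sub>v x) $ i \<noteq> 0"
    have xc: "x \<in> carrier_vec n" using vsubspace_D(1)[OF U x] .
    note m = minv[OF Q(1,2)]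
    have yc: "minv Q *\<^sub>v x \<in> carrier_vec n" using m xc by simp
    have Qy: "Q *\<^sub>v (minv Q *\<^sub>v x) = x"
      unfolding assoc_mult_mat_vec[OF Q(1) m(1) xc, symmetric] using m xc by simp
    define Q1 where "Q1 = replace_col Q x i"
    have Q1: "Q1 \<in> carrier_mat n n" using Q by (simp add: Q1_def replace_col_def)
    \<comment> \<open>Cramer's rule: the new determinant is the old one times the nonzero
      coordinate.\<close>
    have "det Q1 \<noteq> 0" using cramer_lemma_mat[OF Q(1) yc i(2)] nz Q(2) by (simp add: Qy Q1_def)
    have col1: "col Q1 j = (if j = i then x else col Q j)" if "j < n" for j
      using that Q xc by (intro eq_vecI) (auto simp: Q1_def replace_col_def)
    define Q2 where "Q2 = swapcols r i Q1"
    have rn': "r < n" using i by simp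
    have Q2: "Q2 \<in> carrier_mat n n" using Q1 by (simp add: Q2_def)
    have "det Q2 \<noteq> 0"
    proof (cases "r = i")
      case True
      have "swapcols r i Q1 = Q1" using Q1 by (intro eq_matI) (auto simp: True mat_swapcols_def)
      then show ?thesis using \<open>det Q1 \<noteq> 0\<close> by (simp add: Q2_def)
    next
      case False
      then show ?thesis using det_swapcols[of r n i Q1] rn' i Q1 \<open>det Q1 \<noteq> 0\<close> by (simp add: Q2_def)
    qed
    moreover have "col Q2 j \<in> U" if j: "j < Suc r" for j
    proof -
      have "col Q2 j = col Q1 (if j = r then i else j)"
        using j rn' i Q1 by (intro eq_vecI) (auto simp: Q2_def mat_swapcols_def)
      then show ?thesis using col1 j i x Q(3)[of j] by auto
    qed
    ultimately have "P (Suc r)" using Q2 rn' by (auto simp: P_def)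
    then show False using r(2) by fastforce
  qed
  then show ?thesis using Q rn by (intro exI[of _ Q] exI[of _ r]) simp
qed

definition submat :: "'a mat \<Rightarrow> nat \<Rightarrow> nat \<Rightarrow> nat \<Rightarrow> nat \<Rightarrow> 'a mat" where
  "submat T i0 k j0 l = mat k l (\<lambda>(i, j). T $$ (i0 + i, j0 + j))"

lemma submat_carrier [simp]: "submat T i0 k j0 l \<in> carrier_mat k l"
  by (simp add: submat_def)

lemma block_decomposition:
  assumes T: "T \<in> carrier_mat n n" and r: "r \<le> n" and z: "\<And>i j. r \<le> i \<Longrightarrow> i < n \<Longrightarrow> j < r \<Longrightarrow> T $$ (i, j) = 0"
  shows "T = four_block_mat (submat T 0 r 0 r) (submat T 0 r r (n - r)) (0\<^sub>m (n - r) r) (submat T r (n - r) r (n - r))"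
  using T r z by (intro eq_matI) (auto simp: submat_def)

text \<open>One change of basis serves all matrices that preserve \<open>U\<close>, which is
  essential for products of generators.\<close>

lemma invariant_subspace_blocks:
  fixes U :: "'a::field vec set"
  assumes U: "vsubspace n U" and ne: "\<exists>x\<in>U. x \<noteq> 0\<^sub>v n" and pr: "U \<noteq> carrier_vec n"
  obtains Q r where "Q \<in> carrier_mat n n" "det Q \<noteq> 0" "0 < r" "r < n"
    "\<And>A. A \<in> carrier_mat n n \<Longrightarrow> (\<And>x. x \<in> U \<Longrightarrow> A *\<^sub>v x \<in> U) \<Longrightarrow>
      \<exists>B C D. B \<in> carrier_mat r r \<and> C \<in> carrier_mat r (n - r) \<and> D \<in> carrier_mat (n - r) (n - r) \<and>
        minv Q * A * Q = four_block_mat B C (0\<^sub>m (n - r) r) D"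
proof -
  obtain Q r where Q0: "Q \<in> carrier_mat n n \<and> det Q \<noteq> 0 \<and> r \<le> n \<and> (\<forall>j<r. col Q j \<in> U) \<and>
    (\<forall>x\<in>U. \<forall>i. r \<le> i \<longrightarrow> i < n \<longrightarrow> (minv Q *\<^sub>v x) $ i = 0)"
    using adapted_basis[OF U] by (elim exE)
  then have Q: "Q \<in> carrier_mat n n" "det Q \<noteq> 0" "r \<le> n" "\<And>j. j < r \<Longrightarrow> col Q j \<in> U"
    and z: "\<And>x i. x \<in> U \<Longrightarrow> r \<le> i \<Longrightarrow> i < n \<Longrightarrow> (minv Q *\<^sub>v x) $ i = 0"
    by auto
  note m = minv[OF Q(1,2)]
  have cancel: "Q *\<^sub>v (minv Q *\<^sub>v x) = x" if x: "x \<in> carrier_vec n" for x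
    unfolding assoc_mult_mat_vec[OF Q(1) m(1) x, symmetric] using m x by simp
  have "0 < r"
  proof (rule ccontr)
    assume "\<not> 0 < r"
    then have r0: "r = 0" by simp
    obtain x where x: "x \<in> U" "x \<noteq> 0\<^sub>v n" using ne by blast
    have xc: "x \<in> carrier_vec n" using vsubspace_D(1)[OF U x(1)] .
    have "minv Q *\<^sub>v x = 0\<^sub>v n" using z[OF x(1)] r0 m xc by (intro eq_vecI) auto
    then have "x = Q *\<^sub>v 0\<^sub>v n" using cancel[OF xc] by simp
    also have "\<dots> = 0\<^sub>v n" using Q(1) by (intro eq_vecI) auto
    finally show False using x by simp
  qed
  moreover have "r < n"
  proof (rule ccontr)
    assume "\<not> r < n"
    then have rn: "r = n" using Q by simp
    have "x \<in> U" if x: "x \<in> carrier_vec n" for x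
    proof -
      have "Q *\<^sub>v (minv Q *\<^sub>v x) \<in> U"
        using m x Q(4) rn by (intro mult_vec_in_subspace[OF U Q(1)]) auto
      then show ?thesis using cancel[OF x] by simp
    qed
    then show False using pr vsubspace_D(1)[OF U] by blast
  qed
  moreover have "\<exists>B C D. B \<in> carrier_mat r r \<and> C \<in> carrier_mat r (n - r) \<and> D \<in> carrier_mat (n - r) (n - r) \<and>
        minv Q * A * Q = four_block_mat B C (0\<^sub>m (n - r) r) D"
    if A: "A \<in> carrier_mat n n" and inv: "\<And>x. x \<in> U \<Longrightarrow> A *\<^sub>v x \<in> U" for A
  proof -
    define T where "T = minv Q * A * Q"
    have T: "T \<in> carrier_mat n n" using m A Q by (simp add: T_def)
    have "T $$ (i, j) = 0" if ij: "r \<le> i" "i < n" "j < r" for i j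
    proof -
      have jn: "j < n" using ij Q by simp
      have "col T j = (minv Q * A) *\<^sub>v col Q j" unfolding T_def using m A Q jn by (intro col_mult2) auto
      also have "\<dots> = minv Q *\<^sub>v (A *\<^sub>v col Q j)" using m A Q jn by (intro assoc_mult_mat_vec) auto
      finally have "col T j $ i = 0" using z[OF inv[OF Q(4)[OF ij(3)]] ij(1,2)] by simp
      then show ?thesis using T ij jn by simp
    qed
    from block_decomposition[OF T Q(3) this] show ?thesis unfolding T_def by (metis submat_carrier)
  qed
  ultimately show ?thesis using that[OF Q(1,2)] by blast
qed

lemma char_poly_block:
  fixes B D :: "'a::field mat"
  assumes "B \<in> carrier_mat r r" "C \<in> carrier_mat r s" "D \<in> carrier_mat s s"
  shows "char_poly (four_block_mat B C (0\<^sub>m s r) D) = char_poly B * char_poly D"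
proof -
  have "char_poly_matrix (four_block_mat B C (0\<^sub>m s r) D) =
    four_block_mat (char_poly_matrix B) (map_mat (\<lambda>a. [:- a:]) C) (0\<^sub>m s r) (char_poly_matrix D)"
    using assms by (intro eq_matI) (auto simp: char_poly_matrix_def)
  then show ?thesis unfolding char_poly_def
    using assms by (simp add: det_four_block_mat_lower_left_zero[of _ r _ s])
qed

lemma mat_trace_block:
  assumes "B \<in> carrier_mat r r" "C \<in> carrier_mat r s" "D \<in> carrier_mat s s"
  shows "mat_trace (four_block_mat B C (0\<^sub>m s r) D) = mat_trace B + mat_trace D"
proof -
  have "mat_trace (four_block_mat B C (0\<^sub>m s r) D) = (\<Sum>i = 0..<r + s. four_block_mat B C (0\<^sub>m s r) D $$ (i, i))"
    using assms by (simp add: mat_trace_def)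
  also have "\<dots> = (\<Sum>i = 0..<r. four_block_mat B C (0\<^sub>m s r) D $$ (i, i)) + (\<Sum>i = r..<r + s. four_block_mat B C (0\<^sub>m s r) D $$ (i, i))"
    by (rule sum.atLeastLessThan_concat[symmetric]) auto
  also have "(\<Sum>i = r..<r + s. four_block_mat B C (0\<^sub>m s r) D $$ (i, i)) = (\<Sum>i = 0..<s. four_block_mat B C (0\<^sub>m s r) D $$ (i + r, i + r))"
    using sum.shift_bounds_nat_ivl[of _ 0 r s] by (simp add: add.commute)
  finally show ?thesis using assms by (simp add: mat_trace_def)
qed

lemma similar_conj:
  assumes "A \<in> carrier_mat n n" "Q \<in> carrier_mat n n" "det Q \<noteq> (0::'a::field)"
  shows "char_poly (minv Q * A * Q) = char_poly A" "mat_trace (minv Q * A * Q) = mat_trace A"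
proof -
  note m = minv[OF assms(2,3)]
  have "similar_mat (minv Q * A * Q) A"
    unfolding similar_mat_def similar_mat_wit_def
    using assms m by (intro exI[of _ "minv Q"] exI[of _ Q]) (auto simp: Let_def)
  then show "char_poly (minv Q * A * Q) = char_poly A" by (rule char_poly_similar)
  have "mat_trace (minv Q * A * Q) = mat_trace (Q * (minv Q * A))" using assms m by (intro mat_trace_comm) auto
  also have "Q * (minv Q * A) = (Q * minv Q) * A" using assms m by (intro assoc_mult_mat[symmetric]) auto
  finally show "mat_trace (minv Q * A * Q) = mat_trace A" using assms m by simp
qed

lemma eigenvector_exists:
  assumes A: "A \<in> carrier_mat n n" and n: "0 < n"
  shows "\<exists>c v. v \<in> carrier_vec n \<and> v \<noteq> 0\<^sub>v n \<and> A *\<^sub>v v = c \<cdot>\<^sub>v v \<and> poly (char_poly A) (c :: 'a::alg_closed_field) = 0"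
proof -
  have "degree (char_poly A) > 0" using degree_monic_char_poly[OF A] n by simp
  then obtain c where c: "poly (char_poly A) c = 0" using alg_closed_imp_poly_has_root by blast
  then have "eigenvalue A c" using eigenvalue_root_char_poly[OF A] by simp
  then show ?thesis using A c by (auto simp: eigenvalue_def eigenvector_def)
qed

lemma line_subspace:
  assumes v: "(v :: 'a::field vec) \<in> carrier_vec n"
  shows "vsubspace n (range (\<lambda>c. c \<cdot>\<^sub>v v))"
proof -
  have "c \<cdot>\<^sub>v v + d \<cdot>\<^sub>v v = (c + d) \<cdot>\<^sub>v v" "e \<cdot>\<^sub>v (c \<cdot>\<^sub>v v) = (e * c) \<cdot>\<^sub>v v" "0\<^sub>v n = 0 \<cdot>\<^sub>v v" for c d e
    using v by (auto simp: add_smult_distrib_vec smult_smult_assoc)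
  then show ?thesis using v unfolding vsubspace_def by fastforce
qed

lemma line_proper:
  assumes v: "(v :: 'a::field vec) \<in> carrier_vec n" and n: "2 \<le> n"
  shows "range (\<lambda>c. c \<cdot>\<^sub>v v) \<noteq> carrier_vec n"
proof
  assume e: "range (\<lambda>c. c \<cdot>\<^sub>v v) = carrier_vec n"
  have "unit_vec n 0 \<in> range (\<lambda>c. c \<cdot>\<^sub>v v)" "unit_vec n 1 \<in> range (\<lambda>c. c \<cdot>\<^sub>v v)" unfolding e by auto
  then obtain c d where cd: "unit_vec n 0 = c \<cdot>\<^sub>v v" "unit_vec n 1 = d \<cdot>\<^sub>v v" by auto
  have "(unit_vec n 0 :: 'a vec) $ 0 = c * v $ 0" "(unit_vec n 0 :: 'a vec) $ 1 = c * v $ 1"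
    "(unit_vec n 1 :: 'a vec) $ 0 = d * v $ 0" "(unit_vec n 1 :: 'a vec) $ 1 = d * v $ 1"
    using v n unfolding cd by auto
  then show False using n by auto
qed

text \<open>The trace is the sum of the eigenvalues. An eigenvector splits the matrix into two
  smaller diagonal blocks whose characteristic polynomials divide the given one.\<close>

lemma mat_trace_in_subfield:
  assumes k: "subfield_set k" and A: "A \<in> carrier_mat n n"
    and roots: "\<And>x :: 'a::alg_closed_field. poly (char_poly A) x = 0 \<Longrightarrow> x \<in> k"
  shows "mat_trace A \<in> k"
  using A roots
proof (induction n arbitrary: A rule: less_induct)
  case (less n)
  note cl = subring_closed[OF subfield_subring[OF k]]
  consider "n = 0" | "n = 1" | "2 \<le> n" by linarith
  then show ?case
  proof cases
    case 1
    then show ?thesis using less.prems cl by (simp add: mat_trace_def)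
  next
    case 2
    obtain c v where cv: "v \<in> carrier_vec 1" "v \<noteq> 0\<^sub>v 1" "A *\<^sub>v v = c \<cdot>\<^sub>v v" "poly (char_poly A) c = 0"
      using eigenvector_exists[OF less.prems(1)] 2 by auto
    have v0: "v $ 0 \<noteq> 0"
    proof
      assume "v $ 0 = 0"
      then have "v = 0\<^sub>v 1" using cv(1) by (intro eq_vecI) auto
      then show False using cv(2) by simp
    qed
    moreover have "(A *\<^sub>v v) $ 0 = c * v $ 0" using cv by simp
    moreover have "(A *\<^sub>v v) $ 0 = A $$ (0, 0) * v $ 0" using less.prems(1) cv(1) 2 by (simp add: scalar_prod_def)
    ultimately have "A $$ (0, 0) = c" using v0 by simp
    then show ?thesis using less.prems cv(4) 2 by (simp add: mat_trace_def)
  next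
    case 3
    obtain c v where cv: "v \<in> carrier_vec n" "v \<noteq> 0\<^sub>v n" "A *\<^sub>v v = c \<cdot>\<^sub>v v"
      using eigenvector_exists[OF less.prems(1)] 3 by auto
    let ?U = "range (\<lambda>c. c \<cdot>\<^sub>v v)"
    have "v \<in> ?U" by (rule range_eqI[of _ _ 1]) simp
    then have ne: "\<exists>x\<in>?U. x \<noteq> 0\<^sub>v n" using cv(2) by blast
    obtain Q r where Q: "Q \<in> carrier_mat n n" "det Q \<noteq> 0" "0 < r" "r < n"
      and bl: "\<And>A. A \<in> carrier_mat n n \<Longrightarrow> (\<And>x. x \<in> ?U \<Longrightarrow> A *\<^sub>v x \<in> ?U) \<Longrightarrow>
      \<exists>B C D. B \<in> carrier_mat r r \<and> C \<in> carrier_mat r (n - r) \<and> D \<in> carrier_mat (n - r) (n - r) \<and>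
        minv Q * A * Q = four_block_mat B C (0\<^sub>m (n - r) r) D"
      using invariant_subspace_blocks[OF line_subspace[OF cv(1)] ne line_proper[OF cv(1) 3]] by blast
    have "A *\<^sub>v x \<in> ?U" if "x \<in> ?U" for x
    proof -
      obtain e where "x = e \<cdot>\<^sub>v v" using \<open>x \<in> ?U\<close> by auto
      then have "A *\<^sub>v x = (e * c) \<cdot>\<^sub>v v"
        using mult_mat_vec[OF less.prems(1) cv(1), of e] cv(3) by (simp add: smult_smult_assoc)
      then show ?thesis by blast
    qed
    from bl[OF less.prems(1) this] obtain B C D where BCD: "B \<in> carrier_mat r r" "C \<in> carrier_mat r (n - r)" "D \<in> carrier_mat (n - r) (n - r)"
      "minv Q * A * Q = four_block_mat B C (0\<^sub>m (n - r) r) D" by blast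
    have cp: "char_poly A = char_poly B * char_poly D"
      using similar_conj(1)[OF less.prems(1) Q(1,2)] char_poly_block[OF BCD(1-3)] BCD(4) by simp
    have "mat_trace B \<in> k" "mat_trace D \<in> k"
      using less.IH[OF Q(4) BCD(1)] less.IH[OF _ BCD(3)] less.prems(2) cp Q by auto
    moreover have "mat_trace A = mat_trace B + mat_trace D"
      using similar_conj(2)[OF less.prems(1) Q(1,2)] mat_trace_block[OF BCD(1-3)] BCD(4) by simp
    ultimately show ?thesis using cl by simp
  qed
qed

primrec word_prod :: "nat \<Rightarrow> ('s \<Rightarrow> 'a::field mat) \<Rightarrow> 's list \<Rightarrow> 'a mat" where
  "word_prod n f [] = 1\<^sub>m n"
| "word_prod n f (s # u) = f s * word_prod n f u"

lemma word_prod_carrier: "(\<And>s. s \<in> I \<Longrightarrow> f s \<in> carrier_mat n n) \<Longrightarrow> u \<in> lists I \<Longrightarrow> word_prod n f u \<in> carrier_mat n n"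
  by (induction u) (auto intro!: mult_carrier_mat)

lemma word_prod_append: "(\<And>s. s \<in> I \<Longrightarrow> f s \<in> carrier_mat n n) \<Longrightarrow> u \<in> lists I \<Longrightarrow> v \<in> lists I \<Longrightarrow> word_prod n f (u @ v) = word_prod n f u * word_prod n f v"
proof (induction u)
  case Nil
  then show ?case using word_prod_carrier[of I f n v] by simp
next
  case (Cons s u)
  then show ?case using word_prod_carrier[of I f n u] word_prod_carrier[of I f n v]
    by (simp add: assoc_mult_mat[of _ n n _ n _ n])
qed

inductive_set addgen :: "nat \<Rightarrow> nat \<Rightarrow> 'a::field mat set \<Rightarrow> 'a mat set" for r s Z where
  zero: "0\<^sub>m r s \<in> addgen r s Z"
| add: "z \<in> Z \<Longrightarrow> a \<in> addgen r s Z \<Longrightarrow> z + a \<in> addgen r s Z"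

lemma addgen_add:
  assumes Z: "Z \<subseteq> carrier_mat r s"
  shows "a \<in> addgen r s Z \<Longrightarrow> b \<in> addgen r s Z \<Longrightarrow> a + b \<in> addgen r s Z \<and> a \<in> carrier_mat r s"
proof (induction rule: addgen.induct)
  case zero
  have "b \<in> carrier_mat r s" using zero Z by (induction rule: addgen.induct) auto
  then show ?case using zero by simp
next
  case (add z a)
  have "b \<in> carrier_mat r s" using add.prems Z by (induction rule: addgen.induct) auto
  moreover have "z \<in> carrier_mat r s" using add Z by auto
  ultimately have "z + a + b = z + (a + b)" using add.IH[OF add.prems] by (simp add: assoc_add_mat[of _ r s])
  then show ?case using add.IH[OF add.prems] addgen.add[OF add.hyps(1)] \<open>z \<in> carrier_mat r s\<close> by simp
qed

text \<open>Multiplicities of the generators count only modulo the characteristic.\<close>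

lemma addgen_finite:
  assumes ch: "CHAR('a::field) > 0" and Z: "finite Z" "(Z :: 'a mat set) \<subseteq> carrier_mat r s"
  shows "finite (addgen r s Z)"
proof -
  let ?p = "CHAR('a)"
  define g where "g x = mat r s (\<lambda>(i, j). \<Sum>z\<in>Z. of_nat (x z) * z $$ (i, j))" for x :: "'a mat \<Rightarrow> nat"
  let ?X = "PiE Z (\<lambda>_. {0..<?p})"
  have "addgen r s Z \<subseteq> g ` ?X"
  proof
    fix a assume "a \<in> addgen r s Z"
    then show "a \<in> g ` ?X"
    proof (induction rule: addgen.induct)
      case zero
      have "0\<^sub>m r s = g (\<lambda>z\<in>Z. 0)" by (intro eq_matI) (auto simp: g_def)
      moreover have "(\<lambda>z\<in>Z. 0) \<in> ?X" using ch by auto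
      ultimately show ?case by (rule image_eqI)
    next
      case (add z a)
      then obtain x where x: "x \<in> ?X" "a = g x" by auto
      define y where "y = x(z := (x z + 1) mod ?p)"
      have "y \<in> ?X" using x(1) add.hyps(1) ch by (auto simp: y_def PiE_def extensional_def)
      moreover have "z + a = g y"
      proof (rule eq_matI)
        show "dim_row (z + a) = dim_row (g y)" "dim_col (z + a) = dim_col (g y)" by (auto simp: x g_def)
        fix i j assume "i < dim_row (g y)" "j < dim_col (g y)"
        then have ij: "i < r" "j < s" by (auto simp: g_def)
        have ofn: "(of_nat ((x z + 1) mod ?p) :: 'a) = of_nat (x z) + 1"
        proof -
          have "(of_nat (x z + 1) :: 'a) = of_nat ((x z + 1) mod ?p + ?p * ((x z + 1) div ?p))" by simp
          also have "\<dots> = of_nat ((x z + 1) mod ?p)" by (simp only: of_nat_add of_nat_mult of_nat_CHAR) simp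
          finally show ?thesis by (simp add: add.commute)
        qed
        have "g y $$ (i, j) = (\<Sum>z'\<in>Z. of_nat (y z') * z' $$ (i, j))" using ij by (simp add: g_def)
        also have "\<dots> = of_nat (y z) * z $$ (i, j) + (\<Sum>z'\<in>Z - {z}. of_nat (y z') * z' $$ (i, j))"
          using Z add.hyps(1) by (intro sum.remove) auto
        also have "(\<Sum>z'\<in>Z - {z}. of_nat (y z') * z' $$ (i, j)) = (\<Sum>z'\<in>Z - {z}. of_nat (x z') * z' $$ (i, j))"
          by (intro sum.cong) (auto simp: y_def)
        also have "of_nat (y z) * z $$ (i, j) = z $$ (i, j) + of_nat (x z) * z $$ (i, j)"
          using ofn by (simp add: y_def distrib_right)
        also have "z $$ (i, j) + of_nat (x z) * z $$ (i, j) + (\<Sum>z'\<in>Z - {z}. of_nat (x z') * z' $$ (i, j))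
          = z $$ (i, j) + (\<Sum>z'\<in>Z. of_nat (x z') * z' $$ (i, j))"
          using Z add.hyps(1) by (simp add: sum.remove[of Z z] add.assoc)
        finally show "(z + a) $$ (i, j) = g y $$ (i, j)" using ij x(2) by (simp add: g_def)
      qed
      ultimately show ?case by blast
    qed
  qed
  moreover have "finite ?X" using Z by (intro finite_PiE) auto
  ultimately show ?thesis by (meson finite_imageI finite_subset)
qed

text \<open>The upper right block of a product of block triangular matrices.\<close>

primrec corner :: "nat \<Rightarrow> nat \<Rightarrow> ('s \<Rightarrow> 'a::field mat) \<Rightarrow> ('s \<Rightarrow> 'a mat) \<Rightarrow> ('s \<Rightarrow> 'a mat) \<Rightarrow> 's list \<Rightarrow> 'a mat" where
  "corner r q B C D [] = 0\<^sub>m r q"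
| "corner r q B C D (s # u) = B s * corner r q B C D u + C s * word_prod q D u"

lemma word_prod_cong: "(\<And>s. s \<in> I \<Longrightarrow> f s = g s) \<Longrightarrow> u \<in> lists I \<Longrightarrow> word_prod n f u = word_prod n g u"
  by (induction u) auto

lemma word_prod_block:
  assumes B: "\<And>s. s \<in> I \<Longrightarrow> B s \<in> carrier_mat r r" and C: "\<And>s. s \<in> I \<Longrightarrow> C s \<in> carrier_mat r q"
    and D: "\<And>s. s \<in> I \<Longrightarrow> D s \<in> carrier_mat q q" and u: "u \<in> lists I"
  shows "corner r q B C D u \<in> carrier_mat r q \<and>
    word_prod (r + q) (\<lambda>s. four_block_mat (B s) (C s) (0\<^sub>m q r) (D s)) u =
      four_block_mat (word_prod r B u) (corner r q B C D u) (0\<^sub>m q r) (word_prod q D u)"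
  using u
proof (induction u)
  case Nil
  show ?case by (auto intro!: eq_matI)
next
  case (Cons s u)
  note w = word_prod_carrier[of I B r u, OF B] word_prod_carrier[of I D q u, OF D]
  have c: "B s \<in> carrier_mat r r" "C s \<in> carrier_mat r q" "D s \<in> carrier_mat q q"
    "word_prod r B u \<in> carrier_mat r r" "word_prod q D u \<in> carrier_mat q q" "corner r q B C D u \<in> carrier_mat r q"
    using Cons B C D w by auto
  have "four_block_mat (B s) (C s) (0\<^sub>m q r) (D s) * four_block_mat (word_prod r B u) (corner r q B C D u) (0\<^sub>m q r) (word_prod q D u)
    = four_block_mat (B s * word_prod r B u + C s * 0\<^sub>m q r) (B s * corner r q B C D u + C s * word_prod q D u)
        (0\<^sub>m q r * word_prod r B u + D s * 0\<^sub>m q r) (0\<^sub>m q r * corner r q B C D u + D s * word_prod q D u)"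
    using c by (intro mult_four_block_mat) auto
  also have "B s * word_prod r B u + C s * 0\<^sub>m q r = B s * word_prod r B u"
    using c by (simp add: right_mult_zero_mat[of _ r q] right_add_zero_mat[of _ r r])
  also have "0\<^sub>m q r * word_prod r B u + D s * 0\<^sub>m q r = 0\<^sub>m q r"
    using c by (simp add: left_mult_zero_mat[of _ r r] right_mult_zero_mat[of _ q q])
  also have "0\<^sub>m q r * corner r q B C D u + D s * word_prod q D u = D s * word_prod q D u"
    using c by (simp add: left_mult_zero_mat[of _ r q] left_add_zero_mat[of _ q q])
  finally show ?case using Cons c by auto
qed

lemma word_prod_conj:
  assumes Q: "Q \<in> carrier_mat n n" "det Q \<noteq> (0::'a::field)" and f: "\<And>s. s \<in> I \<Longrightarrow> f s \<in> carrier_mat n n"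
    and u: "u \<in> lists I"
  shows "word_prod n (\<lambda>s. minv Q * f s * Q) u = minv Q * word_prod n f u * Q"
  using u
proof (induction u)
  case Nil
  then show ?case using minv[OF Q] Q by simp
next
  case (Cons s u)
  note m = minv[OF Q]
  have c: "f s \<in> carrier_mat n n" "word_prod n f u \<in> carrier_mat n n" using Cons f word_prod_carrier[of I f n u, OF f] by auto
  have "minv Q * f s * Q * (minv Q * word_prod n f u * Q) = minv Q * f s * (Q * minv Q) * word_prod n f u * Q"
    using c m(1) Q by (simp add: assoc_mult_mat[of _ n n _ n _ n])
  also have "\<dots> = minv Q * (f s * word_prod n f u) * Q" using c m Q by (simp add: assoc_mult_mat[of _ n n _ n _ n])
  finally show ?case using Cons by simp
qed

text \<open>Each letter \<open>s\<close> of the word contributes one summand: the \<open>B\<close>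
  product of the letters before it, then \<open>C s\<close>, then the \<open>D\<close> product of
  the letters after it.\<close>

lemma corner_addgen:
  assumes B: "\<And>s. s \<in> I \<Longrightarrow> B s \<in> carrier_mat r r" and C: "\<And>s. s \<in> I \<Longrightarrow> C s \<in> carrier_mat r q"
    and D: "\<And>s. s \<in> I \<Longrightarrow> D s \<in> carrier_mat q q" and u: "u \<in> lists I"
    and Z: "Z = (\<lambda>(b, s, d). b * C s * d) ` (word_prod r B ` lists I \<times> I \<times> word_prod q D ` lists I)"
  shows "corner r q B C D u \<in> addgen r q Z"
proof -
  note wB = word_prod_carrier[of I B r, OF B] and wD = word_prod_carrier[of I D q, OF D]
  have Zc: "Z \<subseteq> carrier_mat r q"
  proof
    fix z assume "z \<in> Z"
    then obtain v t w where z: "z = word_prod r B v * C t * word_prod q D w" "v \<in> lists I" "t \<in> I" "w \<in> lists I"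
      unfolding Z by auto
    show "z \<in> carrier_mat r q" unfolding z(1)
      by (rule mult_carrier_mat[OF mult_carrier_mat[OF wB[OF _ z(2)] C[OF z(3)]] wD[OF _ z(4)]])
  qed
  have inZ: "word_prod r B v * C t * word_prod q D w \<in> Z" if v: "v \<in> lists I" and t: "t \<in> I" and w: "w \<in> lists I" for v t w
  proof -
    have "(word_prod r B v, t, word_prod q D w) \<in> word_prod r B ` lists I \<times> I \<times> word_prod q D ` lists I"
      using v t w by (intro SigmaI imageI)
    then show ?thesis unfolding Z by (rule image_eqI[rotated]) simp
  qed
  have left: "B s * a \<in> addgen r q Z \<and> a \<in> carrier_mat r q" if a: "a \<in> addgen r q Z" and s: "s \<in> I" for a s
    using a
  proof (induction rule: addgen.induct)
    case zero
    show ?case using B[OF s] addgen.zero[of r q Z] by (simp add: right_mult_zero_mat[of _ r r])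
  next
    case (add z a)
    obtain v t w where z: "z = word_prod r B v * C t * word_prod q D w" "v \<in> lists I" "t \<in> I" "w \<in> lists I"
      using add.hyps(1) unfolding Z by auto
    have c: "word_prod r B v \<in> carrier_mat r r" "word_prod q D w \<in> carrier_mat q q" "C t \<in> carrier_mat r q" "B s \<in> carrier_mat r r"
      using z wB wD C B s by auto
    have zc: "z \<in> carrier_mat r q" using z c by simp
    have "B s * z = word_prod r B (s # v) * C t * word_prod q D w"
    proof -
      have "B s * z = B s * (word_prod r B v * C t) * word_prod q D w" unfolding z(1) using c by (intro assoc_mult_mat[symmetric]) auto
      also have "B s * (word_prod r B v * C t) = B s * word_prod r B v * C t" using c by (intro assoc_mult_mat[symmetric]) auto
      finally show ?thesis by simp
    qed
    moreover have "s # v \<in> lists I" using s z by auto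
    ultimately have "B s * z \<in> Z" using inZ[of "s # v" t w] z by simp
    moreover have "B s * (z + a) = B s * z + B s * a" using c zc add.IH by (intro mult_add_distrib_mat) auto
    ultimately show ?case using add.IH zc by (auto intro: addgen.add)
  qed
  show ?thesis using u
  proof (induction u)
    case Nil
    show ?case by (simp add: addgen.zero)
  next
    case (Cons s u)
    have c: "C s * word_prod q D u \<in> carrier_mat r q" using Cons by (intro mult_carrier_mat[OF C wD]) auto
    have "1\<^sub>m r * C s * word_prod q D u \<in> Z" using inZ[of "[]" s u] Cons by simp
    then have "C s * word_prod q D u \<in> Z" using Cons C[of s] by (simp add: left_mult_one_mat[of _ r q])
    from addgen.add[OF this addgen.zero[of r q Z]] have "C s * word_prod q D u \<in> addgen r q Z"
      using c by (simp add: right_add_zero_mat[of _ r q])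
    moreover have "B s * corner r q B C D u \<in> addgen r q Z" using left Cons by auto
    ultimately show ?case using addgen_add[OF Zc] by auto
  qed
qed

text \<open>Required of all words and not just of the generators, so that it controls traces of
  products and passes to the diagonal blocks.\<close>

definition roots_aa :: "nat \<Rightarrow> ('s \<Rightarrow> 'a::field mat) \<Rightarrow> 's set \<Rightarrow> bool" where
  "roots_aa n f I \<longleftrightarrow> (\<forall>u\<in>lists I. \<forall>x. poly (char_poly (word_prod n f u)) x = 0 \<longrightarrow> x \<in> absolutely_algebraic)"

text \<open>Characteristic polynomials of block triangular matrices are products, so the diagonal
  blocks inherit the hypothesis and take finitely many values. The corners are then sums of finitely
  many matrices with repetition, of which positive characteristic leaves finitely many.\<close>

lemma reducible_step:
  fixes f :: "'s \<Rightarrow> 'a::field mat"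
  assumes ch: "CHAR('a) > 0" and I: "finite I" and f: "\<And>s. s \<in> I \<Longrightarrow> f s \<in> carrier_mat n n"
    and U: "vsubspace n U" "\<exists>x\<in>U. x \<noteq> 0\<^sub>v n" "U \<noteq> carrier_vec n"
    and inv: "\<And>s x. s \<in> I \<Longrightarrow> x \<in> U \<Longrightarrow> f s *\<^sub>v x \<in> U"
    and roots: "roots_aa n f I"
    and IH: "\<And>m (g :: 's \<Rightarrow> 'a mat). m < n \<Longrightarrow> (\<And>s. s \<in> I \<Longrightarrow> g s \<in> carrier_mat m m) \<Longrightarrow> roots_aa m g I \<Longrightarrow> finite (word_prod m g ` lists I)"
  shows "finite (word_prod n f ` lists I)"
proof -
  obtain Q r where Q: "Q \<in> carrier_mat n n" "det Q \<noteq> 0" "0 < r" "r < n"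
      and bl: "\<And>A. A \<in> carrier_mat n n \<Longrightarrow> (\<And>x. x \<in> U \<Longrightarrow> A *\<^sub>v x \<in> U) \<Longrightarrow>
      \<exists>B C D. B \<in> carrier_mat r r \<and> C \<in> carrier_mat r (n - r) \<and> D \<in> carrier_mat (n - r) (n - r) \<and>
        minv Q * A * Q = four_block_mat B C (0\<^sub>m (n - r) r) D"
    using invariant_subspace_blocks[OF U] by blast
  define q where "q = n - r"
  have n: "n = r + q" "q < n" using Q by (auto simp: q_def)
  have "\<forall>s\<in>I. \<exists>B C D. B \<in> carrier_mat r r \<and> C \<in> carrier_mat r q \<and> D \<in> carrier_mat q q \<and>
        minv Q * f s * Q = four_block_mat B C (0\<^sub>m q r) D"
    using bl[OF f inv] unfolding q_def by auto
  from bchoice[OF this] obtain B where "\<forall>s\<in>I. \<exists>C D. B s \<in> carrier_mat r r \<and> C \<in> carrier_mat r q \<and> D \<in> carrier_mat q q \<and>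
        minv Q * f s * Q = four_block_mat (B s) C (0\<^sub>m q r) D" by (elim exE)
  from bchoice[OF this] obtain C where "\<forall>s\<in>I. \<exists>D. B s \<in> carrier_mat r r \<and> C s \<in> carrier_mat r q \<and> D \<in> carrier_mat q q \<and>
        minv Q * f s * Q = four_block_mat (B s) (C s) (0\<^sub>m q r) D" by (elim exE)
  from bchoice[OF this] obtain D where BCD: "\<forall>s\<in>I. B s \<in> carrier_mat r r \<and> C s \<in> carrier_mat r q \<and> D s \<in> carrier_mat q q \<and>
        minv Q * f s * Q = four_block_mat (B s) (C s) (0\<^sub>m q r) (D s)" by (elim exE)
  have B: "\<And>s. s \<in> I \<Longrightarrow> B s \<in> carrier_mat r r" and C: "\<And>s. s \<in> I \<Longrightarrow> C s \<in> carrier_mat r q"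
    and D: "\<And>s. s \<in> I \<Longrightarrow> D s \<in> carrier_mat q q" using BCD by auto
  have blk: "minv Q * word_prod n f u * Q = four_block_mat (word_prod r B u) (corner r q B C D u) (0\<^sub>m q r) (word_prod q D u)" if u: "u \<in> lists I" for u
  proof -
    have "minv Q * word_prod n f u * Q = word_prod n (\<lambda>s. minv Q * f s * Q) u" using word_prod_conj[OF Q(1,2) f u] by simp
    also have "\<dots> = word_prod n (\<lambda>s. four_block_mat (B s) (C s) (0\<^sub>m q r) (D s)) u"
      using BCD u by (intro word_prod_cong[of I]) auto
    also have "\<dots> = four_block_mat (word_prod r B u) (corner r q B C D u) (0\<^sub>m q r) (word_prod q D u)"
      using word_prod_block[of I B r C q D u] B C D u n(1) by simp
    finally show ?thesis .
  qed
  have wc: "word_prod n f u \<in> carrier_mat n n" "word_prod r B u \<in> carrier_mat r r" "word_prod q D u \<in> carrier_mat q q" "corner r q B C D u \<in> carrier_mat r q"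
    if u: "u \<in> lists I" for u
    using word_prod_carrier[of I f n u] word_prod_carrier[of I B r u] word_prod_carrier[of I D q u] word_prod_block[of I B r C q D u] f B C D u by auto
  have cp: "char_poly (word_prod n f u) = char_poly (word_prod r B u) * char_poly (word_prod q D u)" if u: "u \<in> lists I" for u
    using similar_conj(1)[OF wc(1)[OF u] Q(1,2)] char_poly_block[OF wc(2)[OF u] wc(4)[OF u] wc(3)[OF u]]
    unfolding blk[OF u] by simp
  have "roots_aa r B I" "roots_aa q D I" using roots cp unfolding roots_aa_def by auto
  then have fin: "finite (word_prod r B ` lists I)" "finite (word_prod q D ` lists I)" using IH B D Q n by blast+
  define Z where "Z = (\<lambda>(b, s, d). b * C s * d) ` (word_prod r B ` lists I \<times> I \<times> word_prod q D ` lists I)"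
  have Zf: "finite Z" unfolding Z_def using fin I by blast
  have Zc: "Z \<subseteq> carrier_mat r q"
  proof
    fix z assume "z \<in> Z"
    then obtain v t w where z: "z = word_prod r B v * C t * word_prod q D w" "v \<in> lists I" "t \<in> I" "w \<in> lists I"
      unfolding Z_def by auto
    show "z \<in> carrier_mat r q" unfolding z(1)
      by (rule mult_carrier_mat[OF mult_carrier_mat[OF wc(2)[OF z(2)] C[OF z(3)]] wc(3)[OF z(4)]])
  qed
  have fc: "finite (addgen r q Z)" by (rule addgen_finite[OF ch Zf Zc])
  have "word_prod n f ` lists I \<subseteq> (\<lambda>(b, c, d). Q * four_block_mat b c (0\<^sub>m q r) d * minv Q) `
      (word_prod r B ` lists I \<times> addgen r q Z \<times> word_prod q D ` lists I)"
  proof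
    fix x assume "x \<in> word_prod n f ` lists I"
    then obtain u where u: "u \<in> lists I" "x = word_prod n f u" by blast
    note m = minv[OF Q(1,2)]
    have "Q * (minv Q * word_prod n f u * Q) * minv Q = (Q * minv Q) * word_prod n f u * (Q * minv Q)"
      using wc(1)[OF u(1)] m(1) Q(1) by (simp add: assoc_mult_mat[of _ n n _ n _ n])
    also have "\<dots> = x" using m u(2) wc(1)[OF u(1)] by simp
    finally have "x = Q * four_block_mat (word_prod r B u) (corner r q B C D u) (0\<^sub>m q r) (word_prod q D u) * minv Q"
      unfolding blk[OF u(1)] by simp
    moreover have "corner r q B C D u \<in> addgen r q Z" using corner_addgen[of I B r C q D u Z] B C D u Z_def by simp
    ultimately show "x \<in> (\<lambda>(b, c, d). Q * four_block_mat b c (0\<^sub>m q r) d * minv Q) `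
      (word_prod r B ` lists I \<times> addgen r q Z \<times> word_prod q D ` lists I)"
      using u(1) by (intro image_eqI[of _ _ "(word_prod r B u, corner r q B C D u, word_prod q D u)"]) auto
  qed
  moreover have "finite ((\<lambda>(b, c, d). Q * four_block_mat b c (0\<^sub>m q r) d * minv Q) `
      (word_prod r B ` lists I \<times> addgen r q Z \<times> word_prod q D ` lists I))" using fin fc by blast
  ultimately show ?thesis by (rule finite_subset)
qed

lemma mat_trace_add: "A \<in> carrier_mat n n \<Longrightarrow> B \<in> carrier_mat n n \<Longrightarrow> mat_trace (A + B) = mat_trace A + mat_trace B"
  by (simp add: mat_trace_def sum.distrib)

lemma mat_trace_smult: "A \<in> carrier_mat n n \<Longrightarrow> mat_trace (c \<cdot>\<^sub>m A) = c * mat_trace A"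
  by (simp add: mat_trace_def sum_distrib_left)

lemma mat_mult_zero_vec: "(A :: 'a::field mat) \<in> carrier_mat n m \<Longrightarrow> A *\<^sub>v 0\<^sub>v m = 0\<^sub>v n"
  by (intro eq_vecI) auto

text \<open>In a basis starting with a kernel vector the first column of the matrix vanishes, so the
  matrix factors through the remaining \<open>d\<close> coordinates.\<close>

lemma singular_factor:
  fixes N :: "'a::field mat"
  assumes N: "N \<in> carrier_mat (Suc d) (Suc d)" and v: "v \<in> carrier_vec (Suc d)" "v \<noteq> 0\<^sub>v (Suc d)" "N *\<^sub>v v = 0\<^sub>v (Suc d)"
  shows "\<exists>L R. L \<in> carrier_mat (Suc d) d \<and> R \<in> carrier_mat d (Suc d) \<and> N = L * R"
proof -
  let ?U = "range (\<lambda>c. c \<cdot>\<^sub>v v)"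
  obtain Q r where Q0: "Q \<in> carrier_mat (Suc d) (Suc d) \<and> det Q \<noteq> 0 \<and> r \<le> Suc d \<and> (\<forall>j<r. col Q j \<in> ?U) \<and>
    (\<forall>x\<in>?U. \<forall>i. r \<le> i \<longrightarrow> i < Suc d \<longrightarrow> (minv Q *\<^sub>v x) $ i = 0)"
    using adapted_basis[OF line_subspace[OF v(1)]] by (elim exE)
  then have Q: "Q \<in> carrier_mat (Suc d) (Suc d)" "det Q \<noteq> 0" by auto
  note m = minv[OF Q]
  have vU: "v \<in> ?U" by (rule range_eqI[of _ _ 1]) simp
  have "0 < r"
  proof (rule ccontr)
    assume "\<not> 0 < r"
    then have "\<forall>i<Suc d. (minv Q *\<^sub>v v) $ i = 0" using Q0 vU by blast
    then have "minv Q *\<^sub>v v = 0\<^sub>v (Suc d)" using m by (intro eq_vecI) auto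
    then have "(Q * minv Q) *\<^sub>v v = 0\<^sub>v (Suc d)" using assoc_mult_mat_vec[OF Q(1) m(1) v(1)] mat_mult_zero_vec[OF Q(1)] by simp
    then show False using m v by simp
  qed
  then have "col Q 0 \<in> ?U" using Q0 by blast
  then obtain c where c: "col Q 0 = c \<cdot>\<^sub>v v" by blast
  define P where "P = N * Q"
  have P: "P \<in> carrier_mat (Suc d) (Suc d)" using N Q by (simp add: P_def)
  have "col P 0 = N *\<^sub>v col Q 0" unfolding P_def using N Q by (intro col_mult2) auto
  also have "\<dots> = 0\<^sub>v (Suc d)" unfolding c mult_mat_vec[OF N v(1)] v(3) by (intro eq_vecI) auto
  finally have c0: "col P 0 = 0\<^sub>v (Suc d)" .
  have P0: "P $$ (a, 0) = 0" if a: "a < Suc d" for a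
  proof -
    have "P $$ (a, 0) = col P 0 $ a" using P a by simp
    then show ?thesis using c0 a by simp
  qed
  define L where "L = mat (Suc d) d (\<lambda>(a, j). P $$ (a, Suc j))"
  define R where "R = mat d (Suc d) (\<lambda>(j, b). minv Q $$ (Suc j, b))"
  have "N = P * minv Q" unfolding P_def using assoc_mult_mat[OF N Q(1) m(1)] m N by simp
  also have "\<dots> = L * R"
  proof (rule eq_matI)
    fix a b assume "a < dim_row (L * R)" "b < dim_col (L * R)"
    then have ab: "a < Suc d" "b < Suc d" by (auto simp: L_def R_def)
    have "(P * minv Q) $$ (a, b) = (\<Sum>j = 0..<Suc d. P $$ (a, j) * minv Q $$ (j, b))"
      using P m ab by (simp add: scalar_prod_def)
    also have "\<dots> = (\<Sum>j = 0..<d. P $$ (a, Suc j) * minv Q $$ (Suc j, b))"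
      using P0[OF ab(1)] by (simp only: sum.atLeast0_lessThan_Suc_shift) (simp add: o_def)
    also have "\<dots> = (L * R) $$ (a, b)" using ab by (simp add: scalar_prod_def L_def R_def)
    finally show "(P * minv Q) $$ (a, b) = (L * R) $$ (a, b)" .
  qed (use P m in \<open>auto simp: L_def R_def\<close>)
  finally show ?thesis by (intro exI[of _ L] exI[of _ R]) (simp add: L_def R_def)
qed

text \<open>Both factors are padded with zeros to square matrices, and a padded column kills the
  determinant.\<close>

lemma det_product_low_rank:
  fixes L :: "'a::field mat"
  assumes L: "L \<in> carrier_mat D m" and R: "R \<in> carrier_mat m D" and "m < D"
  shows "det (L * R) = 0"
proof -
  define L' where "L' = mat D D (\<lambda>(i, j). if j < m then L $$ (i, j) else 0)"
  define R' where "R' = mat D D (\<lambda>(i, j). if i < m then R $$ (i, j) else 0)"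
  have c: "L' \<in> carrier_mat D D" "R' \<in> carrier_mat D D" by (auto simp: L'_def R'_def)
  have "L * R = L' * R'"
  proof (rule eq_matI)
    fix i j assume "i < dim_row (L' * R')" "j < dim_col (L' * R')"
    then have ij: "i < D" "j < D" by (auto simp: L'_def R'_def)
    have "(L' * R') $$ (i, j) = (\<Sum>k = 0..<D. L' $$ (i, k) * R' $$ (k, j))" using c ij by (simp add: scalar_prod_def)
    also have "\<dots> = (\<Sum>k = 0..<m. L $$ (i, k) * R $$ (k, j))"
      using \<open>m < D\<close> ij by (intro sum.mono_neutral_cong_right) (auto simp: L'_def R'_def)
    also have "\<dots> = (L * R) $$ (i, j)" using L R ij by (simp add: scalar_prod_def)
    finally show "(L * R) $$ (i, j) = (L' * R') $$ (i, j)" by simp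
  qed (use L R c in auto)
  moreover have "det L' = 0"
  proof -
    have "L' *\<^sub>v unit_vec D m = 0\<^sub>v D"
      using \<open>m < D\<close> c(1) by (intro eq_vecI) (auto simp: L'_def scalar_prod_right_unit[of _ D])
    moreover have "unit_vec D m \<noteq> (0\<^sub>v D :: 'a vec)" using \<open>m < D\<close> by simp
    ultimately show ?thesis using det_0_iff_vec_prod_zero_field[OF c(1)] unit_vec_carrier by blast
  qed
  ultimately show ?thesis using c by (simp add: det_mult)
qed

section \<open>The algebra spanned by the words and its trace form\<close>

inductive_set wspan :: "nat \<Rightarrow> ('s \<Rightarrow> 'a::field mat) \<Rightarrow> 's set \<Rightarrow> 'a mat set" for n f I where
  zero: "0\<^sub>m n n \<in> wspan n f I"
| add: "u \<in> lists I \<Longrightarrow> a \<in> wspan n f I \<Longrightarrow> c \<cdot>\<^sub>m word_prod n f u + a \<in> wspan n f I"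

locale mat_gens =
  fixes n :: nat and f :: "'s \<Rightarrow> 'a::field mat" and I :: "'s set"
  assumes f: "s \<in> I \<Longrightarrow> f s \<in> carrier_mat n n"
begin

lemma gen_word_carrier: "u \<in> lists I \<Longrightarrow> word_prod n f u \<in> carrier_mat n n"
  using word_prod_carrier[of I f n u] f by blast

lemma wspan_carrier: "a \<in> wspan n f I \<Longrightarrow> a \<in> carrier_mat n n"
  by (induction rule: wspan.induct) (auto simp: gen_word_carrier)

lemma wspan_word_prod: "u \<in> lists I \<Longrightarrow> word_prod n f u \<in> wspan n f I"
proof -
  assume u: "u \<in> lists I"
  have "1 \<cdot>\<^sub>m word_prod n f u + 0\<^sub>m n n = word_prod n f u" using gen_word_carrier[OF u] by (intro eq_matI) auto
  then show ?thesis using wspan.add[OF u wspan.zero, where c = 1 and f = f and n = n] by simp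
qed

lemma wspan_add: "a \<in> wspan n f I \<Longrightarrow> b \<in> wspan n f I \<Longrightarrow> a + b \<in> wspan n f I"
proof (induction rule: wspan.induct)
  case zero
  then show ?case using wspan_carrier by simp
next
  case (add u a c)
  have "c \<cdot>\<^sub>m word_prod n f u + a + b = c \<cdot>\<^sub>m word_prod n f u + (a + b)"
    using gen_word_carrier[OF add.hyps(1)] wspan_carrier[OF add.hyps(2)] wspan_carrier[OF add.prems] by (intro assoc_add_mat) auto
  then show ?case using wspan.add[OF add.hyps(1) add.IH[OF add.prems]] by simp
qed

lemma wspan_smult: "a \<in> wspan n f I \<Longrightarrow> c \<cdot>\<^sub>m a \<in> wspan n f I"
proof (induction rule: wspan.induct)
  case zero
  have "c \<cdot>\<^sub>m 0\<^sub>m n n = (0\<^sub>m n n :: 'a mat)" by (intro eq_matI) auto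
  then show ?case using wspan.zero by simp
next
  case (add u a d)
  have "c \<cdot>\<^sub>m (d \<cdot>\<^sub>m word_prod n f u + a) = (c * d) \<cdot>\<^sub>m word_prod n f u + c \<cdot>\<^sub>m a"
    using gen_word_carrier[OF add.hyps(1)] wspan_carrier[OF add.hyps(2)] by (intro eq_matI) (auto simp: algebra_simps)
  then show ?case using wspan.add[OF add.hyps(1) add.IH] by simp
qed

lemma wspan_word_prod_mult: "a \<in> wspan n f I \<Longrightarrow> v \<in> lists I \<Longrightarrow> word_prod n f v * a \<in> wspan n f I"
proof (induction rule: wspan.induct)
  case zero
  then show ?case using gen_word_carrier wspan.zero by (simp add: right_mult_zero_mat[of _ n n])
next
  case (add u a c)
  have w: "word_prod n f v * word_prod n f u = word_prod n f (v @ u)" "v @ u \<in> lists I" using word_prod_append[of I f n v u] f add by auto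
  have "word_prod n f v * (c \<cdot>\<^sub>m word_prod n f u + a) = word_prod n f v * (c \<cdot>\<^sub>m word_prod n f u) + word_prod n f v * a"
    using gen_word_carrier[OF add.hyps(1)] gen_word_carrier[OF add.prems] wspan_carrier[OF add.hyps(2)] by (intro mult_add_distrib_mat) auto
  also have "word_prod n f v * (c \<cdot>\<^sub>m word_prod n f u) = c \<cdot>\<^sub>m word_prod n f (v @ u)"
    using w(1) gen_word_carrier[OF add.hyps(1)] gen_word_carrier[OF add.prems] by (simp add: mult_smult_distrib)
  finally show ?case using wspan.add[OF w(2) add.IH[OF add.prems]] by simp
qed

lemma wspan_mult: "a \<in> wspan n f I \<Longrightarrow> b \<in> wspan n f I \<Longrightarrow> a * b \<in> wspan n f I"
proof (induction rule: wspan.induct)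
  case zero
  then show ?case using wspan_carrier wspan.zero by (simp add: left_mult_zero_mat[of _ n n])
next
  case (add u a c)
  note bc = wspan_carrier[OF add.prems]
  have "(c \<cdot>\<^sub>m word_prod n f u + a) * b = c \<cdot>\<^sub>m word_prod n f u * b + a * b"
    using gen_word_carrier[OF add.hyps(1)] bc wspan_carrier[OF add.hyps(2)] by (intro add_mult_distrib_mat) auto
  also have "c \<cdot>\<^sub>m word_prod n f u * b = c \<cdot>\<^sub>m (word_prod n f u * b)"
    using gen_word_carrier[OF add.hyps(1)] bc by (intro mult_smult_assoc_mat)
  finally show ?case using wspan_add[OF wspan_smult[OF wspan_word_prod_mult[OF add.prems add.hyps(1)]] add.IH[OF add.prems]] by simp
qed

definition irr :: bool where
  "irr \<longleftrightarrow> (\<forall>U. vsubspace n U \<longrightarrow> (\<forall>s\<in>I. \<forall>x\<in>U. f s *\<^sub>v x \<in> U) \<longrightarrow> (\<exists>x\<in>U. x \<noteq> 0\<^sub>v n) \<longrightarrow> U = carrier_vec n)"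

text \<open>The images of \<open>u\<close> under the algebra form an invariant subspace containing
  \<open>u\<close>.\<close>

lemma wspan_transitive:
  assumes irr and u: "u \<in> carrier_vec n" "u \<noteq> 0\<^sub>v n" and v: "v \<in> carrier_vec n"
  shows "\<exists>x\<in>wspan n f I. x *\<^sub>v u = v"
proof -
  let ?U = "(\<lambda>x. x *\<^sub>v u) ` wspan n f I"
  have cl: "x *\<^sub>v u + y *\<^sub>v u = (x + y) *\<^sub>v u" "c \<cdot>\<^sub>v (x *\<^sub>v u) = (c \<cdot>\<^sub>m x) *\<^sub>v u" "x * y *\<^sub>v u = x *\<^sub>v (y *\<^sub>v u)"
    if "x \<in> wspan n f I" "y \<in> wspan n f I" for x y c
    using u wspan_carrier[OF \<open>x \<in> wspan n f I\<close>] wspan_carrier[OF \<open>y \<in> wspan n f I\<close>]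
    by (auto simp: add_mult_distrib_mat_vec[of _ n n] intro!: eq_vecI)
  have z: "0\<^sub>v n = 0\<^sub>m n n *\<^sub>v u" using u by (intro eq_vecI) (auto simp: scalar_prod_def)
  have "vsubspace n ?U"
    unfolding vsubspace_def
  proof (intro conjI ballI allI)
    show "?U \<subseteq> carrier_vec n" using u wspan_carrier by fastforce
    show "0\<^sub>v n \<in> ?U" unfolding z using wspan.zero by (rule imageI)
  next
    fix p q assume "p \<in> ?U" "q \<in> ?U"
    then obtain x y where "x \<in> wspan n f I" "y \<in> wspan n f I" "p = x *\<^sub>v u" "q = y *\<^sub>v u" by blast
    then show "p + q \<in> ?U" using cl(1)[of x y] wspan_add[of x y] by auto
  next
    fix c p assume "p \<in> ?U"
    then obtain x where "x \<in> wspan n f I" "p = x *\<^sub>v u" by blast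
    then show "c \<cdot>\<^sub>v p \<in> ?U" using cl(2)[of x x c] wspan_smult[of x c] by auto
  qed
  moreover have "f s *\<^sub>v p \<in> ?U" if s: "s \<in> I" and p: "p \<in> ?U" for s p
  proof -
    obtain x where x: "x \<in> wspan n f I" "p = x *\<^sub>v u" using p by blast
    have "word_prod n f [s] = f s" using f[OF s] by (simp add: right_mult_one_mat[of _ n n])
    then have fs: "f s \<in> wspan n f I" using wspan_word_prod[of "[s]"] s by simp
    have "f s *\<^sub>v p = (f s * x) *\<^sub>v u" using cl(3)[OF fs x(1)] x(2) by simp
    then show ?thesis using wspan_mult[OF fs x(1)] by blast
  qed
  moreover have "\<exists>x\<in>?U. x \<noteq> 0\<^sub>v n"
  proof -
    have "1\<^sub>m n \<in> wspan n f I" using wspan_word_prod[of "[]"] by simp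
    moreover have "1\<^sub>m n *\<^sub>v u \<noteq> 0\<^sub>v n" using u by simp
    ultimately show ?thesis by blast
  qed
  ultimately have "?U = carrier_vec n" using \<open>irr\<close> unfolding irr_def by blast
  then have "v \<in> ?U" using v by simp
  then show ?thesis by auto
qed

lemma wspan_trace_zero:
  assumes z: "z \<in> carrier_mat n n" and t: "\<And>u. u \<in> lists I \<Longrightarrow> mat_trace (word_prod n f u * z) = 0" and y: "y \<in> wspan n f I"
  shows "mat_trace (y * z) = 0"
  using y
proof (induction rule: wspan.induct)
  case zero
  then show ?case using z by (simp add: left_mult_zero_mat[of _ n n] mat_trace_def)
next
  case (add u a c)
  have "(c \<cdot>\<^sub>m word_prod n f u + a) * z = c \<cdot>\<^sub>m word_prod n f u * z + a * z"
    using gen_word_carrier[OF add.hyps(1)] z wspan_carrier[OF add.hyps(2)] by (intro add_mult_distrib_mat) auto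
  also have "c \<cdot>\<^sub>m word_prod n f u * z = c \<cdot>\<^sub>m (word_prod n f u * z)"
    using gen_word_carrier[OF add.hyps(1)] z by (intro mult_smult_assoc_mat)
  finally show ?case using gen_word_carrier[OF add.hyps(1)] z wspan_carrier[OF add.hyps(2)] add.IH t[OF add.hyps(1)]
    by (simp add: mat_trace_add[of _ n] mat_trace_smult[of _ n])
qed

end

lemma nonzero_mat_vec:
  fixes M :: "'a::field mat"
  assumes M: "M \<in> carrier_mat n n" "M \<noteq> 0\<^sub>m n n"
  shows "\<exists>q\<in>carrier_vec n. M *\<^sub>v q \<noteq> 0\<^sub>v n"
proof -
  obtain i j where ij: "i < n" "j < n" "M $$ (i, j) \<noteq> 0"
    using M by (metis eq_matI carrier_matD index_zero_mat)
  have "(M *\<^sub>v unit_vec n j) $ i = M $$ (i, j)"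
    using M ij by (simp add: scalar_prod_right_unit[of _ n])
  then have "M *\<^sub>v unit_vec n j \<noteq> 0\<^sub>v n" using ij by auto
  then show ?thesis using unit_vec_carrier by blast
qed

lemma mat_eq_smultI:
  fixes A :: "'a::field mat"
  assumes "A \<in> carrier_mat n n" "B \<in> carrier_mat n n" "A + (- c) \<cdot>\<^sub>m B = 0\<^sub>m n n"
  shows "A = c \<cdot>\<^sub>m B"
proof (rule eq_matI)
  fix i j assume "i < dim_row (c \<cdot>\<^sub>m B)" "j < dim_col (c \<cdot>\<^sub>m B)"
  then have ij: "i < n" "j < n" using assms by auto
  have "(A + (- c) \<cdot>\<^sub>m B) $$ (i, j) = 0" unfolding assms(3) using ij by simp
  then show "A $$ (i, j) = (c \<cdot>\<^sub>m B) $$ (i, j)" using assms(1,2) ij by simp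
qed (use assms in auto)

locale irr_gens = mat_gens n f I for n and f :: "'s \<Rightarrow> 'a::alg_closed_field mat" and I +
  assumes n: "n > 0" and irr: irr
begin

text \<open>Take a nonzero \<open>T = L * R\<close> factoring through the least dimension
  \<open>d\<close>. For each \<open>A\<close> the matrix \<open>R * A * L\<close> has an eigenvalue
  \<open>c\<close>; subtracting it leaves a singular matrix, so \<open>T * A * T\<close> minus
  \<open>c\<close> times \<open>T\<close> factors through a smaller dimension and must
  vanish.\<close>

lemma rank_one_element:
  obtains T where "T \<in> wspan n f I" "T \<noteq> 0\<^sub>m n n" "\<And>A. A \<in> wspan n f I \<Longrightarrow> \<exists>c. T * A * T = c \<cdot>\<^sub>m T"
proof -
  define P where "P d \<longleftrightarrow> (\<exists>L R. L \<in> carrier_mat n d \<and> R \<in> carrier_mat d n \<and> L * R \<in> wspan n f I \<and> L * R \<noteq> 0\<^sub>m n n)" for d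
  have "1\<^sub>m n \<in> wspan n f I" using wspan_word_prod[of "[]"] by simp
  moreover have "1\<^sub>m n \<noteq> (0\<^sub>m n n :: 'a mat)"
  proof
    assume "1\<^sub>m n = (0\<^sub>m n n :: 'a mat)"
    then have "(1\<^sub>m n :: 'a mat) $$ (0, 0) = 0\<^sub>m n n $$ (0, 0)" by simp
    then show False using n by simp
  qed
  ultimately have "P n" unfolding P_def by (intro exI[of _ "1\<^sub>m n"]) simp
  define d where "d = (LEAST d. P d)"
  have "P d" unfolding d_def by (rule LeastI[of P n]) fact
  then obtain L R where LR: "L \<in> carrier_mat n d" "R \<in> carrier_mat d n" "L * R \<in> wspan n f I" "L * R \<noteq> 0\<^sub>m n n"
    unfolding P_def by blast
  have "d \<noteq> 0"
  proof
    assume "d = 0"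
    then have "L * R = 0\<^sub>m n n" using LR(1,2) by (intro eq_matI) (auto simp: scalar_prod_def)
    then show False using LR by simp
  qed
  then obtain d' where d': "d = Suc d'" by (cases d) auto
  have min: "\<not> P d'" using not_less_Least[of d' P] unfolding d_def[symmetric] d' by simp
  have "\<exists>c. L * R * A * (L * R) = c \<cdot>\<^sub>m (L * R)" if A: "A \<in> wspan n f I" for A
  proof -
    have Ac: "A \<in> carrier_mat n n" using wspan_carrier[OF A] .
    define M where "M = R * A * L"
    have M: "M \<in> carrier_mat d d" using LR Ac by (simp add: M_def)
    obtain c v where cv: "v \<in> carrier_vec d" "v \<noteq> 0\<^sub>v d" "M *\<^sub>v v = c \<cdot>\<^sub>v v"
      using eigenvector_exists[OF M] d' by blast
    define N where "N = M + (- c) \<cdot>\<^sub>m 1\<^sub>m d"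
    have N: "N \<in> carrier_mat d d" using M by (simp add: N_def)
    have "N *\<^sub>v v = M *\<^sub>v v + ((- c) \<cdot>\<^sub>m 1\<^sub>m d) *\<^sub>v v" unfolding N_def using M cv(1) by (intro add_mult_distrib_mat_vec) auto
    also have "((- c) \<cdot>\<^sub>m 1\<^sub>m d) *\<^sub>v v = (- c) \<cdot>\<^sub>v v" using cv(1) by (intro eq_vecI) auto
    finally have "N *\<^sub>v v = 0\<^sub>v d" unfolding cv(3) using cv(1) by (intro eq_vecI) auto
    then obtain L' R' where f': "L' \<in> carrier_mat d d'" "R' \<in> carrier_mat d' d" "N = L' * R'"
      using singular_factor[of N d' v] N cv d' by auto
    have LRc: "L * R \<in> carrier_mat n n" using LR by simp
    have e1: "L * R * A * (L * R) = L * M * R"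
      unfolding M_def using LR(1,2) Ac by (simp add: assoc_mult_mat[of _ n d _ n _ n] assoc_mult_mat[of _ d n _ n _ n]
        assoc_mult_mat[of _ n n _ d _ n] assoc_mult_mat[of _ d n _ d _ n] assoc_mult_mat[of _ d n _ n _ d]
        assoc_mult_mat[of _ n d _ d _ n] assoc_mult_mat[of _ n n _ n _ n])
    have "L * N = L * M + L * ((- c) \<cdot>\<^sub>m 1\<^sub>m d)" unfolding N_def using LR M by (intro mult_add_distrib_mat) auto
    also have "L * ((- c) \<cdot>\<^sub>m 1\<^sub>m d) = (- c) \<cdot>\<^sub>m L" using LR(1) mult_smult_distrib[OF LR(1) one_carrier_mat, of "- c"] by simp
    finally have LN: "L * N = L * M + (- c) \<cdot>\<^sub>m L" .
    have "L * N * R = L * M * R + (- c) \<cdot>\<^sub>m L * R" unfolding LN using LR M by (intro add_mult_distrib_mat) auto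
    also have "(- c) \<cdot>\<^sub>m L * R = (- c) \<cdot>\<^sub>m (L * R)" using LR by (intro mult_smult_assoc_mat)
    finally have e2: "L * N * R = L * M * R + (- c) \<cdot>\<^sub>m (L * R)" .
    have "L * N * R \<in> wspan n f I"
      unfolding e2 e1[symmetric] by (intro wspan_add wspan_smult wspan_mult LR A)
    moreover have "L * N * R = (L * L') * (R' * R)"
    proof -
      have "L * N * R = (L * L' * R') * R" unfolding f'(3) using LR f' by (simp add: assoc_mult_mat[of _ n d _ d' _ d])
      also have "\<dots> = (L * L') * (R' * R)" using LR f' by (intro assoc_mult_mat) auto
      finally show ?thesis .
    qed
    moreover have "L * L' \<in> carrier_mat n d'" "R' * R \<in> carrier_mat d' n" using LR f' by auto
    ultimately have "L * N * R = 0\<^sub>m n n" using min unfolding P_def by metis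
    then have z: "L * M * R + (- c) \<cdot>\<^sub>m (L * R) = 0\<^sub>m n n" unfolding e2 .
    have "L * M * R = c \<cdot>\<^sub>m (L * R)"
      using LR M by (intro mat_eq_smultI[OF _ LRc z]) auto
    then show ?thesis unfolding e1 by blast
  qed
  then show ?thesis using that LR(3,4) by blast
qed

text \<open>A nonzero \<open>z\<close> can be multiplied by elements of the algebra so that
  \<open>A * z * B\<close> sends a vector \<open>e\<close> spanning the image of \<open>T\<close> to
  a preimage \<open>p\<close> of \<open>e\<close>. Then \<open>T * A * z * B\<close> has trace 1,
  although all traces against \<open>z\<close> vanish.\<close>

lemma wspan_trace_nondegenerate:
  assumes z: "z \<in> wspan n f I" and t: "\<And>u. u \<in> lists I \<Longrightarrow> mat_trace (word_prod n f u * z) = 0"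
  shows "z = 0\<^sub>m n n"
proof (rule ccontr)
  assume z0: "z \<noteq> 0\<^sub>m n n"
  note wc = wspan_carrier
  have zc: "z \<in> carrier_mat n n" using wc[OF z] by simp
  obtain q where q: "q \<in> carrier_vec n" "z *\<^sub>v q \<noteq> 0\<^sub>v n" using nonzero_mat_vec[OF zc z0] by blast
  obtain T where T: "T \<in> wspan n f I" "T \<noteq> 0\<^sub>m n n" "\<And>A. A \<in> wspan n f I \<Longrightarrow> \<exists>c. T * A * T = c \<cdot>\<^sub>m T"
    using rank_one_element by blast
  have Tc: "T \<in> carrier_mat n n" using wc[OF T(1)] by simp
  obtain p where p: "p \<in> carrier_vec n" "T *\<^sub>v p \<noteq> 0\<^sub>v n" using nonzero_mat_vec[OF Tc T(2)] by blast
  define e where "e = T *\<^sub>v p"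
  have e: "e \<in> carrier_vec n" "e \<noteq> 0\<^sub>v n" using Tc p by (auto simp: e_def)
  have "z *\<^sub>v q \<in> carrier_vec n" using zc q by simp
  then obtain A where A: "A \<in> wspan n f I" "A *\<^sub>v (z *\<^sub>v q) = p"
    using wspan_transitive[OF irr _ q(2) p(1)] by blast
  obtain B where B: "B \<in> wspan n f I" "B *\<^sub>v e = q" using wspan_transitive[OF irr e q(1)] by blast
  have Ac: "A \<in> carrier_mat n n" and Bc: "B \<in> carrier_mat n n" using wc[OF A(1)] wc[OF B(1)] by auto
  define R where "R = A * z * B"
  have R: "R \<in> carrier_mat n n" using Ac zc Bc by (simp add: R_def)
  have "R *\<^sub>v e = (A * z) *\<^sub>v (B *\<^sub>v e)" unfolding R_def using Ac zc Bc e by (intro assoc_mult_mat_vec) auto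
  also have "\<dots> = A *\<^sub>v (z *\<^sub>v q)" unfolding B(2) using Ac zc q by (intro assoc_mult_mat_vec) auto
  finally have Re: "R *\<^sub>v e = p" using A(2) by simp
  \<comment> \<open>Writing \<open>v\<close> as \<open>C\<close> applied to \<open>e\<close> turns
    \<open>T\<close> applied to \<open>v\<close> into \<open>T * C * T\<close> applied to
    \<open>p\<close>; so \<open>T\<close> has rank one.\<close>
  have "\<exists>c. T *\<^sub>v v = c \<cdot>\<^sub>v e" if v: "v \<in> carrier_vec n" for v
  proof -
    obtain C where C: "C \<in> wspan n f I" "C *\<^sub>v e = v" using wspan_transitive[OF irr e v] by blast
    have Cc: "C \<in> carrier_mat n n" using wc[OF C(1)] by simp
    obtain c where c: "T * C * T = c \<cdot>\<^sub>m T" using T(3)[OF C(1)] by blast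
    have "T *\<^sub>v v = (T * C) *\<^sub>v e" unfolding C(2)[symmetric] using Tc Cc e by (intro assoc_mult_mat_vec[symmetric]) auto
    also have "\<dots> = (T * C * T) *\<^sub>v p" unfolding e_def using Tc Cc p by (intro assoc_mult_mat_vec[symmetric]) auto
    also have "\<dots> = c \<cdot>\<^sub>v e" unfolding c e_def using Tc p by (intro eq_vecI) auto
    finally show ?thesis by blast
  qed
  then have "\<forall>j. \<exists>c. T *\<^sub>v unit_vec n j = c \<cdot>\<^sub>v e" by simp
  then obtain \<phi> where \<phi>: "\<And>j. T *\<^sub>v unit_vec n j = \<phi> j \<cdot>\<^sub>v e" by metis
  have Tij: "T $$ (i, j) = \<phi> j * e $ i" if ij: "i < n" "j < n" for i j
  proof -
    have "(T *\<^sub>v unit_vec n j) $ i = T $$ (i, j)" using Tc ij by (simp add: scalar_prod_right_unit[of _ n])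
    then show ?thesis unfolding \<phi> using e ij by simp
  qed
  obtain i where i: "i < n" "e $ i \<noteq> 0"
  proof (rule ccontr)
    assume "\<not> thesis"
    then have "e = 0\<^sub>v n" using e(1) that by (intro eq_vecI) auto
    then show False using e by simp
  qed
  have Rj: "p $ j = (\<Sum>k = 0..<n. R $$ (j, k) * e $ k)" if j: "j < n" for j
    unfolding Re[symmetric] using R e j by (simp add: scalar_prod_def)
  \<comment> \<open>The vector \<open>e\<close> is fixed by \<open>T * R\<close>, and for a matrix
    of rank one with image spanned by \<open>e\<close> the factor is the trace.\<close>
  have "e $ i = (\<Sum>j = 0..<n. T $$ (i, j) * p $ j)" using i Tc p by (simp add: e_def scalar_prod_def)
  also have "\<dots> = (\<Sum>j = 0..<n. \<Sum>k = 0..<n. e $ i * (T $$ (k, j) * R $$ (j, k)))"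
    using Rj i(1) by (simp add: Tij sum_distrib_left ac_simps)
  also have "\<dots> = (\<Sum>k = 0..<n. \<Sum>j = 0..<n. e $ i * (T $$ (k, j) * R $$ (j, k)))" by (rule sum.swap)
  also have "\<dots> = e $ i * mat_trace (T * R)" using Tc R by (simp add: mat_trace_mult[of _ n] sum_distrib_left)
  finally have "mat_trace (T * R) = 1" using i(2) by simp
  moreover have "mat_trace (T * R) = mat_trace (B * T * A * z)"
  proof -
    have "T * R = T * A * z * B" unfolding R_def using Tc Ac zc Bc by (simp add: assoc_mult_mat[of _ n n _ n _ n])
    then have "mat_trace (T * R) = mat_trace (B * (T * A * z))" using Tc Ac zc Bc mat_trace_comm[of "T * A * z" n n B] by simp
    also have "B * (T * A * z) = B * T * A * z" using Tc Ac zc Bc by (simp add: assoc_mult_mat[of _ n n _ n _ n])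
    finally show ?thesis .
  qed
  moreover have "mat_trace (B * T * A * z) = 0"
    using wspan_trace_zero[OF zc t, of "B * T * A"] by (simp add: wspan_mult A(1) B(1) T(1))
  ultimately show False by simp
qed

end

section \<open>Gram matrices of words under the trace form\<close>

context mat_gens
begin

definition lincomb :: "nat \<Rightarrow> (nat \<Rightarrow> 's list) \<Rightarrow> (nat \<Rightarrow> 'a) \<Rightarrow> 'a mat" where
  "lincomb D b c = mat n n (\<lambda>(p, q). \<Sum>j = 0..<D. c j * word_prod n f (b j) $$ (p, q))"

lemma lincomb_carrier: "lincomb D b c \<in> carrier_mat n n"
  by (simp add: lincomb_def)

lemma lincomb_Suc:
  assumes "b D \<in> lists I"
  shows "lincomb (Suc D) b c = c D \<cdot>\<^sub>m word_prod n f (b D) + lincomb D b c"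
  using gen_word_carrier[OF assms] by (intro eq_matI) (auto simp: lincomb_def)

lemma lincomb_0: "lincomb 0 b c = 0\<^sub>m n n"
  by (intro eq_matI) (auto simp: lincomb_def)

lemma lincomb_wspan: "(\<And>j. j < D \<Longrightarrow> b j \<in> lists I) \<Longrightarrow> lincomb D b c \<in> wspan n f I"
proof (induction D)
  case 0
  show ?case unfolding lincomb_0 by (rule wspan.zero)
next
  case (Suc D)
  have bD: "b D \<in> lists I" using Suc.prems by simp
  have "lincomb D b c \<in> wspan n f I" using Suc by simp
  then show ?case unfolding lincomb_Suc[of b D, OF bD] using bD by (intro wspan.add)
qed

lemma lincomb_trace:
  assumes w: "w \<in> lists I"
  shows "(\<And>j. j < D \<Longrightarrow> b j \<in> lists I) \<Longrightarrow>
    mat_trace (word_prod n f w * lincomb D b c) = (\<Sum>j = 0..<D. c j * mat_trace (word_prod n f w * word_prod n f (b j)))"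
proof (induction D)
  case 0
  show ?case unfolding lincomb_0 using gen_word_carrier[OF w] by (simp add: right_mult_zero_mat[of _ n n] mat_trace_def)
next
  case (Suc D)
  have bD: "b D \<in> lists I" using Suc.prems by simp
  note c = gen_word_carrier[OF w] gen_word_carrier[OF bD] lincomb_carrier[of D b c]
  have "word_prod n f w * (c D \<cdot>\<^sub>m word_prod n f (b D) + lincomb D b c) = word_prod n f w * (c D \<cdot>\<^sub>m word_prod n f (b D)) + word_prod n f w * lincomb D b c"
    using c by (intro mult_add_distrib_mat) auto
  also have "word_prod n f w * (c D \<cdot>\<^sub>m word_prod n f (b D)) = c D \<cdot>\<^sub>m (word_prod n f w * word_prod n f (b D))"
    using c by (intro mult_smult_distrib)
  finally have "mat_trace (word_prod n f w * lincomb (Suc D) b c) = c D * mat_trace (word_prod n f w * word_prod n f (b D)) + mat_trace (word_prod n f w * lincomb D b c)"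
    unfolding lincomb_Suc[of b D, OF bD] using c by (simp add: mat_trace_add[of _ n] mat_trace_smult[of _ n])
  then show ?case using Suc by simp
qed

definition gram :: "nat \<Rightarrow> (nat \<Rightarrow> 's list) \<Rightarrow> (nat \<Rightarrow> 's list) \<Rightarrow> 'a mat" where
  "gram D a b = mat D D (\<lambda>(i, j). mat_trace (word_prod n f (a i) * word_prod n f (b j)))"

text \<open>The trace of a product is the scalar product of two vectors with \<open>n * n\<close>
  entries, so the Gram matrix factors through dimension \<open>n * n\<close>.\<close>

lemma gram_rank:
  assumes a: "\<And>i. i < D \<Longrightarrow> a i \<in> lists I" and b: "\<And>i. i < D \<Longrightarrow> b i \<in> lists I" and "n * n < D"
  shows "det (gram D a b) = 0"
proof -
  obtain h where "bij_betw h {0..<card ({0..<n} \<times> {0..<n})} ({0..<n} \<times> {0..<n})"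
    using ex_bij_betw_nat_finite[of "{0..<n} \<times> {0..<n}"] by blast
  then have h: "bij_betw h {0..<n * n} ({0..<n} \<times> {0..<n})" by simp
  define L where "L = mat D (n * n) (\<lambda>(i, k). word_prod n f (a i) $$ (h k))"
  define R where "R = mat (n * n) D (\<lambda>(k, j). word_prod n f (b j) $$ (snd (h k), fst (h k)))"
  have "gram D a b = L * R"
  proof (rule eq_matI)
    fix i j assume "i < dim_row (L * R)" "j < dim_col (L * R)"
    then have ij: "i < D" "j < D" by (auto simp: L_def R_def)
    have "(L * R) $$ (i, j) = (\<Sum>k = 0..<n * n. word_prod n f (a i) $$ (h k) * word_prod n f (b j) $$ (snd (h k), fst (h k)))"
      using ij by (simp add: L_def R_def scalar_prod_def)
    also have "\<dots> = (\<Sum>x\<in>{0..<n} \<times> {0..<n}. word_prod n f (a i) $$ x * word_prod n f (b j) $$ (snd x, fst x))"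
      by (rule sum.reindex_bij_betw[OF h])
    also have "\<dots> = (\<Sum>x = 0..<n. \<Sum>y = 0..<n. word_prod n f (a i) $$ (x, y) * word_prod n f (b j) $$ (y, x))"
      by (simp add: sum.cartesian_product split_def)
    also have "\<dots> = mat_trace (word_prod n f (a i) * word_prod n f (b j))"
      using mat_trace_mult[OF gen_word_carrier[OF a[OF ij(1)]] gen_word_carrier[OF b[OF ij(2)]]] by simp
    finally show "gram D a b $$ (i, j) = (L * R) $$ (i, j)" using ij by (simp add: gram_def)
  qed (auto simp: gram_def L_def R_def)
  then show ?thesis using det_product_low_rank[of L D "n * n" R] assms(3) by (simp add: L_def R_def)
qed

lemma maximal_gram:
  obtains D a b where "\<And>i. i < D \<Longrightarrow> a i \<in> lists I" "\<And>i. i < D \<Longrightarrow> b i \<in> lists I" "det (gram D a b) \<noteq> 0"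
    "\<And>a' b'. (\<forall>i<Suc D. a' i \<in> lists I) \<Longrightarrow> (\<forall>i<Suc D. b' i \<in> lists I) \<Longrightarrow> det (gram (Suc D) a' b') = 0"
proof -
  define P where "P D \<longleftrightarrow> (\<exists>a b. (\<forall>i<D. a i \<in> lists I) \<and> (\<forall>i<D. b i \<in> lists I) \<and> det (gram D a b) \<noteq> 0)" for D
  have "det (gram 0 (\<lambda>_. []) (\<lambda>_. [])) = 1" by (simp add: gram_def)
  then have "P 0" unfolding P_def by (intro exI[of _ "\<lambda>_. []"]) simp
  moreover have "\<forall>D. P D \<longrightarrow> D \<le> n * n"
  proof (intro allI impI)
    fix D assume "P D"
    then obtain a b where ab: "\<forall>i<D. a i \<in> lists I" "\<forall>i<D. b i \<in> lists I" "det (gram D a b) \<noteq> 0"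
      unfolding P_def by blast
    show "D \<le> n * n"
    proof (rule ccontr)
      assume "\<not> D \<le> n * n"
      then show False using gram_rank[of D a b] ab by simp
    qed
  qed
  ultimately obtain D where D: "P D" "\<forall>E. P E \<longrightarrow> E \<le> D" using Nat.ex_has_greatest_nat[of P 0 "n * n"] by blast
  from D(2) have "\<not> P (Suc D)" by fastforce
  moreover obtain a b where "\<forall>i<D. a i \<in> lists I" "\<forall>i<D. b i \<in> lists I" "det (gram D a b) \<noteq> 0"
    using D(1) unfolding P_def by blast
  ultimately show ?thesis using that[of D a b] unfolding P_def by blast
qed

end

lemma mult_mat_vec_index:
  "A \<in> carrier_mat k m \<Longrightarrow> y \<in> carrier_vec m \<Longrightarrow> j < k \<Longrightarrow> (A *\<^sub>v y) $ j = (\<Sum>i = 0..<m. A $$ (j, i) * y $ i)"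
  by (simp add: scalar_prod_def)

context irr_gens
begin

definition coord :: "nat \<Rightarrow> (nat \<Rightarrow> 's list) \<Rightarrow> (nat \<Rightarrow> 's list) \<Rightarrow> 's list \<Rightarrow> nat \<Rightarrow> 'a" where
  "coord D a b u j = (\<Sum>i = 0..<D. minv (gram D a b) $$ (j, i) * mat_trace (word_prod n f (a i) * word_prod n f u))"

text \<open>Border the Gram matrix by any word \<open>w\<close> and by \<open>u\<close>. It is
  singular by maximality, and a kernel vector relates the traces with coefficients already
  determined by the rows \<open>a i\<close>, hence independent of \<open>w\<close>. So the
  difference of both sides is orthogonal to all words.\<close>

lemma word_prod_lincomb:
  assumes a: "\<And>i. i < D \<Longrightarrow> a i \<in> lists I" and b: "\<And>i. i < D \<Longrightarrow> b i \<in> lists I" and nz: "det (gram D a b) \<noteq> 0"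
    and mx: "\<And>a' b'. (\<forall>i<Suc D. a' i \<in> lists I) \<Longrightarrow> (\<forall>i<Suc D. b' i \<in> lists I) \<Longrightarrow> det (gram (Suc D) a' b') = 0"
    and u: "u \<in> lists I"
  shows "word_prod n f u = lincomb D b (coord D a b u)"
proof -
  let ?c = "coord D a b u" and ?t = "\<lambda>v w. mat_trace (word_prod n f v * word_prod n f w)"
  have G: "gram D a b \<in> carrier_mat D D" by (simp add: gram_def)
  note mG = minv[OF G nz]
  have key: "?t w u = (\<Sum>j = 0..<D. ?c j * ?t w (b j))" if w: "w \<in> lists I" for w
  proof -
    define a' where "a' i = (if i < D then a i else w)" for i
    define b' where "b' i = (if i < D then b i else u)" for i
    let ?G = "gram (Suc D) a' b'"
    have Gc: "?G \<in> carrier_mat (Suc D) (Suc D)" by (simp add: gram_def)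
    have "det ?G = 0" using a b w u by (intro mx) (auto simp: a'_def b'_def)
    then obtain v where v: "v \<in> carrier_vec (Suc D)" "v \<noteq> 0\<^sub>v (Suc D)" "?G *\<^sub>v v = 0\<^sub>v (Suc D)"
      using det_0_iff_vec_prod_zero_field[OF Gc] by blast
    have row: "(\<Sum>j = 0..<D. ?t (a' i) (b j) * v $ j) + ?t (a' i) u * v $ D = 0" if i: "i < Suc D" for i
    proof -
      have "(?G *\<^sub>v v) $ i = (\<Sum>j = 0..<Suc D. ?t (a' i) (b' j) * v $ j)"
        using i v(1) by (simp add: gram_def scalar_prod_def del: sum.op_ivl_Suc)
      also have "\<dots> = (\<Sum>j = 0..<D. ?t (a' i) (b j) * v $ j) + ?t (a' i) u * v $ D" by (simp add: b'_def)
      finally show ?thesis using v(3) i by simp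
    qed
    define x where "x = vec D (\<lambda>j. v $ j)"
    have x: "x \<in> carrier_vec D" by (simp add: x_def)
    have Gx: "(gram D a b *\<^sub>v x) $ i = - v $ D * ?t (a i) u" if i: "i < D" for i
    proof -
      have "(gram D a b *\<^sub>v x) $ i = (\<Sum>j = 0..<D. ?t (a i) (b j) * v $ j)"
        using i by (simp add: gram_def x_def scalar_prod_def)
      then show ?thesis using row[of i] i by (simp add: a'_def eq_neg_iff_add_eq_0 mult.commute)
    qed
    have xe: "x = minv (gram D a b) *\<^sub>v (gram D a b *\<^sub>v x)"
      unfolding assoc_mult_mat_vec[OF mG(1) G x, symmetric] mG(3) using x by simp
    have xj: "v $ j = - v $ D * ?c j" if j: "j < D" for j
    proof -
      have "v $ j = x $ j" using j by (simp add: x_def)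
      also have "\<dots> = (minv (gram D a b) *\<^sub>v (gram D a b *\<^sub>v x)) $ j" using xe by simp
      also have "\<dots> = (\<Sum>i = 0..<D. minv (gram D a b) $$ (j, i) * (gram D a b *\<^sub>v x) $ i)"
        using mG(1) G x j by (intro mult_mat_vec_index) auto
      also have "\<dots> = (\<Sum>i = 0..<D. minv (gram D a b) $$ (j, i) * (- v $ D * ?t (a i) u))"
        using Gx by simp
      finally show ?thesis by (simp add: coord_def sum_distrib_left sum_negf[symmetric] ac_simps)
    qed
    \<comment> \<open>A kernel vector with last entry 0 would restrict to one of the invertible
      matrix \<open>gram D a b\<close>.\<close>
    have vD: "v $ D \<noteq> 0"
    proof
      assume z: "v $ D = 0"
      have "v = 0\<^sub>v (Suc D)"
      proof (rule eq_vecI)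
        fix j assume "j < dim_vec (0\<^sub>v (Suc D))"
        then show "v $ j = 0\<^sub>v (Suc D) $ j" using z xj[of j] by (cases "j = D") auto
      qed (use v(1) in simp)
      then show False using v(2) by simp
    qed
    have "(\<Sum>j = 0..<D. ?t w (b j) * v $ j) = - v $ D * (\<Sum>j = 0..<D. ?c j * ?t w (b j))"
      using xj by (simp add: sum_distrib_left ac_simps sum_negf)
    moreover have "(\<Sum>j = 0..<D. ?t w (b j) * v $ j) + ?t w u * v $ D = 0" using row[of D] by (simp add: a'_def)
    ultimately have "v $ D * (?t w u - (\<Sum>j = 0..<D. ?c j * ?t w (b j))) = 0" by (simp add: algebra_simps)
    then show ?thesis using vD by simp
  qed
  define z where "z = word_prod n f u + (- 1) \<cdot>\<^sub>m lincomb D b ?c"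
  have lw: "lincomb D b ?c \<in> wspan n f I" using b by (intro lincomb_wspan)
  have z: "z \<in> wspan n f I" unfolding z_def using lw u by (intro wspan_add wspan_smult wspan_word_prod)
  have "z = 0\<^sub>m n n"
  proof (rule wspan_trace_nondegenerate[OF z])
    fix w assume w: "w \<in> lists I"
    have c: "word_prod n f w \<in> carrier_mat n n" "word_prod n f u \<in> carrier_mat n n" "lincomb D b ?c \<in> carrier_mat n n"
      using gen_word_carrier w u lincomb_carrier by auto
    have "word_prod n f w * z = word_prod n f w * word_prod n f u + word_prod n f w * ((- 1) \<cdot>\<^sub>m lincomb D b ?c)"
      unfolding z_def using c by (intro mult_add_distrib_mat) auto
    also have "word_prod n f w * ((- 1) \<cdot>\<^sub>m lincomb D b ?c) = (- 1) \<cdot>\<^sub>m (word_prod n f w * lincomb D b ?c)"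
      using c by (intro mult_smult_distrib)
    finally have e: "word_prod n f w * z = word_prod n f w * word_prod n f u + (- 1) \<cdot>\<^sub>m (word_prod n f w * lincomb D b ?c)" .
    have c2: "word_prod n f w * word_prod n f u \<in> carrier_mat n n" "word_prod n f w * lincomb D b ?c \<in> carrier_mat n n" using c by auto
    have "mat_trace (word_prod n f w * z) = ?t w u + (- 1) * mat_trace (word_prod n f w * lincomb D b ?c)"
      unfolding e using c2 by (simp add: mat_trace_add[of _ n] mat_trace_smult[of _ n])
    then show "mat_trace (word_prod n f w * z) = 0" using lincomb_trace[OF w b] key[OF w] by simp
  qed
  then have "word_prod n f u = 1 \<cdot>\<^sub>m lincomb D b ?c"
    unfolding z_def using gen_word_carrier[OF u] lincomb_carrier by (intro mat_eq_smultI) auto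
  also have "\<dots> = lincomb D b ?c" by (intro eq_matI) auto
  finally show ?thesis .
qed

text \<open>Coordinates of words are rational expressions in traces, hence absolutely algebraic.
  Those of the empty word and of the words \<open>s # b j\<close> are finitely many and lie in a
  finite field; by induction on length every word is a combination over that field.\<close>

lemma irr_finite:
  assumes ch: "CHAR('a) > 0" and I: "finite I" and roots: "roots_aa n f I"
  shows "finite (word_prod n f ` lists I)"
proof -
  obtain D a b where a: "\<And>i. i < D \<Longrightarrow> a i \<in> lists I" and b: "\<And>i. i < D \<Longrightarrow> b i \<in> lists I" and nz: "det (gram D a b) \<noteq> 0"
    and mx: "\<And>a' b'. (\<forall>i<Suc D. a' i \<in> lists I) \<Longrightarrow> (\<forall>i<Suc D. b' i \<in> lists I) \<Longrightarrow> det (gram (Suc D) a' b') = 0"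
    using maximal_gram by blast
  have wl: "word_prod n f u = lincomb D b (coord D a b u)" if u: "u \<in> lists I" for u
    by (rule word_prod_lincomb) (erule a | erule b | rule nz | (rule mx; assumption) | rule u)+
  let ?k = "absolutely_algebraic :: 'a set"
  have sf: "subfield_set ?k" by (rule subfield_absolutely_algebraic[OF ch])
  have tr: "mat_trace (word_prod n f v * word_prod n f w) \<in> ?k" if v: "v \<in> lists I" and w: "w \<in> lists I" for v w
  proof -
    have vw: "v @ w \<in> lists I" using v w by simp
    have "mat_trace (word_prod n f (v @ w)) \<in> ?k"
      using roots vw unfolding roots_aa_def by (intro mat_trace_in_subfield[OF sf gen_word_carrier[OF vw]]) blast
    then show ?thesis using word_prod_append[of I f n v w] f v w by simp
  qed
  have "gram D a b \<in> mats ?k D" using tr a b by (intro matsI) (auto simp: gram_def)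
  then have "minv (gram D a b) \<in> mats ?k D" by (rule minv_in_subfield[OF sf])
  then have ck: "coord D a b u j \<in> ?k" if "u \<in> lists I" "j < D" for u j
    unfolding coord_def using that a tr
    by (intro subring_sum[OF subfield_subring[OF sf]] subring_closed(5)[OF subfield_subring[OF sf]]) (auto intro: mats_entry)
  define S where "S = coord D a b [] ` {0..<D} \<union> (\<lambda>(s, i, j). coord D a b (s # b i) j) ` (I \<times> {0..<D} \<times> {0..<D})"
  have "finite S" unfolding S_def using I by blast
  moreover have "S \<subseteq> ?k" unfolding S_def using ck b by auto
  ultimately obtain r where r: "r \<ge> 1" "S \<subseteq> frob_fixed r" using absolutely_algebraic_finite[OF ch, of S] by blast
  let ?K = "frob_fixed r :: 'a set"
  have sK: "subring_set ?K" by (rule subfield_subring[OF subfield_frob_fixed[OF ch]])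
  have "\<exists>c. (\<forall>j<D. c j \<in> ?K) \<and> word_prod n f u = lincomb D b c" if u: "u \<in> lists I" for u
    using u
  proof (induction u)
    case Nil
    have "\<forall>j<D. coord D a b [] j \<in> ?K" using r(2) unfolding S_def by auto
    then show ?case using wl[of "[]"] by blast
  next
    case (Cons s u)
    then obtain c where c: "\<forall>j<D. c j \<in> ?K" "word_prod n f u = lincomb D b c" by auto
    have s: "s \<in> I" using Cons by simp
    define c' where "c' l = (\<Sum>j = 0..<D. c j * coord D a b (s # b j) l)" for l
    have "\<forall>l<D. c' l \<in> ?K"
    proof (intro allI impI)
      fix l assume l: "l < D"
      have "coord D a b (s # b j) l \<in> ?K" if j: "j < D" for j
      proof -
        have "coord D a b (s # b j) l \<in> S" unfolding S_def using s j l by (intro UnI2 image_eqI[of _ _ "(s, j, l)"]) auto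
        then show ?thesis using r(2) by blast
      qed
      then show "c' l \<in> ?K" unfolding c'_def using c(1) by (intro subring_sum[OF sK] subring_closed(5)[OF sK]) auto
    qed
    moreover have "word_prod n f (s # u) = lincomb D b c'"
    proof (rule eq_matI)
      fix p q assume "p < dim_row (lincomb D b c')" "q < dim_col (lincomb D b c')"
      then have pq: "p < n" "q < n" by (auto simp: lincomb_def)
      have "word_prod n f (s # u) $$ (p, q) = (\<Sum>x = 0..<n. f s $$ (p, x) * lincomb D b c $$ (x, q))"
        using f[OF s] pq lincomb_carrier[of D b c] by (simp add: c(2) scalar_prod_def)
      also have "\<dots> = (\<Sum>x = 0..<n. \<Sum>j = 0..<D. c j * (f s $$ (p, x) * word_prod n f (b j) $$ (x, q)))"
        using pq by (simp add: lincomb_def sum_distrib_left ac_simps)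
      also have "\<dots> = (\<Sum>j = 0..<D. \<Sum>x = 0..<n. c j * (f s $$ (p, x) * word_prod n f (b j) $$ (x, q)))" by (rule sum.swap)
      also have "\<dots> = (\<Sum>j = 0..<D. c j * word_prod n f (s # b j) $$ (p, q))"
      proof (rule sum.cong[OF refl])
        fix j assume "j \<in> {0..<D}"
        then have "word_prod n f (b j) \<in> carrier_mat n n" using gen_word_carrier b by simp
        then show "(\<Sum>x = 0..<n. c j * (f s $$ (p, x) * word_prod n f (b j) $$ (x, q))) = c j * word_prod n f (s # b j) $$ (p, q)"
          using f[OF s] pq by (simp add: scalar_prod_def sum_distrib_left)
      qed
      also have "\<dots> = (\<Sum>j = 0..<D. \<Sum>l = 0..<D. c j * coord D a b (s # b j) l * word_prod n f (b l) $$ (p, q))"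
      proof (rule sum.cong[OF refl])
        fix j assume "j \<in> {0..<D}"
        then have "s # b j \<in> lists I" using b s by simp
        from arg_cong[OF wl[OF this], of "\<lambda>A. A $$ (p, q)"]
        have "word_prod n f (s # b j) $$ (p, q) = (\<Sum>l = 0..<D. coord D a b (s # b j) l * word_prod n f (b l) $$ (p, q))"
          using pq by (simp add: lincomb_def)
        then show "c j * word_prod n f (s # b j) $$ (p, q) = (\<Sum>l = 0..<D. c j * coord D a b (s # b j) l * word_prod n f (b l) $$ (p, q))"
          by (simp only: sum_distrib_left mult.assoc)
      qed
      also have "\<dots> = (\<Sum>l = 0..<D. \<Sum>j = 0..<D. c j * coord D a b (s # b j) l * word_prod n f (b l) $$ (p, q))" by (rule sum.swap)
      also have "\<dots> = lincomb D b c' $$ (p, q)" using pq by (simp add: lincomb_def c'_def sum_distrib_right)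
      finally show "word_prod n f (s # u) $$ (p, q) = lincomb D b c' $$ (p, q)" .
    qed (use gen_word_carrier[OF Cons.hyps(2)] f[OF s] in \<open>auto simp: lincomb_def c(2)\<close>)
    ultimately show ?case by blast
  qed
  then have ex: "\<forall>u\<in>lists I. \<exists>c. (\<forall>j<D. c j \<in> ?K) \<and> word_prod n f u = lincomb D b c" by blast
  have "word_prod n f ` lists I \<subseteq> lincomb D b ` PiE {0..<D} (\<lambda>_. ?K)"
  proof
    fix x assume "x \<in> word_prod n f ` lists I"
    then obtain c where c: "\<forall>j<D. c j \<in> ?K" "x = lincomb D b c" using ex by blast
    have "lincomb D b c = lincomb D b (restrict c {0..<D})" by (simp add: lincomb_def)
    moreover have "restrict c {0..<D} \<in> PiE {0..<D} (\<lambda>_. ?K)" using c(1) by auto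
    ultimately show "x \<in> lincomb D b ` PiE {0..<D} (\<lambda>_. ?K)" using c(2) by blast
  qed
  moreover have "finite (PiE {0..<D} (\<lambda>_. ?K))" using finite_frob_fixed[OF ch r(1)] by (intro finite_PiE) auto
  ultimately show ?thesis by (meson finite_imageI finite_subset)
qed

end

theorem burnside_schur:
  fixes f :: "'s \<Rightarrow> 'a::alg_closed_field mat"
  assumes ch: "CHAR('a) > 0" and I: "finite I" and f: "\<And>s. s \<in> I \<Longrightarrow> f s \<in> carrier_mat n n"
    and roots: "roots_aa n f I"
  shows "finite (word_prod n f ` lists I)"
  using f roots
proof (induction n arbitrary: f rule: less_induct)
  case (less n)
  interpret mat_gens n f I using less.prems(1) by unfold_locales
  consider "n = 0" | "n > 0" "irr" | "\<not> irr" by blast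
  then show ?case
  proof cases
    case 1
    have "word_prod n f ` lists I \<subseteq> {0\<^sub>m 0 0}"
    proof
      fix x assume "x \<in> word_prod n f ` lists I"
      then have "x \<in> carrier_mat 0 0" using gen_word_carrier 1 by auto
      then show "x \<in> {0\<^sub>m 0 0}" by (auto intro!: eq_matI)
    qed
    then show ?thesis using finite_subset by blast
  next
    case 2
    interpret irr_gens n f I using 2 by unfold_locales
    show ?thesis by (rule irr_finite[OF ch I less.prems(2)])
  next
    case 3
    then obtain U where U: "vsubspace n U" "\<forall>s\<in>I. \<forall>x\<in>U. f s *\<^sub>v x \<in> U" "\<exists>x\<in>U. x \<noteq> 0\<^sub>v n" "U \<noteq> carrier_vec n"
      unfolding irr_def by blast
    show ?thesis
      using U(2) less.IH by (intro reducible_step[OF ch I less.prems(1) U(1,3,4) _ less.prems(2)]) auto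
  qed
qed

section \<open>Finiteness of the image\<close>

lemma map_to_ac_absolutely_algebraic:
  fixes x :: "'k::field"
  assumes ch: "CHAR('k) > 0" and x: "x \<in> absolutely_algebraic"
  shows "to_ac x \<in> absolutely_algebraic"
proof -
  obtain r where r: "r \<ge> 1" "x \<in> frob_fixed r"
    using absolutely_algebraic_finite[OF ch, of "{x}"] x by auto
  then have "to_ac x \<in> frob_fixed r" by (simp add: frob_fixed_def flip: to_ac_power)
  moreover have "CHAR('k alg_closure) > 0" using ch by simp
  ultimately show ?thesis using frob_fixed_absolutely_algebraic r(1) by blast
qed

lemma char_poly_coeff_absolutely_algebraic:
  fixes \<rho> :: "'g \<Rightarrow> 'k::field mat"
  assumes n: "n \<ge> 1" and G: "group G" and fg: "finitely_generated G"
    and inf: "infinite (UNIV :: 'v set)" and fb: "property_FB TYPE('v) n G" and ch: "CHAR('k) > 0"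
    and car: "\<And>g. g \<in> carrier G \<Longrightarrow> \<rho> g \<in> carrier_mat (Suc n) (Suc n)"
    and det: "\<And>g. g \<in> carrier G \<Longrightarrow> det (\<rho> g) \<noteq> 0"
    and hom: "\<And>g h. g \<in> carrier G \<Longrightarrow> h \<in> carrier G \<Longrightarrow> \<rho> (g \<otimes>\<^bsub>G\<^esub> h) = \<rho> g * \<rho> h"
    and one: "\<rho> \<one>\<^bsub>G\<^esub> = 1\<^sub>m (Suc n)"
    and g: "g \<in> carrier G"
  shows "coeff (char_poly (\<rho> g)) i \<in> absolutely_algebraic"
proof (rule ccontr)
  interpret G: group G by (rule G)
  let ?x = "coeff (char_poly (\<rho> g)) i"
  assume nx: "?x \<notin> absolutely_algebraic"
  obtain S where S: "finite S" "S \<subseteq> carrier G" "generate G S = carrier G"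
    using fg unfolding finitely_generated_def by blast
  \<comment> \<open>Entries of the generators suffice: a subfield also contains the entries of
    inverses and products.\<close>
  define A where "A = (\<lambda>(s, p). \<rho> s $$ p) ` (S \<times> ({0..<Suc n} \<times> {0..<Suc n}))"
  have "finite A" unfolding A_def using S(1) by blast
  then obtain F and w :: "'k \<Rightarrow> int" where Fw: "valued_field F w" "countable F" "A \<subseteq> F" "?x \<in> F" "w ?x < 0"
    using exists_valuation[OF ch nx] by blast
  have "0 \<in> (absolutely_algebraic :: 'k set)"
    by (rule subring_closed(1)[OF subfield_subring[OF subfield_absolutely_algebraic[OF ch]]])
  then have x0: "?x \<noteq> 0" using nx by auto
  obtain w' u where wu: "valued_field F w'" "u \<in> F" "u \<noteq> 0" "w' u = (1::int)" "w' ?x < 0"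
    using normalize_valuation[OF ch Fw(1,4) x0 Fw(5)] by blast
  interpret affine_type n using n by unfold_locales
  interpret valued_field F w' by (rule wu(1))
  interpret lattices n F w' u using wu(2-4) by unfold_locales
  have gl: "\<rho> h \<in> GLF" if h: "h \<in> carrier G" for h
  proof -
    have Sm: "\<rho> s \<in> mats F (Suc n)" if s: "s \<in> S" for s
    proof (rule matsI)
      show "\<rho> s \<in> carrier_mat (Suc n) (Suc n)" using car S(2) s by blast
      fix a b assume ab: "a < Suc n" "b < Suc n"
      have "\<rho> s $$ (a, b) \<in> A" unfolding A_def using s ab by (intro image_eqI[of _ _ "(s, a, b)"]) auto
      then show "\<rho> s $$ (a, b) \<in> F" using Fw(3) by blast
    qed
    have "h \<in> generate G S" using h S(3) by simp
    then have "\<rho> h \<in> mats F (Suc n)"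
    proof (induction rule: generate.induct)
      case one
      show ?case unfolding assms(10) by (rule mats_one[OF subring])
    next
      case (incl s)
      then show ?case by (rule Sm)
    next
      case (inv s)
      then have s: "s \<in> carrier G" using S(2) by blast
      note m = minv[OF car[OF s] det[OF s]]
      have si: "inv\<^bsub>G\<^esub> s \<in> carrier G" using s by simp
      have "\<rho> (inv\<^bsub>G\<^esub> s) * \<rho> s = 1\<^sub>m (Suc n)" using hom[OF si s] s one by simp
      then have "\<rho> (inv\<^bsub>G\<^esub> s) * \<rho> s * minv (\<rho> s) = minv (\<rho> s)" using m(1) by simp
      moreover have "\<rho> (inv\<^bsub>G\<^esub> s) * \<rho> s * minv (\<rho> s) = \<rho> (inv\<^bsub>G\<^esub> s) * (\<rho> s * minv (\<rho> s))"
        using car[OF si] car[OF s] m(1) by (rule assoc_mult_mat)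
      ultimately have "\<rho> (inv\<^bsub>G\<^esub> s) = minv (\<rho> s)" using m(2) car[OF si] by simp
      then show ?case using minv_in_subfield[OF subfield Sm[OF inv]] by simp
    next
      case (eng a b)
      then have "a \<in> carrier G" "b \<in> carrier G" using S(3) by auto
      then show ?case using hom mats_mult[OF subring eng.IH] by simp
    qed
    then show ?thesis using det[OF h] by (simp add: GLF_def)
  qed
  have "?x \<in> vring" by (rule fb_integral[OF G fb inf Fw(2) gl hom one g])
  then show False using wu(5) x0 by (simp add: vring_def vge_def)
qed

text \<open>Inverses of the generators are added as letters, because \<open>word_prod\<close> only
  multiplies.\<close>

lemma generate_word_prod:
  fixes f :: "'g \<Rightarrow> 'k::field mat"
  assumes G: "group G" and S: "S \<subseteq> carrier G"
    and car: "\<And>g. g \<in> carrier G \<Longrightarrow> f g \<in> carrier_mat m m"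
    and hom: "\<And>g h. g \<in> carrier G \<Longrightarrow> h \<in> carrier G \<Longrightarrow> f (g \<otimes>\<^bsub>G\<^esub> h) = f g * f h"
    and one: "f \<one>\<^bsub>G\<^esub> = 1\<^sub>m m" and g: "g \<in> generate G S"
  shows "f g \<in> word_prod m f ` lists (S \<union> (\<lambda>s. inv\<^bsub>G\<^esub> s) ` S)"
  using g
proof (induction rule: generate.induct)
  interpret G: group G by (rule G)
  let ?I = "S \<union> (\<lambda>s. inv\<^bsub>G\<^esub> s) ` S"
  have I: "?I \<subseteq> carrier G" using S by auto
  have single: "f s \<in> word_prod m f ` lists ?I" if s: "s \<in> ?I" for s
  proof -
    have "f s = word_prod m f [s]" using car[of s] I s by (auto simp: right_mult_one_mat[of _ m m])
    moreover have "[s] \<in> lists ?I" using s by simp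
    ultimately show ?thesis by blast
  qed
  {
    case one
    show ?case unfolding assms(5) by (rule image_eqI[of _ _ "[]"]) auto
  next
    case (incl s)
    then show ?case by (intro single) auto
  next
    case (inv s)
    then show ?case by (intro single) auto
  next
    case (eng a b)
    then obtain u v where uv: "f a = word_prod m f u" "f b = word_prod m f v" "u \<in> lists ?I" "v \<in> lists ?I" by auto
    have "a \<in> carrier G" "b \<in> carrier G" using eng.hyps G.generate_in_carrier[OF S] by auto
    then have "f (a \<otimes>\<^bsub>G\<^esub> b) = word_prod m f u * word_prod m f v" using hom uv by simp
    also have "\<dots> = word_prod m f (u @ v)"
      using I car by (intro word_prod_append[symmetric, OF _ uv(3,4)]) auto
    finally show ?case using uv(3,4) by (intro image_eqI[of _ _ "u @ v"]) auto
  }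
qed

lemma word_prod_hom_carrier:
  fixes f :: "'g \<Rightarrow> 'k::field mat"
  assumes G: "group G" and I: "I \<subseteq> carrier G"
    and hom: "\<And>g h. g \<in> carrier G \<Longrightarrow> h \<in> carrier G \<Longrightarrow> f (g \<otimes>\<^bsub>G\<^esub> h) = f g * f h"
    and one: "f \<one>\<^bsub>G\<^esub> = 1\<^sub>m m" and u: "u \<in> lists I"
  shows "\<exists>g\<in>carrier G. word_prod m f u = f g"
  using u
proof (induction u)
  interpret G: group G by (rule G)
  {
    case Nil
    show ?case using one by (intro bexI[of _ "\<one>\<^bsub>G\<^esub>"]) auto
  next
    case (Cons s u)
    then obtain g where g: "g \<in> carrier G" "word_prod m f u = f g" by blast
    have s: "s \<in> carrier G" using Cons I by auto
    show ?case using g s hom[OF s g(1)] by (intro bexI[of _ "s \<otimes>\<^bsub>G\<^esub> g"]) auto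
  }
qed

theorem theoremA:
  fixes n :: nat
    and G :: "('g, 'm) monoid_scheme"
    and \<rho> :: "'g \<Rightarrow> 'k::field mat"
  assumes "n \<ge> 1"
    and "group G"
    and "finitely_generated G"
    and "infinite (UNIV :: 'v set)"
    and "property_FB TYPE('v) n G"
    and "CHAR('k) > 0"
    and "\<rho> \<in> hom G (general_linear TYPE('k) (n + 1))"
  shows "finite (\<rho> ` carrier G)"
proof -
  interpret G: group G by (rule assms(2))
  let ?m = "Suc n"
  have un: "\<rho> g \<in> Units (ring_mat TYPE('k) ?m ())" if "g \<in> carrier G" for g
    using assms(7) that by (auto simp: hom_def general_linear_def units_of_def)
  have car: "\<rho> g \<in> carrier_mat ?m ?m" if "g \<in> carrier G" for g
    using un[OF that] by (simp add: Units_def ring_mat_def)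
  have det: "det (\<rho> g) \<noteq> 0" if g: "g \<in> carrier G" for g
  proof -
    obtain B where B: "B \<in> carrier_mat ?m ?m" "B * \<rho> g = 1\<^sub>m ?m" using un[OF g] by (auto simp: Units_def ring_mat_def)
    then have "det B * det (\<rho> g) = 1" using det_mult[OF B(1) car[OF g]] by simp
    then show ?thesis by auto
  qed
  have hom: "\<rho> (g \<otimes>\<^bsub>G\<^esub> h) = \<rho> g * \<rho> h" if "g \<in> carrier G" "h \<in> carrier G" for g h
    using assms(7) that by (auto simp: hom_def general_linear_def units_of_def ring_mat_def)
  have one: "\<rho> \<one>\<^bsub>G\<^esub> = 1\<^sub>m ?m"
  proof -
    let ?E = "\<rho> \<one>\<^bsub>G\<^esub>"
    have E: "?E \<in> carrier_mat ?m ?m" "det ?E \<noteq> 0" using car det by auto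
    note m = minv[OF E]
    \<comment> \<open>\<open>hom\<close> asks only for multiplicativity; an invertible idempotent is
      the identity.\<close>
    have "?E * ?E = ?E" using hom[of "\<one>\<^bsub>G\<^esub>" "\<one>\<^bsub>G\<^esub>"] by simp
    then have "minv ?E * (?E * ?E) = 1\<^sub>m ?m" using m(3) by simp
    moreover have "minv ?E * (?E * ?E) = minv ?E * ?E * ?E" by (rule assoc_mult_mat[symmetric, OF m(1) E(1) E(1)])
    ultimately show ?thesis using m(3) E(1) by simp
  qed
  \<comment> \<open>The Burnside-Schur argument needs eigenvectors, hence the passage to the
    algebraic closure; injectivity of \<open>to_ac\<close> brings finiteness back.\<close>
  define f where "f g = map_mat to_ac (\<rho> g)" for g
  interpret h: comm_ring_hom "to_ac :: 'k \<Rightarrow> 'k alg_closure" by unfold_locales auto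
  have fcar: "f g \<in> carrier_mat ?m ?m" if "g \<in> carrier G" for g
    using car[OF that] by (simp add: f_def)
  have fhom: "f (g \<otimes>\<^bsub>G\<^esub> h) = f g * f h" if "g \<in> carrier G" "h \<in> carrier G" for g h
    unfolding f_def hom[OF that] by (rule h.mat_hom_mult[OF car[OF that(1)] car[OF that(2)]])
  have fone: "f \<one>\<^bsub>G\<^esub> = 1\<^sub>m ?m" unfolding f_def one by (rule h.mat_hom_one)
  have ch: "CHAR('k alg_closure) > 0" using assms(6) by simp
  obtain S where S: "finite S" "S \<subseteq> carrier G" "generate G S = carrier G"
    using assms(3) unfolding finitely_generated_def by blast
  define I where "I = S \<union> (\<lambda>s. inv\<^bsub>G\<^esub> s) ` S"
  have I: "finite I" "I \<subseteq> carrier G" using S by (auto simp: I_def)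
  have "roots_aa ?m f I"
    unfolding roots_aa_def
  proof (intro ballI allI impI)
    fix u x assume u: "u \<in> lists I" and x: "poly (char_poly (word_prod ?m f u)) x = 0"
    obtain g where g: "g \<in> carrier G" "word_prod ?m f u = f g"
      using word_prod_hom_carrier[OF assms(2) I(2) fhom fone u] by blast
    have cp: "char_poly (f g) = map_poly to_ac (char_poly (\<rho> g))"
      unfolding f_def by (rule h.char_poly_hom[OF car[OF g(1)]])
    \<comment> \<open>What is known so far concerns coefficients;
      \<open>absolutely_algebraic_root\<close> passes on to the eigenvalues.\<close>
    have "char_poly (f g) \<in> cpolys absolutely_algebraic"
      unfolding cpolys_def cp
      using char_poly_coeff_absolutely_algebraic[OF assms(1-6) car det hom one g(1)]
      by (auto simp: coeff_map_poly intro: map_to_ac_absolutely_algebraic[OF assms(6)])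
    moreover have "char_poly (f g) \<noteq> 0" using degree_monic_char_poly[OF fcar[OF g(1)]] by auto
    ultimately show "x \<in> absolutely_algebraic"
      using absolutely_algebraic_root[OF ch, of "char_poly (f g)" x] x g(2) by simp
  qed
  then have fin: "finite (word_prod ?m f ` lists I)"
    using I(2) fcar by (intro burnside_schur[OF ch I(1)]) auto
  have "f ` carrier G \<subseteq> word_prod ?m f ` lists I"
    using generate_word_prod[OF assms(2) S(2) fcar fhom fone] S(3) unfolding I_def by auto
  then have "finite (f ` carrier G)" using fin finite_subset by blast
  moreover have "f ` carrier G = map_mat to_ac ` (\<rho> ` carrier G)" by (auto simp: f_def)
  moreover have "inj_on (map_mat (to_ac :: 'k \<Rightarrow> 'k alg_closure)) (\<rho> ` carrier G)"
  proof (rule inj_onI)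
    fix A B assume AB: "A \<in> \<rho> ` carrier G" "B \<in> \<rho> ` carrier G"
      and e: "map_mat to_ac A = (map_mat to_ac B :: 'k alg_closure mat)"
    have c: "A \<in> carrier_mat ?m ?m" "B \<in> carrier_mat ?m ?m" using AB car by auto
    show "A = B"
    proof (rule eq_matI)
      fix i j assume "i < dim_row B" "j < dim_col B"
      then have "(map_mat to_ac A :: 'k alg_closure mat) $$ (i, j) = to_ac (A $$ (i, j))"
        "(map_mat to_ac B :: 'k alg_closure mat) $$ (i, j) = to_ac (B $$ (i, j))" using c by auto
      then show "A $$ (i, j) = B $$ (i, j)" unfolding e by simp
    qed (use c in auto)
  qed
  ultimately show ?thesis by (simp add: finite_image_iff)
qed

end
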